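(* Let $\lambda>1$, $0<\varepsilon\le R$, $\sigma\in\mathbb{R}$, and let $n_0$ be the smallest integer $n_0\ge0$ such that $\lambda>\dfrac{j_{n_0,1}}{y_{n_0,1}}$. Then, for any integer $p\ge n_0$, $$\sup\left\{\left\Vert u_\varepsilon^s(|x|=R)\right\Vert_{H^\sigma}:\ 0<\lambda\omega_\varepsilon\le j_{p,1}\right\}\ \ge\ \sup_{n_0\le n\le p}\left(|a_n|(1+n)^\sigma\left|H^{(1)}_n\!\left(\frac{j_{n,1}}{\lambda}\frac R\varepsilon\right)\right|\right).$$ Furthermore, if $\lambda>\exp(2)$, $$\sup\left\{\left\Vert u_\varepsilon^s(|x|=R)\right\Vert_{H^\sigma}:\ 0<\lambda\omega_\varepsilon<\frac{\sqrt2}{\sqrt{\ln\lambda}}\Big(1+\frac1{2\sqrt{\ln\lambda}}\Big)\right\}\ \ge\ |a_0|\left|H^{(1)}_0\!\left(\frac{\sqrt2}{\lambda\sqrt{\ln\lambda}}\Big(1+\frac1{2\sqrt{\ln\lambda}}\Big)\frac R\varepsilon\right)\right|.$$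
   Context: $j_{n,1}$ and $y_{n,1}$ are the first positive zeros of the Bessel functions $J_n$ and $Y_n$; $H_n^{(1)}=J_n+iY_n$. Setting: $\varepsilon,\omega,q,q_0>0$; $q_\varepsilon=q$ for $|x|<\varepsilon$ and $q_\varepsilon=q_0$ for $|x|>\varepsilon$ in $\mathbb{R}^2$; $\omega_\varepsilon=\sqrt{q_0}\,\omega\varepsilon$ and $\lambda=\sqrt{q/q_0}$; $(r,\theta)$ are polar coordinates. The incident field, a non-singular solution of $\Delta u^i+\omega^2q_0u^i=0$ in $\mathbb{R}^2$, is $u^i=\sum_{n\in\mathbb{Z}}a_nJ_n(\sqrt{q_0}\,\omega r)e^{in\theta}$; the suprema are over $\omega>0$ in the indicated range, with the coefficients $a_n$ and $\varepsilon,q,q_0$ fixed. $u_\varepsilon\in H^1_{loc}(\mathbb{R}^2)$ solves $\Delta u_\varepsilon+\omega^2q_\varepsilon u_\varepsilon=0$, with $u_\varepsilon=u^i+u^s_\varepsilon$ for $|x|>\varepsilon$, where $u_\varepsilon^s$ satisfies the outgoing radiation condition $\partial_ru^s_\varepsilon-i\omega\sqrt{q_0}u^s_\varepsilon=o(r^{-1/2})$. Equivalently, for $r\ge\varepsilon$, $u^s_\varepsilon=\sum_{n}a_nR_n(\omega_\varepsilon,\lambda)H^{(1)}_n(\sqrt{q_0}\,\omega r)e^{in\theta}$, with $$R_n(x,\lambda)=-\frac{\Re D_n}{D_n},\quad D_n=H_n^{(1)\prime}(x)J_n(\lambda x)-\lambda J_n'(\lambda x)H^{(1)}_n(x).$$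 For $f$ on the circle $|x|=R$ with Fourier coefficients $c_n=\frac1{2\pi}\int_0^{2\pi}f(R,\theta)e^{-in\theta}d\theta$, $\Vert f(|x|=R)\Vert_{H^\sigma}=\sqrt{2\pi}\big(\sum_{n}|c_n|^2(1+|n|)^{2\sigma}\big)^{1/2}$ (value $+\infty$ allowed). *)

theory Defs
  imports "HOL-Analysis.Analysis" "HOL-Library.Landau_Symbols"
begin

section \<open>Bessel functions of integer order\<close>

text \<open>The ascending series. As \<open>rGamma\<close> vanishes at the non-positive integers, it also covers
  negative orders, where it gives \<open>J\<^bsub>-n\<^esub> = (-1)\<^sup>n J\<^sub>n\<close>, and it gives the right values at \<open>x = 0\<close>.\<close>

definition bessel_J :: "int \<Rightarrow> real \<Rightarrow> real" where
  "bessel_J n x =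
     (\<Sum>k. (- 1) ^ k / fact k * rGamma (of_int (n + int k + 1)) * (x / 2) powi (n + 2 * int k))"

text \<open>The Bessel function of the second kind (Weber's normalisation), by its classical expansion for
  integer order; only \<open>x > 0\<close> is meaningful.\<close>

definition bessel_Y :: "nat \<Rightarrow> real \<Rightarrow> real" where
  "bessel_Y n x =
     2 / pi * ln (x / 2) * bessel_J (int n) x
     - (\<Sum>k<n. fact (n - k - 1) / fact k * (x / 2) powi (2 * int k - int n)) / pi
     - (\<Sum>k. (- 1) ^ k * (Digamma (real k + 1) + Digamma (real (n + k) + 1))
              / (fact k * fact (n + k)) * (x / 2) ^ (2 * k + n)) / pi"

definition hankel1 :: "nat \<Rightarrow> real \<Rightarrow> complex" where
  "hankel1 n x = Complex (bessel_J (int n) x) (bessel_Y n x)"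

definition first_zero_J :: "nat \<Rightarrow> real" where
  "first_zero_J n = (LEAST x. 0 < x \<and> bessel_J (int n) x = 0)"

definition first_zero_Y :: "nat \<Rightarrow> real" where
  "first_zero_Y n = (LEAST x. 0 < x \<and> bessel_Y n x = 0)"

section \<open>The Sobolev space \<open>H\<^sup>1\<^sub>l\<^sub>o\<^sub>c\<close> of the plane\<close>

text \<open>The plane is \<^typ>\<open>complex\<close>; the two coordinate directions are \<open>1\<close> and \<open>\<i>\<close>. Test functions are
  compactly supported of class \<open>C\<^sup>1\<close>. By mollification, for the spaces and equations below they
  define the same notions as compactly supported smooth ones.\<close>

definition partial :: "complex \<Rightarrow> (complex \<Rightarrow> complex) \<Rightarrow> complex \<Rightarrow> complex" where
  "partial e f z = frechet_derivative f (at z) e"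

definition test_fun :: "(complex \<Rightarrow> complex) \<Rightarrow> bool" where
  "test_fun \<phi> \<longleftrightarrow>
     (\<forall>z. \<phi> differentiable (at z)) \<and>
     continuous_on UNIV (partial 1 \<phi>) \<and> continuous_on UNIV (partial \<i> \<phi>) \<and>
     compact (closure {z. \<phi> z \<noteq> 0})"

definition L2_loc :: "(complex \<Rightarrow> complex) \<Rightarrow> bool" where
  "L2_loc f \<longleftrightarrow> f \<in> borel_measurable lebesgue \<and>
     (\<forall>K. compact K \<longrightarrow> set_integrable lebesgue K (\<lambda>z. (norm (f z))\<^sup>2))"

definition weak_partial ::
  "complex \<Rightarrow> (complex \<Rightarrow> complex) \<Rightarrow> (complex \<Rightarrow> complex) \<Rightarrow> bool" where
  "weak_partial e u g \<longleftrightarrow>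
     (\<forall>\<phi>. test_fun \<phi> \<longrightarrow> (LINT z|lebesgue. u z * partial e \<phi> z) = - (LINT z|lebesgue. g z * \<phi> z))"

definition H1_loc_gradient ::
  "(complex \<Rightarrow> complex) \<Rightarrow> (complex \<Rightarrow> complex) \<Rightarrow> (complex \<Rightarrow> complex) \<Rightarrow> bool" where
  "H1_loc_gradient u gx gy \<longleftrightarrow>
     L2_loc u \<and> L2_loc gx \<and> L2_loc gy \<and> weak_partial 1 u gx \<and> weak_partial \<i> u gy"

text \<open>\<open>u \<in> H\<^sup>1\<^sub>l\<^sub>o\<^sub>c\<close> and \<open>\<Delta> u + c u = 0\<close> weakly in the whole plane.\<close>

definition weak_helmholtz :: "(complex \<Rightarrow> real) \<Rightarrow> (complex \<Rightarrow> complex) \<Rightarrow> bool" where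
  "weak_helmholtz c u \<longleftrightarrow>
     (\<exists>gx gy. H1_loc_gradient u gx gy \<and>
        (\<forall>\<phi>. test_fun \<phi> \<longrightarrow>
           (LINT z|lebesgue. gx z * partial 1 \<phi> z + gy z * partial \<i> \<phi> z)
           = (LINT z|lebesgue. of_real (c z) * u z * \<phi> z)))"

section \<open>The scattering problem\<close>

definition radial_fun :: "(complex \<Rightarrow> complex) \<Rightarrow> complex \<Rightarrow> real \<Rightarrow> complex" where
  "radial_fun v z t = v (t *\<^sub>R sgn z)"

text \<open>\<open>\<partial>\<^sub>r v - i k v = o(r\<^bsup>-1/2\<^esup>)\<close>, uniformly in the direction. Radial differentiability near
  infinity, automatic for the fields below, is required so that \<^const>\<open>vector_derivative\<close> is
  meaningful.\<close>

definition outgoing :: "real \<Rightarrow> (complex \<Rightarrow> complex) \<Rightarrow> bool" where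
  "outgoing k v \<longleftrightarrow>
     (\<forall>\<^sub>F z in at_infinity. radial_fun v z differentiable (at (norm z))) \<and>
     (\<lambda>z. vector_derivative (radial_fun v z) (at (norm z)) - \<i> * of_real k * v z)
       \<in> o[at_infinity](\<lambda>z. complex_of_real (norm z powr (- 1 / 2)))"

text \<open>Unconditional convergence of the modes at every point of the plane already forces locally uniform
  convergence (compare \<open>\<bar>z\<bar>\<close> with \<open>2\<bar>z\<bar>\<close> for large \<open>\<bar>n\<bar>\<close>), so the sum is then an entire solution of
  \<open>\<Delta> v + k\<^sup>2 v = 0\<close>, and every entire solution is of this form.\<close>

definition incident_mode :: "(int \<Rightarrow> complex) \<Rightarrow> real \<Rightarrow> complex \<Rightarrow> int \<Rightarrow> complex" where
  "incident_mode a k z n = a n * of_real (bessel_J n (k * norm z)) * cis (of_int n * Arg z)"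

definition incident_field :: "(int \<Rightarrow> complex) \<Rightarrow> real \<Rightarrow> complex \<Rightarrow> complex" where
  "incident_field a k z = (\<Sum>\<^sub>\<infinity>n. incident_mode a k z n)"

definition ball_index :: "real \<Rightarrow> real \<Rightarrow> real \<Rightarrow> complex \<Rightarrow> real" where
  "ball_index \<epsilon> q q0 z = (if norm z < \<epsilon> then q else q0)"

text \<open>Elements of \<open>H\<^sup>1\<^sub>l\<^sub>o\<^sub>c\<close> are only defined almost everywhere. A solution of the equation has a
  (unique) continuous representative, which is the one that gives its values on circles.\<close>

definition scattering_solution ::
  "real \<Rightarrow> real \<Rightarrow> real \<Rightarrow> real \<Rightarrow> (complex \<Rightarrow> complex) \<Rightarrow> (complex \<Rightarrow> complex) \<Rightarrow> bool" where
  "scattering_solution \<epsilon> q q0 \<omega> ui u \<longleftrightarrow>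
     continuous_on UNIV u \<and>
     weak_helmholtz (\<lambda>z. \<omega>\<^sup>2 * ball_index \<epsilon> q q0 z) u \<and>
     outgoing (\<omega> * sqrt q0) (\<lambda>z. u z - ui z)"

section \<open>Sobolev norms on circles\<close>

definition circle_coeff :: "(complex \<Rightarrow> complex) \<Rightarrow> real \<Rightarrow> int \<Rightarrow> complex" where
  "circle_coeff f R n =
     of_real (1 / (2 * pi)) * integral {0..2 * pi} (\<lambda>\<theta>. f (rcis R \<theta>) * cis (- (of_int n * \<theta>)))"

definition circle_norm :: "real \<Rightarrow> real \<Rightarrow> (complex \<Rightarrow> complex) \<Rightarrow> ereal" where
  "circle_norm \<sigma> R f =
     (let w = (\<lambda>n. (norm (circle_coeff f R n))\<^sup>2 * (1 + \<bar>of_int n\<bar>) powr (2 * \<sigma>))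
      in if w summable_on UNIV then ereal (sqrt (2 * pi) * sqrt (\<Sum>\<^sub>\<infinity>n. w n)) else \<infinity>)"

end

theory Submission imports Defs "HOL-Real_Asymp.Real_Asymp"
begin

text \<open>Separating variables, the scattered field has the Fourier coefficients
 \<open>a\<^sub>n R\<^sub>n H\<^sub>n\<close>. If the imaginary part of the denominator \<open>D\<^sub>n\<close> vanishes, then \<open>R\<^sub>n = -1\<close>, and the
 \<open>n\<close>-th mode alone bounds the norm from below by \<open>\<bar>a\<^sub>n H\<^sub>n\<bar>\<close>. This imaginary part has the sign of the
 derivative of \<open>Y\<^sub>n(x) / J\<^sub>n(lam x)\<close>: it is positive somewhere near \<open>0\<close>, where the quotient rises from
 \<open>-\<infinity>\<close>, and negative at \<open>lam x = j\<^sub>n\<close> as soon as \<open>lam > j\<^sub>n / y\<^sub>n\<close>, so there is a resonance in between;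
 as \<open>\<bar>H\<^sub>n\<bar>\<close> decreases, it may be replaced by its upper bound. For \<open>n = 0\<close> and \<open>lam > exp 2\<close> the sign change is
 located by the power series.

 That the condition persists from \<open>n\<^sub>0\<close> on is the monotonicity of \<open>j\<^sub>n / y\<^sub>n\<close>. With a continuous order \<open>c\<close>,
 the phase of \<open>H\<^sub>c\<close> is defined by its derivative \<open>2 / (pi x N\<^sub>c(x))\<close>, where \<open>N\<^sub>c = \<bar>H\<^sub>c\<bar>\<^sup>2\<close> is given by
 Nicholson's integral, and Watson's formula shows that on a level curve of the phase \<open>d ln x / dc\<close> decreases
 in \<open>x\<close>.\<close>

text \<open>Bessel functions exist here for integer order only, while comparing
  \<open>j_n / y_n\<close> with the next order needs an order that varies continuously. The real
  order therefore enters only through integrals: Nicholson's integral makes sense for every real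
  \<open>c\<close>, is tied to \<open>J\<close> and \<open>Y\<close> at the integers by induction,
  and the phases of neighbouring integer orders are aligned by a limit at infinity. Large arguments
  are handled by concentration of the integrals near \<open>t = 0\<close> instead of asymptotic
  expansions, and identities between integrals by a third-order differential equation with a
  conserved quadratic form. On the scattering side the field is an arbitrary weak solution, so its
  Fourier modes must be extracted from the weak equation. Test functions
  \<open>g (|z|^2) * cnj z ^ m\<close> and the variable \<open>rho = |z|^2\<close> avoid the
  singularity of polar coordinates at the origin and make the radial density constant. What remains
  is a one-dimensional distributional equation, from which regularity and the transmission
  conditions at the interface are recovered.\<close>

abbreviation (input) JB :: "nat => real => real" where "JB n == bessel_J (int n)"

notation (input) tendsto (infixr "--->" 55)

section \<open>Power series of the Bessel functions\<close>

text \<open>Bessel-Clifford functions: up to the factor \<open>(x / 2) ^ n\<close>,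
  \<open>JB n x\<close> is \<open>clifford_J n\<close> at \<open>z = x^2 / 4\<close>, and likewise
  for \<open>Y\<close>. In \<open>z\<close>, differentiation is minus a raising of the index, so
  derivatives and recurrences become termwise facts about series.\<close>

definition clifford_J :: "nat => real => real" where
 "clifford_J n z = (\<Sum>k. (- 1) ^ k / (fact k * fact (n + k)) * z ^ k)"

definition clifford_P :: "nat => real => real" where
 "clifford_P n z = (\<Sum>k<n. fact (n - k - 1) / fact k * z ^ k)"

definition clifford_S :: "nat => real => real" where
 "clifford_S n z = (\<Sum>k. (- 1) ^ k * (Digamma (real k + 1) + Digamma (real (n + k) + 1))
  / (fact k * fact (n + k)) * z ^ k)"

text \<open>The logarithm carries no factor 2 because \<open>ln (x^2 / 4) = 2 * ln (x / 2)\<close>.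
  \<open>clifford_P\<close> is the polynomial that produces the pole, \<open>clifford_S\<close> the
  entire digamma series.\<close>

definition clifford_Y :: "nat => real => real" where
 "clifford_Y n z = (ln z * clifford_J n z - clifford_P n z / z ^ n - clifford_S n z) / pi"

lemma DERIV_unique_ev:
 fixes f g :: "real => real"
 assumes "(f has_real_derivative D) (at z)" "(g has_real_derivative E) (at z)"
  and "\<forall>\<^sub>F w in nhds z. f w = g w"
 shows "D = E"
 using DERIV_unique assms DERIV_cong_ev[OF refl assms(3) refl] by blast

lemma summable_power_fact: "summable (%k. (z::real) ^ k / fact k)"
 using summable_exp_generic[of z] by (simp add: field_simps)

lemma summable_clifford_J: "summable (%k. (- 1) ^ k / (fact k * fact (n + k)) * (z::real) ^ k)"
proof (rule summable_comparison_test'[OF summable_power_fact[of "\<bar>z\<bar>"]])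
 fix k
 have "\<bar>z\<bar> ^ k / (fact k * fact (n + k)) <= \<bar>z\<bar> ^ k / (fact k * 1 :: real)"
  by (intro divide_left_mono mult_left_mono) auto
 then show "norm ((- 1) ^ k / (fact k * fact (n + k)) * z ^ k) <= \<bar>z\<bar> ^ k / fact k"
  by (simp add: abs_mult power_abs)
qed

text \<open>\<open>Digamma (m + 1)\<close> is a harmonic number minus Euler's constant, which lies
  between 0 and 1. The linear bound is far from sharp but enough for convergence, and later for
  explicit estimates at very small arguments.\<close>

lemma abs_Digamma_le: "\<bar>Digamma (real m + 1)\<bar> <= real m + 1"
proof -
 have e: "Digamma (real m + 1) = harm m - euler_mascheroni"
  using Digamma_of_nat[of m, where ?'a=real] by (simp add: add.commute)
 have h: "harm m <= real m"
 proof -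
  have "harm m <= (\<Sum>k=1..m. (1::real))"
  unfolding harm_def by (intro sum_mono) (simp add: field_simps)
  then show ?thesis by simp
 qed
 have "0 <= (harm m :: real)" by (rule harm_nonneg)
 moreover have "0 < (euler_mascheroni :: real)" "(euler_mascheroni :: real) < 1"
  using euler_mascheroni_pos euler_mascheroni_less_13_over_22 by auto
 ultimately show ?thesis using e h by auto
qed

lemma Digamma_Suc: "Digamma (real k + 2) = Digamma (real k + 1) + 1 / (real k + 1)"
 using Digamma_plus1[of "real k + 1"] by (simp add: add.assoc)

lemma summable_clifford_S:
 "summable (%k. (- 1) ^ k * (Digamma (real k + 1) + Digamma (real (n + k) + 1))
  / (fact k * fact (n + k)) * (z::real) ^ k)"
proof (rule summable_comparison_test'[OF summable_mult[OF summable_power_fact[of "2 * \<bar>z\<bar>"]]])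
 fix k
 have "\<bar>Digamma (real k + 1) + Digamma (real (n + k) + 1)\<bar> <= (real k + 1) + (real (n + k) + 1)"
  using abs_Digamma_le[of k] abs_Digamma_le[of "n + k"] by linarith
 also have "... <= 2 * (real n + 1) * (real k + 1)" by (simp add: algebra_simps)
 also have "real k + 1 <= 2 ^ k"
  by (induction k) auto
 finally have b: "\<bar>Digamma (real k + 1) + Digamma (real (n + k) + 1)\<bar> <= 2 * (real n + 1) * 2 ^ k"
  by (simp add: mult_left_mono)
 have "\<bar>Digamma (real k + 1) + Digamma (real (n + k) + 1)\<bar> / (fact k * fact (n + k)) * \<bar>z\<bar> ^ k
  <= 2 * (real n + 1) * 2 ^ k / (fact k * 1) * \<bar>z\<bar> ^ k"
  by (intro mult_right_mono frac_le b mult_left_mono) auto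
 then show "norm ((- 1) ^ k * (Digamma (real k + 1) + Digamma (real (n + k) + 1))
  / (fact k * fact (n + k)) * z ^ k) <= 2 * (real n + 1) * ((2 * \<bar>z\<bar>) ^ k / fact k)"
  by (simp add: abs_mult power_abs power_mult_distrib mult_ac)
qed

lemma suminf_head: "summable f ==> suminf f = f 0 + (\<Sum>k. f (Suc k))" for f :: "nat => real"
 using suminf_split_head[of f] by simp

lemma summable_shift: "summable f ==> summable (%k. f (Suc k))" for f :: "nat => real"
 by (simp add: summable_Suc_iff)

lemma DERIV_clifford_J: "(clifford_J n has_real_derivative - clifford_J (Suc n) z) (at z)"
proof -
 have "diffs (%k. (- 1) ^ k / (fact k * fact (n + k)) :: real)
  = (%k. - ((- 1) ^ k / (fact k * fact (Suc n + k))))"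
  by (auto simp: diffs_def fun_eq_iff divide_simps)
 then have e: "(\<Sum>k. diffs (%k. (- 1) ^ k / (fact k * fact (n + k)) :: real) k * z ^ k) = - clifford_J (Suc n) z"
  unfolding clifford_J_def
  using suminf_minus[OF summable_clifford_J[of "Suc n" z]] by simp
 show ?thesis
  using termdiffs_strong_converges_everywhere[of "%k. (- 1) ^ k / (fact k * fact (n + k)) :: real" z,
  OF summable_clifford_J] unfolding e clifford_J_def[abs_def] .
qed

lemma clifford_J_rec: "z * clifford_J (n + 2) z = (real n + 1) * clifford_J (Suc n) z - clifford_J n z"
proof -
 let ?a = "%n k. (- 1) ^ k / (fact k * fact (n + k)) * z ^ k"
 have s: "summable (?a m)" for m by (rule summable_clifford_J)
 have t: "(real n + 1) * ?a (Suc n) (Suc k) - ?a n (Suc k) = z * ?a (n + 2) k" for k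
 proof -
  have "(real n + 1) / (fact (Suc k) * fact (Suc n + Suc k)) - 1 / (fact (Suc k) * fact (n + Suc k))
  = - (1 / (fact k * fact (n + 2 + k) :: real))"
  by (simp add: divide_simps)
  then have "(- 1) ^ Suc k * z ^ Suc k * ((real n + 1) / (fact (Suc k) * fact (Suc n + Suc k)) - 1 / (fact (Suc k) * fact (n + Suc k)))
  = (- 1) ^ Suc k * z ^ Suc k * - (1 / (fact k * fact (n + 2 + k) :: real))" by (rule arg_cong)
  then show ?thesis by (simp add: right_diff_distrib mult_ac)
 qed
 have t0: "(real n + 1) * ?a (Suc n) 0 - ?a n 0 = 0"
  by (simp add: divide_simps)
 have "(real n + 1) * clifford_J (Suc n) z - clifford_J n z = (\<Sum>k. (real n + 1) * ?a (Suc n) k - ?a n k)"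
  unfolding clifford_J_def suminf_mult[OF s, symmetric] by (intro suminf_diff summable_mult s)
 also have "... = ((real n + 1) * ?a (Suc n) 0 - ?a n 0) + (\<Sum>k. (real n + 1) * ?a (Suc n) (Suc k) - ?a n (Suc k))"
  by (rule suminf_head) (intro summable_diff summable_mult s)
 also have "... = (\<Sum>k. z * ?a (n + 2) k)" unfolding t t0 by simp
 also have "... = z * clifford_J (n + 2) z" unfolding clifford_J_def using s by (rule suminf_mult)
 finally show ?thesis by simp
qed

text \<open>Shifting the summation index changes \<open>Digamma (k + 1)\<close> to
  \<open>Digamma (k + 2)\<close>, which adds \<open>1 / (k + 1)\<close>; these additions sum to the
  tail of the series of \<open>clifford_J n\<close>, divided by \<open>z\<close>.\<close>

lemma DERIV_clifford_S:
 assumes "z ~= 0"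
 shows "(clifford_S n has_real_derivative
  - clifford_S (Suc n) z - (1 / fact n - clifford_J n z) / z) (at z)"
proof -
 let ?c = "%n k. (- 1) ^ k * (Digamma (real k + 1) + Digamma (real (n + k) + 1)) / (fact k * fact (n + k)) :: real"
 let ?a = "%k. (- 1) ^ k / (fact k * fact (n + k)) * z ^ k"
 have d: "diffs (?c n) k * z ^ k = - (?c (Suc n) k * z ^ k) + ?a (Suc k) / z" for k
 proof -
  have D: "Digamma (real k + 1 + 1) = Digamma (real k + 1) + 1 / (real k + 1)"
  using Digamma_Suc[of k] by (simp add: add.commute)
  have f: "fact (Suc k) = (real k + 1) * fact k" "fact (n + Suc k) = (fact (Suc n + k) :: real)"
  "z ^ Suc k = z * z ^ k" "(- 1) ^ Suc k = - ((- 1 :: real) ^ k)" "real (n + Suc k) = real (Suc n + k)"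
  by (simp_all add: add.commute)
  have alg: "(r * (- e * ((d + 1 / r) + d') / (r * u * v))) * w = - (e * (d + d') / (u * v) * w) + - e / (r * u * v) * (z * w) / z"
  if "r > 0" "u > 0" "v > 0" for r e d d' u v w :: real
  using that assms by (simp add: field_simps)
  show ?thesis
  unfolding diffs_def D f of_nat_Suc[of k, where 'a=real, unfolded add.commute[of 1]]
  by (rule alg) auto
 qed
 have E: "(\<Sum>k. ?a (Suc k)) = clifford_J n z - 1 / fact n"
  unfolding clifford_J_def using suminf_head[OF summable_clifford_J[of n z]] by simp
 have sa: "summable (%k. ?a (Suc k))"
  by (rule summable_shift[OF summable_clifford_J])
 have "(\<Sum>k. diffs (?c n) k * z ^ k) = (\<Sum>k. - (?c (Suc n) k * z ^ k) + ?a (Suc k) / z)"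
  unfolding d ..
 also have "... = (\<Sum>k. - (?c (Suc n) k * z ^ k)) + (\<Sum>k. ?a (Suc k) / z)"
  by (intro suminf_add[symmetric] summable_minus summable_divide summable_clifford_S sa)
 also have "... = - clifford_S (Suc n) z + (clifford_J n z - 1 / fact n) / z"
  unfolding suminf_minus[OF summable_clifford_S] suminf_divide[OF sa] E clifford_S_def ..
 finally have e: "(\<Sum>k. diffs (?c n) k * z ^ k) = - clifford_S (Suc n) z - (1 / fact n - clifford_J n z) / z"
  by (simp add: field_simps assms)
 show ?thesis
  using termdiffs_strong_converges_everywhere[of "?c n" z, OF summable_clifford_S]
  unfolding e clifford_S_def[abs_def] .
qed

text \<open>In powers of \<open>1 / z\<close> each term moves to the next pole order. The sum for
  index \<open>Suc n\<close> has one term more, \<open>k = n\<close>, which is subtracted again and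
  later cancels the \<open>1 / fact n\<close> of the digamma series.\<close>

lemma DERIV_clifford_P:
 assumes "z ~= 0"
 shows "((%z. clifford_P n z / z ^ n) has_real_derivative
  - (clifford_P (Suc n) z - z ^ n / fact n) / z ^ Suc n) (at z)"
proof -
 have e: "clifford_P n w / w ^ n = (\<Sum>k<n. fact (n - k - 1) / fact k * inverse w ^ (n - k))"
  if "w ~= 0" for w
  unfolding clifford_P_def sum_divide_distrib
 proof (rule sum.cong[OF refl])
  fix k assume "k \<in> {..<n}"
  then have "w ^ n = w ^ k * w ^ (n - k)" by (simp add: power_add[symmetric])
  then show "fact (n - k - 1) / fact k * w ^ k / w ^ n = fact (n - k - 1) / fact k * inverse w ^ (n - k)"
  using that by (simp add: divide_simps power_inverse)
 qed
 have "((%w. \<Sum>k<n. fact (n - k - 1) / fact k * inverse w ^ (n - k)) has_real_derivative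
  (\<Sum>k<n. fact (n - k - 1) / fact k * (real (n - k) * inverse z ^ (n - k - 1) * (- ((inverse z)^2))))) (at z)"
  using assms
  by (auto intro!: derivative_eq_intros sum.cong simp: power2_eq_square mult_ac)
 moreover have "(\<Sum>k<n. fact (n - k - 1) / fact k * (real (n - k) * inverse z ^ (n - k - 1) * (- ((inverse z)^2))))
  = - (clifford_P (Suc n) z - z ^ n / fact n) / z ^ Suc n"
 proof -
  have "fact (n - k - 1) / fact k * (real (n - k) * inverse z ^ (n - k - 1) * (- ((inverse z)^2)))
  = - (fact (n - k) / fact k * z ^ k / z ^ Suc n)" if k: "k < n" for k
  proof -
  obtain j where j: "n = Suc (k + j)" using k less_imp_Suc_add by auto
  show ?thesis using assms unfolding j by (simp add: field_simps power_add power2_eq_square)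
  qed
  then have "(\<Sum>k<n. fact (n - k - 1) / fact k * (real (n - k) * inverse z ^ (n - k - 1) * (- ((inverse z)^2))))
  = - ((\<Sum>k<n. fact (n - k) / fact k * z ^ k) / z ^ Suc n)"
  by (simp add: sum_divide_distrib sum_negf)
  also have "(\<Sum>k<n. fact (n - k) / fact k * z ^ k) = clifford_P (Suc n) z - z ^ n / fact n"
  by (simp add: clifford_P_def)
  finally show ?thesis by (simp only: minus_divide_left)
 qed
 ultimately have "((%w. \<Sum>k<n. fact (n - k - 1) / fact k * inverse w ^ (n - k)) has_real_derivative
  - (clifford_P (Suc n) z - z ^ n / fact n) / z ^ Suc n) (at z)" by (simp only:)
 then show ?thesis
  by (rule has_field_derivative_transform_within_open[of _ _ _ "- {0}"]) (use assms e in auto)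
qed

text \<open>The derivative of the logarithm and the correction terms of the two preceding
  derivatives cancel, so \<open>Y\<close> obeys the same index shift as \<open>J\<close>.\<close>

lemma DERIV_clifford_Y:
 assumes "0 < z"
 shows "(clifford_Y n has_real_derivative - clifford_Y (Suc n) z) (at z)"
proof -
 have "((%z. (ln z * clifford_J n z - clifford_P n z / z ^ n - clifford_S n z) / pi) has_real_derivative
  (1 / z * clifford_J n z + ln z * (- clifford_J (Suc n) z)
  - (- (clifford_P (Suc n) z - z ^ n / fact n) / z ^ Suc n)
  - (- clifford_S (Suc n) z - (1 / fact n - clifford_J n z) / z)) / pi) (at z)"
  using assms
  by (intro DERIV_cdivide DERIV_diff DERIV_clifford_P DERIV_clifford_S)
  (auto intro!: derivative_eq_intros DERIV_clifford_J)
 moreover have "(1 / z * clifford_J n z + ln z * (- clifford_J (Suc n) z)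
  - (- (clifford_P (Suc n) z - z ^ n / fact n) / z ^ Suc n)
  - (- clifford_S (Suc n) z - (1 / fact n - clifford_J n z) / z)) / pi = - clifford_Y (Suc n) z"
  unfolding clifford_Y_def using assms by (simp add: field_simps)
 ultimately show ?thesis unfolding clifford_Y_def[abs_def] by simp
qed

lemma clifford_S_rec0: "z * clifford_S 2 z = clifford_S 1 z - clifford_S 0 z - 1"
proof -
 let ?a = "%n k. (- 1) ^ k * (Digamma (real k + 1) + Digamma (real (n + k) + 1)) / (fact k * fact (n + k)) * z ^ k"
 have s: "summable (?a m)" for m by (rule summable_clifford_S)
 have t: "?a 1 (Suc k) - ?a 0 (Suc k) = z * ?a 2 k" for k
 proof -
  have D1: "Digamma (real k + 1 + 1) = Digamma (real k + 1) + 1 / (real k + 1)"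
  using Digamma_Suc[of k] by (simp add: add.commute)
  have D2: "Digamma (real k + 1 + 1 + 1) = Digamma (real k + 1) + 1 / (real k + 1) + 1 / (real k + 1 + 1)"
  using Digamma_Suc[of "Suc k"] D1 by (simp add: add_ac)
  have f: "fact (Suc k) = (real k + 1) * fact k" "fact (1 + Suc k) = (real k + 1 + 1) * ((real k + 1) * fact k)"
  "fact (0 + Suc k) = (real k + 1) * fact k" "fact (2 + k) = (real k + 1 + 1) * ((real k + 1) * fact k)"
  "z ^ Suc k = z * z ^ k" "(- 1) ^ Suc k = - ((- 1 :: real) ^ k)"
  "real (Suc k) = real k + 1" "real (1 + Suc k) = real k + 1 + 1" "real (0 + Suc k) = real k + 1"
  "real (2 + k) = real k + 1 + 1"
  by (simp_all add: add.commute)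
  have alg: "- e * ((d + 1 / r) + (d + 1 / r + 1 / (r + 1))) / ((r * u) * ((r + 1) * (r * u))) * w
  - - e * ((d + 1 / r) + (d + 1 / r)) / ((r * u) * (r * u)) * w
  = e * (d + (d + 1 / r + 1 / (r + 1))) / (u * ((r + 1) * (r * u))) * w"
  if "r > 0" "u > 0" for r e d u w :: real
  using that by (simp add: divide_simps) algebra
  show ?thesis
  unfolding f D1 D2 using alg[of "real k + 1" "fact k" "(- 1) ^ k" "Digamma (real k + 1)" "z * z ^ k"]
  by (simp add: mult_ac)
 qed
 have t0: "?a 1 0 - ?a 0 0 = 1"
  using Digamma_Suc[of 0] by simp
 have "clifford_S 1 z - clifford_S 0 z = (\<Sum>k. ?a 1 k - ?a 0 k)"
  unfolding clifford_S_def using s by (intro suminf_diff)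
 also have "... = (?a 1 0 - ?a 0 0) + (\<Sum>k. ?a 1 (Suc k) - ?a 0 (Suc k))"
  by (rule suminf_head) (intro summable_diff s)
 also have "... = 1 + (\<Sum>k. z * ?a 2 k)" unfolding t t0 by simp
 also have "(\<Sum>k. z * ?a 2 k) = z * clifford_S 2 z" unfolding clifford_S_def using s by (rule suminf_mult)
 finally show ?thesis by simp
qed

text \<open>Differentiating the recurrence at index \<open>n\<close> gives the one at index
  \<open>n + 1\<close>, so the digamma series has to be manipulated only for
  \<open>n = 0\<close>.\<close>

lemma clifford_Y_rec:
 "0 < z ==> z * clifford_Y (n + 2) z = (real n + 1) * clifford_Y (Suc n) z - clifford_Y n z"
proof (induction n arbitrary: z)
 case 0
 have P: "clifford_P (Suc 0) z = 1" "clifford_P 2 z = 1 + z" "clifford_P 0 z = 0"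
  by (simp_all add: clifford_P_def numeral_2_eq_2)
 have "z * clifford_J 2 z = clifford_J (Suc 0) z - clifford_J 0 z"
  using clifford_J_rec[of z 0] by (simp add: numeral_2_eq_2)
 then have l: "z * (ln z * clifford_J 2 z) = ln z * clifford_J (Suc 0) z - ln z * clifford_J 0 z"
  by (metis mult.left_commute right_diff_distrib)
 have S: "z * clifford_S 2 z = clifford_S (Suc 0) z - clifford_S 0 z - 1"
  using clifford_S_rec0[of z] by simp
 have p: "z * (clifford_P 2 z / z ^ 2) = 1 / z + 1" using 0 by (simp add: P field_simps power2_eq_square)
 have "z * (ln z * clifford_J 2 z - clifford_P 2 z / z ^ 2 - clifford_S 2 z)
  = (ln z * clifford_J (Suc 0) z - clifford_P (Suc 0) z / z ^ Suc 0 - clifford_S (Suc 0) z)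
  - (ln z * clifford_J 0 z - clifford_P 0 z / z ^ 0 - clifford_S 0 z)"
  unfolding right_diff_distrib l S p by (simp add: P)
 then have "z * (ln z * clifford_J 2 z - clifford_P 2 z / z ^ 2 - clifford_S 2 z) / pi
  = ((ln z * clifford_J (Suc 0) z - clifford_P (Suc 0) z / z ^ Suc 0 - clifford_S (Suc 0) z)
  - (ln z * clifford_J 0 z - clifford_P 0 z / z ^ 0 - clifford_S 0 z)) / pi" by (rule arg_cong)
 then show ?case
  unfolding clifford_Y_def by (simp add: diff_divide_distrib[symmetric] numeral_2_eq_2)
next
 case (Suc n)
 have "((%z. z * clifford_Y (n + 2) z) has_real_derivative
  clifford_Y (n + 2) z + z * (- clifford_Y (Suc (n + 2)) z)) (at z)"
  using Suc.prems by (auto intro!: derivative_eq_intros DERIV_clifford_Y)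
 moreover have "((%z. (real n + 1) * clifford_Y (Suc n) z - clifford_Y n z) has_real_derivative
  (real n + 1) * (- clifford_Y (Suc (Suc n)) z) - (- clifford_Y (Suc n) z)) (at z)"
  using Suc.prems by (intro DERIV_diff DERIV_cmult DERIV_clifford_Y)
 moreover have "\<forall>\<^sub>F w in nhds z. w * clifford_Y (n + 2) w = (real n + 1) * clifford_Y (Suc n) w - clifford_Y n w"
  using eventually_nhds_in_open[of "{0<..}" z] Suc by (auto elim!: eventually_mono)
 ultimately have "clifford_Y (n + 2) z + z * (- clifford_Y (Suc (n + 2)) z)
  = (real n + 1) * (- clifford_Y (Suc (Suc n)) z) - (- clifford_Y (Suc n) z)"
  by (rule DERIV_unique_ev)
 then show ?case by (simp add: algebra_simps)
qed

section \<open>From Clifford series to Bessel functions\<close>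

lemma bessel_J_clifford:
 assumes "0 < x"
 shows "JB n x = (x / 2) ^ n * clifford_J n (x^2 / 4)"
proof -
 have "(- 1) ^ k / fact k * rGamma (of_int (int n + int k + 1)) * (x / 2) powi (int n + 2 * int k)
  = (x / 2) ^ n * ((- 1) ^ k / (fact k * fact (n + k)) * (x^2 / 4) ^ k)" for k
 proof -
  have g: "rGamma (of_int (int n + int k + 1)) = 1 / (fact (n + k) :: real)"
  using Gamma_fact[of "n + k", where ?'a=real] by (simp add: rGamma_inverse_Gamma inverse_eq_divide add_ac)
  have "(x / 2) powi (int n + 2 * int k) = (x / 2) ^ (n + 2 * k)"
  unfolding power_int_of_nat[symmetric] by simp
  also have "... = (x / 2) ^ n * (x^2 / 4) ^ k"
  by (simp add: power_add power_mult power_divide)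
  finally show ?thesis unfolding g by simp
 qed
 then show ?thesis
  unfolding bessel_J_def clifford_J_def using suminf_mult[OF summable_clifford_J] by simp
qed

lemma bessel_Y_clifford:
 assumes "0 < x"
 shows "bessel_Y n x = (x / 2) ^ n * clifford_Y n (x^2 / 4)"
proof -
 have z: "(x^2 / 4) = (x / 2)^2" by (simp add: power_divide)
 have l: "ln (x^2 / 4) = 2 * ln (x / 2)" using assms unfolding z by (simp add: ln_realpow)
 have p2: "a ^ (2 * k) / a ^ n = a ^ n * ((a^2) ^ k / (a^2) ^ n)" if "0 < a" for a :: real and k
  using that by (simp add: power_mult power2_eq_square power_mult_distrib)
 have P: "(\<Sum>k<n. fact (n - k - 1) / fact k * (x / 2) powi (2 * int k - int n))
  = (x / 2) ^ n * (clifford_P n (x^2 / 4) / (x^2 / 4) ^ n)"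
  unfolding clifford_P_def sum_divide_distrib sum_distrib_left
 proof (rule sum.cong[OF refl])
  fix k
  have "(x / 2) powi (2 * int k - int n) = (x / 2) powi (int (2 * k)) / (x / 2) powi int n"
  using assms by (simp add: power_int_diff)
  also have "... = (x / 2) ^ (2 * k) / (x / 2) ^ n" unfolding power_int_of_nat ..
  finally have e: "(x / 2) powi (2 * int k - int n) = (x / 2) ^ (2 * k) / (x / 2) ^ n" .
  have "(x / 2) ^ (2 * k) / (x / 2) ^ n = (x / 2) ^ n * (((x / 2)^2) ^ k / ((x / 2)^2) ^ n)"
  using p2[of "x / 2"] assms by simp
  then show "fact (n - k - 1) / fact k * (x / 2) powi (2 * int k - int n)
  = (x / 2) ^ n * (fact (n - k - 1) / fact k * (x^2 / 4) ^ k / (x^2 / 4) ^ n)"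
  unfolding e z by simp
 qed
 have S: "(\<Sum>k. (- 1) ^ k * (Digamma (real k + 1) + Digamma (real (n + k) + 1))
  / (fact k * fact (n + k)) * (x / 2) ^ (2 * k + n)) = (x / 2) ^ n * clifford_S n (x^2 / 4)"
  unfolding clifford_S_def suminf_mult[OF summable_clifford_S, symmetric] z
  by (simp add: power_add power_mult[symmetric] mult_ac)
 show ?thesis
  unfolding bessel_Y_def bessel_J_clifford[OF assms] P S clifford_Y_def l
  by (simp add: field_simps)
qed

section \<open>Derivatives, recurrences and behaviour at the origin\<close>

text \<open>The derivative of \<open>J\<close> expressed through the next order, so that recurrences
  and Wronskians between neighbouring orders turn into statements about derivatives by mere
  algebra.\<close>

definition dJ :: "nat => real => real" where
 "dJ n x = real n / x * JB n x - JB (Suc n) x"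

definition dY :: "nat => real => real" where
 "dY n x = real n / x * bessel_Y n x - bessel_Y (Suc n) x"

lemma DERIV_clifford_form:
 fixes f :: "nat => real => real" and C :: "nat => real => real"
 assumes f: "!!n z. 0 < z ==> (f n has_real_derivative - f (Suc n) z) (at z)"
  and C: "!!n x. 0 < x ==> C n x = (x / 2) ^ n * f n (x^2 / 4)" and "0 < x"
 shows "(C n has_real_derivative real n / x * C n x - C (Suc n) x) (at x)"
proof -
 have "((%x. (x / 2) ^ n * f n (x^2 / 4)) has_real_derivative
  (real n * (x / 2) ^ (n - 1) * (1 / 2)) * f n (x^2 / 4)
  + (x / 2) ^ n * (- f (Suc n) (x^2 / 4) * (x / 2))) (at x)"
 proof -
  have "((%x. (x / 2) ^ n) has_real_derivative real n * (x / 2) ^ (n - 1) * (1 / 2)) (at x)"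
  by (auto intro!: derivative_eq_intros)
  moreover have "((%x. f n (x^2 / 4)) has_real_derivative - f (Suc n) (x^2 / 4) * (x / 2)) (at x)"
  by (rule DERIV_chain2[OF f]) (use \<open>0 < x\<close> in \<open>auto intro!: derivative_eq_intros\<close>)
  ultimately show ?thesis
  by (rule DERIV_mult[THEN DERIV_cong]) simp
 qed
 moreover have "(real n * (x / 2) ^ (n - 1) * (1 / 2)) = real n / x * (x / 2) ^ n"
  using \<open>0 < x\<close> by (cases n) (auto simp: field_simps)
 moreover have "real n / x * (x / 2) ^ n * f n (x^2 / 4)
  + (x / 2) ^ n * (- f (Suc n) (x^2 / 4) * (x / 2)) = real n / x * C n x - C (Suc n) x"
  using \<open>0 < x\<close> by (simp add: C mult_ac)
 ultimately have "((%x. (x / 2) ^ n * f n (x^2 / 4)) has_real_derivative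
  real n / x * C n x - C (Suc n) x) (at x)"
  by (simp only:)
 then show ?thesis
  by (rule has_field_derivative_transform_within_open[of _ _ _ "{0<..}"]) (use \<open>0 < x\<close> C in auto)
qed

lemma rec_clifford_form:
 fixes f :: "nat => real => real" and C :: "nat => real => real"
 assumes f: "!!n z. 0 < z ==> z * f (n + 2) z = (real n + 1) * f (Suc n) z - f n z"
  and C: "!!n x. 0 < x ==> C n x = (x / 2) ^ n * f n (x^2 / 4)" and "0 < x"
 shows "C (Suc (Suc n)) x = 2 * (real n + 1) / x * C (Suc n) x - C n x"
proof -
 have "C (Suc (Suc n)) x = (x / 2) ^ n * (x^2 / 4 * f (n + 2) (x^2 / 4))"
  using \<open>0 < x\<close> by (simp add: C power2_eq_square)
 also have "... = (x / 2) ^ n * ((real n + 1) * f (Suc n) (x^2 / 4) - f n (x^2 / 4))"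
  using \<open>0 < x\<close> by (subst f) auto
 also have "... = 2 * (real n + 1) / x * C (Suc n) x - C n x"
  using \<open>0 < x\<close> by (simp add: C field_simps)
 finally show ?thesis .
qed

lemma DERIV_J: "0 < x ==> (JB n has_real_derivative dJ n x) (at x)"
 unfolding dJ_def
 by (rule DERIV_clifford_form[of clifford_J "%n. JB n"])
  (auto intro: DERIV_clifford_J bessel_J_clifford)

lemma DERIV_Y: "0 < x ==> (bessel_Y n has_real_derivative dY n x) (at x)"
 unfolding dY_def
 by (rule DERIV_clifford_form[of clifford_Y bessel_Y])
  (auto intro: DERIV_clifford_Y bessel_Y_clifford)

lemma J_rec: "0 < x ==> bessel_J (int (Suc (Suc n))) x
  = 2 * (real n + 1) / x * JB (Suc n) x - JB n x"
 by (rule rec_clifford_form[of clifford_J "%n. JB n"])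
  (use clifford_J_rec in \<open>auto intro: bessel_J_clifford\<close>)

lemma Y_rec: "0 < x ==> bessel_Y (Suc (Suc n)) x
  = 2 * (real n + 1) / x * bessel_Y (Suc n) x - bessel_Y n x"
 by (rule rec_clifford_form[of clifford_Y bessel_Y])
  (use clifford_Y_rec in \<open>auto intro: bessel_Y_clifford\<close>)

text \<open>Bessel's equation, from the raising formula for two consecutive orders and the
  three-term recurrence.\<close>

lemma DERIV_dJ:
 assumes "0 < x"
 shows "(dJ n has_real_derivative - dJ n x / x - (1 - (real n)^2 / x^2) * JB n x) (at x)"
proof -
 have "((%x. real n / x * JB n x - JB (Suc n) x) has_real_derivative
  (- real n / x^2 * JB n x + real n / x * dJ n x) - dJ (Suc n) x) (at x)"
  using assms
  by (auto intro!: derivative_eq_intros DERIV_J simp: power2_eq_square diff_divide_distrib simp del: of_nat_Suc)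
 moreover have "(- real n / x^2 * JB n x + real n / x * dJ n x) - dJ (Suc n) x
  = - dJ n x / x - (1 - (real n)^2 / x^2) * JB n x"
 proof -
  have c: "JB (Suc n) x = real n / x * JB n x - dJ n x" by (simp add: dJ_def)
  have d: "dJ (Suc n) x = JB n x - (real n + 1) / x * JB (Suc n) x"
  unfolding dJ_def[of "Suc n"] J_rec[OF assms] by (simp add: field_simps)
  show ?thesis unfolding d c using assms by (simp add: field_simps power2_eq_square)
 qed
 ultimately show ?thesis unfolding dJ_def[abs_def] by simp
qed

lemma DERIV_dY:
 assumes "0 < x"
 shows "(dY n has_real_derivative - dY n x / x - (1 - (real n)^2 / x^2) * bessel_Y n x) (at x)"
proof -
 have "((%x. real n / x * bessel_Y n x - bessel_Y (Suc n) x) has_real_derivative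
  (- real n / x^2 * bessel_Y n x + real n / x * dY n x) - dY (Suc n) x) (at x)"
  using assms
  by (auto intro!: derivative_eq_intros DERIV_Y simp: power2_eq_square diff_divide_distrib simp del: of_nat_Suc)
 moreover have "(- real n / x^2 * bessel_Y n x + real n / x * dY n x) - dY (Suc n) x
  = - dY n x / x - (1 - (real n)^2 / x^2) * bessel_Y n x"
 proof -
  have c: "bessel_Y (Suc n) x = real n / x * bessel_Y n x - dY n x" by (simp add: dY_def)
  have d: "dY (Suc n) x = bessel_Y n x - (real n + 1) / x * bessel_Y (Suc n) x"
  unfolding dY_def[of "Suc n"] Y_rec[OF assms] by (simp add: field_simps)
  show ?thesis unfolding d c using assms by (simp add: field_simps power2_eq_square)
 qed
 ultimately show ?thesis unfolding dY_def[abs_def] by simp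
qed

section \<open>Limits at the origin and the Wronskian\<close>

lemma isCont_clifford_J: "isCont (clifford_J n) z"
 using DERIV_clifford_J DERIV_isCont by blast

lemma isCont_clifford_S: "isCont (clifford_S n) z"
 unfolding clifford_S_def[abs_def]
 by (rule isCont_powser_converges_everywhere[OF summable_clifford_S])

lemma clifford_J_0: "clifford_J n 0 = 1 / fact n"
 using suminf_head[OF summable_clifford_J[of n 0]] by (simp add: clifford_J_def)

lemma clifford_S_00: "clifford_S 0 0 = - 2 * euler_mascheroni"
 using suminf_head[OF summable_clifford_S[of 0 0]] by (simp add: clifford_S_def)

lemma filterlim_sq_quarter: "filterlim (%x::real. x\<^sup>2 / 4) (at_right 0) (at_right 0)"
 by real_asymp

lemma tendsto_clifford_J: "(clifford_J n ---> 1 / fact n) (at_right 0)"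
 using isCont_clifford_J[where n=n and z=0] unfolding isCont_def clifford_J_0
 by (rule filterlim_mono) (auto simp: at_le)

lemma tendsto_clifford_S: "(clifford_S n ---> clifford_S n 0) (at_right 0)"
 using isCont_clifford_S[where n=n and z=0] unfolding isCont_def
 by (rule filterlim_mono) (auto simp: at_le)

lemma tendsto_J: "((%x. JB n x / (x / 2) ^ n) ---> 1 / fact n) (at_right 0)"
proof (rule Lim_transform_eventually)
 show "((%x. clifford_J n (x^2 / 4)) ---> 1 / fact n) (at_right 0)"
  using filterlim_compose[OF tendsto_clifford_J filterlim_sq_quarter] .
 show "\<forall>\<^sub>F x in at_right 0. clifford_J n (x^2 / 4) = JB n x / (x / 2) ^ n"
  using eventually_at_right_less[of 0] by eventually_elim (simp add: bessel_J_clifford)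
qed

lemma tendsto_J0: "(bessel_J 0 ---> 1) (at_right 0)"
 using tendsto_J[of 0] by simp

lemma tendsto_clifford_J_quot: "((%z. (clifford_J 0 z - 1) / z) ---> - clifford_J 1 0) (at_right 0)"
proof -
 have "((%z. (clifford_J 0 z - 1) / z) ---> - clifford_J 1 0) (at 0)"
  using DERIV_clifford_J[where n=0 and z=0] unfolding DERIV_def by (simp add: clifford_J_0)
 then show ?thesis by (rule tendsto_mono[OF at_le[OF subset_UNIV]])
qed

text \<open>The constant next to the logarithm is kept: the comparison with Nicholson's integral at
  the origin needs \<open>Y_0\<close> up to a vanishing error.\<close>

lemma tendsto_Y0: "((%x. bessel_Y 0 x - 2 / pi * (ln (x / 2) + euler_mascheroni)) ---> 0) (at_right 0)"
proof (rule Lim_transform_eventually)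
 note d = tendsto_clifford_J_quot
 have l: "((%z::real. z * ln z) ---> 0) (at_right 0)" by real_asymp
 have "((%z. (clifford_J 0 z - 1) / z * (z * ln z) - (clifford_S 0 z - clifford_S 0 0)) --->
  - clifford_J 1 0 * 0 - (clifford_S 0 0 - clifford_S 0 0)) (at_right 0)"
  by (intro tendsto_intros d l tendsto_clifford_S)
 then have "((%z. (clifford_J 0 z - 1) / z * (z * ln z) - (clifford_S 0 z - clifford_S 0 0)) ---> 0) (at_right 0)"
  by simp
 from tendsto_mult_left[OF filterlim_compose[OF this filterlim_sq_quarter], of "1 / pi"]
 show "((%x. ((clifford_J 0 (x^2 / 4) - 1) / (x^2 / 4) * ((x^2 / 4) * ln (x^2 / 4))
  - (clifford_S 0 (x^2 / 4) - clifford_S 0 0)) / pi) ---> 0) (at_right 0)"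
  by simp
 show "\<forall>\<^sub>F x in at_right 0. ((clifford_J 0 (x^2 / 4) - 1) / (x^2 / 4) * ((x^2 / 4) * ln (x^2 / 4))
  - (clifford_S 0 (x^2 / 4) - clifford_S 0 0)) / pi
  = bessel_Y 0 x - 2 / pi * (ln (x / 2) + euler_mascheroni)"
  using eventually_at_right_less[of 0]
 proof eventually_elim
  case (elim x)
  have l: "ln (x^2 / 4) = 2 * ln (x / 2)"
  using elim ln_realpow[of "x / 2" 2] by (simp add: power_divide)
  define w where "w = x^2 / 4"
  have w: "w ~= 0" "0 < w" using elim by (auto simp: w_def)
  have "(clifford_J 0 w - 1) / w * (w * ln w) = (clifford_J 0 w - 1) * ln w" using w by simp
  moreover have "bessel_Y 0 x = (ln w * clifford_J 0 w - clifford_S 0 w) / pi"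
  using elim by (simp add: bessel_Y_clifford clifford_Y_def clifford_P_def w_def)
  ultimately show ?case
  unfolding w_def[symmetric] clifford_S_00 using l unfolding w_def[symmetric]
  by (simp add: field_simps)
 qed
qed

lemma Y0_at_bot: "filterlim (bessel_Y 0) at_bot (at_right 0)"
proof -
 have "filterlim (%x::real. 2 / pi * (ln (x / 2) + euler_mascheroni)) at_bot (at_right 0)"
  by real_asymp
 then have "filterlim (%x::real. - (2 / pi * (ln (x / 2) + euler_mascheroni))) at_top (at_right 0)"
  by (simp add: filterlim_uminus_at_bot)
 from filterlim_tendsto_add_at_top[OF tendsto_minus[OF tendsto_Y0] this]
 show ?thesis by (simp add: filterlim_uminus_at_bot)
qed

lemma tendsto_xJ1_Y0: "((%x. x * bessel_J 1 x * bessel_Y 0 x) ---> 0) (at_right 0)"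
proof (rule Lim_transform_eventually)
 have l: "((%x::real. x\<^sup>2 / 2) ---> 0) (at_right 0)" by real_asymp
 have l2: "((%x::real. x\<^sup>2 / 2 * (2 / pi * (ln (x / 2) + euler_mascheroni))) ---> 0) (at_right 0)" by real_asymp
 have "((%x. JB 1 x / (x / 2) ^ 1 * (x^2 / 2 * (bessel_Y 0 x - 2 / pi * (ln (x / 2) + euler_mascheroni))
  + x^2 / 2 * (2 / pi * (ln (x / 2) + euler_mascheroni)))) ---> 1 / fact 1 * (0 * 0 + 0)) (at_right 0)"
  by (intro tendsto_intros tendsto_J[of 1] tendsto_Y0 l l2)
 then show "((%x. JB 1 x / (x / 2) ^ 1 * (x^2 / 2 * (bessel_Y 0 x - 2 / pi * (ln (x / 2) + euler_mascheroni))
  + x^2 / 2 * (2 / pi * (ln (x / 2) + euler_mascheroni)))) ---> 0) (at_right 0)" by simp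
 show "\<forall>\<^sub>F x in at_right 0. JB 1 x / (x / 2) ^ 1 * (x^2 / 2 * (bessel_Y 0 x - 2 / pi * (ln (x / 2) + euler_mascheroni))
  + x^2 / 2 * (2 / pi * (ln (x / 2) + euler_mascheroni))) = x * bessel_J 1 x * bessel_Y 0 x"
  using eventually_at_right_less[of 0]
  by eventually_elim (simp only: distrib_left[symmetric], simp add: power2_eq_square)
qed

lemma tendsto_xJ1: "((%x. x * bessel_J 1 x) ---> 0) (at_right 0)"
proof (rule Lim_transform_eventually)
 have l: "((%x::real. x\<^sup>2 / 2) ---> 0) (at_right 0)" by real_asymp
 have "((%x. JB 1 x / (x / 2) ^ 1 * (x^2 / 2)) ---> 1 / fact 1 * 0) (at_right 0)"
  by (intro tendsto_intros tendsto_J[of 1] l)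
 then show "((%x. JB 1 x / (x / 2) ^ 1 * (x^2 / 2)) ---> 0) (at_right 0)" by simp
 show "\<forall>\<^sub>F x in at_right 0. JB 1 x / (x / 2) ^ 1 * (x^2 / 2) = x * bessel_J 1 x"
  using eventually_at_right_less[of 0] by eventually_elim (simp add: power2_eq_square)
qed

lemma tendsto_xY1: "((%x. x * bessel_Y 1 x) ---> - 2 / pi) (at_right 0)"
proof (rule Lim_transform_eventually)
 have l: "((%z::real. z * ln z) ---> 0) (at_right 0)" by real_asymp
 have i: "((%z::real. z) ---> 0) (at_right 0)" by real_asymp
 have "((%z. 2 / pi * (z * ln z * clifford_J 1 z - 1 - z * clifford_S 1 z)) --->
  2 / pi * (0 * (1 / fact 1) - 1 - 0 * clifford_S 1 0)) (at_right 0)"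
  by (intro tendsto_intros l i tendsto_clifford_S tendsto_clifford_J)
 from filterlim_compose[OF this filterlim_sq_quarter]
 show "((%x. 2 / pi * ((x^2 / 4) * ln (x^2 / 4) * clifford_J 1 (x^2 / 4) - 1 - (x^2 / 4) * clifford_S 1 (x^2 / 4)))
  ---> - 2 / pi) (at_right 0)" by simp
 show "\<forall>\<^sub>F x in at_right 0. 2 / pi * ((x^2 / 4) * ln (x^2 / 4) * clifford_J 1 (x^2 / 4) - 1 - (x^2 / 4) * clifford_S 1 (x^2 / 4))
  = x * bessel_Y 1 x"
  using eventually_at_right_less[of 0]
 proof eventually_elim
  case (elim x)
  define w where "w = x^2 / 4"
  have w: "w ~= 0" "0 < w" using elim by (auto simp: w_def)
  have "x * bessel_Y 1 x = 2 * w * ((ln w * clifford_J 1 w - 1 / w - clifford_S 1 w) / pi)"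
  using elim by (simp add: bessel_Y_clifford clifford_Y_def clifford_P_def w_def power2_eq_square)
  also have "... = 2 / pi * (w * ln w * clifford_J 1 w - 1 - w * clifford_S 1 w)"
  using w by (simp add: field_simps)
  finally show ?case unfolding w_def by simp
 qed
qed

text \<open>By the recurrences the expression does not depend on \<open>n\<close>. For
  \<open>n = 0\<close>, \<open>x\<close> times it is constant, and the constant is read off at the
  origin, where \<open>x * Y_1\<close> tends to \<open>- 2 / pi\<close> and
  \<open>x * J_1 * Y_0\<close> to 0.\<close>

lemma cross_wronskian:
 "0 < x ==> JB (Suc n) x * bessel_Y n x - JB n x * bessel_Y (Suc n) x = 2 / (pi * x)"
proof (induction n)
 case 0
 define W where "W x = x * (bessel_J 1 x * bessel_Y 0 x - bessel_J 0 x * bessel_Y 1 x)" for x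
 have D: "(W has_real_derivative 0) (at x)" if "0 < x" for x
 proof -
  have J0: "(bessel_J 0 has_real_derivative dJ 0 x) (at x)" and J1: "(bessel_J 1 has_real_derivative dJ 1 x) (at x)"
  using DERIV_J[OF that, of 0] DERIV_J[OF that, of 1] by simp_all
  show ?thesis
  unfolding W_def[abs_def]
  proof (rule DERIV_cong)
  show "((%x. x * (bessel_J 1 x * bessel_Y 0 x - bessel_J 0 x * bessel_Y 1 x)) has_real_derivative
  1 * (bessel_J 1 x * bessel_Y 0 x - bessel_J 0 x * bessel_Y 1 x)
  + ((dJ 1 x * bessel_Y 0 x + dY 0 x * bessel_J 1 x) - (dJ 0 x * bessel_Y 1 x + dY 1 x * bessel_J 0 x)) * x) (at x)"
  by (intro DERIV_mult DERIV_diff DERIV_ident J0 J1 DERIV_Y that)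
  have J2: "JB (Suc 1) x = 2 / x * bessel_J 1 x - bessel_J 0 x"
  using J_rec[OF that, of 0] by simp
  have Y2: "bessel_Y (Suc 1) x = 2 / x * bessel_Y 1 x - bessel_Y 0 x"
  using Y_rec[OF that, of 0] by simp
  have J1': "JB (Suc 0) x = bessel_J 1 x" "JB 1 x = bessel_J 1 x" by simp_all
  show "1 * (bessel_J 1 x * bessel_Y 0 x - bessel_J 0 x * bessel_Y 1 x)
  + ((dJ 1 x * bessel_Y 0 x + dY 0 x * bessel_J 1 x) - (dJ 0 x * bessel_Y 1 x + dY 1 x * bessel_J 0 x)) * x = 0"
  unfolding dJ_def dY_def J2 Y2 J1' using that by (simp add: field_simps)
  qed
 qed
 have "((%x. x * bessel_J 1 x * bessel_Y 0 x - bessel_J 0 x * (x * bessel_Y 1 x)) ---> 0 - 1 * (- 2 / pi)) (at_right 0)"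
  by (intro tendsto_intros tendsto_xJ1_Y0 tendsto_J0 tendsto_xY1)
 then have lim: "(W ---> 2 / pi) (at_right 0)"
  unfolding W_def[abs_def] by (simp add: algebra_simps)
 have const: "W y = W x" if "0 < y" for y
 proof -
  have "\<exists>c. \<forall>z\<in>{0<..}. W z = c"
  by (rule has_field_derivative_zero_constant) (auto intro: D has_field_derivative_at_within)
  then show ?thesis using that 0 by auto
 qed
 have "(W ---> W x) (at_right 0)"
  using const eventually_at_right_less[of "0::real"] by (auto intro!: tendsto_eventually elim!: eventually_mono)
 then have "W x = 2 / pi" using lim tendsto_unique trivial_limit_at_right_real by blast
 then show ?case using 0 by (simp add: W_def field_simps)
next
 case (Suc n)
 have "bessel_J (int (Suc (Suc n))) x * bessel_Y (Suc n) x - JB (Suc n) x * bessel_Y (Suc (Suc n)) x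
  = JB (Suc n) x * bessel_Y n x - JB n x * bessel_Y (Suc n) x"
  unfolding J_rec[OF Suc.prems] Y_rec[OF Suc.prems] by (simp add: algebra_simps)
 then show ?case using Suc by simp
qed

lemma wronskian: "0 < x ==> JB n x * dY n x - dJ n x * bessel_Y n x = 2 / (pi * x)"
 using cross_wronskian[of x n] by (simp add: dJ_def dY_def algebra_simps)

text \<open>Needed where \<open>x * Y_1\<close> is multiplied by the divergent \<open>Y_0\<close>.
  The Wronskian expresses \<open>x * Y_1 + 2 / pi\<close> through \<open>x * J_1 * Y_0\<close> and
  \<open>J_0 - 1\<close>, which avoids a second-order expansion of \<open>Y_1\<close>.\<close>

lemma tendsto_xY0pre: "((%x. (x * bessel_Y 1 x + 2 / pi) * bessel_Y 0 x) ---> 0) (at_right 0)"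
proof (rule Lim_transform_eventually)
 have a: "((%x. x * bessel_J 1 x * bessel_Y 0 x * bessel_Y 0 x) ---> 0) (at_right 0)"
 proof (rule Lim_transform_eventually)
  let ?l = "%x::real. 2 / pi * (ln (x / 2) + euler_mascheroni)"
  have l: "((%x::real. x\<^sup>2 / 2) ---> 0) (at_right 0)" by real_asymp
  have l2: "((%x::real. x\<^sup>2 / 2 * ?l x) ---> 0) (at_right 0)" by real_asymp
  have l3: "((%x::real. x\<^sup>2 / 2 * (?l x * ?l x)) ---> 0) (at_right 0)" by real_asymp
  have "((%x. JB 1 x / (x / 2) ^ 1 * (x^2 / 2 * ((bessel_Y 0 x - ?l x) * (bessel_Y 0 x - ?l x))
  + 2 * (x^2 / 2 * ?l x) * (bessel_Y 0 x - ?l x) + x^2 / 2 * (?l x * ?l x))) ---> 1 / fact 1 * (0 * (0 * 0) + 2 * 0 * 0 + 0)) (at_right 0)"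
  by (intro tendsto_intros tendsto_J[of 1] tendsto_Y0 l l2 l3)
  then show "((%x. JB 1 x / (x / 2) ^ 1 * (x^2 / 2 * ((bessel_Y 0 x - ?l x) * (bessel_Y 0 x - ?l x))
  + 2 * (x^2 / 2 * ?l x) * (bessel_Y 0 x - ?l x) + x^2 / 2 * (?l x * ?l x))) ---> 0) (at_right 0)" by simp
  show "\<forall>\<^sub>F x in at_right 0. JB 1 x / (x / 2) ^ 1 * (x^2 / 2 * ((bessel_Y 0 x - ?l x) * (bessel_Y 0 x - ?l x))
  + 2 * (x^2 / 2 * ?l x) * (bessel_Y 0 x - ?l x) + x^2 / 2 * (?l x * ?l x)) = x * bessel_J 1 x * bessel_Y 0 x * bessel_Y 0 x"
  using eventually_at_right_less[of 0]
  proof eventually_elim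
  case (elim x)
  define l where "l = ?l x"
  have e: "x^2 / 2 * ((bessel_Y 0 x - l) * (bessel_Y 0 x - l)) + 2 * (x^2 / 2 * l) * (bessel_Y 0 x - l) + x^2 / 2 * (l * l)
  = x^2 / 2 * (bessel_Y 0 x * bessel_Y 0 x)" by (simp add: algebra_simps)
  show ?case unfolding l_def[symmetric] e using elim by (simp add: power2_eq_square)
  qed
 qed
 have b: "((%x. (bessel_J 0 x - 1) * bessel_Y 0 x) ---> 0) (at_right 0)"
 proof (rule Lim_transform_eventually)
  let ?l = "%x::real. 2 / pi * (ln (x / 2) + euler_mascheroni)"
 note d = tendsto_clifford_J_quot
  note d = filterlim_compose[OF d filterlim_sq_quarter]
  have l: "((%x::real. x\<^sup>2 / 4) ---> 0) (at_right 0)" by real_asymp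
  have l2: "((%x::real. x\<^sup>2 / 4 * ?l x) ---> 0) (at_right 0)" by real_asymp
  have "((%x. (clifford_J 0 (x^2 / 4) - 1) / (x^2 / 4) * (x^2 / 4 * (bessel_Y 0 x - ?l x) + x^2 / 4 * ?l x)) ---> - clifford_J 1 0 * (0 * 0 + 0)) (at_right 0)"
  by (intro tendsto_intros d tendsto_Y0 l l2)
  then show "((%x. (clifford_J 0 (x^2 / 4) - 1) / (x^2 / 4) * (x^2 / 4 * (bessel_Y 0 x - ?l x) + x^2 / 4 * ?l x)) ---> 0) (at_right 0)" by simp
  show "\<forall>\<^sub>F x in at_right 0. (clifford_J 0 (x^2 / 4) - 1) / (x^2 / 4) * (x^2 / 4 * (bessel_Y 0 x - ?l x) + x^2 / 4 * ?l x)
  = (bessel_J 0 x - 1) * bessel_Y 0 x"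
  using eventually_at_right_less[of 0]
  proof eventually_elim
  case (elim x)
  define l where "l = ?l x"
  define w where "w = x^2 / 4"
  have "w ~= 0" using elim by (simp add: w_def)
  moreover have "bessel_J 0 x = clifford_J 0 w" using bessel_J_clifford[OF elim, of 0] by (simp add: w_def)
  moreover have "w * (bessel_Y 0 x - l) + w * l = w * bessel_Y 0 x" by (simp add: algebra_simps)
  ultimately show ?case unfolding l_def[symmetric] w_def[symmetric] by simp
  qed
 qed
 have "((%x. (x * bessel_J 1 x * bessel_Y 0 x * bessel_Y 0 x + 2 / pi * ((bessel_J 0 x - 1) * bessel_Y 0 x)) / bessel_J 0 x)
  ---> (0 + 2 / pi * 0) / 1) (at_right 0)"
  by (intro tendsto_intros a b tendsto_J0) auto
 then show "((%x. (x * bessel_J 1 x * bessel_Y 0 x * bessel_Y 0 x + 2 / pi * ((bessel_J 0 x - 1) * bessel_Y 0 x)) / bessel_J 0 x)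
  ---> 0) (at_right 0)" by simp
 have "\<forall>\<^sub>F x in at_right 0. bessel_J 0 x > 0"
  using order_tendstoD(1)[OF tendsto_J0, of 0] by simp
 with eventually_at_right_less[of 0]
 show "\<forall>\<^sub>F x in at_right 0. (x * bessel_J 1 x * bessel_Y 0 x * bessel_Y 0 x + 2 / pi * ((bessel_J 0 x - 1) * bessel_Y 0 x)) / bessel_J 0 x
  = (x * bessel_Y 1 x + 2 / pi) * bessel_Y 0 x"
 proof eventually_elim
  case (elim x)
  have "bessel_J 0 x * (x * bessel_Y 1 x) = x * bessel_J 1 x * bessel_Y 0 x - 2 / pi"
  using cross_wronskian[of x 0] elim by (simp add: field_simps)
  then have "(x * bessel_Y 1 x) = (x * bessel_J 1 x * bessel_Y 0 x - 2 / pi) / bessel_J 0 x"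
  using elim by (simp add: field_simps)
  then have e: "x * bessel_Y 1 x + 2 / pi = (x * bessel_J 1 x * bessel_Y 0 x + 2 / pi * (bessel_J 0 x - 1)) / bessel_J 0 x"
  using elim by (simp add: divide_simps) (simp add: algebra_simps)
  show ?case unfolding e by (simp add: distrib_right)
 qed
qed

section \<open>Integrals over the half-line\<close>

text \<open>Lebesgue measure on the open half-line as a measure of its own: integrands singular at
  0, or meaningless below 0, then need no indicator functions.\<close>

definition half_line :: "real measure" where
 "half_line = restrict_space lborel {0<..}"

lemma space_half_line [simp]: "space half_line = {0<..}"
 by (simp add: half_line_def space_restrict_space)

lemma borel_measurable_half_line:
 assumes "continuous_on {0<..} f"
 shows "f \<in> borel_measurable half_line"
 unfolding half_line_def
 using borel_measurable_continuous_on_restrict[OF assms]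
 by (simp add: measurable_cong_sets[OF sets_restrict_space_cong[OF sets_lborel] refl])

lemma integral_half_line: "integral\<^sup>L half_line f = (LINT t:{0<..}|lborel. f t)" for f :: "real => real"
 unfolding half_line_def set_lebesgue_integral_def by (subst integral_restrict_space) auto

lemma integrable_half_line: "integrable half_line f \<longleftrightarrow> set_integrable lborel {0<..} f" for f :: "real => real"
 unfolding half_line_def set_integrable_def by (subst integrable_restrict_space) auto

lemma integrable_half_line_bound:
 fixes f g :: "real => real"
 assumes "integrable half_line g" "continuous_on {0<..} f" "!!t. 0 < t ==> \<bar>f t\<bar> <= g t"
 shows "integrable half_line f"
 by (rule Bochner_Integration.integrable_bound[OF assms(1) borel_measurable_half_line[OF assms(2)]])
  (use assms(3) in \<open>force intro!: AE_I2\<close>)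

lemma integral_half_line_mono:
 fixes f g :: "real => real"
 assumes "integrable half_line f" "integrable half_line g" "!!t. 0 < t ==> f t <= g t"
 shows "integral\<^sup>L half_line f <= integral\<^sup>L half_line g"
 by (rule integral_mono) (use assms in auto)

lemma integral_half_line_cong:
 "(!!t. 0 < t ==> f t = g t) ==> integral\<^sup>L half_line f = integral\<^sup>L half_line g"
 by (rule Bochner_Integration.integral_cong) auto

lemma FTC_half_line:
 fixes f F :: "real => real"
 assumes "!!t. 0 < t ==> (F has_real_derivative f t) (at t)" "continuous_on {0<..} f"
  and "integrable half_line f" "(F ---> A) (at_right 0)" "(F ---> B) at_top"
 shows "integral\<^sup>L half_line f = B - A"
proof -
 have e: "einterval 0 \<infinity> = {0<..}" by (auto simp: einterval_def)
 have "(LBINT t=0..\<infinity>. f t) = B - A"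
 proof (rule interval_integral_FTC_integrable)
  show "((F \<circ> real_of_ereal) ---> A) (at_right 0)"
  using assms(4) by (simp add: ereal_tendsto_simps zero_ereal_def)
  show "((F \<circ> real_of_ereal) ---> B) (at_left \<infinity>)"
  using assms(5) by (simp add: ereal_tendsto_simps)
  show "isCont f x" if "0 < ereal x" for x
  using assms(2) that by (simp add: continuous_on_eq_continuous_at)
 qed (use assms in \<open>auto simp: e integrable_half_line has_real_derivative_iff_has_vector_derivative\<close>)
 then show ?thesis
  by (simp add: interval_lebesgue_integral_def e integral_half_line)
qed

lemma FTC_half_line_nonneg:
 fixes f F :: "real => real"
 assumes "!!t. 0 < t ==> (F has_real_derivative f t) (at t)" "continuous_on {0<..} f"
  and "!!t. 0 < t ==> 0 <= f t" "(F ---> A) (at_right 0)" "(F ---> B) at_top"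
 shows "integrable half_line f" "integral\<^sup>L half_line f = B - A"
proof -
 have e: "einterval 0 \<infinity> = {0<..}" by (auto simp: einterval_def)
 have "set_integrable lborel (einterval 0 \<infinity>) f"
 proof (rule interval_integral_FTC_nonneg)
  show "((F \<circ> real_of_ereal) ---> A) (at_right 0)"
  using assms(4) by (simp add: ereal_tendsto_simps zero_ereal_def)
  show "((F \<circ> real_of_ereal) ---> B) (at_left \<infinity>)"
  using assms(5) by (simp add: ereal_tendsto_simps)
  show "isCont f x" if "0 < ereal x" for x
  using assms(2) that by (simp add: continuous_on_eq_continuous_at)
  show "DERIV F x :> f x" if "0 < ereal x" for x using assms(1) that by simp
  show "AE x in lborel. 0 < ereal x --> ereal x < \<infinity> --> 0 <= f x" using assms(3) by auto
 qed auto
 then show i: "integrable half_line f" by (simp add: integrable_half_line e)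
 show "integral\<^sup>L half_line f = B - A" by (rule FTC_half_line[OF assms(1,2) i assms(4,5)])
qed

lemma integral_half_line_scale:
 fixes f :: "real => real"
 assumes "0 < c"
 shows "integral\<^sup>L half_line (%t. f (c * t)) = integral\<^sup>L half_line f / c"
  and "integrable half_line (%t. f (c * t)) \<longleftrightarrow> integrable half_line f"
proof -
 have i: "indicat_real {0<..} (c * t) = indicat_real {0<..} t" for t
  using assms by (simp add: indicator_def zero_less_mult_iff)
 have "(\<integral>t. indicat_real {0<..} t * f t \<partial>lborel) = \<bar>c\<bar> * (\<integral>t. indicat_real {0<..} (0 + c * t) * f (0 + c * t) \<partial>lborel)"
  using lborel_integral_real_affine[of c "%t. indicat_real {0<..} t * f t" 0] assms by simp
 then show "integral\<^sup>L half_line (%t. f (c * t)) = integral\<^sup>L half_line f / c"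
  using assms i by (simp add: integral_half_line set_lebesgue_integral_def)
 have "integrable lborel (%t. indicat_real {0<..} (0 + c * t) * f (0 + c * t)) \<longleftrightarrow> integrable lborel (%t. indicat_real {0<..} t * f t)"
  using assms by (intro lborel_integrable_real_affine_iff) simp
 then show "integrable half_line (%t. f (c * t)) \<longleftrightarrow> integrable half_line f"
  using i by (simp add: integrable_half_line set_integrable_def)
qed

lemma integrable_exp_neg: "integrable half_line (%t. exp (- t))" "integral\<^sup>L half_line (%t. exp (- t)) = (1::real)"
proof -
 have D: "((%t. - exp (- t)) has_real_derivative exp (- t)) (at t)" for t :: real
  by (auto intro!: derivative_eq_intros)
 have c: "continuous_on {0<..} (%t::real. exp (- t))" by (intro continuous_intros)
 have l: "((%t::real. - exp (- t)) ---> -1) (at_right 0)" "((%t::real. - exp (- t)) ---> 0) at_top"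
  by real_asymp+
 show "integrable half_line (%t. exp (- t))" by (rule FTC_half_line_nonneg(1)[OF D c _ l]) simp
 show "integral\<^sup>L half_line (%t. exp (- t)) = (1::real)" using FTC_half_line_nonneg(2)[OF D c _ l] by simp
qed

text \<open>Differentiation under the integral: by the mean value inequality the difference
  quotients are bounded by the majorant of the derivative, so dominated convergence applies along
  every sequence tending to \<open>x0\<close>.\<close>

lemma has_real_derivative_integral:
 fixes f f' :: "real => 'a => real"
 assumes x0: "x0 \<in> {a<..<b}"
  and D: "!!x t. x \<in> {a<..<b} ==> t \<in> space M ==> ((%x. f x t) has_real_derivative f' x t) (at x)"
  and int: "!!x. x \<in> {a<..<b} ==> integrable M (f x)"
  and bnd: "!!x t. x \<in> {a<..<b} ==> t \<in> space M ==> \<bar>f' x t\<bar> <= G t" and G: "integrable M G"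
 shows "integrable M (f' x0)" "((%x. integral\<^sup>L M (f x)) has_real_derivative integral\<^sup>L M (f' x0)) (at x0)"
proof -
 have key: "integrable M (f' x0) \<and> ((%n. (integral\<^sup>L M (f (X n)) - integral\<^sup>L M (f x0)) / (X n - x0)) \<longlonglongrightarrow> integral\<^sup>L M (f' x0))"
  if X: "!!n. X n ~= x0" "!!n. X n \<in> {a<..<b}" "X \<longlonglongrightarrow> x0" for X
 proof -
  let ?q = "%n t. (f (X n) t - f x0 t) / (X n - x0)"
  have int_q: "integrable M (?q n)" for n using int X x0 by auto
  have lim: "(%n. ?q n t) \<longlonglongrightarrow> f' x0 t" if "t \<in> space M" for t
  proof -
  have "((%x. (f x t - f x0 t) / (x - x0)) ---> f' x0 t) (at x0)"
  using D[OF x0 that] by (simp add: has_field_derivative_iff)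
  then show ?thesis
  using X by (auto simp: tendsto_at_iff_sequentially comp_def)
  qed
  have meas: "f' x0 \<in> borel_measurable M"
  by (rule borel_measurable_LIMSEQ_real[OF lim]) (use int_q in auto)
  have le: "\<bar>?q n t\<bar> <= G t" if t: "t \<in> space M" for n t
  proof -
  have "\<bar>f (X n) t - f x0 t\<bar> <= G t * \<bar>X n - x0\<bar>"
  proof -
  have "norm (f (X n) t - f x0 t) <= G t * norm (X n - x0)"
  by (rule field_differentiable_bound[of "{a<..<b}" "%x. f x t" "%x. f' x t"])
  (use D bnd t x0 X in \<open>auto intro: has_field_derivative_at_within\<close>)
  then show ?thesis by simp
  qed
  then show ?thesis using X(1)[of n] by (simp add: divide_le_eq abs_divide)
  qed
  have 1: "integrable M (f' x0)"
  by (rule integrable_dominated_convergence[where s="?q" and w=G])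
  (use meas int_q G lim le in \<open>auto intro!: AE_I2\<close>)
  have 2: "(%n. integral\<^sup>L M (?q n)) \<longlonglongrightarrow> integral\<^sup>L M (f' x0)"
  by (rule integral_dominated_convergence[where w=G])
  (use meas int_q G lim le in \<open>auto intro!: AE_I2\<close>)
  have e: "integral\<^sup>L M (?q n) = (integral\<^sup>L M (f (X n)) - integral\<^sup>L M (f x0)) / (X n - x0)" for n
  using int X x0 by (simp add: Bochner_Integration.integral_diff)
  show ?thesis using 1 2 unfolding e by blast
 qed
 \<comment> \<open>A concrete sequence, only to extract integrability of \<open>f' x0\<close> from
   \<open>key\<close>.\<close>
 obtain X where X: "!!n. X n ~= x0" "!!n. X n \<in> {a<..<b}" "X \<longlonglongrightarrow> x0"
 proof
  let ?X = "%n. x0 + (b - x0) / (real n + 2)"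
  show "?X n ~= x0" for n using x0 by auto
  show "?X n \<in> {a<..<b}" for n
  proof -
  have "0 < (b - x0) / (real n + 2)" using x0 by simp
  moreover have "(b - x0) / (real n + 2) <= (b - x0) / 2" using x0 by (intro divide_left_mono) auto
  moreover have "(b - x0) / 2 < b - x0" using x0 by simp
  ultimately show ?thesis using x0 unfolding greaterThanLessThan_iff by linarith
  qed
  show "?X \<longlonglongrightarrow> x0" by real_asymp
 qed
 show "integrable M (f' x0)" using key[OF X] by simp
 have ev: "\<forall>\<^sub>F x in nhds x0. x \<in> {a<..<b}" using x0 by (intro eventually_nhds_in_open) auto
 show "((%x. integral\<^sup>L M (f x)) has_real_derivative integral\<^sup>L M (f' x0)) (at x0)"
  unfolding has_field_derivative_iff tendsto_at_iff_sequentially comp_def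
 proof (intro allI impI)
  fix X :: "nat => real" assume X: "\<forall>i. X i \<in> UNIV - {x0}" "X \<longlonglongrightarrow> x0"
  obtain N where N: "!!n. n \<ge> N ==> X n \<in> {a<..<b}"
  using eventually_compose_filterlim[OF ev X(2)] by (auto simp: eventually_sequentially)
  have "(%n. (integral\<^sup>L M (f (X (n + N))) - integral\<^sup>L M (f x0)) / (X (n + N) - x0)) \<longlonglongrightarrow> integral\<^sup>L M (f' x0)"
  using X N LIMSEQ_ignore_initial_segment[OF X(2)] by (intro key[THEN conjunct2]) auto
  then show "(%n. (integral\<^sup>L M (f (X n)) - integral\<^sup>L M (f x0)) / (X n - x0)) \<longlonglongrightarrow> integral\<^sup>L M (f' x0)"
  by (rule LIMSEQ_offset)
 qed
qed

section \<open>The Macdonald functions \<open>K_0\<close> and \<open>K_1\<close>\<close>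

lemma power_le_fact_exp: "0 <= v ==> v ^ k <= fact k * exp v" for v :: real
proof -
 assume v: "0 <= v"
 have "(\<Sum>n\<in>{k}. v ^ n / fact n) <= (\<Sum>n. v ^ n / fact n)"
  using v by (intro sum_le_suminf summable_power_fact) auto
 also have "... = exp v" by (simp add: exp_def divide_inverse mult.commute)
 finally show ?thesis by (simp add: field_simps)
qed

lemma exp_neg_power: "0 < y ==> 0 <= v ==> v ^ k * exp (- (y * v)) <= fact k / y ^ k" for v :: real
 using power_le_fact_exp[of "y * v" k]
 by (simp add: power_mult_distrib exp_minus field_simps)

lemma integral_half_line_pos:
 fixes f :: "real => real"
 assumes "integrable half_line f" "!!t. 0 < t ==> 0 < f t"
 shows "0 < integral\<^sup>L half_line f"
proof -
 have n: "AE t in half_line. 0 <= f t" using assms(2) by (force intro!: AE_I2)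
 have "integral\<^sup>L half_line f ~= 0"
 proof
  assume "integral\<^sup>L half_line f = 0"
  then have "AE t in half_line. f t = 0"
  using integral_nonneg_eq_0_iff_AE[OF assms(1) n] by simp
  moreover have "AE t in half_line. f t ~= 0" using assms(2) by (force intro!: AE_I2)
  ultimately have "AE t in half_line. False" by eventually_elim simp
  then have "emeasure half_line (space half_line) = 0"
  using sets.top[of half_line] by (subst (asm) AE_iff_measurable[where N="space half_line"]) auto
  moreover have "emeasure half_line {0<..} = emeasure lborel {0::real<..}"
  unfolding half_line_def by (intro emeasure_restrict_space) auto
  moreover have "emeasure lborel {0<..<1::real} <= emeasure lborel {0::real<..}" by (rule emeasure_mono) auto
  ultimately show False by simp
 qed
 moreover have "0 <= integral\<^sup>L half_line f" using n by (rule integral_nonneg_AE)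
 ultimately show ?thesis by simp
qed

text \<open>\<open>KK 0\<close> and \<open>KK 1\<close> are the Macdonald functions
  \<open>K_0\<close> and \<open>K_1\<close>; in general \<open>KK m\<close> is, up to the sign
  \<open>(- 1) ^ m\<close>, the \<open>m\<close>-th derivative of \<open>K_0\<close>.\<close>

definition KK :: "nat => real => real" where
 "KK m y = (\<integral>u. cosh u ^ m * exp (- (y * cosh u)) \<partial>half_line)"

text \<open>A majorant uniform in \<open>y >= a\<close>: the exponential absorbs one more power of
  \<open>cosh u\<close> than needed, and the spare \<open>1 / cosh u\<close> is at most
  \<open>2 * exp (- u)\<close>.\<close>

lemma KK_dom:
 fixes u :: real
 assumes "0 < a" "a <= y"
 shows "cosh u ^ m * exp (- (y * cosh u)) <= 2 * fact (Suc m) / a ^ Suc m * exp (- u)"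
proof -
 have c: "0 < cosh u" "exp u / 2 <= cosh u" by (rule cosh_real_pos) (simp add: cosh_field_def)
 have b: "cosh u ^ Suc m * exp (- (a * cosh u)) <= fact (Suc m) / a ^ Suc m"
  using exp_neg_power[of a "cosh u" "Suc m"] assms by simp
 have gen: "P <= F * (1 / c)" if "c * P <= F" "0 < c" for c P F :: real
  using that by (simp add: field_simps)
 have 1: "cosh u ^ m * exp (- (a * cosh u)) <= fact (Suc m) / a ^ Suc m * (1 / cosh u)"
  using gen[of "cosh u" "cosh u ^ m * exp (- (a * cosh u))"] b c(1) by (simp only: power_Suc mult.assoc)
 have "1 / cosh u <= 2 * exp (- u)"
  using c by (simp add: exp_minus field_simps)
 then have 2: "fact (Suc m) / a ^ Suc m * (1 / cosh u) <= fact (Suc m) / a ^ Suc m * (2 * exp (- u))"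
  using assms by (intro mult_left_mono) auto
 have 3: "cosh u ^ m * exp (- (y * cosh u)) <= cosh u ^ m * exp (- (a * cosh u))"
  using assms c by (intro mult_left_mono) auto
 have "fact (Suc m) / a ^ Suc m * (2 * exp (- u)) = 2 * fact (Suc m) / a ^ Suc m * exp (- u)" by simp
 with order_trans[OF 3 order_trans[OF 1 2]] show ?thesis by (simp only:)
qed

lemma integrable_KK: "0 < y ==> integrable half_line (%u. cosh u ^ m * exp (- (y * cosh u)))"
 by (rule integrable_half_line_bound[of "%u. 2 * fact (Suc m) / y ^ Suc m * exp (- u)"])
  (use integrable_exp_neg(1) KK_dom[of y y _ m] in \<open>auto intro!: continuous_intros\<close>)

lemma DERIV_KK:
 assumes "0 < y"
 shows "(KK m has_real_derivative - KK (Suc m) y) (at y)"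
proof -
 have "((%y. \<integral>u. cosh u ^ m * exp (- (y * cosh u)) \<partial>half_line) has_real_derivative
  (\<integral>u. - (cosh u ^ Suc m * exp (- (y * cosh u))) \<partial>half_line)) (at y)"
 proof (rule has_real_derivative_integral(2)[where a="y / 2" and b="2 * y"])
  show "integrable half_line (%u. 2 * fact (Suc (Suc m)) / (y / 2) ^ Suc (Suc m) * exp (- u))"
  using integrable_exp_neg by simp
  fix x u assume x: "x \<in> {y / 2<..<2 * y}"
  show "((%x. cosh u ^ m * exp (- (x * cosh u))) has_real_derivative - (cosh u ^ Suc m * exp (- (x * cosh u)))) (at x)"
  by (auto intro!: derivative_eq_intros)
  show "\<bar>- (cosh u ^ Suc m * exp (- (x * cosh u)))\<bar> <= 2 * fact (Suc (Suc m)) / (y / 2) ^ Suc (Suc m) * exp (- u)"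
  using KK_dom[of "y / 2" x u "Suc m"] x assms by (simp only: abs_minus_cancel abs_of_nonneg[OF mult_nonneg_nonneg[OF zero_le_power[OF cosh_real_nonneg] exp_ge_zero]]) simp
 qed (use assms in \<open>auto intro!: integrable_KK\<close>)
 then show ?thesis unfolding KK_def[abs_def] by simp
qed

lemma continuous_on_KK: "continuous_on {0<..} (KK m)"
 by (intro continuous_at_imp_continuous_on ballI) (use DERIV_KK DERIV_isCont in \<open>metis greaterThan_iff\<close>)

lemma KK_pos: "0 < y ==> 0 < KK m y"
 unfolding KK_def by (rule integral_half_line_pos) (auto intro: integrable_KK)

lemma tendsto_exp_cosh: "0 < y ==> ((%u. exp (- (y * cosh u))) ---> 0) at_top" for y :: real
 unfolding cosh_field_def by real_asymp

lemma tendsto_sinh_exp_cosh: "0 < y ==> ((%u. sinh u * exp (- (y * cosh u))) ---> 0) at_top" for y :: real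
 unfolding cosh_field_def sinh_field_def by real_asymp

lemma tendsto_exp_cosh_0: "((%u. exp (- (y * cosh u))) ---> exp (- y)) (at_right 0)" for y :: real
 by (rule tendsto_eq_intros | simp)+

text \<open>The modified Bessel equation of order zero, from integrating the derivative of
  \<open>sinh u * exp (- (y * cosh u))\<close>.\<close>

lemma KK_2:
 assumes "0 < y"
 shows "y * KK 2 y = y * KK 0 y + KK 1 y"
proof -
 let ?e = "%u. exp (- (y * cosh u))"
 have "(\<integral>u. (cosh u ^ 1 * ?e u - y * (cosh u ^ 2 * ?e u)) + y * (cosh u ^ 0 * ?e u) \<partial>half_line) = 0 - 0"
 proof (rule FTC_half_line)
  fix u :: real
  show "((%u. sinh u * ?e u) has_real_derivative (cosh u ^ 1 * ?e u - y * (cosh u ^ 2 * ?e u)) + y * (cosh u ^ 0 * ?e u)) (at u)"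
  by (rule derivative_eq_intros refl | simp)+ (simp add: cosh_square_eq algebra_simps power2_eq_square[of "sinh u", symmetric])
  show "((%u. sinh u * ?e u) ---> 0) (at_right 0)"
  by (rule tendsto_eq_intros | simp)+
  show "integrable half_line (%u. (cosh u ^ 1 * ?e u - y * (cosh u ^ 2 * ?e u)) + y * (cosh u ^ 0 * ?e u))"
  by (intro Bochner_Integration.integrable_add Bochner_Integration.integrable_diff integrable_mult_right integrable_KK assms)
 qed (use assms in \<open>auto intro!: continuous_intros tendsto_sinh_exp_cosh\<close>)
 moreover have "(\<integral>u. (cosh u ^ 1 * ?e u - y * (cosh u ^ 2 * ?e u)) + y * (cosh u ^ 0 * ?e u) \<partial>half_line)
  = (KK 1 y - y * KK 2 y) + y * KK 0 y"
 proof -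
  have lin: "(\<integral>u. (A u - y * B u) + y * C u \<partial>half_line) = (integral\<^sup>L half_line A - y * integral\<^sup>L half_line B) + y * integral\<^sup>L half_line C"
  if "integrable half_line A" "integrable half_line B" "integrable half_line C" for A B C :: "real => real"
  using that by simp
  show ?thesis unfolding KK_def by (rule lin) (intro integrable_KK assms)+
 qed
 ultimately show ?thesis by simp
qed

lemma integral_sinh_exp:
 assumes "0 < y"
 shows "integrable half_line (%u. y * sinh u * exp (- (y * cosh u)))"
  "(\<integral>u. y * sinh u * exp (- (y * cosh u)) \<partial>half_line) = exp (- y)"
proof -
 have D: "((%u. - exp (- (y * cosh u))) has_real_derivative y * sinh u * exp (- (y * cosh u))) (at u)" for u :: real
  by (auto intro!: derivative_eq_intros)
 have c: "continuous_on {0<..} (%u. y * sinh u * exp (- (y * cosh u)))" by (intro continuous_intros)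
 note l = tendsto_minus[OF tendsto_exp_cosh_0[of y]] tendsto_minus[OF tendsto_exp_cosh[OF assms], simplified]
 have p: "0 <= y * sinh u * exp (- (y * cosh u))" if "0 < u" for u using assms that by simp
 show "integrable half_line (%u. y * sinh u * exp (- (y * cosh u)))"
  by (rule FTC_half_line_nonneg(1)[OF D c p l])
 show "(\<integral>u. y * sinh u * exp (- (y * cosh u)) \<partial>half_line) = exp (- y)"
  using FTC_half_line_nonneg(2)[OF D c p l] by simp
qed

text \<open>With \<open>sinh\<close> in place of \<open>cosh\<close> the integral is elementary, and
  the error is \<open>cosh u - sinh u = exp (- u)\<close>. The two bounds give the limits 1 and 0 of
  \<open>y * KK 1 y\<close> at the two ends of the half-line.\<close>

lemma KK1_bounds:
 assumes "0 < y"
 shows "exp (- y) <= y * KK 1 y" "y * KK 1 y <= (1 + y) * exp (- y)"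
proof -
 have i: "integrable half_line (%u. y * (cosh u ^ 1 * exp (- (y * cosh u))))"
  using integrable_KK[OF assms, of 1] by simp
 have e: "y * KK 1 y = (\<integral>u. y * (cosh u ^ 1 * exp (- (y * cosh u))) \<partial>half_line)"
  unfolding KK_def by simp
 have "(\<integral>u. y * sinh u * exp (- (y * cosh u)) \<partial>half_line) <= y * KK 1 y"
  unfolding e using assms i integral_sinh_exp(1)[OF assms]
  by (intro integral_half_line_mono) (auto simp: sinh_less_cosh_real less_imp_le)
 then show "exp (- y) <= y * KK 1 y" unfolding integral_sinh_exp(2)[OF assms] .
 have "y * KK 1 y <= (\<integral>u. y * sinh u * exp (- (y * cosh u)) + y * exp (- y) * exp (- u) \<partial>half_line)"
  unfolding e
 proof (rule integral_half_line_mono[OF i])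
  show "integrable half_line (%u. y * sinh u * exp (- (y * cosh u)) + y * exp (- y) * exp (- u))"
  using integral_sinh_exp(1)[OF assms] integrable_exp_neg(1) by simp
  fix u :: real assume "0 < u"
  have "cosh u = sinh u + exp (- u)" by (simp add: cosh_field_def sinh_field_def field_simps)
  then have "y * (cosh u ^ 1 * exp (- (y * cosh u))) = y * sinh u * exp (- (y * cosh u)) + y * exp (- (y * cosh u)) * exp (- u)"
  by (simp add: algebra_simps)
  moreover have "exp (- (y * cosh u)) <= exp (- y)"
  using assms cosh_real_ge_1[of u] by simp
  ultimately show "y * (cosh u ^ 1 * exp (- (y * cosh u))) <= y * sinh u * exp (- (y * cosh u)) + y * exp (- y) * exp (- u)"
  using assms by (simp add: mult_left_mono mult_right_mono)
 qed
 also have "... = (1 + y) * exp (- y)"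
  using integral_sinh_exp[OF assms] integrable_exp_neg by (simp add: distrib_right)
 finally show "y * KK 1 y <= (1 + y) * exp (- y)" .
qed

lemma exp_neg_le_inverse_sqrt: "0 < v ==> exp (- v) <= 1 / sqrt v" for v :: real
proof -
 assume v: "0 < v"
 have "v <= exp (2 * v)" using exp_ge_add_one_self[of "2 * v"] v by linarith
 then have "sqrt v <= sqrt (exp (2 * v))" by simp
 also have "sqrt (exp (2 * v)) = exp v"
  by (rule real_sqrt_unique) (auto simp: exp_double)
 finally show ?thesis using v by (simp add: exp_minus field_simps)
qed

text \<open>A quarter of the exponent is traded through \<open>exp (- v) <= 1 / sqrt v\<close> for
  integrability in \<open>u\<close>; the remaining three quarters give decay in \<open>y\<close>.
  The singularity \<open>1 / sqrt y\<close> is coarser than the true logarithm, and the rate 3/4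
  leaves a margin over the rate 1/2 demanded of kernels below, in which powers of \<open>y\<close>
  are absorbed.\<close>

lemma KK0_le:
 assumes "0 < y"
 shows "KK 0 y <= 8 / sqrt y * exp (- (3 * y / 4))"
proof -
 have ih: "integrable half_line (%u::real. exp (- (1 / 2 * u)))" "(\<integral>u. exp (- (1 / 2 * u)) \<partial>half_line) = (2::real)"
  using integrable_exp_neg integral_half_line_scale[of "1/2" "%u. exp (- u)"] by auto
 have "KK 0 y <= (\<integral>u. 4 / sqrt y * exp (- (3 * y / 4)) * exp (- (1 / 2 * u)) \<partial>half_line)"
  unfolding KK_def
 proof (rule integral_half_line_mono[OF integrable_KK[OF assms]])
  show "integrable half_line (%u. 4 / sqrt y * exp (- (3 * y / 4)) * exp (- (1 / 2 * u)))"
  using ih(1) by simp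
  fix u :: real assume "0 < u"
  have c: "1 <= cosh u" "exp u / 2 <= cosh u" "0 < cosh u" by (rule cosh_real_ge_1, simp add: cosh_field_def, rule cosh_real_pos)
  have "sqrt (y * cosh u / 4) \<ge> sqrt (y * (exp u / 2) / 4)"
  using c assms by (intro real_sqrt_le_mono divide_right_mono mult_left_mono) auto
  moreover have "sqrt (y * (exp u / 2) / 4) \<ge> sqrt (y * exp u / 16)" using assms by simp
  moreover have "sqrt (y * exp u / 16) = sqrt y * exp (1 / 2 * u) / 4"
  proof -
  have "sqrt (exp u) = exp (1 / 2 * u)"
  by (rule real_sqrt_unique) (auto simp: exp_double[symmetric])
  moreover have "sqrt 16 = (4::real)" by (rule real_sqrt_unique) auto
  ultimately show ?thesis by (simp add: real_sqrt_mult real_sqrt_divide)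
  qed
  ultimately have s: "sqrt y * exp (1 / 2 * u) / 4 <= sqrt (y * cosh u / 4)" by linarith
  have "exp (- (y * cosh u)) = exp (- (3 * (y * cosh u) / 4)) * exp (- (y * cosh u / 4))"
  by (simp add: exp_add[symmetric])
  also have "... <= exp (- (3 * y / 4)) * (1 / sqrt (y * cosh u / 4))"
  using c assms by (intro mult_mono exp_neg_le_inverse_sqrt) auto
  also have "... <= exp (- (3 * y / 4)) * (1 / (sqrt y * exp (1 / 2 * u) / 4))"
  using s assms c by (intro mult_left_mono divide_left_mono) auto
  also have "... = 4 / sqrt y * exp (- (3 * y / 4)) * exp (- (1 / 2 * u))"
  by (simp add: exp_minus field_simps)
  finally show "cosh u ^ 0 * exp (- (y * cosh u)) <= 4 / sqrt y * exp (- (3 * y / 4)) * exp (- (1 / 2 * u))" by simp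
 qed
 also have "... = 8 / sqrt y * exp (- (3 * y / 4))" using ih by simp
 finally show ?thesis .
qed

lemma tendsto_yKK1: "((%y. y * KK 1 y) ---> 1) (at_right 0)"
proof (rule tendsto_sandwich)
 show "((%y::real. exp (- y)) ---> 1) (at_right 0)" "((%y::real. (1 + y) * exp (- y)) ---> 1) (at_right 0)"
  by real_asymp+
qed (use KK1_bounds in \<open>auto intro!: eventually_mono[OF eventually_at_right_less[of "0::real"]]\<close>)

lemma tendsto_yKK1_top: "((%y. y * KK 1 y) ---> 0) at_top"
proof (rule tendsto_sandwich)
 show "((%y::real. exp (- y)) ---> 0) at_top" "((%y::real. (1 + y) * exp (- y)) ---> 0) at_top"
  by real_asymp+
qed (use KK1_bounds in \<open>auto intro!: eventually_mono[OF eventually_gt_at_top[of "0::real"]]\<close>)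

lemma DERIV_yKK1: "0 < y ==> ((%y. y * KK 1 y) has_real_derivative - (y * KK 0 y)) (at y)"
 by (rule DERIV_cong[OF DERIV_mult[OF DERIV_ident DERIV_KK]])
  (use KK_2[of y] in \<open>auto simp: numeral_2_eq_2 mult.commute\<close>)

lemma integral_yKK0: "integrable half_line (%y. y * KK 0 y)" "(\<integral>y. y * KK 0 y \<partial>half_line) = 1"
proof -
 have D: "((%y. - (y * KK 1 y)) has_real_derivative y * KK 0 y) (at y)" if "0 < y" for y
  using DERIV_minus[OF DERIV_yKK1[OF that]] by simp
 have c: "continuous_on {0<..} (%y. y * KK 0 y)" by (intro continuous_intros continuous_on_KK)
 have p: "0 <= y * KK 0 y" if "0 < y" for y using KK_pos[OF that, of 0] that by simp
 note l = tendsto_minus[OF tendsto_yKK1] tendsto_minus[OF tendsto_yKK1_top]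
 show "integrable half_line (%y. y * KK 0 y)" by (rule FTC_half_line_nonneg(1)[OF D c p l])
 show "(\<integral>y. y * KK 0 y \<partial>half_line) = 1" using FTC_half_line_nonneg(2)[OF D c p l] by simp
qed

lemma integral_inverse_cosh: "integrable half_line (%u::real. 1 / cosh u)" "(\<integral>u. 1 / cosh u \<partial>half_line) = pi / 2"
proof -
 have D: "((%u. arctan (sinh u)) has_real_derivative 1 / cosh u) (at u)" for u :: real
 proof -
  have "1 + (sinh u)^2 = cosh u * cosh u" using cosh_square_eq[of u] by (simp add: power2_eq_square)
  then show ?thesis by (auto intro!: derivative_eq_intros simp: inverse_eq_divide)
 qed
 have c: "continuous_on {0<..} (%u::real. 1 / cosh u)" by (intro continuous_intros) auto
 have l1: "((%u::real. arctan (sinh u)) ---> 0) (at_right 0)" by (rule tendsto_eq_intros | simp)+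
 have "filterlim (%u::real. sinh u) at_top at_top" unfolding sinh_field_def by real_asymp
 from filterlim_compose[OF tendsto_arctan_at_top this]
 have l2: "((%u::real. arctan (sinh u)) ---> pi / 2) at_top" .
 have p: "0 <= 1 / cosh u" for u :: real by simp
 show "integrable half_line (%u::real. 1 / cosh u)" by (rule FTC_half_line_nonneg(1)[OF D c p l1 l2])
 show "(\<integral>u. 1 / cosh u \<partial>half_line) = pi / 2" using FTC_half_line_nonneg(2)[OF D c p l1 l2] by simp
qed

text \<open>Dividing by \<open>cosh u\<close> under the integral gives \<open>G\<close> with
  \<open>- G\<close> a primitive of \<open>KK 0\<close>; \<open>G\<close> vanishes at infinity and
  tends at 0 to the integral of \<open>1 / cosh\<close>, which is \<open>pi / 2\<close>.\<close>

lemma integral_KK0: "integrable half_line (KK 0)" "integral\<^sup>L half_line (KK 0) = pi / 2"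
proof -
 let ?f = "%y u. 1 / cosh u * exp (- (y * cosh u))"
 define G where "G y = integral\<^sup>L half_line (?f y)" for y
 have le: "\<bar>?f y u\<bar> <= 1 / cosh u" if "0 <= y" for y u :: real
  using that by (simp add: divide_right_mono)
 have int: "integrable half_line (?f y)" if "0 <= y" for y
 proof (rule integrable_half_line_bound[OF integral_inverse_cosh(1)])
  show "continuous_on {0<..} (?f y)" by (auto intro!: continuous_intros)
 qed (rule le[OF that])
 have D: "((%y. - G y) has_real_derivative KK 0 y) (at y)" if y: "0 < y" for y
 proof -
  have "(G has_real_derivative (\<integral>u. - exp (- (y * cosh u)) \<partial>half_line)) (at y)"
  unfolding G_def[abs_def]
  proof (rule has_real_derivative_integral(2)[where a="y / 2" and b="2 * y"])
  show "integrable half_line (%u. exp (- (y / 2 * cosh u)))"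
  using integrable_KK[of "y / 2" 0] y by simp
  fix x u :: real assume x: "x \<in> {y / 2<..<2 * y}"
  show "((%x. ?f x u) has_real_derivative - exp (- (x * cosh u))) (at x)"
  by (auto intro!: derivative_eq_intros)
  show "\<bar>- exp (- (x * cosh u))\<bar> <= exp (- (y / 2 * cosh u))"
  using x by (simp add: mult_right_mono)
  qed (use y int in auto)
  from DERIV_minus[OF this] show ?thesis unfolding KK_def by simp
 qed
 have c: "continuous_on {0<..} (KK 0)" by (rule continuous_on_KK)
 have p: "0 <= KK 0 y" if "0 < y" for y using KK_pos[OF that, of 0] by simp
 have m: "?f y \<in> borel_measurable half_line" for y
  by (rule borel_measurable_half_line) (auto intro!: continuous_intros)
 have m0: "(%u::real. 1 / cosh u) \<in> borel_measurable half_line"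
  by (rule borel_measurable_half_line) (auto intro!: continuous_intros)
 have l1: "((%y. - G y) ---> - (pi / 2)) (at_right 0)"
 proof (rule tendsto_minus)
  have "(G ---> (\<integral>u. 1 / cosh u \<partial>half_line)) (at_right 0)"
  unfolding tendsto_at_iff_sequentially comp_def
  proof (intro allI impI)
  fix X :: "nat => real" assume X: "\<forall>i. X i \<in> {0<..} - {0}" "X \<longlonglongrightarrow> 0"
  show "(%n. G (X n)) \<longlonglongrightarrow> (\<integral>u. 1 / cosh u \<partial>half_line)"
  unfolding G_def
  proof (rule integral_dominated_convergence[where w="%u. 1 / cosh u"])
  show "AE u in half_line. (%n. ?f (X n) u) \<longlonglongrightarrow> 1 / cosh u"
  proof (rule AE_I2)
  fix u :: real
  have "(%n. ?f (X n) u) \<longlonglongrightarrow> 1 / cosh u * exp (- (0 * cosh u))"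
  by (intro tendsto_intros X(2))
  then show "(%n. ?f (X n) u) \<longlonglongrightarrow> 1 / cosh u" by simp
  qed
  show "AE u in half_line. norm (?f (X n) u) <= 1 / cosh u" for n
  using le[of "X n"] X(1) by (auto intro!: AE_I2 simp: less_imp_le)
  qed (use m m0 integral_inverse_cosh(1) in auto)
  qed
  then show "(G ---> pi / 2) (at_right 0)" unfolding integral_inverse_cosh(2) .
 qed
 have l2: "((%y. - G y) ---> 0) at_top"
 proof (rule Lim_null_comparison)
  show "((%y::real. pi / 2 * exp (- y)) ---> 0) at_top" by real_asymp
  show "\<forall>\<^sub>F y in at_top. norm (- G y) <= pi / 2 * exp (- y)"
  using eventually_gt_at_top[of 0]
  proof eventually_elim
  case (elim y)
  have "G y <= (\<integral>u. 1 / cosh u * exp (- y) \<partial>half_line)"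
  unfolding G_def
  proof (rule integral_half_line_mono[OF int])
  show "integrable half_line (%u. 1 / cosh u * exp (- y))" using integral_inverse_cosh(1) by (intro integrable_mult_left)
  show "?f y u <= 1 / cosh u * exp (- y)" for u :: real
  using elim cosh_real_ge_1[of u] by (intro mult_left_mono) auto
  qed (use elim in auto)
  also have "... = pi / 2 * exp (- y)" using integral_inverse_cosh by (simp only: integral_mult_left_zero)
  finally have "G y <= pi / 2 * exp (- y)" .
  moreover have "0 <= G y" unfolding G_def by (rule integral_nonneg_AE) (auto intro!: AE_I2)
  ultimately show ?case by simp
  qed
 qed
 show "integrable half_line (KK 0)" by (rule FTC_half_line_nonneg(1)[OF D c p l1 l2])
 show "integral\<^sup>L half_line (KK 0) = pi / 2" using FTC_half_line_nonneg(2)[OF D c p l1 l2] by simp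
qed

section \<open>Integral transforms of the Macdonald kernel\<close>

text \<open>After the substitution \<open>y = 2 * x * sinh t\<close> such a kernel is integrable at
  \<open>t = 0\<close> and decays doubly exponentially in \<open>t\<close>, so it may be paired with
  any \<open>g\<close> of exponential growth. The class contains \<open>K_0\<close> with its
  logarithmic singularity, also after multiplication by powers of \<open>y\<close>.\<close>

definition adm_kernel :: "(real => real) => bool" where
 "adm_kernel F \<longleftrightarrow> continuous_on {0<..} F \<and> (\<exists>D\<ge>0. \<forall>y>0. \<bar>F y\<bar> <= D / sqrt y * exp (- (y / 2)))"

definition exp_growth :: "(real => real) => bool" where
 "exp_growth g \<longleftrightarrow> continuous_on {0<..} g \<and> (\<exists>C\<ge>0. \<exists>M\<ge>0. \<forall>t>0. \<bar>g t\<bar> <= C * exp (M * t))"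

definition sinh_transform :: "(real => real) => (real => real) => real => real" where
 "sinh_transform F g x = (\<integral>t. F (2 * x * sinh t) * g t \<partial>half_line)"

text \<open>The common integrable majorant, with primitive
  \<open>2 * arctan (sqrt t)\<close>.\<close>

definition sqrt_weight :: "real => real" where
 "sqrt_weight t = 1 / (sqrt t * (1 + t))"

lemma integrable_sqrt_weight: "integrable half_line sqrt_weight"
proof -
 have D: "((%t. 2 * arctan (sqrt t)) has_real_derivative sqrt_weight t) (at t)" if "0 < t" for t
  unfolding sqrt_weight_def using that
  by (auto intro!: derivative_eq_intros simp: inverse_eq_divide)
 have c: "continuous_on {0<..} sqrt_weight"
  unfolding sqrt_weight_def[abs_def] by (auto intro!: continuous_intros)
 have p: "0 <= sqrt_weight t" if "0 < t" for t using that by (simp add: sqrt_weight_def)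
 have l1: "((%t. 2 * arctan (sqrt t)) ---> 2 * arctan (sqrt 0)) (at_right 0)"
  by (intro tendsto_intros)
 have l2: "((%t. 2 * arctan (sqrt t)) ---> 2 * (pi / 2)) at_top"
  by (intro tendsto_mult_left filterlim_compose[OF tendsto_arctan_at_top] sqrt_at_top)
 show ?thesis by (rule FTC_half_line_nonneg(1)[OF D c p l1 l2])
qed

lemma adm_kernel_add:
 assumes "adm_kernel F" "adm_kernel G"
 shows "adm_kernel (%y. F y + G y)"
proof -
 obtain D where D: "D \<ge> 0" "!!y. y > 0 ==> \<bar>F y\<bar> <= D / sqrt y * exp (- (y / 2))"
  using assms(1) unfolding adm_kernel_def by blast
 obtain E where E: "E \<ge> 0" "!!y. y > 0 ==> \<bar>G y\<bar> <= E / sqrt y * exp (- (y / 2))"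
  using assms(2) unfolding adm_kernel_def by blast
 have "\<bar>F y + G y\<bar> <= (D + E) / sqrt y * exp (- (y / 2))" if "0 < y" for y
  using D(2)[OF that] E(2)[OF that] abs_triangle_ineq[of "F y" "G y"]
  by (simp add: add_divide_distrib distrib_right)
 moreover have "continuous_on {0<..} (%y. F y + G y)"
  using assms unfolding adm_kernel_def by (intro continuous_intros) auto
 ultimately show ?thesis using D(1) E(1) unfolding adm_kernel_def by (auto intro!: exI[of _ "D + E"])
qed

lemma adm_kernel_cmult:
 assumes "adm_kernel F"
 shows "adm_kernel (%y. c * F y)"
proof -
 obtain D where D: "D \<ge> 0" "!!y. y > 0 ==> \<bar>F y\<bar> <= D / sqrt y * exp (- (y / 2))"
  using assms unfolding adm_kernel_def by blast
 have "\<bar>c * F y\<bar> <= (\<bar>c\<bar> * D) / sqrt y * exp (- (y / 2))" if "0 < y" for y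
  using mult_left_mono[OF D(2)[OF that], of "\<bar>c\<bar>"] by (simp add: abs_mult mult_ac)
 moreover have "continuous_on {0<..} (%y. c * F y)"
  using assms unfolding adm_kernel_def by (intro continuous_intros) auto
 ultimately show ?thesis using D(1) unfolding adm_kernel_def by (auto intro!: exI[of _ "\<bar>c\<bar> * D"])
qed

lemma adm_kernel_power:
 assumes "continuous_on {0<..} h" "!!y. 0 < y ==> \<bar>h y\<bar> <= D / sqrt y * exp (- (3 * y / 4))"
 shows "adm_kernel (%y. y ^ k * h y)"
proof -
 have D: "0 <= D" using order_trans[OF abs_ge_zero assms(2)[of 1]] by (simp add: zero_le_mult_iff)
 have "\<bar>y ^ k * h y\<bar> <= (fact k * 4 ^ k * D) / sqrt y * exp (- (y / 2))" if y: "0 < y" for y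
 proof -
  have "y ^ k * exp (- (1 / 4 * y)) <= fact k / (1 / 4) ^ k"
  using exp_neg_power[of "1/4" y k] y by simp
  then have p: "y ^ k * exp (- (1 / 4 * y)) <= fact k * 4 ^ k" by (simp add: power_one_over)
  have "\<bar>y ^ k * h y\<bar> = y ^ k * \<bar>h y\<bar>" using y by (simp add: abs_mult)
  also have "... <= y ^ k * (D / sqrt y * exp (- (3 * y / 4)))"
  using assms(2)[OF y] y by (intro mult_left_mono) auto
  also have "... = (y ^ k * exp (- (1 / 4 * y))) * (D / sqrt y * exp (- (y / 2)))"
  by (simp add: exp_add[symmetric])
  also have "... <= (fact k * 4 ^ k) * (D / sqrt y * exp (- (y / 2)))"
  using p D y by (intro mult_right_mono) auto
  finally show ?thesis by (simp add: mult_ac)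
 qed
 moreover have "continuous_on {0<..} (%y. y ^ k * h y)"
  by (intro continuous_intros assms)
 ultimately show ?thesis using D unfolding adm_kernel_def by (auto intro!: exI[of _ "fact k * 4 ^ k * D"])
qed

lemma adm_KK0: "adm_kernel (%y. y ^ k * KK 0 y)"
 using KK0_le KK_pos[of _ 0] by (intro adm_kernel_power[where D=8] continuous_on_KK) (auto simp: abs_of_pos)

lemma adm_KK1: "adm_kernel (%y. y ^ k * (y * KK 1 y))"
proof (rule adm_kernel_power)
 show "continuous_on {0<..} (%y. y * KK 1 y)" by (intro continuous_intros continuous_on_KK)
 fix y :: real assume y: "0 < y"
 have e: "y ^ j * exp (- (1 / 4 * y)) <= fact j * 4 ^ j" for j
  using exp_neg_power[of "1/4" y j] y by (simp add: power_one_over)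
 have "\<bar>y * KK 1 y\<bar> <= (1 + y) * exp (- y)"
  using KK1_bounds(2)[OF y] KK_pos[OF y, of 1] y by simp
 also have "... = (sqrt y * (1 + y) * exp (- (1 / 4 * y))) * (1 / sqrt y * exp (- (3 * y / 4)))"
  using y by (simp add: exp_add[symmetric])
 \<comment> \<open>With \<open>sqrt y <= 1 + y\<close> the factor is at most
   \<open>(1 + y)^2 * exp (- y / 4)\<close>, and 41 is \<open>1 + 2 * 4 + 2 * 16\<close>, term by
   term.\<close>
 also have "... <= 41 * (1 / sqrt y * exp (- (3 * y / 4)))"
 proof (rule mult_right_mono)
  have "sqrt y <= sqrt ((1 + y)^2)" using y by (intro real_sqrt_le_mono) (simp add: power2_eq_square algebra_simps)
  then have "sqrt y <= 1 + y" using y by simp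
  then have "sqrt y * (1 + y) * exp (- (1 / 4 * y)) <= (1 + y) * (1 + y) * exp (- (1 / 4 * y))"
  using y by (intro mult_right_mono) auto
  also have "... = y ^ 0 * exp (- (1 / 4 * y)) + 2 * (y ^ 1 * exp (- (1 / 4 * y))) + y ^ 2 * exp (- (1 / 4 * y))"
  by (simp add: algebra_simps power2_eq_square)
  also have "... <= fact 0 * 4 ^ 0 + 2 * (fact 1 * 4 ^ 1) + fact 2 * 4 ^ 2"
  by (intro add_mono mult_left_mono e) auto
  also have "... = 41" by (simp add: fact_numeral)
  finally show "sqrt y * (1 + y) * exp (- (1 / 4 * y)) <= 41" .
 qed (use y in auto)
 finally show "\<bar>y * KK 1 y\<bar> <= 41 / sqrt y * exp (- (3 * y / 4))" by simp
qed

text \<open>The kernels \<open>(y d/dy)\<^sup>j K\<^sub>0(y)\<close> for \<open>j = 0, 1, 2, 3\<close>.\<close>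

definition kern :: "nat => real => real" where
 "kern j y = (if j = 0 then KK 0 y else if j = 1 then - (y * KK 1 y)
  else if j = 2 then y\<^sup>2 * KK 0 y else 2 * (y^2 * KK 0 y) + - 1 * (y^2 * (y * KK 1 y)))"

lemma kern_simps:
 "kern 0 y = KK 0 y" "kern (Suc 0) y = - (y * KK 1 y)" "kern 1 y = - (y * KK 1 y)" "kern 2 y = y^2 * KK 0 y"
 "kern 3 y = 2 * (y^2 * KK 0 y) - y^2 * (y * KK 1 y)"
 by (simp_all add: kern_def)

lemma adm_kern: "adm_kernel (kern j)"
proof -
 have "adm_kernel (kern 0)" using adm_KK0[of 0] by (simp add: kern_simps[abs_def])
 moreover have "adm_kernel (kern 1)" using adm_kernel_cmult[OF adm_KK1[of 0], of "-1"] by (simp add: kern_simps[abs_def])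
 moreover have "adm_kernel (kern 2)" using adm_KK0[of 2] by (simp add: kern_simps[abs_def])
 \<comment> \<open>Every index from 3 on denotes the same kernel, so the bound holds for all
   \<open>j\<close>.\<close>
 moreover have "adm_kernel (kern j)" if "2 < j"
 proof -
  have "kern j = (%y. 2 * (y^2 * KK 0 y) + - 1 * (y^2 * (y * KK 1 y)))"
  using that by (auto simp: kern_def fun_eq_iff)
  then show ?thesis
  using adm_kernel_add[OF adm_kernel_cmult[OF adm_KK0[of 2], of 2] adm_kernel_cmult[OF adm_KK1[of 2], of "-1"]]
  by (simp only:)
 qed
 ultimately show ?thesis
  by (metis One_nat_def Suc_1 less_2_cases_iff linorder_neqE_nat)
qed

lemma DERIV_kern:
 assumes "0 < y" "j < 3"
 shows "(kern j has_real_derivative kern (Suc j) y / y) (at y)"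
proof -
 consider "j = 0" | "j = 1" | "j = 2" using assms(2) by linarith
 then show ?thesis
 proof cases
  case 1
  then show ?thesis using DERIV_KK[OF assms(1), of 0] assms by (simp add: kern_simps[abs_def])
 next
  case 2
  then show ?thesis using DERIV_minus[OF DERIV_yKK1[OF assms(1)]] assms
  by (simp add: kern_simps[abs_def] numeral_2_eq_2[symmetric] power2_eq_square)
 next
  case 3
  have "((%y. y\<^sup>2 * KK 0 y) has_real_derivative 2 * y * KK 0 y + (- KK 1 y) * y^2) (at y)"
  by (rule DERIV_cong[OF DERIV_mult[OF _ DERIV_KK[OF assms(1)]]]) (auto intro!: derivative_eq_intros)
  moreover have "2 * y * KK 0 y + (- KK 1 y) * y^2 = kern 3 y / y"
  using assms(1) by (simp add: kern_simps field_simps power2_eq_square)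
  ultimately show ?thesis using 3 by (simp add: kern_simps[abs_def] numeral_3_eq_3[symmetric])
 qed
qed

lemma continuous_on_kern: "continuous_on {0<..} (kern j)"
 using adm_kern unfolding adm_kernel_def by blast

lemma sinh_ge: "0 <= t ==> t <= sinh t" for t :: real
proof -
 assume "0 <= t"
 have "(%t. sinh t - t) 0 <= (%t. sinh t - t) t"
 proof (rule DERIV_nonneg_imp_nondecreasing[OF \<open>0 <= t\<close>])
  show "\<exists>y. ((%t. sinh t - t) has_real_derivative y) (at x) \<and> 0 <= y" for x :: real
  using cosh_real_ge_1[of x] by (intro exI[of _ "cosh x - 1"]) (auto intro!: derivative_eq_intros)
 qed
 then show ?thesis by simp
qed

text \<open>A quadratic minorant, so that completing the square can absorb an arbitrary linear
  exponent.\<close>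

lemma sinh_ge_square: "0 <= t ==> t^2 / 4 - 1 / 2 <= sinh t" for t :: real
proof -
 assume t: "0 <= t"
 have "t^2 <= 2 * exp t" using power_le_fact_exp[OF t, of 2] by (simp add: fact_numeral)
 then have a: "t^2 / 4 <= exp t / 2" by simp
 have b: "exp (- t) / 2 <= 1 / 2" using t by simp
 show ?thesis using diff_mono[OF a b] by (simp only: sinh_field_def diff_divide_distrib)
qed

lemma adm_kernel_majorant:
 assumes "adm_kernel F" "0 < a"
 obtains G where "integrable half_line G" "!!t. 0 < t ==> 0 <= G t"
  "!!x t. a <= x ==> 0 < t ==> \<bar>F (2 * x * sinh t)\<bar> * exp (M * t) <= G t"
proof -
 obtain D where D: "D \<ge> 0" "!!y. y > 0 ==> \<bar>F y\<bar> <= D / sqrt y * exp (- (y / 2))"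
  using assms(1) unfolding adm_kernel_def by blast
 \<comment> \<open>The maximum over \<open>t\<close> of
   \<open>(M + 1) * t - a * (t^2 / 4 - 1 / 2)\<close>: the growth rate \<open>M\<close>, plus one
   unit for the decay that has to survive, against the quadratic minorant of
   \<open>a * sinh t\<close>.\<close>
 define c where "c = (M + 1)^2 / a + a / 2"
 define E where "E = D / sqrt a * exp c"
 have E: "0 <= E" using D assms by (simp add: E_def)
 show ?thesis
 proof (rule that[of "%t. E * sqrt_weight t"])
  show "integrable half_line (%t. E * sqrt_weight t)" using integrable_sqrt_weight by simp
  show "0 <= E * sqrt_weight t" if "0 < t" for t using E that by (simp add: sqrt_weight_def)
  fix x t :: real assume x: "a <= x" and t: "0 < t"
  have st: "t <= sinh t" using sinh_ge[of t] t by simp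
  have pos: "0 < 2 * x * sinh t" using x assms t by simp
  have at: "a * t <= 2 * x * sinh t" using x assms t st by (intro mult_mono) auto
  have "M * t + t - a * sinh t <= c"
  proof -
  have "a * (t^2 / 4 - 1 / 2) <= a * sinh t" using sinh_ge_square[of t] t assms by (intro mult_left_mono) auto
  moreover have "(M + 1) * t <= (M + 1)^2 / a + a * t^2 / 4"
  proof -
  have "0 <= ((M + 1) - a * t / 2)^2 / a" using assms by simp
  also have "((M + 1) - a * t / 2)^2 / a = (M + 1)^2 / a + a * t^2 / 4 - (M + 1) * t"
  using assms by (simp add: power2_eq_square field_simps)
  finally show ?thesis by simp
  qed
  ultimately show ?thesis unfolding c_def by (simp add: algebra_simps)
  qed
  moreover have "a * sinh t <= x * sinh t" using x t by (intro mult_right_mono) auto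
  ultimately have ex: "M * t - x * sinh t <= c - t" by linarith
  have "\<bar>F (2 * x * sinh t)\<bar> * exp (M * t) <= D / sqrt (2 * x * sinh t) * exp (- (2 * x * sinh t / 2)) * exp (M * t)"
  by (intro mult_right_mono D(2) pos) auto
  also have "... = D / sqrt (2 * x * sinh t) * exp (M * t - x * sinh t)"
  by (simp add: exp_diff exp_minus field_simps)
  also have "... <= D / sqrt (a * t) * exp (c - t)"
  using D assms t at ex pos by (intro mult_mono divide_left_mono) auto
  also have "exp (c - t) = exp c * exp (- t)" by (simp add: exp_diff exp_minus divide_inverse)
  also have "D / sqrt (a * t) * (exp c * exp (- t)) <= D / sqrt (a * t) * (exp c * (1 / (1 + t)))"
  using D assms t exp_ge_add_one_self[of t]
  by (intro mult_left_mono) (auto simp: exp_minus field_simps)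
  also have "... = E * sqrt_weight t"
  by (simp add: E_def sqrt_weight_def real_sqrt_mult)
  finally show "\<bar>F (2 * x * sinh t)\<bar> * exp (M * t) <= E * sqrt_weight t" .
 qed
qed

lemma adm_kernel_bound:
 assumes "adm_kernel F" "exp_growth g" "0 < a"
 obtains G where "integrable half_line G"
  "!!x t. a <= x ==> 0 < t ==> \<bar>F (2 * x * sinh t) * g t\<bar> <= G t"
proof -
 obtain C M where CM: "C \<ge> 0" "M \<ge> 0" "!!t. t > 0 ==> \<bar>g t\<bar> <= C * exp (M * t)"
  using assms(2) unfolding exp_growth_def by blast
 obtain G where G: "integrable half_line G" "!!t. 0 < t ==> 0 <= G t"
  "!!x t. a <= x ==> 0 < t ==> \<bar>F (2 * x * sinh t)\<bar> * exp (M * t) <= G t"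
  using adm_kernel_majorant[OF assms(1,3), of M] by blast
 show ?thesis
 proof (rule that[of "%t. C * G t"])
  show "integrable half_line (%t. C * G t)" using G by simp
  fix x t :: real assume x: "a <= x" and t: "0 < t"
  have "\<bar>F (2 * x * sinh t) * g t\<bar> <= \<bar>F (2 * x * sinh t)\<bar> * (C * exp (M * t))"
  unfolding abs_mult using CM(3)[OF t] by (intro mult_left_mono) auto
  also have "... = C * (\<bar>F (2 * x * sinh t)\<bar> * exp (M * t))" by simp
  also have "... <= C * G t" using CM(1) G(3)[OF x t] by (intro mult_left_mono) auto
  finally show "\<bar>F (2 * x * sinh t) * g t\<bar> <= C * G t" .
 qed
qed

lemma continuous_on_sinh_transform_integrand:
 fixes F g :: "real => real" and x :: real
 assumes "continuous_on {0<..} F" "continuous_on {0<..} g" "0 < x"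
 shows "continuous_on {0<..} (%t. F (2 * x * sinh t) * g t)"
proof -
 have "continuous_on {0<..} (F \<circ> (%t. 2 * x * sinh t))"
  using assms(3) by (intro continuous_on_compose continuous_on_subset[OF assms(1)] continuous_intros) auto
 then show ?thesis using assms(2) by (intro continuous_intros) (simp_all add: comp_def)
qed

lemma integrable_sinh_transform:
 assumes "adm_kernel F" "exp_growth g" "0 < x"
 shows "integrable half_line (%t. F (2 * x * sinh t) * g t)"
proof -
 obtain G where G: "integrable half_line G" "!!x' t. x <= x' ==> 0 < t ==> \<bar>F (2 * x' * sinh t) * g t\<bar> <= G t"
  using adm_kernel_bound[OF assms] by blast
 show ?thesis
  using assms G(2)[OF order_refl]
  by (intro integrable_half_line_bound[OF G(1)] continuous_on_sinh_transform_integrand)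
  (auto simp: adm_kernel_def exp_growth_def)
qed

lemma DERIV_sinh_transform:
 assumes F: "adm_kernel F" and G: "adm_kernel G" and g: "exp_growth g" and x: "0 < x"
  and D: "!!y. 0 < y ==> (F has_real_derivative G y / y) (at y)"
 shows "(sinh_transform F g has_real_derivative sinh_transform G g x / x) (at x)"
proof -
 obtain H where H: "integrable half_line H" "!!x' t. x / 2 <= x' ==> 0 < t ==> \<bar>G (2 * x' * sinh t) * g t\<bar> <= H t"
  using adm_kernel_bound[OF G g, of "x / 2"] x by auto
 have "((%x. \<integral>t. F (2 * x * sinh t) * g t \<partial>half_line) has_real_derivative
  (\<integral>t. G (2 * x * sinh t) * g t / x \<partial>half_line)) (at x)"
 proof (rule has_real_derivative_integral(2)[where a="x / 2" and b="2 * x"])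
  show "integrable half_line (%t. H t * (2 / x))" using H by simp
  fix z t assume z: "z \<in> {x / 2<..<2 * x}"
  then have zx: "0 < z" "x / 2 < z" using x by auto
  show "integrable half_line (%t. F (2 * z * sinh t) * g t)"
  by (rule integrable_sinh_transform[OF F g zx(1)])
  assume "t \<in> space half_line"
  then have t: "0 < t" by simp
  have "((%x. F (2 * x * sinh t)) has_real_derivative G (2 * z * sinh t) / (2 * z * sinh t) * (2 * sinh t)) (at z)"
  by (rule DERIV_chain2[OF D]) (use t zx in \<open>auto intro!: derivative_eq_intros\<close>)
  from DERIV_cmult_right[OF this, of "g t"]
  show "((%x. F (2 * x * sinh t) * g t) has_real_derivative G (2 * z * sinh t) * g t / z) (at z)"
  using t zx by (simp add: field_simps)
  have "\<bar>G (2 * z * sinh t) * g t / z\<bar> = \<bar>G (2 * z * sinh t) * g t\<bar> * (1 / z)" using zx by (simp add: abs_divide)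
  also have "... <= H t * (2 / x)"
  using H(2)[of z t] zx t x order_trans[OF abs_ge_zero H(2)[of z t]]
  by (intro mult_mono) (auto simp: field_simps)
  finally show "\<bar>G (2 * z * sinh t) * g t / z\<bar> <= H t * (2 / x)" .
 qed (use x in auto)
 then show ?thesis unfolding sinh_transform_def[abs_def] by simp
qed

lemma DERIV_kern_transform:
 assumes "exp_growth g" "0 < x" "j < 3"
 shows "(sinh_transform (kern j) g has_real_derivative sinh_transform (kern (Suc j)) g x / x) (at x)"
 by (rule DERIV_sinh_transform) (use assms adm_kern DERIV_kern in auto)

lemma tendsto_kern: "(kern 1 ---> - 1) (at_right 0)" "((%y. kern 2 y) ---> 0) (at_right 0)"
  "((%y. kern 2 y / y) ---> 0) (at_right 0)"
proof -
 show "(kern 1 ---> - 1) (at_right 0)"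
  using tendsto_minus[OF tendsto_yKK1] by (simp add: kern_simps[abs_def])
 have ev: "\<forall>\<^sub>F y in at_right 0. norm (y * KK 0 y) <= 8 * sqrt y"
  using eventually_at_right_less[of "0::real"]
 proof eventually_elim
  case (elim y)
  have "KK 0 y <= 8 / sqrt y" using order_trans[OF KK0_le[OF elim], of "8 / sqrt y"] elim
  by (auto simp: divide_le_eq_1 field_simps mult_le_cancel_left1)
  then have "y * KK 0 y <= y * (8 / sqrt y)" using elim by (intro mult_left_mono) auto
  also have "... = 8 * sqrt y" proof -
  have "y * (8 / sqrt y) = 8 * (y / sqrt y)" by simp
  then show ?thesis using elim by (simp only: real_div_sqrt less_imp_le)
  qed
  finally show ?case using KK_pos[OF elim, of 0] elim by simp
 qed
 have "((%y. 8 * sqrt y) ---> 8 * sqrt 0) (at_right 0)" by (intro tendsto_intros)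
 then have "((%y. 8 * sqrt y) ---> 0) (at_right 0)" by simp
 from Lim_null_comparison[OF ev this] have l: "((%y. y * KK 0 y) ---> 0) (at_right 0)" .
 show "((%y. kern 2 y / y) ---> 0) (at_right 0)"
  by (rule Lim_transform_eventually[OF l]) (auto simp: kern_simps power2_eq_square intro!: eventually_mono[OF eventually_at_right_less])
 have "((%y. y * (y * KK 0 y)) ---> 0 * 0) (at_right 0)" by (intro tendsto_intros l)
 then show "((%y. kern 2 y) ---> 0) (at_right 0)" by (simp add: kern_simps power2_eq_square mult.assoc)
qed

text \<open>Concentration at \<open>t = 0\<close>: with \<open>t = w / x\<close> the kernel argument
  \<open>2 * x * sinh (w / x)\<close> tends to \<open>2 * w\<close>, and \<open>g (w / x)\<close> to
  its limit at 0. All behaviour at large argument is derived from this.\<close>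

lemma tendsto_sinh_transform_at_top:
 assumes F: "adm_kernel F" and g: "exp_growth g" and g0: "(g ---> g0) (at_right 0)"
 shows "((%x. x * sinh_transform F g x) ---> integral\<^sup>L half_line F / 2 * g0) at_top"
proof -
 obtain D where D: "D \<ge> 0" "!!y. y > 0 ==> \<bar>F y\<bar> <= D / sqrt y * exp (- (y / 2))"
  using F unfolding adm_kernel_def by blast
 have cF: "continuous_on {0<..} F" using F by (simp add: adm_kernel_def)
 obtain C M where CM: "C \<ge> 0" "M \<ge> 0" "!!t. t > 0 ==> \<bar>g t\<bar> <= C * exp (M * t)"
  using g unfolding exp_growth_def by blast
 have cg: "continuous_on {0<..} g" using g by (simp add: exp_growth_def)
 let ?f = "%x w. F (2 * x * sinh (w / x)) * g (w / x)"
 have e: "x * sinh_transform F g x = integral\<^sup>L half_line (?f x)" if "0 < x" for x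
  using integral_half_line_scale(1)[of "1 / x" "%t. F (2 * x * sinh t) * g t"] that
  by (simp add: sinh_transform_def)
 have mf: "?f x \<in> borel_measurable half_line" if "0 < x" for x
 proof (rule borel_measurable_half_line)
  have "continuous_on {0<..} ((%t. F (2 * x * sinh t) * g t) \<circ> (%w. w / x))"
  using that by (intro continuous_on_compose continuous_on_subset[OF continuous_on_sinh_transform_integrand[OF cF cg that]] continuous_intros) auto
  then show "continuous_on {0<..} (?f x)" by (simp add: comp_def)
 qed
 \<comment> \<open>\<open>max 1 x\<close> keeps the integrand measurable for every \<open>x\<close>,
   as the convergence theorem demands; it equals \<open>x\<close> in the limit.\<close>
 have "((%x. integral\<^sup>L half_line (?f (max 1 x))) ---> (\<integral>w. F (2 * w) * g0 \<partial>half_line)) at_top"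
 proof (rule integral_dominated_convergence_at_top)
  show "integrable half_line (%w. 2 * D * C * sqrt_weight w)" using integrable_sqrt_weight by simp
  show "(%w. F (2 * w) * g0) \<in> borel_measurable half_line"
  proof (rule borel_measurable_half_line)
  have "continuous_on {0<..} (F \<circ> (%w. 2 * w))"
  by (intro continuous_on_compose continuous_on_subset[OF cF] continuous_intros) auto
  then show "continuous_on {0<..} (%w. F (2 * w) * g0)" by (intro continuous_intros) (simp add: comp_def)
  qed
  show "?f (max 1 x) \<in> borel_measurable half_line" for x by (rule mf) simp
  show "AE w in half_line. ((%x. ?f (max 1 x) w) ---> F (2 * w) * g0) at_top"
  proof (rule AE_I2)
  fix w assume "w \<in> space half_line"
  then have w: "0 < w" by simp
  have 1: "((%x. 2 * max 1 x * sinh (w / max 1 x)) ---> 2 * w) at_top"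
  proof (rule Lim_transform_eventually)
  show "((%x. 2 * x * sinh (w / x)) ---> 2 * w) at_top"
  unfolding sinh_field_def using w by real_asymp
  show "\<forall>\<^sub>F x in at_top. 2 * x * sinh (w / x) = 2 * max 1 x * sinh (w / max 1 x)"
  using eventually_ge_at_top[of 1] by eventually_elim (simp add: max_def)
  qed
  have "isCont F (2 * w)" using cF w by (simp add: continuous_on_eq_continuous_at)
  from isCont_tendsto_compose[OF this 1]
  have 2: "((%x. F (2 * max 1 x * sinh (w / max 1 x))) ---> F (2 * w)) at_top" .
  have "filterlim (%x. w / max 1 x) (at_right 0) at_top"
  proof (rule filterlim_mono_eventually[where f = "%x. w / x", OF _ order_refl order_refl])
  show "filterlim (%x. w / x) (at_right 0) at_top" using w by real_asymp
  show "\<forall>\<^sub>F x in at_top. w / x = w / max 1 x"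
  using eventually_ge_at_top[of 1] by eventually_elim (simp add: max_def)
  qed
  from filterlim_compose[OF g0 this]
  show "((%x. ?f (max 1 x) w) ---> F (2 * w) * g0) at_top" by (intro tendsto_mult 2)
  qed
  show "\<forall>\<^sub>F x in at_top. AE w in half_line. norm (?f (max 1 x) w) <= 2 * D * C * sqrt_weight w"
  \<comment> \<open>From \<open>2 * M\<close> on, the growth factor \<open>exp (M * w / x)\<close>
    costs at most \<open>exp (w / 2)\<close>, half of the decay \<open>exp (- w)\<close> of the
    kernel.\<close>
  using eventually_ge_at_top[of "max 1 (2 * M)"]
  proof eventually_elim
  case (elim x)
  then have x: "1 <= x" "2 * M <= x" "max 1 x = x" by auto
  show ?case
  proof (rule AE_I2)
  fix w assume "w \<in> space half_line"
  then have w: "0 < w" by simp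
  have s: "w <= x * sinh (w / x)"
  using mult_left_mono[OF sinh_ge[of "w / x"], of x] w x by simp
  have "\<bar>F (2 * x * sinh (w / x))\<bar> <= D / sqrt (2 * x * sinh (w / x)) * exp (- (2 * x * sinh (w / x) / 2))"
  using w x s by (intro D(2)) auto
  also have "... <= D / sqrt w * exp (- w)"
  using w x s D(1) by (intro mult_mono divide_left_mono) auto
  finally have F1: "\<bar>F (2 * x * sinh (w / x))\<bar> <= D / sqrt w * exp (- w)" .
  have "M * (w / x) <= w / 2"
  using x w mult_right_mono[of "2 * M" x w] by (simp add: field_simps)
  then have "C * exp (M * (w / x)) <= C * exp (w / 2)" using CM(1) by (intro mult_left_mono) auto
  then have g1: "\<bar>g (w / x)\<bar> <= C * exp (w / 2)" using CM(3)[of "w / x"] w x by (auto intro: order_trans)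
  have "norm (?f (max 1 x) w) <= (D / sqrt w * exp (- w)) * (C * exp (w / 2))"
  unfolding x(3) real_norm_def abs_mult using F1 g1 by (intro mult_mono) (auto intro: order_trans[OF abs_ge_zero])
  also have "... = D * C / sqrt w * exp (- (w / 2))"
  by (simp add: exp_add[symmetric])
  also have "exp (- (w / 2)) <= 2 / (1 + w)"
  proof -
  have "(1 + w) / 2 <= exp (w / 2)" using exp_ge_add_one_self[of "w / 2"] w by (simp add: field_simps)
  then show ?thesis using w by (simp add: exp_minus field_simps)
  qed
  then have "D * C / sqrt w * exp (- (w / 2)) <= D * C / sqrt w * (2 / (1 + w))"
  using D(1) CM(1) w by (intro mult_left_mono) auto
  also have "... = 2 * D * C * sqrt_weight w" by (simp add: sqrt_weight_def)
  finally show "norm (?f (max 1 x) w) <= 2 * D * C * sqrt_weight w" .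
  qed
  qed
 qed
 also have "(\<integral>w. F (2 * w) * g0 \<partial>half_line) = integral\<^sup>L half_line F / 2 * g0"
  using integral_half_line_scale(1)[of 2 F] by simp
 finally have "((%x. integral\<^sup>L half_line (?f (max 1 x))) ---> integral\<^sup>L half_line F / 2 * g0) at_top" .
 then show ?thesis
  by (rule Lim_transform_eventually)
  (use eventually_ge_at_top[of 1] in \<open>eventually_elim, simp add: max_def e\<close>)
qed

text \<open>The derivative of \<open>y * K_0\<close> is \<open>K_0 - y * K_1\<close>, and
  \<open>y * K_0\<close> vanishes at both ends, so the two integrals are opposite.\<close>

lemma integral_kern: "integral\<^sup>L half_line (kern 0) = pi / 2" "integral\<^sup>L half_line (kern 1) = - (pi / 2)"
proof -
 show "integral\<^sup>L half_line (kern 0) = pi / 2" using integral_KK0(2) by (simp add: kern_simps[abs_def])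
 have D: "((%y. y * KK 0 y) has_real_derivative KK 0 y + kern 1 y) (at y)" if "0 < y" for y
  by (rule DERIV_cong[OF DERIV_mult[OF DERIV_ident DERIV_KK[OF that]]]) (simp add: kern_simps)
 have i1: "integrable half_line (kern 1)"
 proof -
  obtain D where D: "D \<ge> 0" "!!y. y > 0 ==> \<bar>kern 1 y\<bar> <= D / sqrt y * exp (- (y / 2))"
  using adm_kern[of 1] unfolding adm_kernel_def by blast
  show ?thesis
  proof (rule integrable_half_line_bound)
  show "integrable half_line (%y. 2 * D * sqrt_weight y)" using integrable_sqrt_weight by simp
  fix y :: real assume y: "0 < y"
  have "exp (- (y / 2)) <= 2 / (1 + y)"
  proof -
  have "(1 + y) / 2 <= exp (y / 2)" using exp_ge_add_one_self[of "y / 2"] y by (simp add: field_simps)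
  then show ?thesis using y by (simp add: exp_minus field_simps)
  qed
  then have "D / sqrt y * exp (- (y / 2)) <= D / sqrt y * (2 / (1 + y))"
  using D(1) y by (intro mult_left_mono) auto
  also have "D / sqrt y * (2 / (1 + y)) = 2 * D * sqrt_weight y" by (simp add: sqrt_weight_def)
  finally show "\<bar>kern 1 y\<bar> <= 2 * D * sqrt_weight y" using D(2)[OF y] by linarith
  qed (rule continuous_on_kern)
 qed
 have l: "((%y. y * KK 0 y) ---> 0) (at_right 0)"
  by (rule Lim_transform_eventually[OF tendsto_kern(3)])
  (auto simp: kern_simps power2_eq_square intro!: eventually_mono[OF eventually_at_right_less])
 have l2: "((%y. y * KK 0 y) ---> 0) at_top"
 proof (rule Lim_null_comparison)
  show "((%y. 8 * sqrt y * exp (- (3 * y / 4))) ---> 0) at_top" by real_asymp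
  show "\<forall>\<^sub>F y in at_top. norm (y * KK 0 y) <= 8 * sqrt y * exp (- (3 * y / 4))"
  using eventually_gt_at_top[of 0]
  proof eventually_elim
  case (elim y)
  have "y * KK 0 y <= y * (8 / sqrt y * exp (- (3 * y / 4)))" using elim by (intro mult_left_mono KK0_le) auto
  also have "... = 8 * (y / sqrt y) * exp (- (3 * y / 4))" by simp
  finally show ?case using KK_pos[OF elim, of 0] elim by (simp add: real_div_sqrt)
  qed
 qed
 have "(\<integral>y. KK 0 y + kern 1 y \<partial>half_line) = 0 - 0"
  by (rule FTC_half_line[OF D _ _ l l2])
  (intro continuous_intros continuous_on_kern continuous_on_KK i1 integral_KK0(1)
  Bochner_Integration.integrable_add | assumption)+
 then show "integral\<^sup>L half_line (kern 1) = - (pi / 2)"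
  using i1 integral_KK0 by simp
qed

lemma kern_at_top: "0 < x ==> exp_growth g ==> ((%t. kern j (2 * x * sinh t) * g t) ---> 0) at_top"
proof -
 assume x: "0 < x" and g: "exp_growth g"
 obtain C M where CM: "C \<ge> 0" "M \<ge> 0" "!!t. t > 0 ==> \<bar>g t\<bar> <= C * exp (M * t)"
  using g unfolding exp_growth_def by blast
 obtain D where D: "D \<ge> 0" "!!y. y > 0 ==> \<bar>kern j y\<bar> <= D / sqrt y * exp (- (y / 2))"
  using adm_kern[of j] unfolding adm_kernel_def by blast
 show ?thesis
 proof (rule Lim_null_comparison)
  show "((%t. D / sqrt (2 * x * sinh t) * exp (- (2 * x * sinh t / 2)) * (C * exp (M * t))) ---> 0) at_top"
  proof -
  have "((%t. 1 / sqrt (2 * x * sinh t) * exp (M * t - x * sinh t)) ---> 0) at_top"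
  unfolding sinh_field_def using x by real_asymp
  from tendsto_mult_left[OF this, of "D * C"] show ?thesis
  by (simp add: exp_diff exp_minus field_simps)
  qed
  show "\<forall>\<^sub>F t in at_top. norm (kern j (2 * x * sinh t) * g t)
  <= D / sqrt (2 * x * sinh t) * exp (- (2 * x * sinh t / 2)) * (C * exp (M * t))"
  using eventually_gt_at_top[of 0]
  proof eventually_elim
  case (elim t)
  then have "0 < 2 * x * sinh t" using x by simp
  from mult_mono[OF D(2)[OF this] CM(3)[OF elim]] show ?case
  using D(1) elim x by (simp add: abs_mult)
  qed
 qed
qed

lemma DERIV_kern_sinh:
 assumes "0 < t" "0 < x" "j < 3"
 shows "((%t. kern j (2 * x * sinh t)) has_real_derivative kern (Suc j) (2 * x * sinh t) * cosh t / sinh t) (at t)"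
proof -
 have "((%t. kern j (2 * x * sinh t)) has_real_derivative
  kern (Suc j) (2 * x * sinh t) / (2 * x * sinh t) * (2 * x * cosh t)) (at t)"
  by (rule DERIV_chain2[OF DERIV_kern]) (use assms in \<open>auto intro!: derivative_eq_intros\<close>)
 then show ?thesis using assms by simp
qed

section \<open>Functions of exponential growth and identities for the transforms\<close>

lemma exp_growth_add: "exp_growth f ==> exp_growth g ==> exp_growth (%t. f t + g t)"
proof -
 assume f: "exp_growth f" and g: "exp_growth g"
 obtain C M where C: "C \<ge> 0" "M \<ge> 0" "!!t. t > 0 ==> \<bar>f t\<bar> <= C * exp (M * t)"
  using f unfolding exp_growth_def by blast
 obtain D L where D: "D \<ge> 0" "L \<ge> 0" "!!t. t > 0 ==> \<bar>g t\<bar> <= D * exp (L * t)"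
  using g unfolding exp_growth_def by blast
 have "\<bar>f t + g t\<bar> <= (C + D) * exp ((M + L) * t)" if t: "0 < t" for t
 proof -
  have "C * exp (M * t) <= C * exp ((M + L) * t)" "D * exp (L * t) <= D * exp ((M + L) * t)"
  using C D t by (auto intro!: mult_left_mono simp: algebra_simps)
  then show ?thesis using C(3)[OF t] D(3)[OF t] by (simp add: distrib_right)
 qed
 then show ?thesis using f g C D unfolding exp_growth_def
  by (intro conjI continuous_intros exI[of _ "C + D"] exI[of _ "M + L"]) auto
qed

lemma exp_growth_mult: "exp_growth f ==> exp_growth g ==> exp_growth (%t. f t * g t)"
proof -
 assume f: "exp_growth f" and g: "exp_growth g"
 obtain C M where C: "C \<ge> 0" "M \<ge> 0" "!!t. t > 0 ==> \<bar>f t\<bar> <= C * exp (M * t)"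
  using f unfolding exp_growth_def by blast
 obtain D L where D: "D \<ge> 0" "L \<ge> 0" "!!t. t > 0 ==> \<bar>g t\<bar> <= D * exp (L * t)"
  using g unfolding exp_growth_def by blast
 have "\<bar>f t * g t\<bar> <= (C * D) * exp ((M + L) * t)" if t: "0 < t" for t
  using mult_mono[OF C(3)[OF t] D(3)[OF t]] C(1)
  unfolding distrib_right exp_add by (simp add: abs_mult mult_ac)
 then show ?thesis using f g C D unfolding exp_growth_def
  by (intro conjI continuous_intros exI[of _ "C * D"] exI[of _ "M + L"]) auto
qed

lemma exp_growth_const: "exp_growth (%t. c)"
 unfolding exp_growth_def by (intro conjI exI[of _ "\<bar>c\<bar>"] exI[of _ 0]) auto

lemma exp_growth_exp: "exp_growth (%t. exp (c * t))"
 unfolding exp_growth_def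
 by (intro conjI exI[of _ 1] exI[of _ "\<bar>c\<bar>"]) (auto intro!: continuous_intros mult_right_mono)

lemma exp_growth_ident: "exp_growth (%t. t)"
proof -
 have "\<bar>t\<bar> <= 1 * exp (1 * t)" if "0 < t" for t :: real
  using exp_ge_add_one_self[of t] that by (simp only: mult_1_left abs_of_pos)
 then show ?thesis unfolding exp_growth_def by (intro conjI continuous_intros exI[of _ 1]) auto
qed

lemma exp_growth_cosh: "exp_growth (%t. cosh (c * t))"
proof -
 have "exp_growth (%t. 1 / 2 * exp (c * t) + 1 / 2 * exp ((- c) * t))"
  by (intro exp_growth_add exp_growth_mult exp_growth_const exp_growth_exp)
 then show ?thesis by (simp add: cosh_field_def add_divide_distrib)
qed

lemma exp_growth_sinh: "exp_growth (%t. sinh (c * t))"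
proof -
 have "exp_growth (%t. 1 / 2 * exp (c * t) + (- 1 / 2) * exp ((- c) * t))"
  by (intro exp_growth_add exp_growth_mult exp_growth_const exp_growth_exp)
 then show ?thesis by (simp add: sinh_field_def diff_divide_distrib)
qed

text \<open>As \<open>coth^2 = 1 + 1 / sinh^2\<close>, the excess over \<open>kern 3\<close> is
  \<open>(kern 3 - kern 2) / sinh^2\<close>, and
  \<open>kern 3 - kern 2 = y^2 * (kern 0 + kern 1)\<close> with
  \<open>y^2 = 4 * x^2 * sinh^2 t\<close>. This is how \<open>x^2\<close> gets out of the
  kernel.\<close>

lemma kern_ode:
 assumes "0 < x" "0 < t"
 defines "y \<equiv> 2 * x * sinh t"
 shows "kern 3 y * cosh t / sinh t * (cosh t / sinh t) + kern 2 y * (1 - (cosh t / sinh t)^2)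
  = kern 3 y + 4 * x^2 * kern 1 y + 4 * x^2 * kern 0 y"
proof -
 have s: "sinh t > 0" using assms by simp
 have c: "(cosh t)^2 = 1 + (sinh t)^2" using cosh_square_eq[of t] by simp
 have q: "cosh t / sinh t * (cosh t / sinh t) = 1 + 1 / (sinh t)^2" "(cosh t / sinh t)^2 = 1 + 1 / (sinh t)^2"
  using s c by (simp_all add: power2_eq_square field_simps)
 have "kern 3 y * (1 + 1 / (sinh t)^2) + kern 2 y * (1 - (1 + 1 / (sinh t)^2))
  = kern 3 y + 4 * x^2 * kern 1 y + 4 * x^2 * kern 0 y"
  using s unfolding kern_simps y_def by (simp add: field_simps power2_eq_square)
 then show ?thesis using q(1) unfolding q(2) by (simp only: times_divide_eq_right[symmetric] mult.assoc)
qed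

text \<open>In terms of \<open>T\<^sub>j = sinh_transform (kern j) g\<close>, where \<open>T\<^sub>j\<^sub>+\<^sub>1 = x dT\<^sub>j/dx\<close>, this is the
 third-order equation of products of Bessel functions.\<close>

lemma sinh_transform_ode:
 assumes g: "exp_growth g" and g1: "exp_growth g'" and g2: "exp_growth g''"
  and D1: "!!t. (g has_real_derivative g' t) (at t)" and D2: "!!t. (g' has_real_derivative g'' t) (at t)"
  and x: "0 < x"
 shows "sinh_transform (kern 3) g x + 4 * x^2 * sinh_transform (kern 1) g x + 4 * x^2 * sinh_transform (kern 0) g x
  = sinh_transform (kern 1) g'' x - g' 0"
proof -
 let ?y = "%t. 2 * x * sinh t"
 let ?f = "%t. (kern 3 (?y t) * g t + 4 * x^2 * (kern 1 (?y t) * g t) + 4 * x^2 * (kern 0 (?y t) * g t)) - kern 1 (?y t) * g'' t"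
 \<comment> \<open>Boundary term of two integrations by parts in \<open>t\<close>, where
   differentiation in \<open>t\<close> raises the kernel index with a factor \<open>coth t\<close>.
   At 0 only \<open>- kern 1 * g'\<close> survives and tends to \<open>g' 0\<close>; at infinity
   everything vanishes.\<close>
 let ?F = "%t. kern 2 (?y t) * (cosh t / sinh t) * g t - kern 1 (?y t) * g' t"
 have cg: "isCont g 0" "isCont g' 0" using D1 D2 DERIV_isCont by blast+
 have I: "integrable half_line (%t. kern j (?y t) * g t)" "integrable half_line (%t. kern j (?y t) * g'' t)" for j
  using integrable_sinh_transform[OF adm_kern _ x] g g2 by auto
 have C: "continuous_on {0<..} (%t. kern j (?y t) * g t)" "continuous_on {0<..} (%t. kern j (?y t) * g'' t)" for j
  using continuous_on_sinh_transform_integrand[OF continuous_on_kern _ x] g g2 by (auto simp: exp_growth_def)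
 have "integral\<^sup>L half_line ?f = 0 - g' 0"
 proof (rule FTC_half_line)
  fix t :: real assume t: "0 < t"
  have s: "sinh t > 0" using t by simp
  have c: "((%t. cosh t / sinh t) has_real_derivative 1 - (cosh t / sinh t)^2) (at t)"
  using s by (auto intro!: derivative_eq_intros simp: power2_eq_square field_simps)
  have k2: "((%t. kern 2 (?y t)) has_real_derivative kern 3 (?y t) * cosh t / sinh t) (at t)"
  using DERIV_kern_sinh[OF t x, of 2] by (simp add: numeral_3_eq_3[symmetric])
  have k1: "((%t. kern 1 (?y t)) has_real_derivative kern 2 (?y t) * cosh t / sinh t) (at t)"
  using DERIV_kern_sinh[OF t x, of 1] by (simp add: numeral_2_eq_2[symmetric])
  have "(?F has_real_derivative ((kern 3 (?y t) * cosh t / sinh t * (cosh t / sinh t) + (1 - (cosh t / sinh t)^2) * kern 2 (?y t)) * g t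
  + g' t * (kern 2 (?y t) * (cosh t / sinh t))) - (kern 2 (?y t) * cosh t / sinh t * g' t + g'' t * kern 1 (?y t))) (at t)"
  by (intro DERIV_diff DERIV_mult k1 k2 c D1 D2)
  moreover have "((kern 3 (?y t) * cosh t / sinh t * (cosh t / sinh t) + (1 - (cosh t / sinh t)^2) * kern 2 (?y t)) * g t
  + g' t * (kern 2 (?y t) * (cosh t / sinh t))) - (kern 2 (?y t) * cosh t / sinh t * g' t + g'' t * kern 1 (?y t)) = ?f t"
  proof -
  have gen: "((k3 * c / s * (c / s) + (1 - (c / s)^2) * k2) * g0 + g10 * (k2 * (c / s))) - (k2 * c / s * g10 + g20 * k1)
  = (k3 * g0 + d * (k1 * g0) + d * (k0 * g0)) - k1 * g20"
  if "k3 * c / s * (c / s) + k2 * (1 - (c / s)^2) = k3 + d * k1 + d * k0"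
  for k3 c s k2 g0 g10 g20 k1 k0 d :: real
  proof -
  have "(k3 * c / s * (c / s) + (1 - (c / s)^2) * k2) * g0 = (k3 + d * k1 + d * k0) * g0"
  using that by (simp only: mult.commute[of "1 - _" k2])
  then show ?thesis by (simp add: algebra_simps)
  qed
  show ?thesis by (rule gen) (rule kern_ode[OF x t])
  qed
  ultimately show "(?F has_real_derivative ?f t) (at t)" by (simp only:)
 next
  show "continuous_on {0<..} ?f" by (intro continuous_on_add continuous_on_diff continuous_on_mult_left C)
  show "integrable half_line ?f" by (intro Bochner_Integration.integrable_add Bochner_Integration.integrable_diff integrable_mult_right I)
  have y0: "filterlim ?y (at_right 0) (at_right 0)" unfolding sinh_field_def using x by real_asymp
  have gl: "(g ---> g 0) (at_right 0)" "(g' ---> g' 0) (at_right 0)"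
  using cg[unfolded isCont_def, THEN tendsto_mono[OF at_le[OF subset_UNIV]]] by blast+
  have ch: "((%t::real. 2 * x * cosh t) ---> 2 * x * cosh 0) (at_right 0)" by (intro tendsto_intros)
  have "((%t. kern 2 (?y t) / ?y t * (2 * x * cosh t) * g t - kern 1 (?y t) * g' t) ---> 0 * (2 * x * cosh 0) * g 0 - (- 1) * g' 0) (at_right 0)"
  by (intro tendsto_intros gl ch filterlim_compose[OF tendsto_kern(1) y0] filterlim_compose[OF tendsto_kern(3) y0])
  then have "((%t. kern 2 (?y t) / ?y t * (2 * x * cosh t) * g t - kern 1 (?y t) * g' t) ---> g' 0) (at_right 0)" by simp
  then show "(?F ---> g' 0) (at_right 0)"
  by (rule Lim_transform_eventually) (use x in \<open>auto intro!: eventually_mono[OF eventually_at_right_less]\<close>)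
  have a: "((%t::real. cosh t / sinh t) ---> 1) at_top" unfolding cosh_field_def sinh_field_def by real_asymp
  have "((%t. (kern 2 (?y t) * g t) * (cosh t / sinh t) - kern 1 (?y t) * g' t) ---> 0 * 1 - 0) at_top"
  by (intro tendsto_intros a kern_at_top x g g1)
  then show "(?F ---> 0) at_top" by (simp add: mult_ac)
 qed
 moreover have "integral\<^sup>L half_line ?f = (sinh_transform (kern 3) g x + 4 * x^2 * sinh_transform (kern 1) g x
  + 4 * x^2 * sinh_transform (kern 0) g x) - sinh_transform (kern 1) g'' x"
 proof -
  have lin: "(\<integral>t. (a t + c * b t + c * d t) - e t \<partial>half_line) = (integral\<^sup>L half_line a + c * integral\<^sup>L half_line b + c * integral\<^sup>L half_line d) - integral\<^sup>L half_line e"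
  if "integrable half_line a" "integrable half_line b" "integrable half_line d" "integrable half_line e" for a b d e :: "real => real" and c
  using that by simp
  show ?thesis unfolding sinh_transform_def by (rule lin) (rule I)+
 qed
 ultimately show ?thesis by simp
qed

text \<open>The counterpart for \<open>J^2 + Y^2\<close> of the raising formula
  \<open>C_{n+1} = (n / x) * C_n - C_n'\<close>, here for real order. It is one integration by parts
  of \<open>kern 1 * sinh (2 * c * t)\<close>, after expanding
  \<open>cosh (2 * c * t + 2 * t)\<close>.\<close>

lemma sinh_transform_ladder:
 assumes x: "0 < x"
 shows "x^2 * sinh_transform (kern 0) (%t. cosh (2 * (c + 1) * t)) x
  = x^2 * sinh_transform (kern 0) (%t. cosh (2 * c * t)) x - c * sinh_transform (kern 1) (%t. cosh (2 * c * t)) x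
  + sinh_transform (kern 2) (%t. cosh (2 * c * t)) x / 2"
proof -
 let ?y = "%t. 2 * x * sinh t"
 let ?C = "%t. cosh (2 * c * t)" and ?D = "%t. cosh (2 * (c + 1) * t)"
 note g = exp_growth_cosh[of "2 * c"] exp_growth_cosh[of "2 * (c + 1)"]
 let ?f = "%t. (x^2 * (kern 0 (?y t) * ?D t) - x^2 * (kern 0 (?y t) * ?C t)) + (c * (kern 1 (?y t) * ?C t) + (- 1 / 2) * (kern 2 (?y t) * ?C t))"
 have I: "integrable half_line (%t. kern j (?y t) * ?C t)" "integrable half_line (%t. kern j (?y t) * ?D t)" for j
  using integrable_sinh_transform[OF adm_kern _ x] g by auto
 have C: "continuous_on {0<..} (%t. kern j (?y t) * ?C t)" "continuous_on {0<..} (%t. kern j (?y t) * ?D t)" for j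
  using continuous_on_sinh_transform_integrand[OF continuous_on_kern _ x] g by (auto simp: exp_growth_def)
 let ?F = "%t. 1 / 2 * (kern 1 (?y t) * sinh (2 * c * t))"
 have "integral\<^sup>L half_line ?f = 0 - 0"
 proof (rule FTC_half_line)
  fix t :: real assume t: "0 < t"
  have s: "sinh t > 0" using t by simp
  have k1: "((%t. kern 1 (?y t)) has_real_derivative kern 2 (?y t) * cosh t / sinh t) (at t)"
  using DERIV_kern_sinh[OF t x, of 1] by (simp add: numeral_2_eq_2[symmetric])
  have "(?F has_real_derivative 1 / 2 * (kern 2 (?y t) * cosh t / sinh t * sinh (2 * c * t) + 2 * c * cosh (2 * c * t) * kern 1 (?y t))) (at t)"
  by (intro DERIV_cmult DERIV_mult k1) (auto intro!: derivative_eq_intros)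
  moreover have "1 / 2 * (kern 2 (?y t) * cosh t / sinh t * sinh (2 * c * t) + 2 * c * cosh (2 * c * t) * kern 1 (?y t)) = ?f t"
  proof -
  have a: "cosh (2 * (c + 1) * t) = cosh (2 * c * t) * (1 + 2 * (sinh t)^2) + sinh (2 * c * t) * (2 * sinh t * cosh t)"
  proof -
  have "cosh (2 * t) = 1 + 2 * (sinh t)^2" using cosh_double[of t] cosh_square_eq[of t] by simp
  moreover have "cosh (2 * (c + 1) * t) = cosh (2 * c * t + 2 * t)" by (simp add: algebra_simps)
  ultimately show ?thesis by (simp only: cosh_add sinh_double)
  qed
  have gen: "1 / 2 * ((y^2 * k0) * h / w * S + 2 * c * C * - (y * k1))
  = (x^2 * (k0 * (C * (1 + 2 * w^2) + S * (2 * w * h))) - x^2 * (k0 * C))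
  + (c * (- (y * k1) * C) + (- 1 / 2) * ((y^2 * k0) * C))"
  if "y = 2 * x * w" "0 < w" for y k0 h w S C k1 :: real
  proof -
  have "(y^2 * k0) * h / w * S = 4 * x^2 * w * k0 * h * S"
  using that by (simp add: power2_eq_square)
  then show ?thesis unfolding that(1) by (simp add: algebra_simps power2_eq_square)
  qed
  show ?thesis unfolding a kern_simps by (rule gen[OF refl s])
  qed
  ultimately show "(?F has_real_derivative ?f t) (at t)" by (simp only:)
 next
  show "continuous_on {0<..} ?f" by (intro continuous_on_add continuous_on_diff continuous_on_mult_left C)
  show "integrable half_line ?f" by (intro Bochner_Integration.integrable_add Bochner_Integration.integrable_diff integrable_mult_right I)
  have y0: "filterlim ?y (at_right 0) (at_right 0)" unfolding sinh_field_def using x by real_asymp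
  have sh: "((%t::real. sinh (2 * c * t)) ---> sinh (2 * c * 0)) (at_right 0)" by (intro tendsto_intros)
  have "(?F ---> 1 / 2 * (- 1 * sinh (2 * c * 0))) (at_right 0)"
  by (intro tendsto_intros sh filterlim_compose[OF tendsto_kern(1) y0])
  then show "(?F ---> 0) (at_right 0)" by simp
  have "(?F ---> 1 / 2 * 0) at_top"
  by (intro tendsto_intros kern_at_top x exp_growth_sinh)
  then show "(?F ---> 0) at_top" by simp
 qed
 moreover have "integral\<^sup>L half_line ?f = (x^2 * sinh_transform (kern 0) ?D x - x^2 * sinh_transform (kern 0) ?C x)
  + (c * sinh_transform (kern 1) ?C x + (- 1 / 2) * sinh_transform (kern 2) ?C x)"
 proof -
  have lin: "(\<integral>t. (p * a t - p * b t) + (q * d t + r * e t) \<partial>half_line) = (p * integral\<^sup>L half_line a - p * integral\<^sup>L half_line b) + (q * integral\<^sup>L half_line d + r * integral\<^sup>L half_line e)"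
  if "integrable half_line a" "integrable half_line b" "integrable half_line d" "integrable half_line e" for a b d e :: "real => real" and p q r
  using that by simp
  show ?thesis unfolding sinh_transform_def by (rule lin) (rule I)+
 qed
 ultimately show ?thesis by (simp add: algebra_simps)
qed

section \<open>Logarithmic integrals and the behaviour at the origin\<close>

lemma Gamma_half_line:
 assumes "0 < (s::real)"
 shows "integrable half_line (%w. w powr (s - 1) * exp (- w))" "(\<integral>w. w powr (s - 1) * exp (- w) \<partial>half_line) = Gamma s"
proof -
 have "has_bochner_integral lborel (%t. indicator {0<..} t *\<^sub>R (t powr (s - 1) * exp (- t))) (Gamma s)"
 proof (rule has_bochner_integral_nn_integral)
  show "(%t. indicator {0<..} t *\<^sub>R (t powr (s - 1) * exp (- t))) \<in> borel_measurable lborel" by measurable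
  have "(\<integral>\<^sup>+t. ennreal (indicator {0<..} t *\<^sub>R (t powr (s - 1) * exp (- t))) \<partial>lborel)
  = (\<integral>\<^sup>+t. ennreal (indicator {0..} t * t powr (s - 1) / exp t) \<partial>lborel)"
  by (intro nn_integral_cong) (auto simp: indicator_def exp_minus field_simps)
  then show "(\<integral>\<^sup>+t. ennreal (indicator {0<..} t *\<^sub>R (t powr (s - 1) * exp (- t))) \<partial>lborel) = ennreal (Gamma s)"
  using Gamma_conv_nn_integral_real[OF assms] by simp
 qed (use assms in \<open>auto intro: less_imp_le Gamma_real_pos\<close>)
 then show "integrable half_line (%w. w powr (s - 1) * exp (- w))" "(\<integral>w. w powr (s - 1) * exp (- w) \<partial>half_line) = Gamma s"
  by (auto simp: integrable_half_line set_integrable_def integral_half_line set_lebesgue_integral_def has_bochner_integral_iff)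
qed

lemma abs_ln_le: "0 < w ==> \<bar>ln w\<bar> <= 2 / sqrt w + w" for w :: real
proof -
 assume w: "0 < w"
 have "ln w <= w" using ln_le_minus_one[OF w] by linarith
 moreover have "- ln w <= 2 / sqrt w"
 proof -
  have "ln (1 / sqrt w) <= 1 / sqrt w" using ln_le_minus_one[of "1 / sqrt w"] w by simp
  moreover have "ln (1 / sqrt w) = - ln w / 2" using w by (simp add: ln_div ln_sqrt)
  ultimately show ?thesis by (simp add: field_simps)
 qed
 moreover have "0 <= 2 / sqrt w" using w by simp
 ultimately show ?thesis using w by linarith
qed

text \<open>The derivative of the Gamma integral at 2, where \<open>Gamma 2 = 1\<close> and
  \<open>Digamma 2 = 1 - euler_mascheroni\<close>.\<close>

lemma integral_w_ln_exp:
 "integrable half_line (%w. w * ln w * exp (- w))" "(\<integral>w. w * ln w * exp (- w) \<partial>half_line) = 1 - euler_mascheroni"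
proof -
 let ?f = "%s w::real. w powr (s - 1) * exp (- w)" and ?f' = "%s w::real. w powr (s - 1) * ln w * exp (- w)"
 have *: "integrable half_line (?f' 2) \<and> ((%s. integral\<^sup>L half_line (?f s)) has_real_derivative integral\<^sup>L half_line (?f' 2)) (at 2)"
 proof -
  have G: "integrable half_line (%w::real. (3 * fact 0 * 2 ^ 0 + 3 * (fact 3 * 2 ^ 3)) * exp (- (1 / 2 * w)))"
  using integrable_exp_neg integral_half_line_scale(2)[of "1/2" "%u. exp (- u)"] by simp
  have I: "integrable half_line (?f s)" if "s \<in> {3/2<..<3}" for s :: real
  using Gamma_half_line[of s] that by simp
  have D: "((%s. ?f s w) has_real_derivative ?f' s w) (at s)" if "w \<in> space half_line" for s w :: real
  using that by (auto intro!: derivative_eq_intros)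
  have B: "\<bar>?f' s w\<bar> <= (3 * fact 0 * 2 ^ 0 + 3 * (fact 3 * 2 ^ 3)) * exp (- (1 / 2 * w))"
  if s: "s \<in> {3/2<..<3}" and "w \<in> space half_line" for s w :: real
  proof -
  have w: "0 < w" using that by simp
  have b: "w powr (s - 1) * \<bar>ln w\<bar> <= 3 + 3 * w ^ 3"
  proof (cases "w <= 1")
  case True
  have "w powr (s - 1) <= w powr (1 / 2)" using True w s by (intro powr_mono') auto
  then have "w powr (s - 1) * \<bar>ln w\<bar> <= sqrt w * (2 / sqrt w + w)"
  using w abs_ln_le[OF w] by (intro mult_mono) (auto simp: powr_half_sqrt)
  also have "... = 2 + sqrt w * w" using w by (simp add: distrib_left)
  finally have "w powr (s - 1) * \<bar>ln w\<bar> <= 2 + sqrt w * w" .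
  moreover have "sqrt w * w <= 1 * 1" using True w by (intro mult_mono) auto
  moreover have "0 <= w ^ 3" using w by simp
  ultimately show ?thesis by linarith
  next
  case False
  have "w powr (s - 1) <= w powr 2" using False s by (intro powr_mono) auto
  moreover have "\<bar>ln w\<bar> <= w" using ln_le_minus_one[OF w] False by simp
  ultimately have "w powr (s - 1) * \<bar>ln w\<bar> <= w ^ 2 * w"
  using w by (intro mult_mono) auto
  moreover have "w ^ 2 * w = w ^ 3" by (simp add: power2_eq_square power3_eq_cube)
  moreover have "0 <= w ^ 3" using w by simp
  ultimately show ?thesis by linarith
  qed
  have e: "w ^ j * exp (- (1 / 2 * w)) <= fact j * 2 ^ j" for j
  using exp_neg_power[of "1/2" w j] w by (simp add: power_one_over)
  have "\<bar>?f' s w\<bar> = w powr (s - 1) * \<bar>ln w\<bar> * exp (- w)" by (simp add: abs_mult)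
  also have "... <= (3 + 3 * w ^ 3) * exp (- w)" using b by (intro mult_right_mono) auto
  also have "(3 + 3 * w ^ 3) * exp (- w)
  = (3 * (w ^ 0 * exp (- (1 / 2 * w))) + 3 * (w ^ 3 * exp (- (1 / 2 * w)))) * exp (- (1 / 2 * w))"
  proof -
  have "exp (- w) = exp (- (1 / 2 * w)) * exp (- (1 / 2 * w))" by (simp add: exp_add[symmetric])
  then show ?thesis by (simp add: algebra_simps)
  qed
  also have "... <= (3 * (fact 0 * 2 ^ 0) + 3 * (fact 3 * 2 ^ 3)) * exp (- (1 / 2 * w))"
  by (intro mult_right_mono add_mono mult_left_mono e) auto
  finally show ?thesis by simp
  qed
  show ?thesis
  using has_real_derivative_integral[of 2 "3/2" 3 half_line ?f ?f', OF _ D I B G] by simp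
 qed
 have ev: "\<forall>\<^sub>F s in nhds 2. integral\<^sup>L half_line (?f s) = Gamma s"
  using eventually_nhds_in_open[of "{0::real<..}" 2] Gamma_half_line by (auto elim!: eventually_mono)
 have D2: "Digamma (2::real) = 1 - euler_mascheroni"
  using Digamma_plus1[of "1::real"] by simp
 have "((%s. integral\<^sup>L half_line (?f s)) has_real_derivative Gamma 2 * Digamma 2) (at (2::real))"
 proof (subst DERIV_cong_ev[OF refl ev refl])
  show "(Gamma has_real_derivative Gamma 2 * Digamma 2) (at (2::real))"
  by (rule has_field_derivative_Gamma) auto
 qed
 from DERIV_unique[OF this conjunct2[OF *]]
 have "integral\<^sup>L half_line (?f' 2) = Gamma 2 * (1 - euler_mascheroni)" using D2 by simp
 moreover have "Gamma (2::real) = 1" using Gamma_fact[of 1, where ?'a=real] by simp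
 moreover have "integral\<^sup>L half_line (?f' 2) = (\<integral>w. w * ln w * exp (- w) \<partial>half_line)"
  by (rule integral_half_line_cong) simp
 moreover have "integrable half_line (?f' 2) \<longleftrightarrow> integrable half_line (%w. w * ln w * exp (- w))"
  by (rule Bochner_Integration.integrable_cong) auto
 ultimately show "integrable half_line (%w. w * ln w * exp (- w))" "(\<integral>w. w * ln w * exp (- w) \<partial>half_line) = 1 - euler_mascheroni"
  using * by simp_all
qed

lemma integral_w_exp: "integrable half_line (%w. w * exp (- w))" "(\<integral>w. w * exp (- w) \<partial>half_line) = (1::real)"
proof -
 have "integral\<^sup>L half_line (%w::real. w powr (2 - 1) * exp (- w)) = (\<integral>w. w * exp (- w) \<partial>half_line)"
  by (rule integral_half_line_cong) simp
 moreover have "integrable half_line (%w::real. w powr (2 - 1) * exp (- w)) \<longleftrightarrow> integrable half_line (%w. w * exp (- w))"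
  by (rule Bochner_Integration.integrable_cong) auto
 moreover have "Gamma (2::real) = 1" using Gamma_fact[of 1, where ?'a=real] by simp
 ultimately show "integrable half_line (%w. w * exp (- w))" "(\<integral>w. w * exp (- w) \<partial>half_line) = (1::real)"
  using Gamma_half_line[of 2] by simp_all
qed

lemma integral_w_ln_exp_scaled:
 assumes c: "0 < c"
 shows "(\<integral>w. w * ln w * exp (- (w * c)) \<partial>half_line) = (1 - euler_mascheroni - ln c) / c^2"
  "integrable half_line (%w. w * ln w * exp (- (w * c)))"
proof -
 let ?g = "%v. 1 / c * (v * ln v * exp (- v)) - ln c / c * (v * exp (- v))"
 have i: "integrable half_line ?g" using integral_w_ln_exp integral_w_exp by simp
 have e: "w * ln w * exp (- (w * c)) = ?g (c * w)" if "0 < w" for w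
  using that c by (simp add: ln_mult field_simps)
 have "integral\<^sup>L half_line (%w. ?g (c * w)) = integral\<^sup>L half_line ?g / c"
  by (rule integral_half_line_scale(1)[OF c])
 moreover have "integral\<^sup>L half_line ?g = 1 / c * (1 - euler_mascheroni) - ln c / c * 1"
  using integral_w_ln_exp integral_w_exp by simp
 moreover have "(\<integral>w. w * ln w * exp (- (w * c)) \<partial>half_line) = integral\<^sup>L half_line (%w. ?g (c * w))"
  by (rule integral_half_line_cong[OF e])
 ultimately have "(\<integral>w. w * ln w * exp (- (w * c)) \<partial>half_line) = (1 / c * (1 - euler_mascheroni) - ln c / c * 1) / c"
  by (simp only:)
 also have "... = (1 - euler_mascheroni - ln c) / c^2"
  using c by (simp add: field_simps power2_eq_square)
 finally show "(\<integral>w. w * ln w * exp (- (w * c)) \<partial>half_line) = (1 - euler_mascheroni - ln c) / c^2" .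
 have "integrable half_line (%w. w * ln w * exp (- (w * c))) \<longleftrightarrow> integrable half_line (%w. ?g (c * w))"
  by (rule Bochner_Integration.integrable_cong) (use e in auto)
 then show "integrable half_line (%w. w * ln w * exp (- (w * c)))"
  using i integral_half_line_scale(2)[OF c, of ?g] by simp
qed

lemma integrable_exp_half: "integrable half_line (%u::real. exp (- (1 / 2 * u)))"
 using integrable_exp_neg integral_half_line_scale(2)[of "1/2" "%u. exp (- u)"] by simp

text \<open>Majorant for the limit at the origin in \<open>tendsto_T1_0\<close>: for
  \<open>x <= 1\<close> the logarithm of \<open>w / 2 + sqrt (w^2 / 4 + x^2)\<close> lies between
  \<open>ln w\<close> and \<open>w\<close>.\<close>

lemma integrable_wK0_majorant: "integrable half_line (%w. w * KK 0 w * (\<bar>ln w\<bar> + w))"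
proof (rule integrable_half_line_bound)
 show "integrable half_line (%w. (8 * 2 * (fact 0 * 4 ^ 0) + 8 * 2 * (fact 2 * 4 ^ 2) + 8 * 2 * (fact 1 * 4 ^ 1)) * exp (- (1 / 2 * w)))"
  using integrable_exp_half by simp
 show "continuous_on {0<..} (%w. w * KK 0 w * (\<bar>ln w\<bar> + w))"
  by (intro continuous_intros continuous_on_KK) auto
 fix w :: real assume w: "0 < w"
 have e: "w ^ j * exp (- (1 / 4 * w)) <= fact j * 4 ^ j" for j
  using exp_neg_power[of "1/4" w j] w by (simp add: power_one_over)
 have "\<bar>w * KK 0 w * (\<bar>ln w\<bar> + w)\<bar> = w * KK 0 w * (\<bar>ln w\<bar> + w)"
  using w KK_pos[OF w, of 0] by simp
 also have "... <= w * (8 / sqrt w * exp (- (3 * w / 4))) * ((2 / sqrt w + w) + w)"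
  using w KK_pos[OF w, of 0] KK0_le[OF w] abs_ln_le[OF w] by (intro mult_mono add_mono) auto
 also have "... = 8 * (2 + 2 * (w * sqrt w)) * exp (- (3 * w / 4))"
 proof -
  have "w / sqrt w = sqrt w" using w by (simp add: real_div_sqrt)
  moreover have "w * (8 / sqrt w * exp (- (3 * w / 4))) = 8 * (w / sqrt w) * exp (- (3 * w / 4))" by simp
  ultimately have "w * (8 / sqrt w * exp (- (3 * w / 4))) = 8 * sqrt w * exp (- (3 * w / 4))" by (simp only:)
  moreover have b: "sqrt w * ((2 / sqrt w + w) + w) = 2 + 2 * (w * sqrt w)" using w by (simp add: field_simps)
  ultimately show ?thesis unfolding b[symmetric] by (simp only: mult.assoc mult.left_commute mult.commute)
 qed
 also have "... <= 8 * (2 + 2 * (w * (1 + w))) * exp (- (3 * w / 4))"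
 proof -
  have "sqrt w <= sqrt ((1 + w)^2)" using w by (intro real_sqrt_le_mono) (simp add: power2_eq_square algebra_simps)
  then have "sqrt w <= 1 + w" using w by simp
  then show ?thesis using w by (intro mult_right_mono mult_left_mono add_left_mono) auto
 qed
 also have "... = (8 * 2 * (w ^ 0 * exp (- (1 / 4 * w))) + 8 * 2 * (w ^ 2 * exp (- (1 / 4 * w))) + 8 * 2 * (w ^ 1 * exp (- (1 / 4 * w)))) * exp (- (1 / 2 * w))"
 proof -
  have "exp (- (3 * w / 4)) = exp (- (1 / 4 * w)) * exp (- (1 / 2 * w))" by (simp add: exp_add[symmetric])
  then show ?thesis by (simp add: algebra_simps power2_eq_square)
 qed
 also have "... <= (8 * 2 * (fact 0 * 4 ^ 0) + 8 * 2 * (fact 2 * 4 ^ 2) + 8 * 2 * (fact 1 * 4 ^ 1)) * exp (- (1 / 2 * w))"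
  by (intro mult_right_mono add_mono mult_left_mono e) auto
 finally show "\<bar>w * KK 0 w * (\<bar>ln w\<bar> + w)\<bar> <= (8 * 2 * (fact 0 * 4 ^ 0) + 8 * 2 * (fact 2 * 4 ^ 2) + 8 * 2 * (fact 1 * 4 ^ 1)) * exp (- (1 / 2 * w))" .
qed

lemma sigma_finite_half_line: "sigma_finite_measure half_line"
 unfolding half_line_def by (rule sigma_finite_measure_restrict_space) (auto intro: lborel.sigma_finite_measure_axioms)

text \<open>The limit at infinity of a primitive of
  \<open>(1 - c - ln (cosh u)) / (cosh u)^2\<close>; the \<open>ln 2\<close> is the limit of
  \<open>u - ln (cosh u)\<close>.\<close>

lemma tendsto_logcosh: "((%u::real. (1 - c) * tanh u - tanh u * ln (cosh u) + u - tanh u) ---> ln 2 - c) at_top"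
proof -
 have t: "((%u::real. tanh u) ---> 1) at_top"
  unfolding tanh_def sinh_field_def cosh_field_def by real_asymp
 have m: "((%u::real. u - tanh u * ln (cosh u)) ---> ln 2) at_top"
  unfolding tanh_def sinh_field_def cosh_field_def by real_asymp (simp add: ln_div)
 have "((%u::real. (1 - c) * tanh u + (u - tanh u * ln (cosh u)) - tanh u) ---> (1 - c) * 1 + ln 2 - 1) at_top"
  by (intro tendsto_intros t m)
 then show ?thesis by (simp add: algebra_simps)
qed

text \<open>Inserting the integral for \<open>K_0\<close> and exchanging the order of integration
  leaves the derivative of the Gamma integral at 2, scaled by \<open>cosh u\<close>, and then an
  elementary integral in \<open>u\<close>.\<close>

lemma integral_wK0_ln:
 "integrable half_line (%w. w * KK 0 w * ln w)" "(\<integral>w. w * KK 0 w * ln w \<partial>half_line) = ln 2 - euler_mascheroni"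
proof -
 interpret half_line: sigma_finite_measure half_line by (rule sigma_finite_half_line)
 interpret P: pair_sigma_finite half_line half_line ..
 let ?f = "%(w, u). w * ln w * exp (- (w * cosh u)) :: real"
 have [measurable]: "(%x. x) \<in> borel_measurable half_line"
  by (rule borel_measurable_half_line) (rule continuous_on_id)
 have [measurable]: "(%x. cosh x) \<in> borel_measurable half_line"
  by (rule borel_measurable_half_line) (auto intro!: continuous_intros)
 have [measurable]: "(%x. x * ln x) \<in> borel_measurable half_line"
  by (rule borel_measurable_half_line) (auto intro!: continuous_intros)
 have m: "?f \<in> borel_measurable (half_line \<Otimes>\<^sub>M half_line)"
  unfolding split_beta by measurable
 have inner: "(\<integral>u. exp (- (w * cosh u)) \<partial>half_line) = KK 0 w" for w by (simp add: KK_def)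
 show i1: "integrable half_line (%w. w * KK 0 w * ln w)"
 proof (rule integrable_half_line_bound[OF integrable_wK0_majorant])
  show "continuous_on {0<..} (%w. w * KK 0 w * ln w)" by (auto intro!: continuous_intros continuous_on_KK)
  fix w :: real assume w: "0 < w"
  have "0 <= w * KK 0 w" using w KK_pos[OF w, of 0] by simp
  then show "\<bar>w * KK 0 w * ln w\<bar> <= w * KK 0 w * (\<bar>ln w\<bar> + w)"
  using w unfolding abs_mult[of "w * KK 0 w"] by (intro mult_mono) auto
 qed
 have int: "integrable (half_line \<Otimes>\<^sub>M half_line) ?f"
 proof (rule P.Fubini_integrable[OF m])
  have "integrable half_line (%w. \<bar>w * KK 0 w * ln w\<bar>)" using i1 by simp
  moreover have "(\<integral>u. norm (?f (w, u)) \<partial>half_line) = \<bar>w * KK 0 w * ln w\<bar>" if "w \<in> space half_line" for w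
  using that KK_pos[of w 0] by (simp add: abs_mult inner)
  ultimately show "integrable half_line (%w. \<integral>u. norm (?f (w, u)) \<partial>half_line)"
  by (subst Bochner_Integration.integrable_cong[OF refl])
  show "AE w in half_line. integrable half_line (%u. ?f (w, u))"
  using integrable_KK[of _ 0] by (auto intro!: AE_I2)
 qed
 have "(\<integral>w. w * KK 0 w * ln w \<partial>half_line) = (\<integral>w. (\<integral>u. ?f (w, u) \<partial>half_line) \<partial>half_line)"
  by (simp add: inner mult_ac)
 also have "... = (\<integral>u. (\<integral>w. ?f (w, u) \<partial>half_line) \<partial>half_line)"
  using P.Fubini_integral[of "%w u. ?f (w, u)"] int by (simp add: split_beta)
 also have "... = (\<integral>u. (1 - euler_mascheroni - ln (cosh u)) / (cosh u)^2 \<partial>half_line)"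
  using integral_w_ln_exp_scaled(1) by simp
 also have "... = (ln 2 - euler_mascheroni) - 0"
 proof (rule FTC_half_line[OF _ _ _ _ tendsto_logcosh])
  fix u :: real
  have c: "cosh u > 0" by simp
  have D: "((%u. (1 - euler_mascheroni) * tanh u - tanh u * ln (cosh u) + u - tanh u) has_real_derivative
  (1 - euler_mascheroni) * (1 - (tanh u)^2) - ((1 - (tanh u)^2) * ln (cosh u) + (sinh u / cosh u) * tanh u) + 1 - (1 - (tanh u)^2)) (at u)"
  using c by (auto intro!: derivative_eq_intros)
  moreover have "(1 - euler_mascheroni) * (1 - (tanh u)^2) - ((1 - (tanh u)^2) * ln (cosh u) + (sinh u / cosh u) * tanh u) + 1 - (1 - (tanh u)^2)
  = (1 - euler_mascheroni - ln (cosh u)) / (cosh u)^2"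
  proof -
  have "(sinh u)^2 = (cosh u)^2 - 1" using cosh_square_eq[of u] by simp
  then have t: "1 - (tanh u)^2 = 1 / (cosh u)^2" using c by (simp add: tanh_def power_divide diff_divide_distrib)
  have s: "sinh u / cosh u * tanh u = (tanh u)^2" by (simp add: tanh_def power2_eq_square)
  have gen: "(1 - c) * (1 - P) - ((1 - P) * l + P) + 1 - (1 - P) = (1 - c - l) * (1 - P)" for c P l :: real
  by (simp add: algebra_simps)
  show ?thesis unfolding s gen unfolding t by simp
  qed
  ultimately show "((%u. (1 - euler_mascheroni) * tanh u - tanh u * ln (cosh u) + u - tanh u) has_real_derivative
  (1 - euler_mascheroni - ln (cosh u)) / (cosh u)^2) (at u)" by simp
 next
  show "continuous_on {0<..} (%u::real. (1 - euler_mascheroni - ln (cosh u)) / (cosh u)^2)"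
  by (auto intro!: continuous_intros simp: less_imp_neq)
  have "integrable half_line (%u. \<integral>w. ?f (w, u) \<partial>half_line)"
  using P.integrable_snd[of "%w u. ?f (w, u)"] int by (simp add: split_beta)
  then show "integrable half_line (%u::real. (1 - euler_mascheroni - ln (cosh u)) / (cosh u)^2)"
  using integral_w_ln_exp_scaled(1) by simp
  have "((%u::real. (1 - euler_mascheroni) * tanh u - tanh u * ln (cosh u) + u - tanh u) --->
  (1 - euler_mascheroni) * tanh 0 - tanh 0 * ln (cosh 0) + 0 - tanh 0) (at_right 0)"
  by (intro tendsto_intros) auto
  then show "((%u::real. (1 - euler_mascheroni) * tanh u - tanh u * ln (cosh u) + u - tanh u) ---> 0) (at_right 0)" by simp
 qed
 finally show "(\<integral>w. w * KK 0 w * ln w \<partial>half_line) = ln 2 - euler_mascheroni" by simp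
qed

text \<open>Integration by parts against the factor \<open>t\<close>, then
  \<open>w = 2 * x * sinh t\<close>. The parameter \<open>x\<close> thereby moves into
  \<open>arsinh (w / (2 * x))\<close>, whose logarithmic growth as \<open>x\<close> tends to 0 is
  explicit.\<close>

lemma integral_parts_T1:
 assumes x: "0 < x"
 shows "integrable half_line (%w. w * KK 0 w * arsinh (w / (2 * x)))"
  "- sinh_transform (kern 1) (%_. 1) x = (\<integral>w. w * KK 0 w * arsinh (w / (2 * x)) \<partial>half_line)"
proof -
 let ?y = "%t. 2 * x * sinh t"
 have cth: "t * cosh t / sinh t <= t + 1" if t: "0 < t" for t :: real
 proof -
  have "t * (cosh t - sinh t) <= t * 1"
  using t by (intro mult_left_mono) (auto simp: cosh_minus_sinh)
  also have "t * 1 <= sinh t" using sinh_ge[of t] t by simp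
  finally show ?thesis using t by (simp add: field_simps)
 qed
 have g: "exp_growth (%t. t * cosh t / sinh t)"
 proof -
  have "continuous_on {0<..} (%t::real. t * cosh t / sinh t)" by (auto intro!: continuous_intros)
  moreover have "\<bar>t * cosh t / sinh t\<bar> <= 1 * exp (1 * t)" if t: "0 < t" for t :: real
  proof -
  have "0 <= t * cosh t / sinh t" using t by simp
  then show ?thesis using cth[OF t] exp_ge_add_one_self[of t] by (simp only: mult_1_left abs_of_nonneg)
  qed
  ultimately show ?thesis unfolding exp_growth_def by (intro conjI exI[of _ 1]) auto
 qed
 note g1 = exp_growth_const[of 1]
 have I1: "integrable half_line (%t. kern 1 (?y t) * 1)" by (rule integrable_sinh_transform[OF adm_kern g1 x])
 have I2: "integrable half_line (%t. kern 2 (?y t) * (t * cosh t / sinh t))" by (rule integrable_sinh_transform[OF adm_kern g x])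
 have C1: "continuous_on {0<..} (%t. kern 1 (?y t) * 1)"
  by (rule continuous_on_sinh_transform_integrand[OF continuous_on_kern _ x]) (rule continuous_on_const)
 have C2: "continuous_on {0<..} (%t. kern 2 (?y t) * (t * cosh t / sinh t))"
  by (rule continuous_on_sinh_transform_integrand[OF continuous_on_kern _ x]) (use g in \<open>simp add: exp_growth_def\<close>)
 have "(\<integral>t. kern 1 (?y t) * 1 + kern 2 (?y t) * (t * cosh t / sinh t) \<partial>half_line) = 0 - 0"
 proof (rule FTC_half_line)
  fix t :: real assume t: "0 < t"
  have k1: "((%t. kern 1 (?y t)) has_real_derivative kern 2 (?y t) * cosh t / sinh t) (at t)"
  using DERIV_kern_sinh[OF t x, of 1] by (simp add: numeral_2_eq_2[symmetric])
  show "((%t. t * kern 1 (?y t)) has_real_derivative kern 1 (?y t) * 1 + kern 2 (?y t) * (t * cosh t / sinh t)) (at t)"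
  by (rule DERIV_cong[OF DERIV_mult[OF DERIV_ident k1]]) simp
 next
  show "continuous_on {0<..} (%t. kern 1 (?y t) * 1 + kern 2 (?y t) * (t * cosh t / sinh t))"
  by (rule continuous_on_add[OF C1 C2])
  show "integrable half_line (%t. kern 1 (?y t) * 1 + kern 2 (?y t) * (t * cosh t / sinh t))"
  by (rule Bochner_Integration.integrable_add[OF I1 I2])
  have y0: "filterlim ?y (at_right 0) (at_right 0)" unfolding sinh_field_def using x by real_asymp
  have "((%t. t * kern 1 (?y t)) ---> 0 * - 1) (at_right 0)"
  by (intro tendsto_intros filterlim_compose[OF tendsto_kern(1) y0])
  then show "((%t. t * kern 1 (?y t)) ---> 0) (at_right 0)" by simp
  show "((%t. t * kern 1 (?y t)) ---> 0) at_top"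
  using kern_at_top[OF x exp_growth_ident, of 1] by (simp add: mult.commute)
 qed
 then have e1: "- sinh_transform (kern 1) (%_. 1) x = (\<integral>t. kern 2 (?y t) * (t * cosh t / sinh t) \<partial>half_line)"
  using I1 I2 by (simp add: sinh_transform_def)
 let ?f = "%w. w * KK 0 w * arsinh (w / (2 * x))"
 have fg: "kern 2 (?y t) * (t * cosh t / sinh t) = ?f (?y t) * (2 * x * cosh t)" if "0 < t" for t
  using that x by (simp add: kern_simps power2_eq_square arsinh_sinh_real)
 have e: "einterval 0 \<infinity> = {0<..}" by (auto simp: einterval_def)
 have S: "set_integrable lborel (einterval 0 \<infinity>) ?f \<and> (LBINT w=0..\<infinity>. ?f w) = (LBINT t=0..\<infinity>. ?f (?y t) * (2 * x * cosh t))"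
 proof -
  have 1: "DERIV ?y t :> 2 * x * cosh t" for t by (auto intro!: derivative_eq_intros)
  have c: "continuous_on {0<..} ?f" using x by (intro continuous_intros continuous_on_KK) auto
  have 2: "isCont ?f (?y t)" if "0 < ereal t" for t
  using that x c by (simp add: continuous_on_eq_continuous_at)
  have 3: "isCont (%t. 2 * x * cosh t) t" for t by (intro continuous_intros)
  have 4: "0 <= ?f (?y t)" if "0 < ereal t" for t
  using that x KK_pos[of "?y t" 0] by (simp add: arsinh_sinh_real)
  have 5: "0 <= 2 * x * cosh t" for t using x by simp
  have "((%t. ?y t) ---> ?y 0) (at_right 0)" by (intro tendsto_intros)
  then have 6: "((ereal \<circ> ?y \<circ> real_of_ereal) ---> 0) (at_right 0)"
  by (simp add: ereal_tendsto_simps zero_ereal_def o_assoc)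
  have "filterlim ?y at_top at_top" unfolding sinh_field_def using x by real_asymp
  then have 7: "((ereal \<circ> ?y \<circ> real_of_ereal) ---> \<infinity>) (at_left \<infinity>)"
  by (simp add: ereal_tendsto_simps)
  have "integrable half_line (%t. ?f (?y t) * (2 * x * cosh t))"
  by (subst Bochner_Integration.integrable_cong[OF refl fg[symmetric]]) (use I2 in auto)
  then have 8: "set_integrable lborel (einterval 0 \<infinity>) (%t. ?f (?y t) * (2 * x * cosh t))"
  by (simp only: integrable_half_line e)
  have "(0::ereal) < \<infinity>" by simp
  from interval_integral_substitution_nonneg[OF this 1 2 3 4 5 6 7 8] show ?thesis by simp
 qed
 then show "integrable half_line ?f" by (simp add: integrable_half_line e)
 have "(\<integral>t. kern 2 (?y t) * (t * cosh t / sinh t) \<partial>half_line) = (\<integral>t. ?f (?y t) * (2 * x * cosh t) \<partial>half_line)"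
  by (rule integral_half_line_cong[OF fg])
 then show "- sinh_transform (kern 1) (%_. 1) x = integral\<^sup>L half_line ?f"
  unfolding e1 using S by (simp add: integral_half_line interval_lebesgue_integral_def e)
qed

text \<open>Since \<open>w * K_0\<close> has integral 1, \<open>ln x\<close> may be moved under the
  integral, where it combines with \<open>arsinh\<close> to a logarithm tending to
  \<open>ln w\<close>. The exact constant decides the coefficients in Nicholson's formula for order
  0.\<close>

lemma tendsto_T1_0:
 "((%x. sinh_transform (kern 1) (%_. 1) x - ln x) ---> euler_mascheroni - ln 2) (at_right 0)"
proof -
 let ?h = "%x w. w * KK 0 w * ln (w / 2 + sqrt (w^2 / 4 + x^2))"
 have ar: "arsinh (w / (2 * x)) + ln x = ln (w / 2 + sqrt (w^2 / 4 + x^2))" if "0 < x" "0 < w" for x w :: real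
 proof -
  have "(w / (2 * x))^2 + 1 = (w^2 / 4 + x^2) / x^2" using that by (simp add: field_simps power2_eq_square)
  then have "sqrt ((w / (2 * x))^2 + 1) = sqrt (w^2 / 4 + x^2) / x" using that by (simp add: real_sqrt_divide)
  moreover have "w / (2 * x) = w / 2 / x" by simp
  ultimately have "arsinh (w / (2 * x)) = ln ((w / 2 + sqrt (w^2 / 4 + x^2)) / x)"
  unfolding arsinh_real_def by (simp only: add_divide_distrib)
  also have "... = ln (w / 2 + sqrt (w^2 / 4 + x^2)) - ln x"
  proof -
  have "0 < w / 2 + sqrt (w^2 / 4 + x^2)" using that by (intro add_pos_nonneg) auto
  then show ?thesis using that by (simp add: ln_div)
  qed
  finally show ?thesis by simp
 qed
 have eq: "- (sinh_transform (kern 1) (%_. 1) x - ln x) = integral\<^sup>L half_line (?h x)" if x: "0 < x" for x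
 proof -
  have "- sinh_transform (kern 1) (%_. 1) x + ln x * 1 =
  (\<integral>w. w * KK 0 w * arsinh (w / (2 * x)) + ln x * (w * KK 0 w) \<partial>half_line)"
  unfolding integral_parts_T1(2)[OF x]
  using integral_parts_T1(1)[OF x] integral_yKK0
  by (simp only: Bochner_Integration.integral_add integrable_mult_right integral_mult_right_zero)
  also have "... = integral\<^sup>L half_line (?h x)"
  by (rule integral_half_line_cong, subst ar[OF x, symmetric]) (simp_all add: algebra_simps)
  finally show ?thesis by simp
 qed
 have "((%x. integral\<^sup>L half_line (?h x)) ---> (\<integral>w. w * KK 0 w * ln w \<partial>half_line)) (at_right 0)"
  unfolding tendsto_at_iff_sequentially comp_def
 proof (intro allI impI)
  fix X :: "nat => real" assume X: "\<forall>i. X i \<in> {0<..} - {0}" "X \<longlonglongrightarrow> 0"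
  have Xp: "0 < X n" for n using X(1) by auto
  obtain N where N: "!!n. n \<ge> N ==> X n <= 1"
  using order_tendstoD(2)[OF X(2), of 1] by (auto simp: eventually_sequentially intro: less_imp_le)
  have "(%n. integral\<^sup>L half_line (?h (X (n + N)))) \<longlonglongrightarrow> (\<integral>w. w * KK 0 w * ln w \<partial>half_line)"
  proof (rule integral_dominated_convergence[where w="%w. w * KK 0 w * (\<bar>ln w\<bar> + w)"])
  show "(%w. w * KK 0 w * ln w) \<in> borel_measurable half_line"
  by (rule borel_measurable_half_line) (auto intro!: continuous_intros continuous_on_KK)
  show "?h (X (n + N)) \<in> borel_measurable half_line" for n
  proof (rule borel_measurable_half_line)
  have "w / 2 + sqrt (w^2 / 4 + x^2) ~= 0" if "0 < w" for w x :: real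
  using that real_sqrt_ge_zero[of "w^2 / 4 + x^2"] by (smt (verit) half_gt_zero zero_le_power2 divide_nonneg_nonneg)
  then show "continuous_on {0<..} (?h (X (n + N)))"
  by (intro continuous_intros continuous_on_KK) auto
  qed
  show "AE w in half_line. (%n. ?h (X (n + N)) w) \<longlonglongrightarrow> w * KK 0 w * ln w"
  proof (rule AE_I2)
  fix w assume "w \<in> space half_line"
  then have w: "0 < w" by simp
  have "(%n. ?h (X n) w) \<longlonglongrightarrow> w * KK 0 w * ln (w / 2 + sqrt (w^2 / 4 + 0^2))"
  using w by (intro tendsto_intros X(2)) (auto simp: real_sqrt_divide)
  then have "(%n. ?h (X n) w) \<longlonglongrightarrow> w * KK 0 w * ln w" using w by (simp add: real_sqrt_divide)
  then show "(%n. ?h (X (n + N)) w) \<longlonglongrightarrow> w * KK 0 w * ln w" by (rule LIMSEQ_ignore_initial_segment)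
  qed
  show "AE w in half_line. norm (?h (X (n + N)) w) <= w * KK 0 w * (\<bar>ln w\<bar> + w)" for n
  proof (rule AE_I2)
  fix w assume "w \<in> space half_line"
  then have w: "0 < w" by simp
  define x where "x = X (n + N)"
  have x: "0 < x" "x <= 1" using Xp N by (auto simp: x_def)
  let ?s = "sqrt (w^2 / 4 + x^2)"
  have s1: "w / 2 <= ?s" using w by (intro real_le_rsqrt) (simp add: power_divide)
  have s2: "?s <= w / 2 + x" using w x by (intro real_le_lsqrt) (auto simp: power2_eq_square algebra_simps)
  have l1: "ln w <= ln (w / 2 + ?s)" using w s1 by (subst ln_le_cancel_iff) auto
  have "ln (w / 2 + ?s) <= ln (w + 1)" using w s1 s2 x by (subst ln_le_cancel_iff) auto
  also have "... <= w" using ln_le_minus_one[of "w + 1"] w by simp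
  finally have l2: "ln (w / 2 + ?s) <= w" .
  have "\<bar>ln (w / 2 + ?s)\<bar> <= \<bar>ln w\<bar> + w" using l1 l2 w by linarith
  then show "norm (?h (X (n + N)) w) <= w * KK 0 w * (\<bar>ln w\<bar> + w)"
  using w KK_pos[OF w, of 0] by (simp add: abs_mult x_def mult_left_mono)
  qed
  qed (rule integrable_wK0_majorant)
  then show "(%n. integral\<^sup>L half_line (?h (X n))) \<longlonglongrightarrow> (\<integral>w. w * KK 0 w * ln w \<partial>half_line)"
  by (rule LIMSEQ_offset)
 qed
 then have "((%x. integral\<^sup>L half_line (?h x)) ---> ln 2 - euler_mascheroni) (at_right 0)"
  unfolding integral_wK0_ln(2) .
 then have "((%x. - (sinh_transform (kern 1) (%_. 1) x - ln x)) ---> ln 2 - euler_mascheroni) (at_right 0)"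
  by (rule Lim_transform_eventually) (use eventually_at_right_less[of 0] eq in \<open>auto elim: eventually_mono\<close>)
 from tendsto_minus[OF this] show ?thesis by simp
qed

section \<open>Nicholson's formula\<close>

text \<open>Nicholson's integral for real order \<open>c\<close>; \<open>j\<close> counts
  applications of \<open>x d/dx\<close>, for \<open>j\<close> up to 3.\<close>

definition Nic :: "real => nat => real => real" where
 "Nic c j x = 8 / pi^2 * sinh_transform (kern j) (%t. cosh (2 * c * t)) x"

lemma DERIV_Nic: "0 < x ==> j < 3 ==> (Nic c j has_real_derivative Nic c (Suc j) x / x) (at x)"
 unfolding Nic_def[abs_def]
 by (rule DERIV_cong[OF DERIV_cmult[OF DERIV_kern_transform[OF exp_growth_cosh]]]) auto

lemma Nic_ode:
 assumes "0 < x"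
 shows "Nic c 3 x + 4 * (x^2 - c^2) * Nic c 1 x + 4 * x^2 * Nic c 0 x = 0"
proof -
 have g2: "exp_growth (%t. (2 * c)\<^sup>2 * cosh (2 * c * t))" by (intro exp_growth_mult exp_growth_const exp_growth_cosh)
 have g1: "exp_growth (%t. 2 * c * sinh (2 * c * t))" by (intro exp_growth_mult exp_growth_const exp_growth_sinh)
 have "sinh_transform (kern 3) (%t. cosh (2 * c * t)) x + 4 * x^2 * sinh_transform (kern 1) (%t. cosh (2 * c * t)) x
  + 4 * x^2 * sinh_transform (kern 0) (%t. cosh (2 * c * t)) x
  = sinh_transform (kern 1) (%t. (2 * c)\<^sup>2 * cosh (2 * c * t)) x - 2 * c * sinh (2 * c * 0)"
  by (rule sinh_transform_ode[OF exp_growth_cosh g1 g2 _ _ assms])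
  (auto intro!: derivative_eq_intros simp: power2_eq_square)
 moreover have "sinh_transform (kern 1) (%t. (2 * c)\<^sup>2 * cosh (2 * c * t)) x = (2 * c)^2 * sinh_transform (kern 1) (%t. cosh (2 * c * t)) x"
  unfolding sinh_transform_def by (subst integral_mult_right_zero[symmetric]) (simp add: mult_ac)
 ultimately have "sinh_transform (kern 3) (%t. cosh (2 * c * t)) x + 4 * (x^2 - c^2) * sinh_transform (kern 1) (%t. cosh (2 * c * t)) x
  + 4 * x^2 * sinh_transform (kern 0) (%t. cosh (2 * c * t)) x = 0"
  by (simp add: algebra_simps power2_eq_square)
 then have "8 / pi^2 * (sinh_transform (kern 3) (%t. cosh (2 * c * t)) x + 4 * (x^2 - c^2) * sinh_transform (kern 1) (%t. cosh (2 * c * t)) x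
  + 4 * x^2 * sinh_transform (kern 0) (%t. cosh (2 * c * t)) x) = 0" by simp
 then show ?thesis unfolding Nic_def by (simp add: distrib_left mult_ac)
qed

lemma Nic_ladder:
 assumes "0 < x"
 shows "x^2 * Nic (c + 1) 0 x = x^2 * Nic c 0 x - c * Nic c 1 x + Nic c 2 x / 2"
 using arg_cong[OF sinh_transform_ladder[OF assms, of c], of "%z. 8 / pi^2 * z"]
 unfolding Nic_def by (simp add: distrib_left right_diff_distrib mult_ac)

lemma Nic_at_top:
 "((%x. x * Nic c 0 x) ---> 2 / pi) at_top" "((%x. x * Nic c 1 x) ---> - (2 / pi)) at_top"
 "\<exists>l. ((%x. x * Nic c 2 x) ---> l) at_top"
proof -
 have g: "((%t. cosh (2 * c * t)) ---> 1) (at_right 0)"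
 proof -
  have "((%t. cosh (2 * c * t)) ---> cosh (2 * c * 0)) (at_right 0)" by (intro tendsto_intros)
  then show ?thesis by simp
 qed
 have *: "((%x. x * Nic c j x) ---> 8 / pi^2 * (integral\<^sup>L half_line (kern j) / 2 * 1)) at_top" for j
  using tendsto_mult_left[OF tendsto_sinh_transform_at_top[OF adm_kern exp_growth_cosh g, of j], of "8 / pi^2"]
  unfolding Nic_def by (simp add: mult_ac)
 show "((%x. x * Nic c 0 x) ---> 2 / pi) at_top"
  using *[of 0] unfolding integral_kern by (simp add: power2_eq_square)
 show "((%x. x * Nic c 1 x) ---> - (2 / pi)) at_top"
  using *[of 1] unfolding integral_kern by (simp add: power2_eq_square)
 show "\<exists>l. ((%x. x * Nic c 2 x) ---> l) at_top" using * by blast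
qed

lemma sinh_transform_pos:
 assumes "adm_kernel F" "exp_growth g" "0 < x" "!!y. 0 < y ==> 0 < F y" "!!t. 0 < t ==> 0 < g t"
 shows "0 < sinh_transform F g x"
 unfolding sinh_transform_def
 by (rule integral_half_line_pos[OF integrable_sinh_transform[OF assms(1-3)]]) (use assms in simp)

lemma Nic_pos: "0 < x ==> 0 < Nic c 0 x"
 unfolding Nic_def
 by (intro mult_pos_pos sinh_transform_pos adm_kern exp_growth_cosh) (auto simp: kern_simps KK_pos)

lemma Nic1_neg:
 assumes "0 < x" shows "Nic c 1 x < 0"
proof -
 have "0 < sinh_transform (%y. - 1 * kern 1 y) (%t. cosh (2 * c * t)) x"
  by (intro sinh_transform_pos adm_kernel_cmult adm_kern exp_growth_cosh assms) (auto simp: kern_simps KK_pos)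
 also have "sinh_transform (%y. - 1 * kern 1 y) (%t. cosh (2 * c * t)) x = - sinh_transform (kern 1) (%t. cosh (2 * c * t)) x"
  unfolding sinh_transform_def by simp
 finally have "sinh_transform (kern 1) (%t. cosh (2 * c * t)) x < 0" by simp
 then show ?thesis unfolding Nic_def by (intro mult_pos_neg) auto
qed

lemma constant_on_pos_reals:
 fixes f :: "real => real"
 assumes "!!x. 0 < x ==> (f has_real_derivative 0) (at x)"
 obtains c where "!!x. 0 < x ==> f x = c"
proof -
 have "\<exists>c. \<forall>z\<in>{0<..}. f z = c"
  by (rule has_field_derivative_zero_constant) (auto intro: assms has_field_derivative_at_within)
 then show ?thesis using that by auto
qed

text \<open>Solutions \<open>N\<close> of the third-order equation (\<open>M\<close> and \<open>P\<close> stand for \<open>x N'\<close> and \<open>x (x N')'\<close>)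
 are quadratic forms in the two Bessel functions. The coefficients come from
 solving the three equations for \<open>N\<close>, \<open>x N'\<close> and \<open>x (x N')'\<close>.\<close>

lemma bessel_product_representation:
 fixes N M P :: "real => real" and n :: nat
 defines "J \<equiv> JB n" and "Y \<equiv> bessel_Y n"
 assumes N: "!!x. 0 < x ==> (N has_real_derivative M x / x) (at x)"
  and M: "!!x. 0 < x ==> (M has_real_derivative P x / x) (at x)"
  and P: "!!x. 0 < x ==> (P has_real_derivative - (4 * (x^2 - (real n)^2) * M x + 4 * x^2 * N x) / x) (at x)"
 obtains a b c where
  "!!x. 0 < x ==> N x = a * (J x)^2 + b * (J x * Y x) + c * (Y x)^2"
  "!!x. 0 < x ==> M x = x * (2 * a * (J x * dJ n x) + b * (J x * dY n x + dJ n x * Y x) + 2 * c * (Y x * dY n x))"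
  "!!x. 0 < x ==> P x / 2 + (x^2 - (real n)^2) * N x = x^2 * (a * (dJ n x)^2 + b * (dJ n x * dY n x) + c * (dY n x)^2)"
proof -
 define R where "R x = P x / 2 + (x^2 - (real n)^2) * N x" for x
 \<comment> \<open>This expression is constant for any two solutions \<open>p\<close>,
   \<open>q\<close> of Bessel's equation. Taking them among \<open>J\<close> and \<open>Y\<close>
   gives, up to the squared Wronskian, the three coefficients of the quadratic form.\<close>
 define form where "form p p' q q' x = N x * (x^2 * (p' x * q' x)) - M x / 2 * (x * (p x * q' x + p' x * q x)) + R x * (p x * q x)"
  for p p' q q' x
 have dR: "(R has_real_derivative - (x^2 - (real n)^2) * M x / x) (at x)" if "0 < x" for x
 proof -
  have "(R has_real_derivative - (4 * (x^2 - (real n)^2) * M x + 4 * x^2 * N x) / x / 2 + (2 * x * N x + M x / x * (x^2 - (real n)^2))) (at x)"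
  unfolding R_def[abs_def]
  by (intro DERIV_add DERIV_cdivide P that DERIV_mult N) (auto intro!: derivative_eq_intros)
  moreover have "- (4 * (x^2 - (real n)^2) * M x + 4 * x^2 * N x) / x / 2 + (2 * x * N x + M x / x * (x^2 - (real n)^2)) = - (x^2 - (real n)^2) * M x / x"
  using that by (simp add: field_simps power2_eq_square)
  ultimately show ?thesis by (simp only:)
 qed
 have dform: "(form p p' q q' has_real_derivative 0) (at x)"
  if x: "0 < x" and dp: "!!x. 0 < x ==> (p has_real_derivative p' x) (at x)" "!!x. 0 < x ==> (p' has_real_derivative - p' x / x - (1 - (real n)^2 / x^2) * p x) (at x)"
  and dq: "!!x. 0 < x ==> (q has_real_derivative q' x) (at x)" "!!x. 0 < x ==> (q' has_real_derivative - q' x / x - (1 - (real n)^2 / x^2) * q x) (at x)"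
  for p p' q q' x
 proof -
  define p2 where "p2 = - p' x / x - (1 - (real n)^2 / x^2) * p x"
  define q2 where "q2 = - q' x / x - (1 - (real n)^2 / x^2) * q x"
  have D: "(form p p' q q' has_real_derivative
  (M x / x * (x^2 * (p' x * q' x)) + (2 * x * (p' x * q' x) + (p2 * q' x + q2 * p' x) * x^2) * N x)
  - (P x / x / 2 * (x * (p x * q' x + p' x * q x)) + (1 * (p x * q' x + p' x * q x) + ((p' x * q' x + q2 * p x) + (p2 * q x + q' x * p' x)) * x) * (M x / 2))
  + (- (x^2 - (real n)^2) * M x / x * (p x * q x) + (p' x * q x + q' x * p x) * R x)) (at x)"
  unfolding form_def[abs_def]
  using dp(1)[OF x] dp(2)[OF x, folded p2_def] dq(1)[OF x] dq(2)[OF x, folded q2_def]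
  by (intro DERIV_add DERIV_diff DERIV_mult DERIV_cdivide N M dR x DERIV_ident) (auto intro!: derivative_eq_intros)
  have p2: "x^2 * p2 = - (x * p' x) - (x^2 - (real n)^2) * p x" and q2: "x^2 * q2 = - (x * q' x) - (x^2 - (real n)^2) * q x"
  using x unfolding p2_def q2_def by (simp_all add: field_simps power2_eq_square)
  have "x * ((M x / x * (x^2 * (p' x * q' x)) + (2 * x * (p' x * q' x) + (p2 * q' x + q2 * p' x) * x^2) * N x)
  - (P x / x / 2 * (x * (p x * q' x + p' x * q x)) + (1 * (p x * q' x + p' x * q x) + ((p' x * q' x + q2 * p x) + (p2 * q x + q' x * p' x)) * x) * (M x / 2))
  + (- (x^2 - (real n)^2) * M x / x * (p x * q x) + (p' x * q x + q' x * p x) * R x)) = 0"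
  proof -
  have "x * ((M x / x * (x^2 * (p' x * q' x)) + (2 * x * (p' x * q' x) + (p2 * q' x + q2 * p' x) * x^2) * N x)
  - (P x / x / 2 * (x * (p x * q' x + p' x * q x)) + (1 * (p x * q' x + p' x * q x) + ((p' x * q' x + q2 * p x) + (p2 * q x + q' x * p' x)) * x) * (M x / 2))
  + (- (x^2 - (real n)^2) * M x / x * (p x * q x) + (p' x * q x + q' x * p x) * R x))
  = (M x * (x^2 * (p' x * q' x)) + x * (2 * x * (p' x * q' x) + ((x^2 * p2) * q' x + (x^2 * q2) * p' x)) * N x)
  - (P x / 2 * (x * (p x * q' x + p' x * q x)) + (x * (p x * q' x + p' x * q x) + (2 * x^2 * p' x * q' x + (x^2 * q2) * p x + (x^2 * p2) * q x)) * (M x / 2))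
  + (- (x^2 - (real n)^2) * M x * (p x * q x) + x * (p' x * q x + q' x * p x) * R x)"
  using x by (simp add: field_simps power2_eq_square)
  also have "... = 0" unfolding p2 q2 R_def by (simp add: algebra_simps power2_eq_square)
  finally show ?thesis .
  qed
  then show ?thesis using D x by simp
 qed
 have dJ1: "(J has_real_derivative dJ n x) (at x)" and dY1: "(Y has_real_derivative dY n x) (at x)"
  and dJ2: "(dJ n has_real_derivative - dJ n x / x - (1 - (real n)^2 / x^2) * J x) (at x)"
  and dY2: "(dY n has_real_derivative - dY n x / x - (1 - (real n)^2 / x^2) * Y x) (at x)" if "0 < x" for x
  using that DERIV_J DERIV_Y DERIV_dJ DERIV_dY by (simp_all add: J_def Y_def)
 obtain A where A: "!!x. 0 < x ==> form Y (dY n) Y (dY n) x = A"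
  using constant_on_pos_reals dform[OF _ dY1 dY2 dY1 dY2] by metis
 obtain B where B: "!!x. 0 < x ==> form J (dJ n) Y (dY n) x = B"
  using constant_on_pos_reals dform[OF _ dJ1 dJ2 dY1 dY2] by metis
 obtain C where C: "!!x. 0 < x ==> form J (dJ n) J (dJ n) x = C"
  using constant_on_pos_reals dform[OF _ dJ1 dJ2 dJ1 dJ2] by metis
 define k where "k = pi^2 / 4"
 have W: "k * (x * (J x * dY n x - dJ n x * Y x))^2 = 1" if "0 < x" for x
 proof -
  have "x * (J x * dY n x - dJ n x * Y x) = 2 / pi"
  using wronskian[OF that, of n] that by (simp add: J_def Y_def)
  then show ?thesis by (simp only: k_def power_divide) simp
 qed
 show ?thesis
 proof (rule that[of "k * A" "- 2 * k * B" "k * C"])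
  fix x :: real assume x: "0 < x"
  have "k * A * (J x)^2 + - 2 * k * B * (J x * Y x) + k * C * (Y x)^2 = N x * (k * (x * (J x * dY n x - dJ n x * Y x))^2)"
  unfolding A[OF x, symmetric] B[OF x, symmetric] C[OF x, symmetric] form_def
  by (simp add: algebra_simps power2_eq_square)
  then show "N x = k * A * (J x)^2 + - 2 * k * B * (J x * Y x) + k * C * (Y x)^2" unfolding W[OF x] by simp
  have "x * (2 * (k * A) * (J x * dJ n x) + - 2 * k * B * (J x * dY n x + dJ n x * Y x) + 2 * (k * C) * (Y x * dY n x)) = M x * (k * (x * (J x * dY n x - dJ n x * Y x))^2)"
  unfolding A[OF x, symmetric] B[OF x, symmetric] C[OF x, symmetric] form_def
  by (simp add: algebra_simps power2_eq_square)
  then show "M x = x * (2 * (k * A) * (J x * dJ n x) + - 2 * k * B * (J x * dY n x + dJ n x * Y x) + 2 * (k * C) * (Y x * dY n x))" unfolding W[OF x] by simp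
  have "x^2 * (k * A * (dJ n x)^2 + - 2 * k * B * (dJ n x * dY n x) + k * C * (dY n x)^2) = R x * (k * (x * (J x * dY n x - dJ n x * Y x))^2)"
  unfolding A[OF x, symmetric] B[OF x, symmetric] C[OF x, symmetric] form_def
  by (simp add: algebra_simps power2_eq_square)
  then show "P x / 2 + (x^2 - (real n)^2) * N x = x^2 * (k * A * (dJ n x)^2 + - 2 * k * B * (dJ n x * dY n x) + k * C * (dY n x)^2)"
  unfolding W[OF x] R_def by simp
 qed
qed

text \<open>At the origin \<open>Nic 0 1\<close> agrees with \<open>4 / pi * Y_0\<close> up to a
  vanishing error. As \<open>Y_0\<close> diverges, this forces the coefficient of
  \<open>Y_0^2\<close> to be 1, and then that of \<open>J_0 * Y_0\<close> to be 0. The coefficient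
  \<open>a\<close> of \<open>J_0^2\<close> is invisible there, because \<open>x * J_0 * J_0'\<close>
  tends to 0; it is found at infinity.\<close>

lemma Nic_0_form:
 obtains a where "!!x. 0 < x ==> Nic 0 0 x = a * (bessel_J 0 x)^2 + (bessel_Y 0 x)^2"
  "!!x. 0 < x ==> Nic 0 1 x = x * (2 * a * (bessel_J 0 x * dJ 0 x) + 2 * (bessel_Y 0 x * dY 0 x))"
  "!!x. 0 < x ==> Nic 0 2 x / 2 + x^2 * Nic 0 0 x = x^2 * (a * (dJ 0 x)^2 + (dY 0 x)^2)"
proof -
 have D: "(Nic 0 0 has_real_derivative Nic 0 1 x / x) (at x)" "(Nic 0 1 has_real_derivative Nic 0 2 x / x) (at x)"
  "(Nic 0 2 has_real_derivative - (4 * (x^2 - (real 0)^2) * Nic 0 1 x + 4 * x^2 * Nic 0 0 x) / x) (at x)" if "0 < x" for x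
 proof -
  have "Nic 0 3 x = - (4 * (x^2 - (real 0)^2) * Nic 0 1 x + 4 * x^2 * Nic 0 0 x)"
  using Nic_ode[OF that, of 0] by simp
  then show "(Nic 0 2 has_real_derivative - (4 * (x^2 - (real 0)^2) * Nic 0 1 x + 4 * x^2 * Nic 0 0 x) / x) (at x)"
  using DERIV_Nic[OF that, of 2 0] by (simp add: numeral_3_eq_3)
  show "(Nic 0 0 has_real_derivative Nic 0 1 x / x) (at x)" "(Nic 0 1 has_real_derivative Nic 0 2 x / x) (at x)"
  using DERIV_Nic[OF that, of 0 0] DERIV_Nic[OF that, of 1 0] by (simp_all add: numeral_2_eq_2)
 qed
 obtain a b c where rep:
  "!!x. 0 < x ==> Nic 0 0 x = a * (JB 0 x)^2 + b * (JB 0 x * bessel_Y 0 x) + c * (bessel_Y 0 x)^2"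
  "!!x. 0 < x ==> Nic 0 1 x = x * (2 * a * (JB 0 x * dJ 0 x) + b * (JB 0 x * dY 0 x + dJ 0 x * bessel_Y 0 x) + 2 * c * (bessel_Y 0 x * dY 0 x))"
  "!!x. 0 < x ==> Nic 0 2 x / 2 + (x^2 - (real 0)^2) * Nic 0 0 x = x^2 * (a * (dJ 0 x)^2 + b * (dJ 0 x * dY 0 x) + c * (dY 0 x)^2)"
  using bessel_product_representation[of "Nic 0 0" "Nic 0 1" "Nic 0 2" 0, OF D] by metis
 have lim1: "((%x. Nic 0 1 x - 4 / pi * bessel_Y 0 x) ---> 0) (at_right 0)"
 proof (rule Lim_transform_eventually)
  have "((%x. 8 / pi^2 * ((sinh_transform (kern 1) (%_. 1) x - ln x) - (euler_mascheroni - ln 2))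
  - 4 / pi * (bessel_Y 0 x - 2 / pi * (ln (x / 2) + euler_mascheroni))) --->
  8 / pi^2 * ((euler_mascheroni - ln 2) - (euler_mascheroni - ln 2)) - 4 / pi * 0) (at_right 0)"
  by (intro tendsto_intros tendsto_T1_0 tendsto_Y0)
  then show "((%x. 8 / pi^2 * ((sinh_transform (kern 1) (%_. 1) x - ln x) - (euler_mascheroni - ln 2))
  - 4 / pi * (bessel_Y 0 x - 2 / pi * (ln (x / 2) + euler_mascheroni))) ---> 0) (at_right 0)" by simp
  show "\<forall>\<^sub>F x in at_right 0. 8 / pi^2 * ((sinh_transform (kern 1) (%_. 1) x - ln x) - (euler_mascheroni - ln 2))
  - 4 / pi * (bessel_Y 0 x - 2 / pi * (ln (x / 2) + euler_mascheroni)) = Nic 0 1 x - 4 / pi * bessel_Y 0 x"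
  using eventually_at_right_less[of 0]
  by eventually_elim (simp add: Nic_def ln_div field_simps power2_eq_square)
 qed
 have lim2: "((%x. Nic 0 1 x - 4 / pi * c * bessel_Y 0 x) ---> 2 / pi * b) (at_right 0)"
 proof (rule Lim_transform_eventually)
  have "((%x. - 2 * a * (bessel_J 0 x * (x * bessel_J 1 x)) - b * (bessel_J 0 x * (x * bessel_Y 1 x) + x * bessel_J 1 x * bessel_Y 0 x)
  - 2 * c * ((x * bessel_Y 1 x + 2 / pi) * bessel_Y 0 x)) ---> - 2 * a * (1 * 0) - b * (1 * (- 2 / pi) + 0) - 2 * c * 0) (at_right 0)"
  by (intro tendsto_intros tendsto_J0 tendsto_xJ1 tendsto_xY1 tendsto_xJ1_Y0 tendsto_xY0pre)
  then show "((%x. - 2 * a * (bessel_J 0 x * (x * bessel_J 1 x)) - b * (bessel_J 0 x * (x * bessel_Y 1 x) + x * bessel_J 1 x * bessel_Y 0 x)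
  - 2 * c * ((x * bessel_Y 1 x + 2 / pi) * bessel_Y 0 x)) ---> 2 / pi * b) (at_right 0)" by (simp add: mult.commute)
  show "\<forall>\<^sub>F x in at_right 0. - 2 * a * (bessel_J 0 x * (x * bessel_J 1 x)) - b * (bessel_J 0 x * (x * bessel_Y 1 x) + x * bessel_J 1 x * bessel_Y 0 x)
  - 2 * c * ((x * bessel_Y 1 x + 2 / pi) * bessel_Y 0 x) = Nic 0 1 x - 4 / pi * c * bessel_Y 0 x"
  using eventually_at_right_less[of 0]
  proof eventually_elim
  case (elim x)
  show ?case unfolding rep(2)[OF elim] by (simp add: dJ_def dY_def algebra_simps)
  qed
 qed
 have lim3: "((%x. 4 / pi * (c - 1) * bessel_Y 0 x) ---> - (2 / pi * b)) (at_right 0)"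
 proof -
  have "((%x. (Nic 0 1 x - 4 / pi * bessel_Y 0 x) - (Nic 0 1 x - 4 / pi * c * bessel_Y 0 x)) ---> 0 - 2 / pi * b) (at_right 0)"
  by (intro tendsto_diff lim1 lim2)
  then show ?thesis by (simp add: algebra_simps diff_divide_distrib)
 qed
 have c: "c = 1"
 proof (rule ccontr)
  assume "c ~= 1"
  then have nz: "4 / pi * (c - 1) ~= 0" by simp
  have "((%x. (4 / pi * (c - 1) * bessel_Y 0 x) / (4 / pi * (c - 1))) ---> - (2 / pi * b) / (4 / pi * (c - 1))) (at_right 0)"
  by (intro tendsto_divide lim3 tendsto_const nz)
  then have "(bessel_Y 0 ---> - (2 / pi * b) / (4 / pi * (c - 1))) (at_right 0)" using nz by simp
  moreover have "filterlim (bessel_Y 0) at_infinity (at_right 0)"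
  using Y0_at_bot filterlim_at_bot_imp_at_infinity by blast
  ultimately show False using not_tendsto_and_filterlim_at_infinity trivial_limit_at_right_real by blast
 qed
 have b: "b = 0"
 proof -
  have "((%x. 0) ---> - (2 / pi * b)) (at_right (0::real))" using lim3 c by simp
  then have "- (2 / pi * b) = 0" by (rule tendsto_unique[OF trivial_limit_at_right_real _ tendsto_const])
  then show ?thesis by simp
 qed
 show ?thesis by (rule that[of a]) (use rep b c in auto)
qed

lemma tendsto_product_at_top:
 fixes f g :: "real => real"
 assumes "((%x. x * f x) ---> l) at_top" "((%x. x * g x) ---> m) at_top"
 shows "((%x. f x * g x) ---> 0) at_top"
proof (rule Lim_transform_eventually)
 have "((%x::real. 1 / x) ---> 0) at_top" by real_asymp
 then have "((%x. (1 / x * (x * f x)) * (1 / x * (x * g x))) ---> (0 * l) * (0 * m)) at_top"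
  by (intro tendsto_intros assms)
 then show "((%x. (1 / x * (x * f x)) * (1 / x * (x * g x))) ---> 0) at_top" by simp
 show "\<forall>\<^sub>F x in at_top. (1 / x * (x * f x)) * (1 / x * (x * g x)) = f x * g x"
  using eventually_gt_at_top[of 0] by eventually_elim simp
qed

text \<open>With \<open>d = c^2\<close> this is the quadratic first integral of the third-order
  equation; the limit is the same for every \<open>d\<close>, since \<open>Nic c 0\<close> tends to
  0.\<close>

lemma Nic_first_integral_at_top:
 "((%x. 2 * Nic c 0 x * Nic c 2 x - (Nic c 1 x)^2 + 4 * (x^2 - d) * (Nic c 0 x)^2) ---> 16 / pi^2) at_top"
proof -
 obtain l where l: "((%x. x * Nic c 2 x) ---> l) at_top" using Nic_at_top(3) by blast
 have "((%x. 2 * (Nic c 0 x * Nic c 2 x) - Nic c 1 x * Nic c 1 x + 4 * ((x * Nic c 0 x) * (x * Nic c 0 x) - d * (Nic c 0 x * Nic c 0 x)))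
  ---> 2 * 0 - 0 + 4 * (2 / pi * (2 / pi) - d * 0)) at_top"
  by (intro tendsto_intros tendsto_product_at_top[OF Nic_at_top(1) l] tendsto_product_at_top[OF Nic_at_top(2) Nic_at_top(2)]
  tendsto_product_at_top[OF Nic_at_top(1) Nic_at_top(1)] Nic_at_top(1))
 then show ?thesis by (simp add: algebra_simps power2_eq_square)
qed

text \<open>For \<open>a * J_0^2 + Y_0^2\<close> the first integral is \<open>4 * a\<close> times
  the square of \<open>x\<close> times the Wronskian, that is \<open>16 / pi^2 * a\<close>; its
  limit at infinity is \<open>16 / pi^2\<close>.\<close>

lemma Nic_0: "0 < x ==> Nic 0 0 x = (bessel_J 0 x)^2 + (bessel_Y 0 x)^2"
proof -
 obtain a where rep: "!!x. 0 < x ==> Nic 0 0 x = a * (bessel_J 0 x)^2 + (bessel_Y 0 x)^2"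
  "!!x. 0 < x ==> Nic 0 1 x = x * (2 * a * (bessel_J 0 x * dJ 0 x) + 2 * (bessel_Y 0 x * dY 0 x))"
  "!!x. 0 < x ==> Nic 0 2 x / 2 + x^2 * Nic 0 0 x = x^2 * (a * (dJ 0 x)^2 + (dY 0 x)^2)"
  using Nic_0_form by metis
 have "2 * Nic 0 0 x * Nic 0 2 x - (Nic 0 1 x)^2 + 4 * (x^2 - 0) * (Nic 0 0 x)^2 = 16 / pi^2 * a" if x: "0 < x" for x
 proof -
  have "2 * Nic 0 0 x * Nic 0 2 x - (Nic 0 1 x)^2 + 4 * (x^2 - 0) * (Nic 0 0 x)^2
  = 4 * Nic 0 0 x * (Nic 0 2 x / 2 + x^2 * Nic 0 0 x) - (Nic 0 1 x)^2"
  by (simp add: algebra_simps power2_eq_square)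
  also have "... = 4 * a * (x * (bessel_J 0 x * dY 0 x - dJ 0 x * bessel_Y 0 x))^2"
  unfolding rep(3)[OF x] unfolding rep(1,2)[OF x] by (simp add: algebra_simps power2_eq_square)
  also have "... = 16 / pi^2 * a"
  proof -
  have "x * (bessel_J 0 x * dY 0 x - dJ 0 x * bessel_Y 0 x) = 2 / pi"
  using wronskian[OF x, of 0] x by simp
  then show ?thesis by (simp only: power_divide) simp
  qed
  finally show ?thesis .
 qed
 then have "\<forall>\<^sub>F x in at_top. 2 * Nic 0 0 x * Nic 0 2 x - (Nic 0 1 x)^2 + 4 * (x^2 - 0) * (Nic 0 0 x)^2 = 16 / pi^2 * a"
  by (intro eventually_mono[OF eventually_gt_at_top[of 0]])
 then have "((%x. 16 / pi^2 * a) ---> 16 / pi^2) (at_top :: real filter)"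
  by (rule Lim_transform_eventually[OF Nic_first_integral_at_top])
 then have "16 / pi^2 * a = 16 / pi^2" by (simp add: tendsto_const_iff)
 then have "a = 1" by simp
 then show "0 < x ==> Nic 0 0 x = (bessel_J 0 x)^2 + (bessel_Y 0 x)^2" using rep(1) by simp
qed

text \<open>Bessel's equation removes the second derivatives and leaves \<open>J'^2 + Y'^2\<close>,
  which the ladder needs. Nicholson's formula is a hypothesis for the single order \<open>n\<close>,
  because this is used inside the induction that proves it.\<close>

lemma Nic_derivs:
 assumes N: "!!x. 0 < x ==> Nic (real n) 0 x = (JB n x)^2 + (bessel_Y n x)^2" and x: "0 < x"
 shows "Nic (real n) 1 x = 2 * x * (JB n x * dJ n x + bessel_Y n x * dY n x)"
  "Nic (real n) 2 x / 2 + (x^2 - (real n)^2) * Nic (real n) 0 x = x^2 * ((dJ n x)^2 + (dY n x)^2)"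
proof -
 let ?J = "JB n" and ?Y = "bessel_Y n"
 have N1: "Nic (real n) 1 x = 2 * x * (?J x * dJ n x + ?Y x * dY n x)" if x: "0 < x" for x
 proof -
  have ev: "\<forall>\<^sub>F w in nhds x. Nic (real n) 0 w = (?J w)^2 + (?Y w)^2"
  using eventually_nhds_in_open[of "{0<..}" x] x N by (auto elim!: eventually_mono)
  have "((%x. (?J x)\<^sup>2 + (?Y x)^2) has_real_derivative 2 * ?J x * dJ n x + 2 * ?Y x * dY n x) (at x)"
  using DERIV_J[OF x, of n] DERIV_Y[OF x, of n] by (auto intro!: derivative_eq_intros)
  from DERIV_unique_ev[OF DERIV_Nic[OF x, of 0] this ev] show ?thesis using x by (simp add: field_simps)
 qed
 then show "Nic (real n) 1 x = 2 * x * (?J x * dJ n x + ?Y x * dY n x)" using x .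
 have ev: "\<forall>\<^sub>F w in nhds x. Nic (real n) 1 w = 2 * w * (?J w * dJ n w + ?Y w * dY n w)"
  using eventually_nhds_in_open[of "{0<..}" x] x N1 by (auto elim!: eventually_mono)
 define j2 where "j2 = - dJ n x / x - (1 - (real n)^2 / x^2) * ?J x"
 define y2 where "y2 = - dY n x / x - (1 - (real n)^2 / x^2) * ?Y x"
 have "((%x. 2 * x * (?J x * dJ n x + ?Y x * dY n x)) has_real_derivative
  2 * (?J x * dJ n x + ?Y x * dY n x) + ((dJ n x * dJ n x + j2 * ?J x) + (dY n x * dY n x + y2 * ?Y x)) * (2 * x)) (at x)"
  using DERIV_J[OF x, of n] DERIV_Y[OF x, of n] DERIV_dJ[OF x, of n] DERIV_dY[OF x, of n]
  unfolding j2_def y2_def by (intro DERIV_mult DERIV_add) (auto intro!: derivative_eq_intros)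
 from DERIV_unique_ev[OF DERIV_Nic[OF x, of 1] this ev]
 have "Nic (real n) 2 x = x * (2 * (?J x * dJ n x + ?Y x * dY n x) + ((dJ n x * dJ n x + j2 * ?J x) + (dY n x * dY n x + y2 * ?Y x)) * (2 * x))"
  using x by (simp add: field_simps numeral_2_eq_2)
 also have "... = 2 * x^2 * ((dJ n x)^2 + (dY n x)^2) - 2 * (x^2 - (real n)^2) * ((?J x)^2 + (?Y x)^2)"
 proof -
  have 1: "x^2 * j2 = - (x * dJ n x) - (x^2 - (real n)^2) * ?J x" and 2: "x^2 * y2 = - (x * dY n x) - (x^2 - (real n)^2) * ?Y x"
  using x unfolding j2_def y2_def by (simp_all add: field_simps power2_eq_square)
  have "x * (2 * (?J x * dJ n x + ?Y x * dY n x) + ((dJ n x * dJ n x + j2 * ?J x) + (dY n x * dY n x + y2 * ?Y x)) * (2 * x))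
  = 2 * x * (?J x * dJ n x + ?Y x * dY n x) + 2 * (x^2 * (dJ n x)^2 + (x^2 * j2) * ?J x + x^2 * (dY n x)^2 + (x^2 * y2) * ?Y x)"
  by (simp add: algebra_simps power2_eq_square)
  then show ?thesis unfolding 1 2 by (simp add: algebra_simps power2_eq_square)
 qed
 finally show "Nic (real n) 2 x / 2 + (x^2 - (real n)^2) * Nic (real n) 0 x = x^2 * ((dJ n x)^2 + (dY n x)^2)"
  unfolding N[OF x] by (simp add: algebra_simps)
qed

text \<open>Induction by the ladder: its right-hand side completes to
  \<open>(n J_n - x J_n')^2 + (n Y_n - x Y_n')^2\<close>, and
  \<open>n J_n - x J_n' = x J_{n+1}\<close>, likewise for \<open>Y\<close>.\<close>

theorem Nicholson: "0 < x ==> Nic (real n) 0 x = (JB n x)^2 + (bessel_Y n x)^2"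
proof (induction n arbitrary: x)
 case 0
 then show ?case using Nic_0 by simp
next
 case (Suc n)
 note x = Suc.prems
 have d: "Nic (real n) 1 x = 2 * x * (JB n x * dJ n x + bessel_Y n x * dY n x)"
  "Nic (real n) 2 x / 2 + (x^2 - (real n)^2) * Nic (real n) 0 x = x^2 * ((dJ n x)^2 + (dY n x)^2)"
  by (rule Nic_derivs[OF Suc.IH x]; assumption)+
 let ?J = "JB n x" and ?Y = "bessel_Y n x"
 have "x^2 * Nic (real n + 1) 0 x = x^2 * Nic (real n) 0 x - real n * Nic (real n) 1 x + Nic (real n) 2 x / 2"
  by (rule Nic_ladder[OF x])
 also have "... = (real n)^2 * Nic (real n) 0 x - real n * Nic (real n) 1 x + (Nic (real n) 2 x / 2 + (x^2 - (real n)^2) * Nic (real n) 0 x)"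
  by (simp add: algebra_simps)
 also have "... = (real n * ?J - x * dJ n x)^2 + (real n * ?Y - x * dY n x)^2"
  unfolding d(2) unfolding d(1) Suc.IH[OF x] by (simp add: algebra_simps power2_eq_square)
 also have "real n * ?J - x * dJ n x = x * JB (Suc n) x"
  using x by (simp add: dJ_def field_simps)
 also have "real n * ?Y - x * dY n x = x * bessel_Y (Suc n) x"
  using x by (simp add: dY_def field_simps)
 finally have "x^2 * Nic (real n + 1) 0 x = x^2 * ((JB (Suc n) x)^2 + (bessel_Y (Suc n) x)^2)"
  by (simp add: power_mult_distrib distrib_left)
 then show ?case using x by (simp add: add.commute)
qed

section \<open>The Hankel function and the first zeros\<close>

lemma hankel_norm: "0 < x ==> (norm (hankel1 n x))^2 = Nic (real n) 0 x"
 by (simp add: hankel1_def cmod_def Nicholson)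

lemma Nic_antimono: "0 < x ==> x <= y ==> Nic c 0 y <= Nic c 0 x"
proof -
 assume x: "0 < x" "x <= y"
 show ?thesis
 proof (rule DERIV_nonpos_imp_nonincreasing[OF x(2)])
  fix z assume "x <= z"
  then have z: "0 < z" using x by simp
  show "\<exists>D. (Nic c 0 has_real_derivative D) (at z) \<and> D <= 0"
  using DERIV_Nic[OF z, of 0 c] Nic1_neg[OF z, of c] z
  by (intro exI[of _ "Nic c (Suc 0) z / z"]) (auto simp: divide_le_0_iff)
 qed
qed

lemma hankel_antimono: "0 < x ==> x <= y ==> norm (hankel1 n y) <= norm (hankel1 n x)"
 by (rule power2_le_imp_le) (auto simp: hankel_norm intro: Nic_antimono)

definition dH :: "nat => real => complex" where
 "dH n x = Complex (dJ n x) (dY n x)"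

lemma isCont_bessel:
 assumes "0 < x"
 shows "isCont (JB n) x" "isCont (bessel_Y n) x" "isCont (dJ n) x" "isCont (dY n) x"
 using DERIV_isCont[OF DERIV_J[OF assms]] DERIV_isCont[OF DERIV_Y[OF assms]]
  DERIV_isCont[OF DERIV_dJ[OF assms]] DERIV_isCont[OF DERIV_dY[OF assms]] by auto

lemma continuous_on_bessel:
 assumes "S \<subseteq> {0<..}"
 shows "continuous_on S (JB n)" "continuous_on S (bessel_Y n)" "continuous_on S (dJ n)" "continuous_on S (dY n)"
 using assms isCont_bessel by (auto intro!: continuous_at_imp_continuous_on)

text \<open>This is the logarithmic derivative of \<open>H\<close>, with \<open>i\<close>
  subtracted: the real part comes from the modulus, the imaginary part from the Wronskian. It serves
  both the radiation condition, as the coefficient tends to 0, and the construction of the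
  phase.\<close>

lemma hankel_outgoing:
 assumes "0 < x"
 shows "dH n x - \<i> * hankel1 n x = Complex (Nic (real n) 1 x / (2 * x * Nic (real n) 0 x)) (2 / (pi * x * Nic (real n) 0 x) - 1) * hankel1 n x"
proof -
 define N where "N = Nic (real n) 0 x"
 have N: "N = (JB n x)^2 + (bessel_Y n x)^2" "0 < N"
  using Nicholson[OF assms, of n] Nic_pos[OF assms, of "real n"] by (simp_all only: N_def)
 define P where "P = JB n x * dJ n x + bessel_Y n x * dY n x"
 define W where "W = JB n x * dY n x - dJ n x * bessel_Y n x"
 have 1: "Nic (real n) 1 x / (2 * x * N) = P / N"
  using Nic_derivs(1)[OF Nicholson assms, of n] assms by (simp add: P_def)
 have 2: "2 / (pi * x * N) = W / N" using wronskian[OF assms, of n] by (simp add: W_def field_simps)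
 have a: "P * JB n x - W * bessel_Y n x = dJ n x * N" "P * bessel_Y n x + W * JB n x = dY n x * N"
  unfolding P_def W_def N(1) by (simp_all add: algebra_simps power2_eq_square)
 have "P / N * JB n x - W / N * bessel_Y n x = dJ n x" "P / N * bessel_Y n x + W / N * JB n x = dY n x"
  using a N(2) by (simp_all add: field_simps)
 then show ?thesis
  unfolding N_def[symmetric] 1 2 dH_def hankel1_def by (simp add: complex_eq_iff algebra_simps)
qed

lemma hankel_outgoing_coeff:
 "((%x. Complex (Nic (real n) 1 x / (2 * x * Nic (real n) 0 x)) (2 / (pi * x * Nic (real n) 0 x) - 1)) ---> 0) at_top"
proof -
 have i: "((%x::real. 1 / (2 * x)) ---> 0) at_top" by real_asymp
 have "((%x. 1 / (2 * x) * ((x * Nic (real n) 1 x) / (x * Nic (real n) 0 x))) ---> 0 * (- (2 / pi) / (2 / pi))) at_top"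
  by (intro tendsto_intros i Nic_at_top(1,2)) auto
 then have "((%x. 1 / (2 * x) * ((x * Nic (real n) 1 x) / (x * Nic (real n) 0 x))) ---> 0) at_top" by simp
 then have 1: "((%x. Nic (real n) 1 x / (2 * x * Nic (real n) 0 x)) ---> 0) at_top"
  by (rule Lim_transform_eventually) (intro eventually_mono[OF eventually_gt_at_top[of 0]], simp)
 have "((%x. 2 / pi / (x * Nic (real n) 0 x) - 1) ---> 2 / pi / (2 / pi) - 1) at_top"
  by (intro tendsto_intros Nic_at_top(1)) auto
 then have 2: "((%x. 2 / (pi * x * Nic (real n) 0 x) - 1) ---> 0) at_top" by (simp add: mult.assoc)
 show ?thesis using tendsto_Complex[OF 1 2] by (simp add: Complex_eq_0 zero_complex.code)
qed

section \<open>Existence and ordering of the first zeros\<close>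

lemma J_pos_near_0: "\<forall>\<^sub>F x in at_right 0. 0 < JB n x"
proof -
 have "\<forall>\<^sub>F x in at_right 0. 0 < JB n x / (x / 2) ^ n"
  using order_tendstoD(1)[OF tendsto_J[of n], of 0] by simp
 with eventually_at_right_less[of "0::real"] show ?thesis
  by eventually_elim (simp add: zero_less_divide_iff)
qed

lemma tendsto_J_0: "(JB n ---> (if n = 0 then 1 else 0)) (at_right 0)"
proof (rule Lim_transform_eventually)
 have "((%x::real. (x / 2) ^ n) ---> (0 / 2) ^ n) (at_right 0)" by (intro tendsto_intros) auto
 from tendsto_mult[OF tendsto_J[of n] this]
 show "((%x. JB n x / (x / 2) ^ n * (x / 2) ^ n) ---> (if n = 0 then 1 else 0)) (at_right 0)"
  by (cases n) auto
 show "\<forall>\<^sub>F x in at_right 0. JB n x / (x / 2) ^ n * (x / 2) ^ n = JB n x"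
  using eventually_at_right_less[of "0::real"] by eventually_elim simp
qed

text \<open>\<open>LEAST\<close> over the reals names a zero only if the infimum is attained: zeros
  stay above \<open>d\<close>, and on \<open>{d..z}\<close> they form a closed set.\<close>

lemma least_zero:
 fixes f :: "real => real"
 assumes c: "!!x. 0 < x ==> isCont f x" and d: "0 < d" "!!x. 0 < x ==> x < d ==> f x ~= 0" and z: "0 < z" "f z = 0"
 defines "L \<equiv> (LEAST x. 0 < x \<and> f x = 0)"
 shows "0 < L" "f L = 0" "!!x. 0 < x ==> x < L ==> f x ~= 0" "L <= z"
proof -
 define S where "S = {x \<in> {d..z}. f x = 0}"
 have dz: "d <= z" using d z by (meson not_le)
 have "continuous_on {d..z} f" using c d by (auto intro!: continuous_at_imp_continuous_on)
 then have "closed S" unfolding S_def by (intro continuous_closed_preimage_constant) auto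
 moreover have "S ~= {}" "bdd_below S" using z dz by (auto simp: S_def)
 ultimately have i: "Inf S \<in> S" using closed_contains_Inf by blast
 have least: "Inf S <= x" if x: "0 < x" "f x = 0" for x
 proof (cases "x <= z")
  case True
  then have "x \<in> S" using x d(2)[of x] by (force simp: S_def)
  then show ?thesis by (rule cInf_lower) fact
 next
  case False
  have "Inf S <= z" using i by (auto simp: S_def)
  then show ?thesis using False by simp
 qed
 have L: "L = Inf S"
  unfolding L_def using i d(1) least by (intro Least_equality) (auto simp: S_def)
 show "0 < L" "f L = 0" "L <= z" using i d(1) by (auto simp: L S_def)
 show "f x ~= 0" if "0 < x" "x < L" for x using least[OF that(1)] that(2) by (auto simp: L)
qed

lemma no_sign_change:
 fixes f :: "real => real"
 assumes c: "!!x. 0 < x ==> isCont f x" and nz: "!!x. 0 < x ==> x < L ==> f x ~= 0"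
  and ev: "\<forall>\<^sub>F x in at_right 0. 0 < f x" and x: "0 < x" "x < L"
 shows "0 < f x"
proof (rule ccontr)
 assume "\<not> 0 < f x"
 then have neg: "f x < 0" using nz[OF x] by linarith
 obtain e where e: "0 < e" "!!y. 0 < y ==> y < e ==> 0 < f y"
  using ev by (auto simp: eventually_at_right_field)
 define y where "y = min e x / 2"
 have y: "0 < y" "y < e" "y < x" using e x by (auto simp: y_def)
 have "\<exists>z\<ge>y. z <= x \<and> f z = 0"
  using y neg e(2)[OF y(1,2)] c by (intro IVT2) auto
 then show False using nz x y by (metis order_le_less_trans order_less_le_trans)
qed

text \<open>Away from the zeros of \<open>J\<close>, \<open>arctan (Y / J)\<close> is the phase of
  \<open>H\<close> up to a constant; its speed contains only the modulus, by the Wronskian.\<close>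

lemma DERIV_arctan_YJ:
 assumes "0 < x" "JB n x ~= 0"
 shows "((%x. bessel_Y n x / JB n x) has_real_derivative 2 / (pi * x * (JB n x)^2)) (at x)"
  "((%x. arctan (bessel_Y n x / JB n x)) has_real_derivative 2 / (pi * x * Nic (real n) 0 x)) (at x)"
proof -
 have W: "dY n x * JB n x - bessel_Y n x * dJ n x = 2 / (pi * x)"
  using wronskian[OF assms(1), of n] by (simp add: mult.commute)
 show D: "((%x. bessel_Y n x / JB n x) has_real_derivative 2 / (pi * x * (JB n x)^2)) (at x)"
  using DERIV_divide[OF DERIV_Y[OF assms(1), of n] DERIV_J[OF assms(1), of n] assms(2)] unfolding W
  by (simp add: power2_eq_square)
 have "((%x. arctan (bessel_Y n x / JB n x)) has_real_derivative
  inverse (1 + (bessel_Y n x / JB n x)^2) * (2 / (pi * x * (JB n x)^2))) (at x)"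
  by (rule DERIV_chain2[OF DERIV_arctan D])
 moreover have "inverse (1 + (bessel_Y n x / JB n x)^2) * (2 / (pi * x * (JB n x)^2)) = 2 / (pi * x * Nic (real n) 0 x)"
 proof -
  have "(JB n x)^2 * (1 + (bessel_Y n x / JB n x)^2) = Nic (real n) 0 x"
  using assms(2) by (simp add: Nicholson[OF assms(1)] power_divide distrib_left)
  then show ?thesis by (simp add: inverse_eq_divide mult_ac)
 qed
 ultimately show "((%x. arctan (bessel_Y n x / JB n x)) has_real_derivative 2 / (pi * x * Nic (real n) 0 x)) (at x)" by simp
qed

lemma phase_speed_at_top: "((%x. 2 / (pi * x * Nic c 0 x)) ---> 1) at_top"
proof -
 have "((%x. 2 / pi / (x * Nic c 0 x)) ---> 2 / pi / (2 / pi)) at_top"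
  by (intro tendsto_intros Nic_at_top(1)) auto
 then show ?thesis by (simp add: mult.assoc)
qed

text \<open>Without zeros \<open>arctan (Y / J)\<close> would be a phase on the whole half-line. Its
  speed tends to 1; at speed 1/2 it gains 5 over a length of 10, while \<open>arctan\<close> stays
  between -2 and 2.\<close>

lemma J_has_zero: "\<exists>z>0. JB n z = 0"
proof (rule ccontr)
 assume "\<not> ?thesis"
 then have nz: "!!z. 0 < z ==> JB n z ~= 0" by auto
 obtain N where N: "!!x. N <= x ==> 1 / 2 < 2 / (pi * x * Nic (real n) 0 x)"
  using order_tendstoD(1)[OF phase_speed_at_top[of "real n"], of "1/2"] unfolding eventually_at_top_linorder by auto
 define a where "a = max 1 N"
 have a: "0 < a" "!!x. a <= x ==> 1 / 2 < 2 / (pi * x * Nic (real n) 0 x)"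
  using N by (auto simp: a_def)
 let ?f = "%x. arctan (bessel_Y n x / JB n x) - x / 2"
 have "?f a <= ?f (a + 10)"
 proof (rule DERIV_nonneg_imp_nondecreasing[where f="?f" and a=a and b="a + 10"])
  fix x assume x: "a <= x"
  have "(?f has_real_derivative 2 / (pi * x * Nic (real n) 0 x) - 1 / 2) (at x)"
  using a x nz by (intro DERIV_diff DERIV_arctan_YJ(2)) (auto intro!: derivative_eq_intros)
  then show "\<exists>y. (?f has_real_derivative y) (at x) \<and> 0 <= y" using a(2)[OF x] by (intro exI conjI) auto
 qed simp
 moreover have "arctan u < 2" "- 2 < arctan u" for u
  using arctan_ubound[of u] arctan_lbound[of u] pi_less_4 by linarith+
 from this(1)[of "bessel_Y n (a + 10) / JB n (a + 10)"] this(2)[of "bessel_Y n a / JB n a"]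
 have "arctan (bessel_Y n (a + 10) / JB n (a + 10)) < 2" "- 2 < arctan (bessel_Y n a / JB n a)" .
 ultimately show False by (simp add: add_divide_distrib)
qed

lemma first_zero_J:
 shows "0 < first_zero_J n" "JB n (first_zero_J n) = 0"
  "!!x. 0 < x ==> x < first_zero_J n ==> 0 < JB n x"
proof -
 obtain z where z: "0 < z" "JB n z = 0" using J_has_zero by blast
 obtain e where e: "0 < e" "!!y. 0 < y ==> y < e ==> 0 < JB n y"
  using J_pos_near_0[of n] by (auto simp: eventually_at_right_field)
 have c: "!!x. 0 < x ==> isCont (JB n) x" by (rule isCont_bessel)
 have e2: "JB n x ~= 0" if "0 < x" "x < e" for x using e(2)[OF that] by simp
 note L = least_zero[OF c e(1) e2 z, folded first_zero_J_def]
 show "0 < first_zero_J n" "JB n (first_zero_J n) = 0" using L by auto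
 show "0 < JB n x" if "0 < x" "x < first_zero_J n" for x
  by (rule no_sign_change[OF c L(3) J_pos_near_0 that])
qed

lemma J_nonneg: "0 < x ==> x <= first_zero_J n ==> 0 <= JB n x"
 using first_zero_J(2)[of n] first_zero_J(3)[of x n] by (metis less_eq_real_def)

text \<open>\<open>J\<close> descends to its first zero, so \<open>J'\<close> is not positive there;
  the Wronskian reduces to \<open>- J' * Y > 0\<close>, which excludes \<open>J' = 0\<close> and
  fixes the sign of \<open>Y\<close>.\<close>

lemma dJ_first_zero: "dJ n (first_zero_J n) < 0" "0 < bessel_Y n (first_zero_J n)"
proof -
 let ?j = "first_zero_J n"
 note j = first_zero_J(1)[of n] first_zero_J(2)[of n] first_zero_J(3)[where n=n]
 have w: "- (dJ n ?j * bessel_Y n ?j) = 2 / (pi * ?j)" using wronskian[OF j(1), of n] j(2) by simp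
 have "0 < 2 / (pi * ?j)" using j(1) by simp
 then have p: "dJ n ?j * bessel_Y n ?j < 0" using w by linarith
 have "\<not> 0 < dJ n ?j"
 proof
  assume "0 < dJ n ?j"
  from DERIV_pos_inc_left[OF DERIV_J[OF j(1)] this] obtain d where d: "0 < d"
  "!!h. 0 < h ==> h < d ==> JB n (?j - h) < JB n ?j" by blast
  define h where "h = min d ?j / 2"
  have "0 < h" "h < d" "h < ?j" using d(1) j(1) by (auto simp: h_def)
  then show False using d(2)[of h] j(3)[of "?j - h"] j(2) by simp
 qed
 then show "dJ n ?j < 0" using p by (metis linorder_neqE_linordered_idom mult_eq_0_iff less_irrefl)
 then show "0 < bessel_Y n ?j" using p by (simp add: mult_less_0_iff)
qed

text \<open>The derivative \<open>2 / (pi * x * J^2)\<close> of the quotient is at least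
  \<open>1 / (2 * pi * x)\<close> where \<open>J < 2\<close>. Hence divergence at least logarithmic
  for all orders at once, without looking at the polynomial part of \<open>Y\<close>.\<close>

lemma YJ_at_bot: "filterlim (%x. bessel_Y n x / JB n x) at_bot (at_right 0)"
proof -
 let ?r = "%x. bessel_Y n x / JB n x"
 have "\<forall>\<^sub>F x in at_right 0. JB n x < 2"
  using order_tendstoD(2)[OF tendsto_J_0[of n], of 2] by (auto split: if_splits)
 then obtain e where e: "0 < e" "!!y. 0 < y ==> y < e ==> JB n y < 2"
  by (auto simp: eventually_at_right_field)
 define d where "d = min e (first_zero_J n) / 2"
 have d: "0 < d" "d < e" "d < first_zero_J n" using e first_zero_J(1)[of n] by (auto simp: d_def)
 have le: "?r x <= ?r d - 1 / (2 * pi) * (ln d - ln x)" if x: "0 < x" "x <= d" for x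
 proof -
  have "?r x - 1 / (2 * pi) * ln x <= ?r d - 1 / (2 * pi) * ln d"
  proof (rule DERIV_nonneg_imp_nondecreasing[OF x(2)])
  fix z assume z: "x <= z" "z <= d"
  then have z0: "0 < z" using x by simp
  have J: "0 < JB n z" "JB n z < 2" using z z0 d first_zero_J(3)[of z n] e(2)[of z] by auto
  have "((%x. ?r x - 1 / (2 * pi) * ln x) has_real_derivative 2 / (pi * z * (JB n z)^2) - 1 / (2 * pi) * (1 / z)) (at z)"
  using z0 J by (intro DERIV_diff DERIV_arctan_YJ(1)) (auto intro!: derivative_eq_intros)
  moreover have "1 / (2 * pi) * (1 / z) <= 2 / (pi * z * (JB n z)^2)"
  proof -
  have "(JB n z)^2 <= 2^2" using J by (intro power_mono) auto
  then have "2 / (pi * z * 4) <= 2 / (pi * z * (JB n z)^2)"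
  using z0 J by (intro divide_left_mono mult_left_mono) auto
  then show ?thesis by simp
  qed
  ultimately show "\<exists>y. ((%x. ?r x - 1 / (2 * pi) * ln x) has_real_derivative y) (at z) \<and> 0 <= y"
  by (intro exI conjI) auto
  qed
  then show ?thesis by (simp add: right_diff_distrib)
 qed
 have "filterlim (%x. - (?r d - 1 / (2 * pi) * (ln d - ln x))) at_top (at_right 0)"
  by real_asymp
 then have "filterlim (%x. - ?r x) at_top (at_right 0)"
 proof (rule filterlim_at_top_mono)
  show "\<forall>\<^sub>F x in at_right 0. - (?r d - 1 / (2 * pi) * (ln d - ln x)) <= - ?r x"
  unfolding eventually_at_right_field using d(1) le by (intro exI[of _ d]) (auto simp del: minus_diff_eq)
 qed
 then show ?thesis by (simp add: filterlim_uminus_at_bot)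
qed

lemma Y_neg_near_0: "\<forall>\<^sub>F x in at_right 0. bessel_Y n x < 0"
proof -
 have "\<forall>\<^sub>F x in at_right 0. bessel_Y n x / JB n x < 0"
  using YJ_at_bot[of n] by (auto simp: filterlim_at_bot_dense)
 with J_pos_near_0[of n] show ?thesis
  by eventually_elim (simp add: divide_less_0_iff)
qed

text \<open>\<open>Y\<close> is negative near 0 and, by the Wronskian, positive at the first zero of
  \<open>J\<close>; so it vanishes strictly before.\<close>

lemma first_zero_Y:
 shows "0 < first_zero_Y n" "bessel_Y n (first_zero_Y n) = 0"
  "!!x. 0 < x ==> x < first_zero_Y n ==> bessel_Y n x < 0"
  "first_zero_Y n < first_zero_J n"
proof -
 note j = first_zero_J(1)[of n] first_zero_J(2)[of n] first_zero_J(3)[where n=n]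
 obtain e where e: "0 < e" "!!y. 0 < y ==> y < e ==> bessel_Y n y < 0"
  using Y_neg_near_0[of n] by (auto simp: eventually_at_right_field)
 define d where "d = min e (first_zero_J n) / 2"
 have d: "0 < d" "d < e" "d < first_zero_J n" using e j(1) by (auto simp: d_def)
 have c: "!!x. 0 < x ==> isCont (bessel_Y n) x" by (rule isCont_bessel)
 have "\<exists>z\<ge>d. z <= first_zero_J n \<and> bessel_Y n z = 0"
  using d e(2)[OF d(1,2)] dJ_first_zero(2)[of n] c by (intro IVT) auto
 then obtain z where z: "d <= z" "z <= first_zero_J n" "bessel_Y n z = 0" by blast
 have e2: "bessel_Y n x ~= 0" if "0 < x" "x < e" for x using e(2)[OF that] by simp
 have z0: "0 < z" using d z by simp
 note L = least_zero[OF c e(1) e2 z0 z(3), folded first_zero_Y_def]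
 show "0 < first_zero_Y n" "bessel_Y n (first_zero_Y n) = 0" using L by auto
 show "first_zero_Y n < first_zero_J n"
  using L(4) z dJ_first_zero(2)[of n] by (metis order_le_less order_less_le_trans less_irrefl)
 show "bessel_Y n x < 0" if "0 < x" "x < first_zero_Y n" for x
 proof -
  have "0 < - bessel_Y n x"
  by (rule no_sign_change[where f="%x. - bessel_Y n x" and L="first_zero_Y n"])
  (use that L(3) Y_neg_near_0 c in \<open>auto intro: continuous_intros\<close>)
  then show ?thesis by simp
 qed
qed

text \<open>At the first zero of \<open>Y_{n+1}\<close> the cross Wronskian says
  \<open>J_{n+1} * Y_n > 0\<close>, and \<open>J_{n+1}\<close> is still positive there; so
  \<open>Y_n\<close> has already changed sign.\<close>

lemma first_zero_Y_less_Suc: "first_zero_Y n < first_zero_Y (Suc n)"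
proof (rule ccontr)
 let ?y = "first_zero_Y (Suc n)"
 assume "\<not> first_zero_Y n < ?y"
 then have "bessel_Y n ?y <= 0"
  using first_zero_Y(1)[of "Suc n"] first_zero_Y(2)[of n] first_zero_Y(3)[of ?y n] by (metis less_eq_real_def linorder_neqE_linordered_idom)
 moreover have "0 < JB (Suc n) ?y" using first_zero_Y(1,4) first_zero_J(3) by blast
 ultimately have "JB (Suc n) ?y * bessel_Y n ?y <= 0" by (simp add: mult_nonneg_nonpos)
 moreover have "JB (Suc n) ?y * bessel_Y n ?y = 2 / (pi * ?y)"
  using cross_wronskian[OF first_zero_Y(1)[of "Suc n"], of n] first_zero_Y(2)[of "Suc n"] by simp
 moreover have "0 < 2 / (pi * ?y)" using first_zero_Y(1)[of "Suc n"] by simp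
 ultimately show False by linarith
qed

lemma first_zero_J_less_Suc: "first_zero_J n < first_zero_J (Suc n)"
proof (rule ccontr)
 let ?j = "first_zero_J (Suc n)"
 assume "\<not> first_zero_J n < ?j"
 then have "0 <= JB n ?j" using J_nonneg first_zero_J(1)[of "Suc n"] by simp
 then have "0 <= JB n ?j * bessel_Y (Suc n) ?j" using dJ_first_zero(2)[of "Suc n"] by simp
 moreover have "- (JB n ?j * bessel_Y (Suc n) ?j) = 2 / (pi * ?j)"
  using cross_wronskian[OF first_zero_J(1)[of "Suc n"], of n] first_zero_J(2)[of "Suc n"] by simp
 moreover have "0 < 2 / (pi * ?j)" using first_zero_J(1)[of "Suc n"] by simp
 ultimately show False by linarith
qed

lemma first_zero_J_mono: "n <= p ==> first_zero_J n <= first_zero_J p"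
 by (rule lift_Suc_mono_le[of first_zero_J]) (auto intro: less_imp_le first_zero_J_less_Suc)

text \<open>If \<open>y_n <= n\<close>, Bessel's equation makes \<open>x * J'\<close> increasing on
  the interval from 0 to \<open>y_n\<close>, and it is positive somewhere, since \<open>J\<close>
  starts from 0. But at \<open>y_n\<close>, where \<open>Y = 0\<close>, the decrease of
  \<open>J^2 + Y^2\<close> gives \<open>J * J' < 0\<close>.\<close>

lemma first_zero_Y_gt: "0 < n ==> real n < first_zero_Y n"
proof (rule ccontr)
 let ?y = "first_zero_Y n"
 note y = first_zero_Y(1)[of n] first_zero_Y(2)[of n] first_zero_Y(3)[where n=n] first_zero_Y(4)[of n]
 assume n: "0 < n" and "\<not> real n < ?y"
 then have yn: "?y <= real n" by simp
 have Jp: "0 < JB n x" if "0 < x" "x <= ?y" for x using that y(4) first_zero_J(3)[of x n] by simp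
 have "2 * ?y * (JB n ?y * dJ n ?y) < 0"
  using Nic_derivs(1)[OF Nicholson y(1), of n] Nic1_neg[OF y(1), of "real n"] y(2) by simp
 then have neg: "dJ n ?y < 0" using y(1) Jp[of ?y] by (simp add: mult_less_0_iff)
 have "\<forall>\<^sub>F x in at_right 0. JB n x < JB n ?y"
  using order_tendstoD(2)[OF tendsto_J_0[of n], of "JB n ?y"] n Jp[of ?y] y(1) by simp
 then obtain e where e: "0 < e" "!!x. 0 < x ==> x < e ==> JB n x < JB n ?y"
  by (auto simp: eventually_at_right_field)
 define a where "a = min e ?y / 2"
 have a: "0 < a" "a < e" "a < ?y" using e y(1) by (auto simp: a_def)
 obtain z where z: "a < z" "z < ?y" "JB n ?y - JB n a = (?y - a) * dJ n z"
  using MVT2[OF a(3), of "JB n" "dJ n"] DERIV_J a by force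
 have "0 < dJ n z" using z(3) e(2)[OF a(1,2)] a(3) by (metis diff_gt_0_iff_gt zero_less_mult_pos)
 have "z * dJ n z <= ?y * dJ n ?y"
 proof (rule DERIV_nonneg_imp_nondecreasing[where f="%x. x * dJ n x"])
  show "z <= ?y" using z by simp
  fix x assume x: "z <= x" "x <= ?y"
  then have x0: "0 < x" using a z by simp
  have "((%x. x * dJ n x) has_real_derivative 1 * dJ n x + (- dJ n x / x - (1 - (real n)^2 / x^2) * JB n x) * x) (at x)"
  by (intro DERIV_mult DERIV_ident DERIV_dJ x0)
  moreover have "1 * dJ n x + (- dJ n x / x - (1 - (real n)^2 / x^2) * JB n x) * x = ((real n)^2 - x^2) * JB n x / x"
  using x0 by (simp add: field_simps power2_eq_square)
  moreover have "0 <= ((real n)^2 - x^2) * JB n x / x"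
  using x0 x yn Jp[of x] by (intro divide_nonneg_pos mult_nonneg_nonneg) (auto intro!: power_mono)
  ultimately show "\<exists>y. ((%x. x * dJ n x) has_real_derivative y) (at x) \<and> 0 <= y" by metis
 qed
 moreover have "0 < z * dJ n z" using \<open>0 < dJ n z\<close> a z by simp
 moreover have "?y * dJ n ?y < 0" using neg y(1) by (simp add: mult_pos_neg)
 ultimately show False by linarith
qed

text \<open>Sturm comparison with a sine in the variable \<open>ln x\<close>: where \<open>x\<^sup>2 - n^2\<close> is large, zeros of
 \<open>J\<^sub>n\<close> are logarithmically close.\<close>

lemma exists_zero_ratio_less:
 assumes lam: "1 < lam"
 shows "\<exists>n. first_zero_J n / first_zero_Y n < lam"
proof (rule ccontr)
 assume "\<not> ?thesis"
 then have r: "lam <= first_zero_J n / first_zero_Y n" for n by (auto simp: not_less)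
 \<comment> \<open>Frequency in the variable \<open>ln x\<close>: half a period is
   \<open>pi / w = ln lam / 4\<close>, less than the length \<open>ln lam / 2\<close> of the
   interval from \<open>sqrt lam * y_n\<close> to \<open>lam * y_n\<close>, on which
   \<open>J\<close> would be positive.\<close>
 define w where "w = 4 * pi / ln lam"
 have w: "0 < w" using lam by (simp add: w_def)
 obtain n where n: "w^2 / (lam - 1) + 1 < real n" using reals_Archimedean2 by blast
 have n1: "1 < real n" using n lam by (smt (verit) zero_le_power2 divide_nonneg_pos)
 have "w^2 / (lam - 1) <= real n" using n by simp
 then have "w^2 <= real n * (lam - 1)" using lam by (simp add: field_simps)
 also have "... <= real n * real n * (lam - 1)" using n1 lam by (intro mult_right_mono) auto
 finally have wn: "w^2 <= (lam - 1) * (real n)^2" by (simp add: power2_eq_square mult_ac)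
 let ?y = "first_zero_Y n"
 have y: "real n < ?y" "0 < ?y" using first_zero_Y_gt[of n] n1 first_zero_Y(1)[of n] by auto
 have jy: "lam * ?y <= first_zero_J n" using r[of n] y by (simp add: field_simps)
 define a where "a = sqrt lam * ?y"
 define b where "b = a * exp (pi / w)"
 have pw: "pi / w = ln lam / 4" by (simp add: w_def)
 have ab: "0 < a" "a < b" using y lam w by (auto simp: a_def b_def)
 have "exp (pi / w) < sqrt lam"
 proof -
  have "sqrt lam = exp (ln lam / 2)" using lam by (simp add: ln_sqrt[symmetric])
  then show ?thesis unfolding pw using lam by simp
 qed
 then have "b < a * sqrt lam" using ab by (simp add: b_def)
 also have "a * sqrt lam = lam * ?y" using lam by (simp add: a_def)
 finally have bj: "b < first_zero_J n" using jy by simp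
 have Jp: "0 < JB n x" if "a <= x" "x <= b" for x using that ab bj first_zero_J(3)[of x n] by simp
 \<comment> \<open>Wronskian, with respect to \<open>ln x\<close>, of \<open>J\<close> and the sine.
   It decreases because \<open>x^2 - n^2 >= w^2\<close>, while its end values would require an
   increase.\<close>
 define F where "F x = x * dJ n x * sin (w * (ln x - ln a)) - w * JB n x * cos (w * (ln x - ln a))" for x
 have "F b <= F a"
 proof (rule DERIV_nonpos_imp_nonincreasing[where f=F and a=a and b=b])
  show "a <= b" using ab by simp
  fix x assume x: "a <= x" "x <= b"
  then have x0: "0 < x" using ab by simp
  let ?s = "sin (w * (ln x - ln a))" and ?c = "cos (w * (ln x - ln a))"
  have s: "((%x. sin (w * (ln x - ln a))) has_real_derivative ?c * (w * (1 / x))) (at x)"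
  and c: "((%x. cos (w * (ln x - ln a))) has_real_derivative - ?s * (w * (1 / x))) (at x)"
  using x0 by (auto intro!: derivative_eq_intros)
  have "(F has_real_derivative ((1 * dJ n x + (- dJ n x / x - (1 - (real n)^2 / x^2) * JB n x) * x) * ?s + (?c * (w * (1 / x))) * (x * dJ n x))
  - (w * dJ n x * ?c + (- ?s * (w * (1 / x))) * (w * JB n x))) (at x)"
  unfolding F_def[abs_def] by (intro DERIV_diff DERIV_mult DERIV_cmult DERIV_ident DERIV_dJ DERIV_J s c x0)
  moreover have "((1 * dJ n x + (- dJ n x / x - (1 - (real n)^2 / x^2) * JB n x) * x) * ?s + (?c * (w * (1 / x))) * (x * dJ n x))
  - (w * dJ n x * ?c + (- ?s * (w * (1 / x))) * (w * JB n x)) = (w^2 - (x^2 - (real n)^2)) * (JB n x * ?s / x)"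
  using x0 by (simp add: field_simps power2_eq_square)
  moreover have "(w^2 - (x^2 - (real n)^2)) * (JB n x * ?s / x) <= 0"
  proof (rule mult_nonpos_nonneg)
  have "a^2 <= x^2" using x ab by (intro power_mono) auto
  moreover have "a^2 = lam * ?y^2" using lam by (simp add: a_def power_mult_distrib)
  moreover have "(real n)^2 <= ?y^2" using y by (intro power_mono) auto
  then have "lam * (real n)^2 <= lam * ?y^2" using lam by (intro mult_left_mono) auto
  ultimately show "w^2 - (x^2 - (real n)^2) <= 0" using wn by (simp add: algebra_simps)
  have "ln x - ln a <= pi / w"
  proof -
  have "ln x <= ln b" using x x0 ab by simp
  also have "ln b = ln a + pi / w" using ab by (simp add: b_def ln_mult)
  finally show ?thesis by simp
  qed
  then have "w * (ln x - ln a) <= pi" using w by (simp add: field_simps)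
  moreover have "0 <= w * (ln x - ln a)" using w x ab by simp
  ultimately have "0 <= ?s" by (intro sin_ge_zero)
  then show "0 <= JB n x * ?s / x" using x0 Jp[OF x] by simp
  qed
  ultimately show "\<exists>D. (F has_real_derivative D) (at x) \<and> D <= 0" by metis
 qed
 moreover have "F a < 0" using ab w Jp[of a] by (simp add: F_def)
 moreover have "0 < F b"
 proof -
  have "w * (ln b - ln a) = pi" using ab w by (simp add: b_def ln_mult)
  then show ?thesis using ab w Jp[of b] by (simp add: F_def)
 qed
 ultimately show False by linarith
qed

section \<open>Watson's formula and the phase of the Hankel function\<close>

text \<open>Watson's integral: for Bessel functions of real order \<open>c\<close>,
  \<open>J * dY/dc - Y * dJ/dc = - 4 / pi * Bt c 0 x\<close>. Here it serves to define the
  derivative of the phase in the order.\<close>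

definition Bt :: "real => nat => real => real" where
 "Bt c j x = sinh_transform (kern j) (%t. exp (- (2 * c) * t)) x"

definition Nd :: "real => nat => real => real" where
 "Nd c j x = 8 / pi^2 * sinh_transform (kern j) (%t. 2 * (t * sinh (2 * c * t))) x"

lemma exp_growth_tsinh: "exp_growth (%t. 2 * (t * sinh (2 * c * t)))"
 by (intro exp_growth_mult exp_growth_const exp_growth_ident exp_growth_sinh)

lemma DERIV_Bt: "0 < x ==> j < 3 ==> (Bt c j has_real_derivative Bt c (Suc j) x / x) (at x)"
 unfolding Bt_def[abs_def] by (rule DERIV_kern_transform[OF exp_growth_exp]) auto

lemma DERIV_Nd: "0 < x ==> j < 3 ==> (Nd c j has_real_derivative Nd c (Suc j) x / x) (at x)"
 unfolding Nd_def[abs_def]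
 by (rule DERIV_cong[OF DERIV_cmult[OF DERIV_kern_transform[OF exp_growth_tsinh]]]) auto

lemma sinh_transform_cmult: "sinh_transform F (%t. c * g t) x = c * sinh_transform F g x"
 unfolding sinh_transform_def by (subst integral_mult_right_zero[symmetric]) (simp add: mult_ac)

text \<open>\<open>exp (- 2 * c * t)\<close> has slope \<open>- 2 * c\<close> at 0, where
  \<open>cosh\<close> has slope 0; this boundary term is the inhomogeneity.\<close>

lemma Bt_ode:
 assumes "0 < x"
 shows "Bt c 3 x + 4 * (x^2 - c^2) * Bt c 1 x + 4 * x^2 * Bt c 0 x = 2 * c"
proof -
 have g2: "exp_growth (%t. (2 * c)\<^sup>2 * exp (- (2 * c) * t))" by (intro exp_growth_mult exp_growth_const exp_growth_exp)
 have g1: "exp_growth (%t. (- (2 * c)) * exp (- (2 * c) * t))" by (intro exp_growth_mult exp_growth_const exp_growth_exp)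
 have "Bt c 3 x + 4 * x^2 * Bt c 1 x + 4 * x^2 * Bt c 0 x
  = sinh_transform (kern 1) (%t. (2 * c)\<^sup>2 * exp (- (2 * c) * t)) x - - (2 * c) * exp (- (2 * c) * 0)"
  unfolding Bt_def
  by (rule sinh_transform_ode[OF exp_growth_exp g1 g2 _ _ assms])
  (auto intro!: derivative_eq_intros simp: power2_eq_square)
 then show ?thesis unfolding sinh_transform_cmult Bt_def[symmetric] by (simp add: algebra_simps power2_eq_square)
qed

text \<open>The equation of \<open>Nic c\<close> differentiated in the order; the right-hand side
  comes from the derivative of the coefficient \<open>c^2\<close>.\<close>

lemma Nd_ode:
 assumes "0 < x"
 shows "Nd c 3 x + 4 * (x^2 - c^2) * Nd c 1 x + 4 * x^2 * Nd c 0 x = 8 * c * Nic c 1 x"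
proof -
 let ?g = "%t. 2 * (t * sinh (2 * c * t))"
 have g1: "exp_growth (%t. 2 * sinh (2 * c * t) + 4 * c * (t * cosh (2 * c * t)))"
  by (intro exp_growth_add exp_growth_mult exp_growth_const exp_growth_ident exp_growth_sinh exp_growth_cosh)
 have g2: "exp_growth (%t. 8 * c * cosh (2 * c * t) + 4 * c^2 * ?g t)"
  by (intro exp_growth_add exp_growth_mult exp_growth_const exp_growth_tsinh exp_growth_cosh exp_growth_ident exp_growth_sinh)
 have "sinh_transform (kern 3) ?g x + 4 * x^2 * sinh_transform (kern 1) ?g x + 4 * x^2 * sinh_transform (kern 0) ?g x
  = sinh_transform (kern 1) (%t. 8 * c * cosh (2 * c * t) + 4 * c^2 * ?g t) x - (2 * sinh (2 * c * 0) + 4 * c * (0 * cosh (2 * c * 0)))"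
  by (rule sinh_transform_ode[OF exp_growth_tsinh g1 g2 _ _ assms])
  (auto intro!: derivative_eq_intros simp: algebra_simps power2_eq_square)
 moreover have "sinh_transform (kern 1) (%t. 8 * c * cosh (2 * c * t) + 4 * c^2 * ?g t) x
  = 8 * c * sinh_transform (kern 1) (%t. cosh (2 * c * t)) x + 4 * c^2 * sinh_transform (kern 1) ?g x"
 proof -
  have "sinh_transform (kern 1) (%t. 8 * c * cosh (2 * c * t) + 4 * c^2 * ?g t) x
  = sinh_transform (kern 1) (%t. 8 * c * cosh (2 * c * t)) x + sinh_transform (kern 1) (%t. 4 * c^2 * ?g t) x"
  unfolding sinh_transform_def distrib_left
  by (intro Bochner_Integration.integral_add integrable_sinh_transform[OF adm_kern _ assms]
  exp_growth_mult exp_growth_const exp_growth_tsinh exp_growth_cosh exp_growth_ident exp_growth_sinh)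
  then show ?thesis unfolding sinh_transform_cmult .
 qed
 ultimately have e: "sinh_transform (kern 3) ?g x + 4 * (x^2 - c^2) * sinh_transform (kern 1) ?g x + 4 * x^2 * sinh_transform (kern 0) ?g x
  = 8 * c * sinh_transform (kern 1) (%t. cosh (2 * c * t)) x"
  by (simp add: algebra_simps)
 show ?thesis
  using arg_cong[OF e, of "%z. 8 / pi^2 * z"] unfolding Nd_def Nic_def by (simp add: distrib_left mult_ac)
qed

lemma Bt_at_top:
 "((%x. x * Bt c 0 x) ---> pi / 4) at_top" "((%x. x * Bt c 1 x) ---> - (pi / 4)) at_top"
 "\<exists>l. ((%x. x * Bt c 2 x) ---> l) at_top"
proof -
 have g: "((%t. exp (- (2 * c) * t)) ---> 1) (at_right 0)"
 proof -
  have "((%t. exp (- (2 * c) * t)) ---> exp (- (2 * c) * 0)) (at_right 0)" by (intro tendsto_intros)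
  then show ?thesis by simp
 qed
 have *: "((%x. x * Bt c j x) ---> integral\<^sup>L half_line (kern j) / 2 * 1) at_top" for j
  unfolding Bt_def by (rule tendsto_sinh_transform_at_top[OF adm_kern exp_growth_exp g])
 show "((%x. x * Bt c 0 x) ---> pi / 4) at_top"
  using *[of 0] unfolding integral_kern by simp
 show "((%x. x * Bt c 1 x) ---> - (pi / 4)) at_top"
  using *[of 1] unfolding integral_kern by simp
 show "\<exists>l. ((%x. x * Bt c 2 x) ---> l) at_top" using * by blast
qed

lemma Nd_at_top: "((%x. x * Nd c j x) ---> 0) at_top"
proof -
 have g: "((%t. 2 * (t * sinh (2 * c * t))) ---> 0) (at_right 0)"
 proof -
  have "((%t. 2 * (t * sinh (2 * c * t))) ---> 2 * (0 * sinh (2 * c * 0))) (at_right 0)" by (intro tendsto_intros)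
  then show ?thesis by simp
 qed
 show ?thesis
  using tendsto_mult_left[OF tendsto_sinh_transform_at_top[OF adm_kern exp_growth_tsinh g, of j], of "8 / pi^2"]
  unfolding Nd_def by (simp add: mult_ac)
qed

lemma tendsto_0_of_mult_ident:
 fixes f :: "real => real"
 assumes "((%x. x * f x) ---> l) at_top"
 shows "(f ---> 0) at_top"
proof (rule Lim_transform_eventually)
 have "((%x::real. 1 / x) ---> 0) at_top" by real_asymp
 then have "((%x. 1 / x * (x * f x)) ---> 0 * l) at_top" by (intro tendsto_intros assms)
 then show "((%x. 1 / x * (x * f x)) ---> 0) at_top" by simp
 show "\<forall>\<^sub>F x in at_top. 1 / x * (x * f x) = f x"
  using eventually_gt_at_top[of 0] by eventually_elim simp
qed

lemma exists_constant_on_pos_reals: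
 fixes f :: "real => real"
 assumes "!!x. 0 < x ==> (f has_real_derivative 0) (at x)"
 shows "\<exists>c. \<forall>x>0. f x = c"
 using constant_on_pos_reals[OF assms] by blast

text \<open>Watson's identity for the derivative of the phase in the order. The difference of both sides
 solves the same third-order equation as \<open>Nic c\<close>, decays faster than \<open>1/x\<close>, and is therefore null and
 orthogonal to the time-like vector \<open>Nic c\<close> for the Lorentzian form that is constant along solutions.\<close>

lemma Watson_identity:
 assumes x: "0 < x"
 shows "2 * (Bt c 1 x * Nic c 0 x - Bt c 0 x * Nic c 1 x) = Nd c 0 x"
proof -
 let ?N = "Nic c" and ?B = "Bt c" and ?D = "Nd c"
 define W where "W x = ?B 1 x * ?N 0 x - ?B 0 x * ?N 1 x" for x
 define V where "V x = ?B 2 x * ?N 1 x - ?B 1 x * ?N 2 x" for x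
 \<comment> \<open>\<open>Z0\<close> is the difference of the two sides. \<open>Z1\<close> and
   \<open>Z2\<close> are its successive images under \<open>x d/dx\<close>, with the third-order
   terms eliminated, and \<open>Z3\<close> is what the homogeneous equation prescribes for the next
   one.\<close>
 define Z0 where "Z0 x = 2 * W x - ?D 0 x" for x
 define Z1 where "Z1 x = 2 * (?B 2 x * ?N 0 x - ?B 0 x * ?N 2 x) - ?D 1 x" for x
 define Z2 where "Z2 x = 2 * (2 * c * ?N 0 x - 4 * (x^2 - c^2) * W x + V x) - ?D 2 x" for x
 define Z3 where "Z3 x = - (4 * (x^2 - c^2) * Z1 x + 4 * x^2 * Z0 x)" for x
 have N3: "?N 3 x = - (4 * (x^2 - c^2) * ?N 1 x + 4 * x^2 * ?N 0 x)" if "0 < x" for x using Nic_ode[OF that, of c] by linarith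
 have B3: "?B 3 x = 2 * c - (4 * (x^2 - c^2) * ?B 1 x + 4 * x^2 * ?B 0 x)" if "0 < x" for x using Bt_ode[OF that, of c] by linarith
 have D3: "?D 3 x = 8 * c * ?N 1 x - (4 * (x^2 - c^2) * ?D 1 x + 4 * x^2 * ?D 0 x)" if "0 < x" for x using Nd_ode[OF that, of c] by linarith
 have dN: "(?N 0 has_real_derivative ?N 1 x / x) (at x)" "(?N 1 has_real_derivative ?N 2 x / x) (at x)" "(?N 2 has_real_derivative ?N 3 x / x) (at x)" if "0 < x" for x
  using DERIV_Nic[OF that, of 0 c] DERIV_Nic[OF that, of 1 c] DERIV_Nic[OF that, of 2 c] by (simp_all add: numeral_2_eq_2 numeral_3_eq_3)
 have dB: "(?B 0 has_real_derivative ?B 1 x / x) (at x)" "(?B 1 has_real_derivative ?B 2 x / x) (at x)" "(?B 2 has_real_derivative ?B 3 x / x) (at x)" if "0 < x" for x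
  using DERIV_Bt[OF that, of 0 c] DERIV_Bt[OF that, of 1 c] DERIV_Bt[OF that, of 2 c] by (simp_all add: numeral_2_eq_2 numeral_3_eq_3)
 have dD: "(?D 0 has_real_derivative ?D 1 x / x) (at x)" "(?D 1 has_real_derivative ?D 2 x / x) (at x)" "(?D 2 has_real_derivative ?D 3 x / x) (at x)" if "0 < x" for x
  using DERIV_Nd[OF that, of 0 c] DERIV_Nd[OF that, of 1 c] DERIV_Nd[OF that, of 2 c] by (simp_all add: numeral_2_eq_2 numeral_3_eq_3)
 have dW: "(W has_real_derivative (?B 2 x * ?N 0 x - ?B 0 x * ?N 2 x) / x) (at x)" if p: "0 < x" for x
 proof -
  have "(W has_real_derivative (?B 2 x / x * ?N 0 x + ?N 1 x / x * ?B 1 x) - (?B 1 x / x * ?N 1 x + ?N 2 x / x * ?B 0 x)) (at x)"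
  unfolding W_def[abs_def] by (intro DERIV_diff DERIV_mult dN dB p)
  moreover have "(?B 2 x / x * ?N 0 x + ?N 1 x / x * ?B 1 x) - (?B 1 x / x * ?N 1 x + ?N 2 x / x * ?B 0 x) = (?B 2 x * ?N 0 x - ?B 0 x * ?N 2 x) / x"
  using p by (simp add: field_simps)
  ultimately show ?thesis by (simp only:)
 qed
 have dZ0: "(Z0 has_real_derivative Z1 x / x) (at x)" if p: "0 < x" for x
 proof -
  have "(Z0 has_real_derivative 2 * ((?B 2 x * ?N 0 x - ?B 0 x * ?N 2 x) / x) - ?D 1 x / x) (at x)"
  unfolding Z0_def[abs_def] by (intro DERIV_diff DERIV_cmult dW dD p)
  then show ?thesis by (simp add: Z1_def diff_divide_distrib)
 qed
 have dZ1: "(Z1 has_real_derivative Z2 x / x) (at x)" if p: "0 < x" for x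
 proof -
  have "(Z1 has_real_derivative 2 * ((?B 3 x / x * ?N 0 x + ?N 1 x / x * ?B 2 x) - (?B 1 x / x * ?N 2 x + ?N 3 x / x * ?B 0 x)) - ?D 2 x / x) (at x)"
  unfolding Z1_def[abs_def] by (intro DERIV_diff DERIV_mult DERIV_cmult dN dB dD p)
  moreover have "2 * ((?B 3 x / x * ?N 0 x + ?N 1 x / x * ?B 2 x) - (?B 1 x / x * ?N 2 x + ?N 3 x / x * ?B 0 x)) - ?D 2 x / x
  = (2 * (?B 3 x * ?N 0 x - ?N 3 x * ?B 0 x + V x) - ?D 2 x) / x"
  using p by (simp add: V_def field_simps)
  moreover have "?B 3 x * ?N 0 x - ?N 3 x * ?B 0 x = 2 * c * ?N 0 x - 4 * (x^2 - c^2) * W x"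
  unfolding N3[OF p] B3[OF p] W_def by (simp add: algebra_simps)
  ultimately show ?thesis by (simp add: Z2_def)
 qed
 have dZ2: "(Z2 has_real_derivative Z3 x / x) (at x)" if p: "0 < x" for x
 proof -
  have dV: "(V has_real_derivative (?B 3 x / x * ?N 1 x + ?N 2 x / x * ?B 2 x) - (?B 2 x / x * ?N 2 x + ?N 3 x / x * ?B 1 x)) (at x)"
  unfolding V_def[abs_def] by (intro DERIV_diff DERIV_mult dN dB p)
  have "(Z2 has_real_derivative 2 * (2 * c * (?N 1 x / x) - ((4 * (2 * x)) * W x + (?B 2 x * ?N 0 x - ?B 0 x * ?N 2 x) / x * (4 * (x^2 - c^2)))
  + ((?B 3 x / x * ?N 1 x + ?N 2 x / x * ?B 2 x) - (?B 2 x / x * ?N 2 x + ?N 3 x / x * ?B 1 x))) - ?D 3 x / x) (at x)"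
  unfolding Z2_def[abs_def]
  by (intro DERIV_diff DERIV_add DERIV_mult DERIV_cmult dN dV dW dD p) (auto intro!: derivative_eq_intros)
  moreover have "2 * (2 * c * (?N 1 x / x) - ((4 * (2 * x)) * W x + (?B 2 x * ?N 0 x - ?B 0 x * ?N 2 x) / x * (4 * (x^2 - c^2)))
  + ((?B 3 x / x * ?N 1 x + ?N 2 x / x * ?B 2 x) - (?B 2 x / x * ?N 2 x + ?N 3 x / x * ?B 1 x))) - ?D 3 x / x
  = (2 * (2 * c * ?N 1 x - 8 * x^2 * W x - (?B 2 x * ?N 0 x - ?B 0 x * ?N 2 x) * (4 * (x^2 - c^2)) + (?B 3 x * ?N 1 x - ?N 3 x * ?B 1 x)) - ?D 3 x) / x"
  using p by (simp add: field_simps power2_eq_square)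
  moreover have "2 * (2 * c * ?N 1 x - 8 * x^2 * W x - (?B 2 x * ?N 0 x - ?B 0 x * ?N 2 x) * (4 * (x^2 - c^2)) + (?B 3 x * ?N 1 x - ?N 3 x * ?B 1 x)) - ?D 3 x = Z3 x"
  unfolding N3[OF p] B3[OF p] D3[OF p] Z3_def Z1_def Z0_def W_def by (simp add: algebra_simps)
  ultimately show ?thesis by (simp only:)
 qed
 \<comment> \<open>The polarised first integral of the third-order equation, constant for any two
   solutions.\<close>
 have const: "\<exists>k. \<forall>x>0. F0 x * G2 x + F2 x * G0 x - F1 x * G1 x + 4 * (x^2 - c^2) * (F0 x * G0 x) = k"
  if dF: "!!x. 0 < x ==> (F0 has_real_derivative F1 x / x) (at x)" "!!x. 0 < x ==> (F1 has_real_derivative F2 x / x) (at x)"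
  "!!x. 0 < x ==> (F2 has_real_derivative - (4 * (x^2 - c^2) * F1 x + 4 * x^2 * F0 x) / x) (at x)"
  and dG: "!!x. 0 < x ==> (G0 has_real_derivative G1 x / x) (at x)" "!!x. 0 < x ==> (G1 has_real_derivative G2 x / x) (at x)"
  "!!x. 0 < x ==> (G2 has_real_derivative - (4 * (x^2 - c^2) * G1 x + 4 * x^2 * G0 x) / x) (at x)"
  for F0 F1 F2 G0 G1 G2 :: "real => real"
 proof -
  have "((%x. F0 x * G2 x + F2 x * G0 x - F1 x * G1 x + 4 * (x^2 - c^2) * (F0 x * G0 x)) has_real_derivative 0) (at x)" if p: "0 < x" for x
  proof -
  have "((%x. F0 x * G2 x + F2 x * G0 x - F1 x * G1 x + 4 * (x^2 - c^2) * (F0 x * G0 x)) has_real_derivative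
  (F1 x / x * G2 x + - (4 * (x^2 - c^2) * G1 x + 4 * x^2 * G0 x) / x * F0 x) + (- (4 * (x^2 - c^2) * F1 x + 4 * x^2 * F0 x) / x * G0 x + G1 x / x * F2 x)
  - (F2 x / x * G1 x + G2 x / x * F1 x) + (4 * (2 * x) * (F0 x * G0 x) + (F1 x / x * G0 x + G1 x / x * F0 x) * (4 * (x^2 - c^2)))) (at x)"
  by (intro DERIV_diff DERIV_add DERIV_mult DERIV_cmult dF dG p) (auto intro!: derivative_eq_intros)
  moreover have "(F1 x / x * G2 x + - (4 * (x^2 - c^2) * G1 x + 4 * x^2 * G0 x) / x * F0 x) + (- (4 * (x^2 - c^2) * F1 x + 4 * x^2 * F0 x) / x * G0 x + G1 x / x * F2 x)
  - (F2 x / x * G1 x + G2 x / x * F1 x) + (4 * (2 * x) * (F0 x * G0 x) + (F1 x / x * G0 x + G1 x / x * F0 x) * (4 * (x^2 - c^2))) = 0"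
  proof -
  have gen: "(u1 * (x * v2) + - (4 * q * (x * v1) + 4 * x^2 * g0) / x * f0) + (- (4 * q * (x * u1) + 4 * x^2 * f0) / x * g0 + v1 * (x * u2))
  - (u2 * (x * v1) + v2 * (x * u1)) + (4 * (2 * x) * (f0 * g0) + (u1 * g0 + v1 * f0) * (4 * q)) = 0" for u1 u2 v1 v2 f0 g0 q :: real
  proof -
  have r: "- (4 * q * (x * v1) + 4 * x^2 * g0) / x = - (4 * q * v1 + 4 * x * g0)" for v1 g0 :: real
  using p by (simp add: field_simps power2_eq_square)
  show ?thesis unfolding r by (simp add: algebra_simps)
  qed
  have e: "x * (z / x) = z" for z :: real using p by simp
  show ?thesis using gen[of "F1 x / x" "G2 x / x" "x^2 - c^2" "G1 x / x" "G0 x" "F0 x" "F2 x / x"] unfolding e .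
  qed
  ultimately show ?thesis by (simp only:)
  qed
  then show ?thesis by (rule exists_constant_on_pos_reals)
 qed
 have dN3: "(?N 2 has_real_derivative - (4 * (x^2 - c^2) * ?N 1 x + 4 * x^2 * ?N 0 x) / x) (at x)" if "0 < x" for x
  using dN(3)[OF that] unfolding N3[OF that] .
 note dZ2' = dZ2[unfolded Z3_def]
 have ek1: "\<exists>k. \<forall>x>0. Z0 x * Z2 x + Z2 x * Z0 x - Z1 x * Z1 x + 4 * (x^2 - c^2) * (Z0 x * Z0 x) = k"
  by (rule const) (erule dZ0 dZ1 dZ2' dN(1) dN(2) dN3)+
 obtain k1 where k1: "!!x. 0 < x ==> Z0 x * Z2 x + Z2 x * Z0 x - Z1 x * Z1 x + 4 * (x^2 - c^2) * (Z0 x * Z0 x) = k1"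
  using ek1 by blast
 have ek2: "\<exists>k. \<forall>x>0. Z0 x * ?N 2 x + Z2 x * ?N 0 x - Z1 x * ?N 1 x + 4 * (x^2 - c^2) * (Z0 x * ?N 0 x) = k"
  by (rule const) (erule dZ0 dZ1 dZ2' dN(1) dN(2) dN3)+
 obtain k2 where k2: "!!x. 0 < x ==> Z0 x * ?N 2 x + Z2 x * ?N 0 x - Z1 x * ?N 1 x + 4 * (x^2 - c^2) * (Z0 x * ?N 0 x) = k2"
  using ek2 by blast
 have ek3: "\<exists>k. \<forall>x>0. ?N 0 x * ?N 2 x + ?N 2 x * ?N 0 x - ?N 1 x * ?N 1 x + 4 * (x^2 - c^2) * (?N 0 x * ?N 0 x) = k"
  by (rule const) (erule dZ0 dZ1 dZ2' dN(1) dN(2) dN3)+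
 obtain k3 where k3: "!!x. 0 < x ==> ?N 0 x * ?N 2 x + ?N 2 x * ?N 0 x - ?N 1 x * ?N 1 x + 4 * (x^2 - c^2) * (?N 0 x * ?N 0 x) = k3"
  using ek3 by blast
 obtain l where l: "((%x. x * ?N 2 x) ---> l) at_top" using Nic_at_top(3) by blast
 obtain m where m: "((%x. x * ?B 2 x) ---> m) at_top" using Bt_at_top(3) by blast
 note NB = Nic_at_top(1)[of c] Nic_at_top(2)[of c] l Bt_at_top(1)[of c] Bt_at_top(2)[of c] m
 note NB0 = NB[THEN tendsto_0_of_mult_ident]
 \<comment> \<open>Both products are exactly of order \<open>1 / x^2\<close>, and their leading
   coefficients cancel. \<open>Z2\<close> contains \<open>x^2 * W\<close>, so it is this
   cancellation that makes \<open>Z2\<close> vanish at infinity.\<close>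
 have x2W: "((%x. x\<^sup>2 * W x) ---> 0) at_top"
 proof -
  have "((%x. (x * ?B 1 x) * (x * ?N 0 x) - (x * ?B 0 x) * (x * ?N 1 x)) ---> - (pi / 4) * (2 / pi) - (pi / 4) * - (2 / pi)) at_top"
  by (intro tendsto_intros NB)
  then show ?thesis by (simp add: W_def algebra_simps power2_eq_square)
 qed
 have W0: "(W ---> 0) at_top"
 proof -
  have "((%x. ?B 1 x * ?N 0 x - ?B 0 x * ?N 1 x) ---> 0 * 0 - 0 * 0) at_top" by (intro tendsto_intros NB0)
  then show ?thesis by (simp add: W_def[abs_def])
 qed
 have xZ0: "((%x. x * Z0 x) ---> 0) at_top"
 proof -
  have "((%x. 2 * ((x * ?B 1 x) * ?N 0 x - (x * ?B 0 x) * ?N 1 x) - x * ?D 0 x) ---> 2 * (- (pi / 4) * 0 - (pi / 4) * 0) - 0) at_top"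
  by (intro tendsto_intros NB NB0 Nd_at_top)
  then show ?thesis by (simp add: Z0_def W_def algebra_simps)
 qed
 note Z0l = tendsto_0_of_mult_ident[OF xZ0]
 have Z1l: "(Z1 ---> 0) at_top"
 proof -
  have "((%x. 2 * (?B 2 x * ?N 0 x - ?B 0 x * ?N 2 x) - ?D 1 x) ---> 2 * (0 * 0 - 0 * 0) - 0) at_top"
  by (intro tendsto_intros NB0 tendsto_0_of_mult_ident[OF Nd_at_top])
  then show ?thesis by (simp add: Z1_def[abs_def])
 qed
 have Z2l: "(Z2 ---> 0) at_top"
 proof -
  have "((%x. 2 * (2 * c * ?N 0 x - 4 * (x^2 * W x - c^2 * W x) + (?B 2 x * ?N 1 x - ?B 1 x * ?N 2 x)) - ?D 2 x)
  ---> 2 * (2 * c * 0 - 4 * (0 - c^2 * 0) + (0 * 0 - 0 * 0)) - 0) at_top"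
  by (intro tendsto_intros NB0 x2W W0 tendsto_0_of_mult_ident[OF Nd_at_top])
  then show ?thesis by (simp add: Z2_def[abs_def] V_def left_diff_distrib right_diff_distrib mult.assoc)
 qed
 have lim_const: "k = k'" if "!!x. 0 < x ==> f x = k" "(f ---> k') at_top" for f :: "real => real" and k k'
 proof -
  have "(f ---> k) at_top"
  by (rule tendsto_eventually) (intro eventually_mono[OF eventually_gt_at_top[of 0]] that)
  then show ?thesis using that(2) tendsto_unique trivial_limit_at_top_linorder by blast
 qed
 have "k1 = 0"
 proof (rule lim_const[OF k1])
  have "((%x. Z0 x * Z2 x + Z2 x * Z0 x - Z1 x * Z1 x + 4 * ((x * Z0 x) * (x * Z0 x) - c^2 * (Z0 x * Z0 x))) ---> 0 * 0 + 0 * 0 - 0 * 0 + 4 * (0 * 0 - c^2 * (0 * 0))) at_top"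
  by (intro tendsto_intros xZ0 Z0l Z1l Z2l)
  then show "((%x. Z0 x * Z2 x + Z2 x * Z0 x - Z1 x * Z1 x + 4 * (x^2 - c^2) * (Z0 x * Z0 x)) ---> 0) at_top"
  by (simp add: algebra_simps power2_eq_square)
 qed
 moreover have "k2 = 0"
 proof (rule lim_const[OF k2])
  have "((%x. Z0 x * ?N 2 x + Z2 x * ?N 0 x - Z1 x * ?N 1 x + 4 * ((x * Z0 x) * (x * ?N 0 x) - c^2 * (Z0 x * ?N 0 x))) ---> 0 * 0 + 0 * 0 - 0 * 0 + 4 * (0 * (2 / pi) - c^2 * (0 * 0))) at_top"
  by (intro tendsto_intros xZ0 Z0l Z1l Z2l NB NB0)
  then show "((%x. Z0 x * ?N 2 x + Z2 x * ?N 0 x - Z1 x * ?N 1 x + 4 * (x^2 - c^2) * (Z0 x * ?N 0 x)) ---> 0) at_top"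
  by (simp add: algebra_simps power2_eq_square)
 qed
 moreover have "k3 = 16 / pi^2"
 proof (rule lim_const[OF k3])
  show "((%x. ?N 0 x * ?N 2 x + ?N 2 x * ?N 0 x - ?N 1 x * ?N 1 x + 4 * (x^2 - c^2) * (?N 0 x * ?N 0 x)) ---> 16 / pi^2) at_top"
  using Nic_first_integral_at_top[of c "c^2"] by (simp add: algebra_simps power2_eq_square)
 qed
 ultimately have E: "Z0 x * Z2 x + Z2 x * Z0 x - Z1 x * Z1 x + 4 * (x^2 - c^2) * (Z0 x * Z0 x) = 0"
  "Z0 x * ?N 2 x + Z2 x * ?N 0 x - Z1 x * ?N 1 x + 4 * (x^2 - c^2) * (Z0 x * ?N 0 x) = 0"
  "?N 0 x * ?N 2 x + ?N 2 x * ?N 0 x - ?N 1 x * ?N 1 x + 4 * (x^2 - c^2) * (?N 0 x * ?N 0 x) = 16 / pi^2"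
  using k1[OF x] k2[OF x] k3[OF x] by simp_all
 \<comment> \<open>Eliminating \<open>z2\<close> and \<open>n2\<close> from nullity, orthogonality
   and the value \<open>e\<close> leaves a sum of two squares; as \<open>e\<close> is
   \<open>16 / pi^2\<close>, the weight of \<open>z0^2\<close> is positive.\<close>
 have gen: "(n0 * z1 - n1 * z0)^2 + e * z0^2 = 0"
  if "z0 * z2 + z2 * z0 - z1 * z1 + q * (z0 * z0) = 0" "z0 * n2 + z2 * n0 - z1 * n1 + q * (z0 * n0) = 0"
  "n0 * n2 + n2 * n0 - n1 * n1 + q * (n0 * n0) = e" for z0 z1 z2 n0 n1 n2 q e :: real
 proof -
  have "(n0 * z1 - n1 * z0)^2 + e * z0^2 = - n0\<^sup>2 * (z0 * z2 + z2 * z0 - z1 * z1 + q * (z0 * z0))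
  + 2 * n0 * z0 * (z0 * n2 + z2 * n0 - z1 * n1 + q * (z0 * n0))"
  unfolding that(3)[symmetric] by (simp add: algebra_simps power2_eq_square)
  then show ?thesis unfolding that(1,2) by simp
 qed
 have "(?N 0 x * Z1 x - ?N 1 x * Z0 x)^2 + 16 / pi^2 * (Z0 x)^2 = 0" by (rule gen[OF E])
 then have "16 / pi^2 * (Z0 x)^2 <= 0" using zero_le_power2[of "?N 0 x * Z1 x - ?N 1 x * Z0 x"] by linarith
 then have "Z0 x = 0" by (simp add: mult_le_0_iff divide_le_0_iff zero_less_mult_iff)
 then show ?thesis by (simp add: Z0_def W_def)
qed

section \<open>Joint continuity and differentiation in the order\<close>

lemma continuous_on_sinh_transform_param:
 fixes g :: "real => real => real"
 assumes F: "adm_kernel F" and gt: "!!c. continuous_on {0<..} (g c)" and gc: "!!t. 0 < t ==> continuous_on UNIV (%c. g c t)"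
  and bnd: "!!L. \<exists>C\<ge>0. \<exists>M. \<forall>c t. \<bar>c\<bar> <= L --> 0 < t --> \<bar>g c t\<bar> <= C * exp (M * t)"
 shows "continuous_on (UNIV \<times> {0<..}) (%(c, x). sinh_transform F (g c) x)"
 unfolding continuous_on_sequentially comp_def
proof (intro allI ballI impI, safe)
 have cF: "continuous_on {0<..} F" using F by (simp add: adm_kernel_def)
 fix X :: "nat => real \<times> real" and c x :: real
 assume x: "0 < x" and Xs: "\<forall>n. X n \<in> UNIV \<times> {0<..}" and X: "X \<longlonglongrightarrow> (c, x)"
 have X1: "(%n. fst (X n)) \<longlonglongrightarrow> c" and X2: "(%n. snd (X n)) \<longlonglongrightarrow> x"
  using tendsto_fst[OF X] tendsto_snd[OF X] by simp_all
 have Xp: "0 < snd (X n)" for n using Xs by (metis SigmaD2 greaterThan_iff prod.collapse)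
 obtain C M where CM: "0 <= C" "!!c' t. \<bar>c'\<bar> <= \<bar>c\<bar> + 1 ==> 0 < t ==> \<bar>g c' t\<bar> <= C * exp (M * t)"
  using bnd[of "\<bar>c\<bar> + 1"] by blast
 obtain G where G: "integrable half_line G" "!!t. 0 < t ==> 0 <= G t"
  "!!x' t. x / 2 <= x' ==> 0 < t ==> \<bar>F (2 * x' * sinh t)\<bar> * exp (M * t) <= G t"
  using adm_kernel_majorant[OF F, of "x / 2" M] x by (metis half_gt_zero)
 have "\<forall>\<^sub>F n in sequentially. x / 2 < snd (X n)" using order_tendstoD(1)[OF X2, of "x / 2"] x by simp
 moreover have "\<forall>\<^sub>F n in sequentially. \<bar>fst (X n)\<bar> < \<bar>c\<bar> + 1"
  using order_tendstoD(2)[OF tendsto_rabs[OF X1], of "\<bar>c\<bar> + 1"] by simp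
 ultimately have "\<forall>\<^sub>F n in sequentially. x / 2 < snd (X n) \<and> \<bar>fst (X n)\<bar> < \<bar>c\<bar> + 1" by (rule eventually_conj)
 then obtain N where N: "!!n. n \<ge> N ==> x / 2 <= snd (X n) \<and> \<bar>fst (X n)\<bar> <= \<bar>c\<bar> + 1"
  unfolding eventually_sequentially by (meson less_imp_le)
 let ?f = "%n t. F (2 * snd (X n) * sinh t) * g (fst (X n)) t"
 have "(%n. integral\<^sup>L half_line (?f (n + N))) \<longlonglongrightarrow> integral\<^sup>L half_line (%t. F (2 * x * sinh t) * g c t)"
 proof (rule integral_dominated_convergence[where w="%t. C * G t"])
  show "(%t. F (2 * x * sinh t) * g c t) \<in> borel_measurable half_line"
  by (rule borel_measurable_half_line[OF continuous_on_sinh_transform_integrand[OF cF gt x]])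
  show "?f (n + N) \<in> borel_measurable half_line" for n
  by (rule borel_measurable_half_line[OF continuous_on_sinh_transform_integrand[OF cF gt Xp]])
  show "AE t in half_line. (%n. ?f (n + N) t) \<longlonglongrightarrow> F (2 * x * sinh t) * g c t"
  proof (rule AE_I2)
  fix t assume "t \<in> space half_line"
  then have t: "0 < t" by simp
  have "isCont F (2 * x * sinh t)" using cF x t by (simp add: continuous_on_eq_continuous_at)
  then have 1: "(%n. F (2 * snd (X n) * sinh t)) \<longlonglongrightarrow> F (2 * x * sinh t)"
  by (rule isCont_tendsto_compose) (intro tendsto_intros X2)
  have "isCont (%c. g c t) c" using gc[OF t] by (simp add: continuous_on_eq_continuous_at)
  then have 2: "(%n. g (fst (X n)) t) \<longlonglongrightarrow> g c t"
  by (rule isCont_tendsto_compose) (rule X1)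
  show "(%n. ?f (n + N) t) \<longlonglongrightarrow> F (2 * x * sinh t) * g c t"
  using LIMSEQ_ignore_initial_segment[OF tendsto_mult[OF 1 2]] .
  qed
  show "AE t in half_line. norm (?f (n + N) t) <= C * G t" for n
  proof (rule AE_I2)
  fix t assume "t \<in> space half_line"
  then have t: "0 < t" by simp
  have n: "x / 2 <= snd (X (n + N))" "\<bar>fst (X (n + N))\<bar> <= \<bar>c\<bar> + 1" using N[of "n + N"] by auto
  have "norm (?f (n + N) t) <= \<bar>F (2 * snd (X (n + N)) * sinh t)\<bar> * (C * exp (M * t))"
  unfolding real_norm_def abs_mult using CM(2)[OF n(2) t] by (intro mult_left_mono) auto
  also have "... = C * (\<bar>F (2 * snd (X (n + N)) * sinh t)\<bar> * exp (M * t))" by simp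
  also have "... <= C * G t" using CM(1) G(3)[OF n(1) t] by (intro mult_left_mono) auto
  finally show "norm (?f (n + N) t) <= C * G t" .
  qed
 qed (use G(1) in simp)
 then have "(%n. integral\<^sup>L half_line (?f n)) \<longlonglongrightarrow> integral\<^sup>L half_line (%t. F (2 * x * sinh t) * g c t)"
  by (rule LIMSEQ_offset)
 then show "(%n. case X n of (c, x) => sinh_transform F (g c) x) \<longlonglongrightarrow> sinh_transform F (g c) x"
  unfolding sinh_transform_def by (simp add: split_beta)
qed

lemma abs_sinh_le: "\<bar>sinh (2 * c * t)\<bar> <= exp (2 * L * t)" "\<bar>cosh (2 * c * t)\<bar> <= exp (2 * L * t)" "exp (- (2 * c) * t) <= exp (2 * L * t)"
 if "\<bar>c\<bar> <= L" "0 < t" for c t L :: real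
proof -
 have "\<bar>c * t\<bar> <= L * t" using that by (simp add: abs_mult mult_right_mono)
 then have b: "2 * c * t <= 2 * L * t" "- (2 * c * t) <= 2 * L * t" by linarith+
 then have e: "exp (2 * c * t) <= exp (2 * L * t)" "exp (- (2 * c * t)) <= exp (2 * L * t)" by simp_all
 have p: "0 < exp (2 * c * t)" "0 < exp (- (2 * c * t))" by simp_all
 have gen1: "\<bar>(P - Q) / 2\<bar> <= E" and gen2: "\<bar>(P + Q) / 2\<bar> <= E" if "0 < P" "0 < Q" "P <= E" "Q <= E" for P Q E :: real
  using that by (auto simp: abs_le_iff field_simps)
 show "\<bar>sinh (2 * c * t)\<bar> <= exp (2 * L * t)" "\<bar>cosh (2 * c * t)\<bar> <= exp (2 * L * t)"
  unfolding sinh_field_def cosh_field_def by (rule gen1[OF p e], rule gen2[OF p e])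
 show "exp (- (2 * c) * t) <= exp (2 * L * t)" using e(2) by simp
qed

lemma abs_tsinh_le: "\<bar>c\<bar> <= L ==> 0 < t ==> \<bar>2 * (t * sinh (2 * c * t))\<bar> <= 2 * exp ((2 * L + 1) * t)" for c t L :: real
proof -
 assume *: "\<bar>c\<bar> <= L" "0 < t"
 have "t <= exp t" using exp_ge_add_one_self[of t] by linarith
 then have "t * \<bar>sinh (2 * c * t)\<bar> <= exp t * exp (2 * L * t)"
  using * abs_sinh_le(1)[OF *] by (intro mult_mono) auto
 also have "exp t * exp (2 * L * t) = exp ((2 * L + 1) * t)" by (simp add: exp_add[symmetric] algebra_simps)
 finally show ?thesis using *(2) by (simp add: abs_mult)
qed

lemma continuous_on_Nic: "continuous_on (UNIV \<times> {0<..}) (%(c, x). Nic c 0 x)"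
proof -
 have "continuous_on (UNIV \<times> {0<..}) (%(c, x). sinh_transform (kern 0) (%t. cosh (2 * c * t)) x)"
 proof (rule continuous_on_sinh_transform_param[OF adm_kern])
  show "\<exists>C\<ge>0. \<exists>M. \<forall>(c::real) (t::real). \<bar>c\<bar> <= L --> 0 < t --> \<bar>cosh (2 * c * t)\<bar> <= C * exp (M * t)" for L :: real
  by (rule exI[of _ 1], intro conjI, simp, rule exI[of _ "2 * L"]) (use abs_sinh_le(2) in auto)
 qed (auto intro!: continuous_intros)
 then have "continuous_on (UNIV \<times> {0<..}) (%p. 8 / pi^2 * (case p of (c, x) => sinh_transform (kern 0) (%t. cosh (2 * c * t)) x))"
  by (intro continuous_intros)
 then show ?thesis by (simp add: Nic_def split_beta)
qed

lemma continuous_on_Bt: "continuous_on (UNIV \<times> {0<..}) (%(c, x). Bt c 0 x)"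
 unfolding Bt_def
proof (rule continuous_on_sinh_transform_param[OF adm_kern])
 show "\<exists>C\<ge>0. \<exists>M. \<forall>(c::real) (t::real). \<bar>c\<bar> <= L --> 0 < t --> \<bar>exp (- (2 * c) * t)\<bar> <= C * exp (M * t)" for L :: real
  by (rule exI[of _ 1], intro conjI, simp, rule exI[of _ "2 * L"]) (use abs_sinh_le(3) in auto)
qed (auto intro!: continuous_intros)

lemma continuous_on_Nd: "continuous_on (UNIV \<times> {0<..}) (%(c, x). Nd c 0 x)"
proof -
 have "continuous_on (UNIV \<times> {0<..}) (%(c, x). sinh_transform (kern 0) (%t. 2 * (t * sinh (2 * c * t))) x)"
 proof (rule continuous_on_sinh_transform_param[OF adm_kern])
  show "\<exists>C\<ge>0. \<exists>M. \<forall>(c::real) (t::real). \<bar>c\<bar> <= L --> 0 < t --> \<bar>2 * (t * sinh (2 * c * t))\<bar> <= C * exp (M * t)" for L :: real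
  by (rule exI[of _ 2], intro conjI, simp, rule exI[of _ "2 * L + 1"]) (use abs_tsinh_le in auto)
 qed (auto intro!: continuous_intros)
 then have "continuous_on (UNIV \<times> {0<..}) (%p. 8 / pi^2 * (case p of (c, x) => sinh_transform (kern 0) (%t. 2 * (t * sinh (2 * c * t))) x))"
  by (intro continuous_intros)
 then show ?thesis by (simp add: Nd_def split_beta)
qed

lemma DERIV_Nic_order:
 assumes x: "0 < x"
 shows "((%c. Nic c 0 x) has_real_derivative Nd c 0 x) (at c)"
proof -
 obtain G where G: "integrable half_line G" "!!t. 0 < t ==> 0 <= G t"
  "!!x' t. x <= x' ==> 0 < t ==> \<bar>kern 0 (2 * x' * sinh t)\<bar> * exp ((2 * (\<bar>c\<bar> + 1) + 1) * t) <= G t"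
  using adm_kernel_majorant[OF adm_kern[of 0] x, where M="2 * (\<bar>c\<bar> + 1) + 1"] by metis
 have "((%c. \<integral>t. kern 0 (2 * x * sinh t) * cosh (2 * c * t) \<partial>half_line) has_real_derivative
  (\<integral>t. kern 0 (2 * x * sinh t) * (2 * (t * sinh (2 * c * t))) \<partial>half_line)) (at c)"
 proof (rule has_real_derivative_integral(2)[where a="c - 1" and b="c + 1" and G="%t. 2 * G t"])
  fix v t assume v: "v \<in> {c - 1<..<c + 1}"
  show "integrable half_line (%t. kern 0 (2 * x * sinh t) * cosh (2 * v * t))"
  by (rule integrable_sinh_transform[OF adm_kern exp_growth_cosh x])
  assume "t \<in> space half_line"
  then have t: "0 < t" by simp
  show "((%v. kern 0 (2 * x * sinh t) * cosh (2 * v * t)) has_real_derivative kern 0 (2 * x * sinh t) * (2 * (t * sinh (2 * v * t)))) (at v)"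
  by (auto intro!: derivative_eq_intros)
  have "\<bar>v\<bar> <= \<bar>c\<bar> + 1" using v by auto
  from abs_tsinh_le[OF this t]
  have "\<bar>kern 0 (2 * x * sinh t)\<bar> * \<bar>2 * (t * sinh (2 * v * t))\<bar> <= \<bar>kern 0 (2 * x * sinh t)\<bar> * (2 * exp ((2 * (\<bar>c\<bar> + 1) + 1) * t))"
  by (intro mult_left_mono) auto
  also have "... <= 2 * G t" using G(3)[OF order_refl t] by simp
  finally show "\<bar>kern 0 (2 * x * sinh t) * (2 * (t * sinh (2 * v * t)))\<bar> <= 2 * G t" by (simp only: abs_mult)
 qed (use G in auto)
 from DERIV_cmult[OF this, of "8 / pi^2"] show ?thesis unfolding Nic_def Nd_def sinh_transform_def .
qed

text \<open>With \<open>theta\<close> for the phase, \<open>phw\<close> is its derivative in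
  \<open>x\<close>, \<open>phb\<close> minus its derivative in the order, and \<open>phm\<close>
  minus its mixed derivative. That \<open>phw\<close> and \<open>phb\<close> have compatible mixed
  derivatives is exactly Watson's identity.\<close>

definition phw :: "real => real => real" where "phw c x = 2 / (pi * x * Nic c 0 x)"
definition phb :: "real => real => real" where "phb c x = 4 / pi * (Bt c 0 x / Nic c 0 x)"
definition phm :: "real => real => real" where "phm c x = 2 * Nd c 0 x / (pi * x * (Nic c 0 x)^2)"

lemma Bt_pos: "0 < x ==> 0 < Bt c 0 x"
 unfolding Bt_def by (intro sinh_transform_pos adm_kern exp_growth_exp) (auto simp: kern_simps KK_pos)

lemma Bt_antimono:
 assumes "0 < x" "x <= y"
 shows "Bt c 0 y <= Bt c 0 x"
proof (rule DERIV_nonpos_imp_nonincreasing[where f="Bt c 0" and a=x and b=y, OF assms(2)])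
 fix z assume "x <= z"
 then have z: "0 < z" using assms by simp
 have "0 < sinh_transform (%y. - 1 * kern 1 y) (%t. exp (- (2 * c) * t)) z"
  by (intro sinh_transform_pos adm_kernel_cmult adm_kern exp_growth_exp z) (auto simp: kern_simps KK_pos)
 also have "sinh_transform (%y. - 1 * kern 1 y) (%t. exp (- (2 * c) * t)) z = - Bt c 1 z"
  unfolding sinh_transform_def Bt_def by simp
 finally have "Bt c 1 z < 0" by simp
 then show "\<exists>D. (Bt c 0 has_real_derivative D) (at z) \<and> D <= 0"
  using DERIV_Bt[OF z, of 0 c] z by (intro exI[of _ "Bt c 1 z / z"]) (auto simp: divide_le_0_iff)
qed

lemma phw_pos: "0 < x ==> 0 < phw c x"
 using Nic_pos by (simp add: phw_def)

text \<open>The quotient \<open>phb / phw = 2 * x * Bt c 0 x\<close> is the speed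
  \<open>dx/dc\<close> along a level curve of the phase.\<close>

lemma phb_eq: "0 < x ==> phb c x = 2 * x * Bt c 0 x * phw c x"
 by (simp add: phw_def phb_def)

lemma phb_pos: "0 < x ==> 0 < phb c x"
 using Nic_pos Bt_pos by (simp add: phb_def)

text \<open>For \<open>c >= 0\<close>, \<open>exp (- 2 * c * t) <= 1 <= cosh (2 * c * t)\<close>.
  The bound equals the limit at infinity and doubles as a dominating constant.\<close>

lemma phb_le: "0 < x ==> 0 <= c ==> phb c x <= pi / 2"
proof -
 assume x: "0 < x" and c: "0 <= c"
 have "Bt c 0 x <= sinh_transform (kern 0) (%t. cosh (2 * c * t)) x"
  unfolding Bt_def sinh_transform_def
 proof (rule integral_half_line_mono)
  show "integrable half_line (%t. kern 0 (2 * x * sinh t) * exp (- (2 * c) * t))"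
  by (rule integrable_sinh_transform[OF adm_kern exp_growth_exp x])
  show "integrable half_line (%t. kern 0 (2 * x * sinh t) * cosh (2 * c * t))"
  by (rule integrable_sinh_transform[OF adm_kern exp_growth_cosh x])
  fix t :: real assume t: "0 < t"
  have "exp (- (2 * c) * t) <= 1" using c t by simp
  also have "1 <= cosh (2 * c * t)" by (rule cosh_real_ge_1)
  finally show "kern 0 (2 * x * sinh t) * exp (- (2 * c) * t) <= kern 0 (2 * x * sinh t) * cosh (2 * c * t)"
  using KK_pos[of "2 * x * sinh t" 0] x t by (intro mult_left_mono) (auto simp: kern_simps)
 qed
 also have "... = pi^2 / 8 * Nic c 0 x" by (simp add: Nic_def)
 finally have "Bt c 0 x / Nic c 0 x <= pi^2 / 8" using Nic_pos[OF x, of c] by (simp add: divide_le_eq)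
 then have "4 / pi * (Bt c 0 x / Nic c 0 x) <= 4 / pi * (pi^2 / 8)" by (intro mult_left_mono) auto
 then show ?thesis by (simp add: phb_def power2_eq_square)
qed

lemma phb_at_top: "(phb c ---> pi / 2) at_top"
proof -
 have "((%x. 4 / pi * ((x * Bt c 0 x) / (x * Nic c 0 x))) ---> 4 / pi * ((pi / 4) / (2 / pi))) at_top"
  by (intro tendsto_intros Bt_at_top Nic_at_top) auto
 then have "((%x. 4 / pi * ((x * Bt c 0 x) / (x * Nic c 0 x))) ---> pi / 2) at_top" by simp
 then show ?thesis
  by (rule Lim_transform_eventually) (intro eventually_mono[OF eventually_gt_at_top[of 0]], simp add: phb_def)
qed

lemma DERIV_phb:
 assumes x: "0 < x"
 shows "(phb c has_real_derivative phm c x) (at x)"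
proof -
 have N: "Nic c 0 x ~= 0" using Nic_pos[OF x, of c] by simp
 have "((%x. 4 / pi * (Bt c 0 x / Nic c 0 x)) has_real_derivative
  4 / pi * ((Bt c 1 x / x * Nic c 0 x - Bt c 0 x * (Nic c 1 x / x)) / (Nic c 0 x * Nic c 0 x))) (at x)"
  using DERIV_Bt[OF x, of 0 c] DERIV_Nic[OF x, of 0 c] by (intro DERIV_cmult DERIV_divide N) simp_all
 moreover have "4 / pi * ((Bt c 1 x / x * Nic c 0 x - Bt c 0 x * (Nic c 1 x / x)) / (Nic c 0 x * Nic c 0 x)) = phm c x"
 proof -
  have "Bt c 1 x / x * Nic c 0 x - Bt c 0 x * (Nic c 1 x / x) = Nd c 0 x / (2 * x)"
  unfolding Watson_identity[OF x, of c, symmetric] using x by (simp add: field_simps)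
  then show ?thesis by (simp add: phm_def power2_eq_square)
 qed
 ultimately show ?thesis unfolding phb_def[abs_def] by simp
qed

lemma DERIV_phw_order:
 assumes x: "0 < x"
 shows "((%c. phw c x) has_real_derivative - phm c x) (at c)"
proof -
 have N: "Nic c 0 x ~= 0" using Nic_pos[OF x, of c] by simp
 have "((%c. 2 / (pi * x) * (1 / Nic c 0 x)) has_real_derivative
  2 / (pi * x) * ((0 * Nic c 0 x - 1 * Nd c 0 x) / (Nic c 0 x * Nic c 0 x))) (at c)"
  by (intro DERIV_cmult DERIV_divide DERIV_const DERIV_Nic_order x N)
 then show ?thesis by (simp add: phw_def phm_def power2_eq_square mult_ac)
qed

lemma continuous_on_phase:
 "continuous_on (UNIV \<times> {0<..}) (%(c, x). phw c x)" "continuous_on (UNIV \<times> {0<..}) (%(c, x). phb c x)"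
 "continuous_on (UNIV \<times> {0<..}) (%(c, x). phm c x)"
proof -
 have N: "continuous_on (UNIV \<times> {0<..}) (%p. Nic (fst p) 0 (snd p))" and B: "continuous_on (UNIV \<times> {0<..}) (%p. Bt (fst p) 0 (snd p))"
  and D: "continuous_on (UNIV \<times> {0<..}) (%p. Nd (fst p) 0 (snd p))"
  using continuous_on_Nic continuous_on_Bt continuous_on_Nd by (simp_all add: split_beta)
 have nz: "Nic (fst p) 0 (snd p) ~= 0" "snd p ~= 0" if "p \<in> UNIV \<times> {0::real<..}" for p
  using that Nic_pos[of "snd p" "fst p"] by auto
 show "continuous_on (UNIV \<times> {0<..}) (%(c, x). phw c x)"
  unfolding phw_def split_beta by (intro continuous_intros N ballI) (use nz in auto)
 show "continuous_on (UNIV \<times> {0<..}) (%(c, x). phb c x)"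
  unfolding phb_def split_beta by (intro continuous_intros N B ballI) (use nz in auto)
 show "continuous_on (UNIV \<times> {0<..}) (%(c, x). phm c x)"
  unfolding phm_def split_beta by (intro continuous_intros N D ballI) (use nz in auto)
qed

lemma continuous_on_phase_sections:
 "continuous_on {0<..} (phw c)" "0 < x ==> continuous_on S (%c. phb c x)" "0 < x ==> continuous_on S (%c. phm c x)"
proof -
 have "continuous_on {0<..} ((%(c, x). phw c x) \<circ> (%x. (c, x)))"
  by (intro continuous_on_compose continuous_on_subset[OF continuous_on_phase(1)] continuous_intros) auto
 then show "continuous_on {0<..} (phw c)" by (simp add: comp_def)
 assume x: "0 < x"
 have "continuous_on S ((%(c, x). phb c x) \<circ> (%c. (c, x)))" "continuous_on S ((%(c, x). phm c x) \<circ> (%c. (c, x)))"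
  using x by (intro continuous_on_compose continuous_on_subset[OF continuous_on_phase(2)] continuous_on_subset[OF continuous_on_phase(3)] continuous_intros; auto)+
 then show "continuous_on S (%c. phb c x)" "continuous_on S (%c. phm c x)" by (simp_all add: comp_def)
qed

text \<open>The closed form \<open>phw dx - phb dc\<close> integrated from \<open>(m, a)\<close>,
  first in \<open>x\<close> at order \<open>m\<close>, then in the order at fixed \<open>x\<close>.
  The base order \<open>m\<close> lies below the orders of interest, so that these are interior
  points.\<close>

definition phase :: "real => real => real => real => real" where
 "phase a m c x = integral {a..x} (phw m) - integral {m..c} (%s. phb s x)"

lemma DERIV_phase_order:
 assumes "0 < x" "m < c"
 shows "((%c. phase a m c x) has_real_derivative - phb c x) (at c)"
proof -
 have "((%c. integral {m..c} (%s. phb s x)) has_real_derivative phb c x) (at c within {m..c + 1})"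
  by (rule integral_has_real_derivative) (use assms continuous_on_phase_sections(2) in auto)
 then have "((%c. integral {m..c} (%s. phb s x)) has_real_derivative phb c x) (at c)"
  using assms by (simp add: at_within_Icc_at)
 then show ?thesis unfolding phase_def by (auto intro!: derivative_eq_intros)
qed

lemma DERIV_phase:
 assumes "0 < a" "a < x" "m <= c"
 shows "(phase a m c has_real_derivative phw c x) (at x)"
proof -
 have x: "0 < x" using assms by simp
 have "((%x. integral {a..x} (phw m)) has_real_derivative phw m x) (at x within {a..x + 1})"
  by (rule integral_has_real_derivative) (use assms in \<open>auto intro: continuous_on_subset[OF continuous_on_phase_sections(1)]\<close>)
 then have 1: "((%x. integral {a..x} (phw m)) has_real_derivative phw m x) (at x)"
  using assms by (simp add: at_within_Icc_at)
 have "((%x. integral (cbox m c) (%s. phb s x)) has_field_derivative integral (cbox m c) (%s. phm s x)) (at x within {0<..})"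
 proof (rule leibniz_rule_field_derivative)
  show "((%x. phb s x) has_field_derivative phm s x) (at x within {0<..})" if "x \<in> {0<..}" for x s
  using DERIV_phb that has_field_derivative_at_within by blast
  show "(%s. phb s x) integrable_on cbox m c" if "x \<in> {0<..}" for x
  using that by (intro integrable_continuous continuous_on_phase_sections(2)) simp
  have "continuous_on ({0<..} \<times> cbox m c) ((%(c, x). phm c x) \<circ> prod.swap)"
  by (intro continuous_on_compose continuous_on_swap continuous_on_subset[OF continuous_on_phase(3)]) auto
  then show "continuous_on ({0<..} \<times> cbox m c) (%(x, s). phm s x)" by (simp add: comp_def split_beta)
 qed (use x in auto)
 then have 2: "((%x. integral {m..c} (%s. phb s x)) has_real_derivative integral {m..c} (%s. phm s x)) (at x)"
  using x by (simp add: at_within_open[of x "{0<..}"])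
 \<comment> \<open>Integrating the mixed derivative over the order turns \<open>phw m\<close> into
   \<open>phw c\<close>.\<close>
 have "((%s. - phm s x) has_integral (phw c x - phw m x)) {m..c}"
  using assms(3)
 proof (rule fundamental_theorem_of_calculus)
  show "((%c. phw c x) has_vector_derivative - phm s x) (at s within {m..c})" for s
  using DERIV_phw_order[OF x, of s] by (auto simp: has_real_derivative_iff_has_vector_derivative[symmetric] intro: has_field_derivative_at_within)
 qed
 then have "integral {m..c} (%s. - phm s x) = phw c x - phw m x" by (rule integral_unique)
 then have "integral {m..c} (%s. phm s x) = phw m x - phw c x" by simp
 then show ?thesis unfolding phase_def[abs_def] using DERIV_diff[OF 1 2] by simp
qed

text \<open>The order derivative \<open>- phb\<close> tends boundedly to \<open>- pi / 2\<close>: at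
  infinity one unit of order costs a quarter turn, and at finite \<open>x\<close> never
  more.\<close>

lemma tendsto_phase_increment:
 assumes n: "0 <= c" "m <= c"
 shows "((%x. phase a m (c + 1) x - phase a m c x) ---> - (pi / 2)) at_top"
  and "!!x c'. 0 < x ==> c <= c' ==> c' <= c + 1 ==> - (pi / 2) <= phase a m c' x - phase a m c x \<and> phase a m c' x <= phase a m c x"
proof -
 have e: "phase a m c' x - phase a m c x = - integral {c..c'} (%s. phb s x)" if "0 < x" "c <= c'" for x c'
 proof -
  have "integral {m..c} (%s. phb s x) + integral {c..c'} (%s. phb s x) = integral {m..c'} (%s. phb s x)"
  using n that by (intro Henstock_Kurzweil_Integration.integral_combine integrable_continuous_real continuous_on_phase_sections(2)) auto
  then show ?thesis by (simp add: phase_def)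
 qed
 have int: "(%s. phb s x) integrable_on {c..c'}" if "0 < x" for x c'
  using that by (intro integrable_continuous_real continuous_on_phase_sections(2))
 show "- (pi / 2) <= phase a m c' x - phase a m c x \<and> phase a m c' x <= phase a m c x"
  if "0 < x" "c <= c'" "c' <= c + 1" for x c'
 proof -
  have "integral {c..c'} (%s. phb s x) <= integral {c..c'} (%s. pi / 2)"
  by (intro integral_le int that) (use phb_le that n in auto)
  also have "... = (c' - c) * (pi / 2)" using that by simp
  also have "... <= 1 * (pi / 2)" using that by (intro mult_right_mono) auto
  finally have "integral {c..c'} (%s. phb s x) <= pi / 2" by simp
  moreover have "0 <= integral {c..c'} (%s. phb s x)"
  using phb_pos that by (intro integral_nonneg int) (auto intro: less_imp_le)
  ultimately show ?thesis using e[OF that(1,2)] by linarith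
 qed
 have "((%x. integral {c..c + 1} (%s. phb s x)) ---> integral {c..c + 1} (%s. pi / 2)) at_top"
 proof (rule tendsto_at_topI_sequentially)
  fix X :: "nat => real" assume X: "filterlim X at_top sequentially"
  obtain N where N: "!!k. k \<ge> N ==> 0 < X k"
  using X unfolding filterlim_at_top_dense eventually_sequentially by blast
  have "(%k. integral {c..c + 1} (%s. phb s (X (k + N)))) \<longlonglongrightarrow> integral {c..c + 1} (%s. pi / 2)"
  proof (rule dominated_convergence(2)[where h="%s. pi / 2"])
  show "(%s. phb s (X (k + N))) integrable_on {c..c + 1}" for k by (rule int) (simp add: N)
  show "norm (phb s (X (k + N))) <= pi / 2" if "s \<in> {c..c + 1}" for s k
  using phb_pos[of "X (k + N)" s] phb_le[of "X (k + N)" s] N[of "k + N"] that n by simp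
  show "(%k. phb s (X (k + N))) \<longlonglongrightarrow> pi / 2" if "s \<in> {c..c + 1}" for s
  using LIMSEQ_ignore_initial_segment[OF filterlim_compose[OF phb_at_top X]] .
  qed auto
  then show "(%k. integral {c..c + 1} (%s. phb s (X k))) \<longlonglongrightarrow> integral {c..c + 1} (%s. pi / 2)"
  by (rule LIMSEQ_offset)
 qed
 then have "((%x. - integral {c..c + 1} (%s. phb s x)) ---> - (pi / 2)) at_top"
  using tendsto_minus by fastforce
 then show "((%x. phase a m (c + 1) x - phase a m c x) ---> - (pi / 2)) at_top"
  by (rule Lim_transform_eventually) (intro eventually_mono[OF eventually_gt_at_top[of 0]], simp add: e)
qed

section \<open>Monotonicity of the zero ratio\<close>

text \<open>A mean-value form of the increment in \<open>x\<close>, whose factor \<open>W\<close>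
  converges because \<open>phw\<close> is jointly continuous. It takes the place of total
  differentiability of the phase, both in the chain rule and in the implicit differentiation
  below.\<close>

lemma phase_increment:
 assumes a: "0 < a" and S: "!!c. c \<in> S ==> m <= c" and c0: "c0 \<in> S" "a < u c0" and u: "(u ---> u c0) (at c0 within S)"
 shows "\<exists>W. (W ---> phw c0 (u c0)) (at c0 within S) \<and>
  (\<forall>\<^sub>F c in at c0 within S. phase a m c (u c) - phase a m c (u c0) = W c * (u c - u c0))"
proof -
 let ?x = "u c0"
 define P where "P c z \<longleftrightarrow> \<bar>z - ?x\<bar> <= \<bar>u c - ?x\<bar> \<and> phase a m c (u c) - phase a m c ?x = phw c z * (u c - ?x)" for c z
 define z where "z c = (SOME z. P c z)" for c
 have ex: "\<exists>z. P c z" if c: "c \<in> S" "a < u c" for c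
 proof (cases "u c" ?x rule: linorder_cases)
  case less
  obtain z where "u c < z" "z < ?x" "phase a m c ?x - phase a m c (u c) = (?x - u c) * phw c z"
  using MVT2[OF less, of "phase a m c" "phw c"] DERIV_phase[OF a _ S[OF c(1)]] c less by force
  then show ?thesis unfolding P_def by (intro exI[of _ z]) (auto simp: algebra_simps)
 next
  case equal
  then show ?thesis unfolding P_def by (intro exI[of _ ?x]) auto
 next
  case greater
  obtain z where "?x < z" "z < u c" "phase a m c (u c) - phase a m c ?x = (u c - ?x) * phw c z"
  using MVT2[OF greater, of "phase a m c" "phw c"] DERIV_phase[OF a _ S[OF c(1)]] c0 greater by force
  then show ?thesis unfolding P_def by (intro exI[of _ z]) (auto simp: algebra_simps)
 qed
 have "\<forall>\<^sub>F c in at c0 within S. c \<in> S" by (simp add: eventually_at_filter)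
 moreover have "\<forall>\<^sub>F c in at c0 within S. a < u c" using order_tendstoD(1)[OF u c0(2)] .
 ultimately have ev: "\<forall>\<^sub>F c in at c0 within S. P c (z c)"
  by eventually_elim (unfold z_def, rule someI_ex, rule ex)
 have "((%c. \<bar>u c - ?x\<bar>) ---> \<bar>?x - ?x\<bar>) (at c0 within S)" by (intro tendsto_intros u)
 then have "((%c. \<bar>u c - ?x\<bar>) ---> 0) (at c0 within S)" by simp
 then have "((%c. z c - ?x) ---> 0) (at c0 within S)"
  by (rule Lim_null_comparison[rotated]) (use ev in eventually_elim, simp add: P_def)
 then have zl: "(z ---> ?x) (at c0 within S)" by (simp add: LIM_zero_iff)
 have x0: "0 < ?x" using a c0 by simp
 have "continuous_on (UNIV \<times> {0<..}) (%(c, x). phw c x)" by (rule continuous_on_phase)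
 then have "isCont (%(c, x). phw c x) (c0, ?x)"
  using x0 by (simp add: continuous_on_eq_continuous_at open_Times)
 from isCont_tendsto_compose[OF this tendsto_Pair[OF tendsto_ident_at zl]]
 have "((%c. phw c (z c)) ---> phw c0 ?x) (at c0 within S)" by simp
 moreover have "\<forall>\<^sub>F c in at c0 within S. phase a m c (u c) - phase a m c ?x = phw c (z c) * (u c - ?x)"
  using ev by eventually_elim (simp add: P_def)
 ultimately show ?thesis by blast
qed

lemma tendsto_phase_order:
 assumes "0 < x" "m < c0"
 shows "((%c. phase a m c x) ---> phase a m c0 x) (at c0 within S)"
 using DERIV_isCont[OF DERIV_phase_order[OF assms, of a]] unfolding isCont_def
 by (rule tendsto_mono[rotated]) (rule at_le[OF subset_UNIV])

lemma tendsto_phase_curve: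
 assumes a: "0 < a" and S: "!!c. c \<in> S ==> m < c" and c0: "c0 \<in> S" "a < u c0" and u: "(u ---> u c0) (at c0 within S)"
 shows "((%c. phase a m c (u c)) ---> phase a m c0 (u c0)) (at c0 within S)"
proof -
 obtain W where W: "(W ---> phw c0 (u c0)) (at c0 within S)"
  "\<forall>\<^sub>F c in at c0 within S. phase a m c (u c) - phase a m c (u c0) = W c * (u c - u c0)"
  using phase_increment[OF a less_imp_le[OF S] c0 u] by blast
 have x0: "0 < u c0" using a c0 by simp
 have "((%c. W c * (u c - u c0) + phase a m c (u c0)) ---> phw c0 (u c0) * (u c0 - u c0) + phase a m c0 (u c0)) (at c0 within S)"
  by (intro tendsto_intros W u tendsto_phase_order x0 S c0)
 then have "((%c. W c * (u c - u c0) + phase a m c (u c0)) ---> phase a m c0 (u c0)) (at c0 within S)" by simp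
 then show ?thesis
  by (rule Lim_transform_eventually) (use W(2) in eventually_elim, simp)
qed

lemma DERIV_phase_curve:
 assumes a: "0 < a" and c0: "m < c0" "a < u c0" and u: "(u has_real_derivative u') (at c0)"
 shows "((%c. phase a m c (u c)) has_real_derivative phw c0 (u c0) * u' - phb c0 (u c0)) (at c0)"
proof -
 let ?S = "{m<..}"
 have at: "at c0 within ?S = at c0" using c0 by (intro at_within_open) auto
 have ul: "(u ---> u c0) (at c0 within ?S)" using DERIV_isCont[OF u] by (simp add: isCont_def at)
 obtain W where W: "(W ---> phw c0 (u c0)) (at c0)"
  "\<forall>\<^sub>F c in at c0. phase a m c (u c) - phase a m c (u c0) = W c * (u c - u c0)"
  using phase_increment[where m=m, OF a _ _ c0(2) ul] c0 unfolding at by auto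
 have x0: "0 < u c0" using a c0 by simp
 have "((%c. W c * ((u c - u c0) / (c - c0)) + (phase a m c (u c0) - phase a m c0 (u c0)) / (c - c0)) --->
  phw c0 (u c0) * u' + - phb c0 (u c0)) (at c0)"
  using u DERIV_phase_order[OF x0 c0(1), of a] unfolding has_field_derivative_iff by (intro tendsto_intros W)
 then have "((%c. (phase a m c (u c) - phase a m c0 (u c0)) / (c - c0)) ---> phw c0 (u c0) * u' + - phb c0 (u c0)) (at c0)"
  by (rule Lim_transform_eventually)
  (use W(2) in eventually_elim, metis add.commute add_divide_distrib diff_add_cancel diff_diff_eq2 times_divide_eq_right add_diff_eq)
 then show ?thesis unfolding has_field_derivative_iff by simp
qed

lemma phase_mono:
 assumes "0 < a" "a < x" "x < y" "m <= c"
 shows "phase a m c x < phase a m c y"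
proof (rule DERIV_pos_imp_increasing[OF assms(3)])
 fix z assume "x <= z"
 then have "a < z" "0 < z" using assms by auto
 then show "\<exists>D. (phase a m c has_real_derivative D) (at z) \<and> 0 < D"
  using DERIV_phase[OF assms(1) _ assms(4)] phw_pos by blast
qed

text \<open>Strict monotonicity in \<open>x\<close> traps the level point between
  \<open>y c0 - d\<close> and \<open>y c0 + d\<close>, where the phase depends continuously on the
  order.\<close>

lemma phase_level_continuous:
 assumes a: "0 < a" and S: "!!c. c \<in> S ==> m < c" and c0: "c0 \<in> S"
  and y: "!!c. c \<in> S ==> a < y c" "!!c. c \<in> S ==> phase a m c (y c) = k"
 shows "(y ---> y c0) (at c0 within S)"
proof (rule tendstoI)
 fix e :: real assume e: "0 < e"
 define d where "d = min e (y c0 - a) / 2"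
 have d: "0 < d" "d < e" "a < y c0 - d" using e y(1)[OF c0] by (auto simp: d_def min_def field_simps)
 have m0: "m < c0" by (rule S[OF c0])
 have "phase a m c0 (y c0 - d) < k" "k < phase a m c0 (y c0 + d)"
  using phase_mono[OF a d(3), of "y c0" m c0] phase_mono[OF a y(1)[OF c0], of "y c0 + d" m c0] y(2)[OF c0] d(1) m0 by auto
 moreover have "0 < y c0 - d" "0 < y c0 + d" using a d by auto
 ultimately have "\<forall>\<^sub>F c in at c0 within S. phase a m c (y c0 - d) < k" "\<forall>\<^sub>F c in at c0 within S. k < phase a m c (y c0 + d)"
  using order_tendstoD[OF tendsto_phase_order[OF _ m0]] by blast+
 moreover have "\<forall>\<^sub>F c in at c0 within S. c \<in> S" by (simp add: eventually_at_filter)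
 ultimately show "\<forall>\<^sub>F c in at c0 within S. dist (y c) (y c0) < e"
 proof eventually_elim
  case (elim c)
  have m: "m <= c" using S elim by (simp add: less_imp_le)
  have "y c0 - d < y c"
  proof (rule ccontr)
  assume "\<not> y c0 - d < y c"
  then have "phase a m c (y c) <= phase a m c (y c0 - d)"
  using phase_mono[OF a y(1), of c "y c0 - d" m c] elim m by (cases "y c = y c0 - d") auto
  then show False using y(2)[of c] elim by simp
  qed
  moreover have "y c < y c0 + d"
  proof (rule ccontr)
  assume "\<not> y c < y c0 + d"
  then have "phase a m c (y c0 + d) <= phase a m c (y c)"
  using phase_mono[OF a, of "y c0 + d" "y c" m c] elim m d a by (cases "y c = y c0 + d") auto
  then show False using y(2)[of c] elim by simp
  qed
  ultimately show ?case using d by (simp add: dist_real_def)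
 qed
qed

text \<open>Implicit differentiation: dividing the increment identity by \<open>W\<close>, which is
  positive near \<open>c0\<close>, turns the order derivative of the phase into the derivative of
  the level curve.\<close>

lemma phase_level_DERIV:
 assumes a: "0 < a" and S: "open S" "!!c. c \<in> S ==> m < c" and c0: "c0 \<in> S"
  and y: "!!c. c \<in> S ==> a < y c" "!!c. c \<in> S ==> phase a m c (y c) = k"
 shows "(y has_real_derivative phb c0 (y c0) / phw c0 (y c0)) (at c0)"
proof -
 have at: "at c0 within S = at c0" using c0 S(1) by (rule at_within_open)
 have yl: "(y ---> y c0) (at c0 within S)" by (rule phase_level_continuous[OF a S(2) c0 y])
 obtain W where W: "(W ---> phw c0 (y c0)) (at c0)"
  "\<forall>\<^sub>F c in at c0. phase a m c (y c) - phase a m c (y c0) = W c * (y c - y c0)"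
  using phase_increment[where m=m, OF a less_imp_le[OF S(2)] c0 y(1)[OF c0] yl] unfolding at by blast
 have x0: "0 < y c0" using a y(1)[OF c0] by simp
 have wp: "0 < phw c0 (y c0)" by (rule phw_pos[OF x0])
 have Wp: "\<forall>\<^sub>F c in at c0. 0 < W c" using order_tendstoD(1)[OF W(1) wp] .
 have inS: "\<forall>\<^sub>F c in at c0. c \<in> S" using S(1) c0 by (metis eventually_at_topological)
 have "((%c. - ((phase a m c (y c0) - phase a m c0 (y c0)) / (c - c0)) / W c) ---> - (- phb c0 (y c0)) / phw c0 (y c0)) (at c0)"
  using DERIV_phase_order[OF x0 S(2)[OF c0], of a] wp unfolding has_field_derivative_iff by (intro tendsto_intros W) auto
 then have "((%c. (y c - y c0) / (c - c0)) ---> - (- phb c0 (y c0)) / phw c0 (y c0)) (at c0)"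
 proof (rule Lim_transform_eventually)
  show "\<forall>\<^sub>F c in at c0. - ((phase a m c (y c0) - phase a m c0 (y c0)) / (c - c0)) / W c = (y c - y c0) / (c - c0)"
  using W(2) Wp inS
  proof eventually_elim
  case (elim c)
  have "phase a m c (y c0) - phase a m c0 (y c0) = - (W c * (y c - y c0))"
  using elim(1) y(2)[OF elim(3)] y(2)[OF c0] by simp
  then show ?case using elim(2) by simp
  qed
 qed
 then show ?thesis unfolding has_field_derivative_iff by simp
qed

text \<open>\<open>H\<close> divided by its modulus and by \<open>cis\<close> of the phase is
  constant, since modulus and phase speed supply the real and imaginary parts of its logarithmic
  derivative. The constant is the unit \<open>z\<close>.\<close>

lemma hankel_phase:
 assumes a: "0 < a" and m: "m <= real n"
 obtains z where "norm z = 1" "!!x. a < x ==> hankel1 n x = of_real (sqrt (Nic (real n) 0 x)) * cis (phase a m (real n) x) * z"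
proof -
 let ?J = "JB n" and ?Y = "bessel_Y n" and ?N = "Nic (real n) 0" and ?F = "phase a m (real n)"
 \<comment> \<open>\<open>P\<close> and \<open>Q\<close> are the real and imaginary part of
   \<open>H * cis (- phase) / |H|\<close>.\<close>
 define P where "P x = (?J x * cos (?F x) + ?Y x * sin (?F x)) / sqrt (?N x)" for x
 define Q where "Q x = (?Y x * cos (?F x) - ?J x * sin (?F x)) / sqrt (?N x)" for x
 have D: "(P has_real_derivative 0) (at x)" "(Q has_real_derivative 0) (at x)" if x: "a < x" for x
 proof -
  have x0: "0 < x" using a x by simp
  define w where "w = phw (real n) x"
  define al where "al = Nic (real n) 1 x / (2 * x * ?N x)"
  define c where "c = cos (?F x)"
  define s where "s = sin (?F x)"
  define r where "r = sqrt (?N x)"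
  have N: "0 < ?N x" by (rule Nic_pos[OF x0])
  have r: "0 < r" using N by (simp add: r_def)
  have dJ: "dJ n x = al * ?J x - w * ?Y x" and dY: "dY n x = al * ?Y x + w * ?J x"
  using hankel_outgoing[OF x0, of n] unfolding al_def w_def phw_def dH_def hankel1_def
  by (simp_all add: complex_eq_iff algebra_simps)
  have dc: "((%x. cos (?F x)) has_real_derivative - s * w) (at x)" and ds: "((%x. sin (?F x)) has_real_derivative c * w) (at x)"
  using DERIV_phase[OF a x m] unfolding s_def c_def w_def by (auto intro!: derivative_eq_intros)
  have dr: "((%x. sqrt (?N x)) has_real_derivative al * r) (at x)"
  proof -
  have "((%x. sqrt (?N x)) has_real_derivative inverse (sqrt (?N x)) / 2 * (Nic (real n) 1 x / x)) (at x)"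
  using DERIV_chain2[OF DERIV_real_sqrt[OF N] DERIV_Nic[OF x0, of 0 "real n"]] by simp
  moreover have "inverse (sqrt (?N x)) / 2 * (Nic (real n) 1 x / x) = al * r"
  proof -
  have "?N x = r * r" using N by (simp add: r_def)
  then show ?thesis using r unfolding al_def r_def[symmetric] by (simp add: field_simps)
  qed
  ultimately show ?thesis by simp
  qed
  have rn: "sqrt (?N x) ~= 0" using N by simp
  have "(P has_real_derivative (((dJ n x * c + (- s * w) * ?J x) + (dY n x * s + (c * w) * ?Y x)) * r - (?J x * c + ?Y x * s) * (al * r)) / (r * r)) (at x)"
  unfolding P_def[abs_def] c_def s_def r_def
  by (intro DERIV_divide DERIV_add DERIV_mult DERIV_J DERIV_Y x0 rn dc[unfolded s_def] ds[unfolded c_def] dr[unfolded r_def])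
  moreover have "(((dJ n x * c + (- s * w) * ?J x) + (dY n x * s + (c * w) * ?Y x)) * r - (?J x * c + ?Y x * s) * (al * r)) / (r * r) = 0"
  unfolding dJ dY by (simp add: algebra_simps)
  ultimately show "(P has_real_derivative 0) (at x)" by (rule DERIV_cong)
  have "(Q has_real_derivative (((dY n x * c + (- s * w) * ?Y x) - (dJ n x * s + (c * w) * ?J x)) * r - (?Y x * c - ?J x * s) * (al * r)) / (r * r)) (at x)"
  unfolding Q_def[abs_def] c_def s_def r_def
  by (intro DERIV_divide DERIV_diff DERIV_mult DERIV_J DERIV_Y x0 rn dc[unfolded s_def] ds[unfolded c_def] dr[unfolded r_def])
  moreover have "(((dY n x * c + (- s * w) * ?Y x) - (dJ n x * s + (c * w) * ?J x)) * r - (?Y x * c - ?J x * s) * (al * r)) / (r * r) = 0"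
  unfolding dJ dY by (simp add: algebra_simps)
  ultimately show "(Q has_real_derivative 0) (at x)" by (rule DERIV_cong)
 qed
 have "\<exists>p. \<forall>x\<in>{a<..}. P x = p"
  by (rule has_field_derivative_zero_constant) (auto intro: D has_field_derivative_at_within)
 then obtain p where p: "!!x. a < x ==> P x = p" by auto
 have "\<exists>p. \<forall>x\<in>{a<..}. Q x = p"
  by (rule has_field_derivative_zero_constant) (auto intro: D has_field_derivative_at_within)
 then obtain q where q: "!!x. a < x ==> Q x = q" by auto
 have H: "hankel1 n x = of_real (sqrt (?N x)) * cis (?F x) * Complex p q" if x: "a < x" for x
 proof -
  have x0: "0 < x" using a x by simp
  define c where "c = cos (?F x)"
  define s where "s = sin (?F x)"
  define r where "r = sqrt (?N x)"
  have r: "0 < r" using Nic_pos[OF x0] by (simp add: r_def)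
  have cs: "c * c + s * s = 1" unfolding c_def s_def by (metis power2_eq_square sin_cos_squared_add2)
  have P: "r * p = ?J x * c + ?Y x * s" and Q: "r * q = ?Y x * c - ?J x * s"
  using p[OF x] q[OF x] r unfolding P_def Q_def c_def s_def r_def by (auto simp: field_simps)
  have "c * (r * p) - s * (r * q) = ?J x * (c * c + s * s)" "s * (r * p) + c * (r * q) = ?Y x * (c * c + s * s)"
  unfolding P Q by (simp_all add: algebra_simps)
  then show ?thesis unfolding cs hankel1_def
  by (simp add: complex_eq_iff c_def[symmetric] s_def[symmetric] r_def[symmetric] algebra_simps)
 qed
 have "norm (Complex p q) = 1"
 proof -
  have x0: "0 < a + 1" using a by simp
  have "norm (hankel1 n (a + 1)) = sqrt (?N (a + 1)) * norm (Complex p q)"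
  using H[of "a + 1"] Nic_pos[OF x0, of "real n"] by (simp add: norm_mult)
  moreover have "norm (hankel1 n (a + 1)) = sqrt (?N (a + 1))"
  using hankel_norm[OF x0, of n] by (metis norm_ge_zero real_sqrt_unique)
  ultimately show ?thesis using Nic_pos[OF x0, of "real n"] by simp
 qed
 then show ?thesis using that H by blast
qed

text \<open>Let \<open>k\<close> be the phase at \<open>y_n\<close>, where \<open>H_n\<close> is
  real and positive, and let \<open>y c\<close> follow the level \<open>k\<close> from order
  \<open>n\<close> to \<open>n + 1\<close>. With \<open>r = j_n / y_n\<close>, the phase at
  \<open>r * y c\<close> is \<open>k + pi / 2\<close> for \<open>c = n\<close> and does not decrease
  along the curve, since \<open>d ln y / dc = 2 * Bt c 0 y\<close> and \<open>Bt\<close> decreases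
  in \<open>x\<close>. At order \<open>n + 1\<close> the curve has reached \<open>y_{n+1}\<close>,
  so \<open>J_{n+1}\<close> vanishes no later than at \<open>r * y_{n+1}\<close>.\<close>

theorem zero_ratio_antimono:
 "first_zero_J (Suc n) / first_zero_Y (Suc n) <= first_zero_J n / first_zero_Y n"
proof -
 let ?y = "first_zero_Y n" and ?j = "first_zero_J n" and ?y' = "first_zero_Y (Suc n)" and ?j' = "first_zero_J (Suc n)"
 have y0: "0 < ?y" and yj: "?y < ?j" by (rule first_zero_Y)+
 \<comment> \<open>A base point below every zero that occurs.\<close>
 define a where "a = ?y / 2"
 have a: "0 < a" "a < ?y" using y0 by (auto simp: a_def)
 \<comment> \<open>One below \<open>n\<close>, hence negative for \<open>n = 0\<close>; the
   integrals make sense for every real order.\<close>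
 define m where "m = real n - 1"
 define T where "T = phase a m"
 define k where "k = T (real n) ?y"
 have mn: "m <= real n" "m <= real (Suc n)" by (auto simp: m_def)
 obtain z where z: "norm z = 1" "!!x. a < x ==> hankel1 n x = of_real (sqrt (Nic (real n) 0 x)) * cis (T (real n) x) * z"
  using hankel_phase[OF a(1) mn(1)] unfolding T_def by metis
 obtain z' where z': "norm z' = 1" "!!x. a < x ==> hankel1 (Suc n) x = of_real (sqrt (Nic (real (Suc n)) 0 x)) * cis (T (real (Suc n)) x) * z'"
  using hankel_phase[OF a(1) mn(2)] unfolding T_def by metis
 have zk: "z = cis (- k)"
 proof -
  have J: "0 < JB n ?y" using first_zero_J(3)[of ?y n] y0 yj by simp
  have "hankel1 n ?y = of_real (sqrt (Nic (real n) 0 ?y)) * (cis k * z)"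
  using z(2)[OF a(2)] by (simp add: k_def mult.assoc)
  moreover have "hankel1 n ?y = of_real (JB n ?y)"
  using first_zero_Y(2)[of n] by (simp add: hankel1_def complex_eq_iff)
  moreover have "sqrt (Nic (real n) 0 ?y) = JB n ?y"
  using Nicholson[OF y0, of n] first_zero_Y(2)[of n] J by simp
  ultimately have "cis k * z = 1" using J by simp
  then have "cis (- k) * (cis k * z) = cis (- k)" by simp
  then show ?thesis by (simp add: mult.assoc[symmetric] cis_mult)
 qed
 have H: "hankel1 n x = of_real (sqrt (Nic (real n) 0 x)) * cis (T (real n) x - k)" if "a < x" for x
  using z(2)[OF that] unfolding zk by (simp add: cis_mult mult.assoc)
 define E where "E = z' * cis k"
 have H1: "hankel1 (Suc n) x = of_real (sqrt (Nic (real (Suc n)) 0 x)) * cis (T (real (Suc n)) x - k) * E" if "a < x" for x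
  using z'(2)[OF that] unfolding E_def by (simp add: cis_mult mult.assoc mult.left_commute[of "cis _" z'])
 have nE: "norm E = 1" using z'(1) by (simp add: E_def norm_mult)
 have inc: "((%x. T (real (Suc n)) x - T (real n) x) ---> - (pi / 2)) at_top"
  using tendsto_phase_increment(1)[of "real n" m a] mn unfolding T_def by (simp add: add.commute)
 have T_le: "- (pi / 2) <= T c x - T (real n) x" "T c x <= T (real n) x" if "0 < x" "real n <= c" "c <= real n + 1" for x c
  using tendsto_phase_increment(2)[of "real n" m x c a] mn that unfolding T_def by auto
 \<comment> \<open>\<open>E\<close> is the unit by which the phases of \<open>H_n\<close> and
   \<open>H_{n+1}\<close> could be misaligned. The cross Wronskian gives
   \<open>Im (H_{n+1} * cnj H_n)\<close>; divided by the moduli it tends to -1, while the phase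
   difference tends to \<open>- pi / 2\<close>. So \<open>Re E = 1\<close>, and
   \<open>|E| = 1\<close> leaves only \<open>E = 1\<close>.\<close>
 have "E = 1"
 proof -
  have I: "Im (cis (T (real (Suc n)) x - T (real n) x) * E) = - (2 / (pi * x)) / (sqrt (Nic (real n) 0 x) * sqrt (Nic (real (Suc n)) 0 x))" if x: "a < x" for x
  proof -
  have x0: "0 < x" using a x by simp
  let ?r = "sqrt (Nic (real n) 0 x) * sqrt (Nic (real (Suc n)) 0 x)"
  have r: "0 < ?r" using Nic_pos[OF x0] by simp
  have "hankel1 (Suc n) x * cnj (hankel1 n x) = of_real ?r * (cis (T (real (Suc n)) x - k) * cis (- (T (real n) x - k)) * E)"
  unfolding H[OF x] H1[OF x] by (simp add: cis_cnj mult_ac)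
  also have "cis (T (real (Suc n)) x - k) * cis (- (T (real n) x - k)) = cis (T (real (Suc n)) x - T (real n) x)"
  by (simp add: cis_mult)
  finally have "Im (hankel1 (Suc n) x * cnj (hankel1 n x)) = ?r * Im (cis (T (real (Suc n)) x - T (real n) x) * E)" by simp
  moreover have "Im (hankel1 (Suc n) x * cnj (hankel1 n x)) = - (2 / (pi * x))"
  using cross_wronskian[OF x0, of n] by (simp add: hankel1_def algebra_simps)
  ultimately have "?r * Im (cis (T (real (Suc n)) x - T (real n) x) * E) = - (2 / (pi * x))" by (rule trans[OF sym])
  then show ?thesis by (rule eq_divide_imp[OF less_imp_neq[OF r, symmetric], OF trans[OF mult.commute]])
  qed
  have "((%x. Im (cis (T (real (Suc n)) x - T (real n) x) * E)) ---> Im (cis (- (pi / 2)) * E)) at_top"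
  by (intro tendsto_intros inc)
  moreover have "((%x. Im (cis (T (real (Suc n)) x - T (real n) x) * E)) ---> - 1) at_top"
  proof (rule Lim_transform_eventually)
  have "((%x. - (2 / pi) / (sqrt (x * Nic (real n) 0 x) * sqrt (x * Nic (real (Suc n)) 0 x))) ---> - (2 / pi) / (sqrt (2 / pi) * sqrt (2 / pi))) at_top"
  by (intro tendsto_intros Nic_at_top(1)) auto
  then show "((%x. - (2 / pi) / (sqrt (x * Nic (real n) 0 x) * sqrt (x * Nic (real (Suc n)) 0 x))) ---> - 1) at_top" by simp
  show "\<forall>\<^sub>F x in at_top. - (2 / pi) / (sqrt (x * Nic (real n) 0 x) * sqrt (x * Nic (real (Suc n)) 0 x)) = Im (cis (T (real (Suc n)) x - T (real n) x) * E)"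
  using eventually_gt_at_top[of a]
  proof eventually_elim
  case (elim x)
  then have x0: "0 < x" using a by simp
  have "sqrt (x * Nic (real n) 0 x) * sqrt (x * Nic (real (Suc n)) 0 x) = (sqrt x * sqrt x) * (sqrt (Nic (real n) 0 x) * sqrt (Nic (real (Suc n)) 0 x))"
  by (simp add: real_sqrt_mult mult_ac)
  then show ?case unfolding I[OF elim] using x0 by (simp add: mult_ac)
  qed
  qed
  ultimately have "Im (cis (- (pi / 2)) * E) = - 1" using tendsto_unique trivial_limit_at_top_linorder by blast
  then have re: "Re E = 1" by (simp add: cis.code)
  moreover have "(Re E)^2 + (Im E)^2 = 1" using nE by (metis cmod_power2 one_power2)
  ultimately show "E = 1" by (simp add: complex_eq_iff)
 qed
 then have H': "hankel1 (Suc n) x = of_real (sqrt (Nic (real (Suc n)) 0 x)) * cis (T (real (Suc n)) x - k)" if "a < x" for x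
  using H1[OF that] by simp
 have J: "JB n x = sqrt (Nic (real n) 0 x) * cos (T (real n) x - k)" "bessel_Y n x = sqrt (Nic (real n) 0 x) * sin (T (real n) x - k)" if "a < x" for x
  using H[OF that] by (auto simp: hankel1_def complex_eq_iff)
 have J': "JB (Suc n) x = sqrt (Nic (real (Suc n)) 0 x) * cos (T (real (Suc n)) x - k)"
  "bessel_Y (Suc n) x = sqrt (Nic (real (Suc n)) 0 x) * sin (T (real (Suc n)) x - k)" if "a < x" for x
  using H'[OF that] by (auto simp: hankel1_def complex_eq_iff)
 have mono: "T c x < T c x'" if "a < x" "x < x'" "m <= c" for c x x'
  unfolding T_def by (rule phase_mono[OF a(1) that])
 have cont: "isCont (T c) x" if "a < x" "m <= c" for c x
  unfolding T_def using DERIV_phase[OF a(1) that] by (rule DERIV_isCont)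
 \<comment> \<open>The cosine vanishes at \<open>j_n\<close>, so the phase there is at least
   \<open>k + pi / 2\<close>. It cannot exceed this value, or \<open>J_n\<close> would vanish
   earlier, where the phase passes \<open>k + pi / 2\<close>.\<close>
 have Tj: "T (real n) ?j = k + pi / 2"
 proof -
  have lo: "k < T (real n) ?j" unfolding k_def by (rule mono[OF a(2) yj mn(1)])
  have "cos (T (real n) ?j - k) = 0"
  using J(1)[of ?j] first_zero_J(2)[of n] a yj Nic_pos[of ?j "real n"] by simp
  then have ge: "k + pi / 2 <= T (real n) ?j"
  using cos_gt_zero[of "T (real n) ?j - k"] lo by force
  have "\<not> k + pi / 2 < T (real n) ?j"
  proof
  assume "k + pi / 2 < T (real n) ?j"
  then have "\<exists>x\<ge>?y. x <= ?j \<and> T (real n) x = k + pi / 2"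
  using yj cont mn a by (intro IVT) (auto simp: k_def less_imp_le)
  then obtain x where x: "?y <= x" "x <= ?j" "T (real n) x = k + pi / 2" by blast
  have "x ~= ?j" using x \<open>k + pi / 2 < T (real n) ?j\<close> by auto
  then have "0 < JB n x" using x y0 by (intro first_zero_J(3)) auto
  moreover have "JB n x = 0" using J(1)[of x] x a by simp
  ultimately show False by simp
  qed
  then show ?thesis using ge by simp
 qed
 let ?S = "{real n..real n + 1}"
 \<comment> \<open>From order \<open>n\<close> to \<open>c <= n + 1\<close> the phase drops by at
   most \<open>pi / 2\<close>, which is its rise from \<open>y_n\<close> to \<open>j_n\<close>; so
   the level \<open>k\<close> is met in between.\<close>
 have ex: "\<exists>x. ?y <= x \<and> x <= ?j \<and> T c x = k" if c: "c \<in> ?S" for c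
 proof -
  have "T c ?y <= k" unfolding k_def using T_le(2)[of ?y c] c y0 by auto
  moreover have "k <= T c ?j" using T_le(1)[of ?j c] c Tj yj y0 by auto
  ultimately show ?thesis using yj cont[of _ c] c a by (intro IVT) (auto simp: m_def)
 qed
 then obtain y where y: "!!c. c \<in> ?S ==> ?y <= y c \<and> y c <= ?j \<and> T c (y c) = k" by metis
 have ya: "a < y c" if "c \<in> ?S" for c using y[OF that] a by auto
 have mS: "m < c" if "c \<in> ?S" for c using that by (auto simp: m_def)
 have uniq: "x = y c" if "c \<in> ?S" "a < x" "T c x = k" for c x
  using mono[of x "y c" c] mono[of "y c" x c] that y[OF that(1)] ya[OF that(1)] mS[OF that(1)] by (cases x "y c" rule: linorder_cases) auto
 define r where "r = ?j / ?y"
 have r1: "1 < r" using yj y0 by (simp add: r_def)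
 have yn: "y (real n) = ?y" using uniq[of "real n" ?y] a by (simp add: k_def)
 define g where "g c = T c (r * y c)" for c
 have ra: "a < r * y c" "y c < r * y c" if "c \<in> ?S" for c
 proof -
  have "0 < y c" using ya[OF that] a by simp
  then show "y c < r * y c" using r1 by simp
  then show "a < r * y c" using ya[OF that] by simp
 qed
 have "g (real n) <= g (real n + 1)"
 proof (rule DERIV_nonneg_imp_increasing_open[of "real n" "real n + 1" g])
  show "continuous_on ?S g"
  unfolding continuous_on_def
  proof
  fix c0 assume c0: "c0 \<in> ?S"
  have "(y ---> y c0) (at c0 within ?S)"
  by (rule phase_level_continuous[OF a(1) mS c0 ya, where k=k]) (use y in \<open>auto simp: T_def\<close>)
  then have "((%c. r * y c) ---> r * y c0) (at c0 within ?S)" by (intro tendsto_intros)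
  from tendsto_phase_curve[OF a(1) mS c0 ra(1)[OF c0] this]
  show "(g ---> g c0) (at c0 within ?S)" unfolding g_def[abs_def] T_def by simp
  qed
  fix c assume c: "real n < c" "c < real n + 1"
  then have cS: "c \<in> ?S" and cI: "c \<in> {real n<..<real n + 1}" by auto
  have y0: "0 < y c" using ya[OF cS] a by simp
  have "(y has_real_derivative phb c (y c) / phw c (y c)) (at c)"
  by (rule phase_level_DERIV[OF a(1) open_greaterThanLessThan _ cI, where k=k and m=m]) (use y ya mS in \<open>auto simp: T_def\<close>)
  moreover have "phb c (y c) / phw c (y c) = 2 * y c * Bt c 0 (y c)"
  using phb_eq[OF y0, of c] phw_pos[OF y0, of c] by simp
  ultimately have "((%c. r * y c) has_real_derivative r * (2 * y c * Bt c 0 (y c))) (at c)"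
  by (intro DERIV_cmult) simp
  from DERIV_phase_curve[OF a(1) mS[OF cS] ra(1)[OF cS] this]
  have "(g has_real_derivative phw c (r * y c) * (r * (2 * y c * Bt c 0 (y c))) - phb c (r * y c)) (at c)"
  unfolding g_def[abs_def] T_def .
  moreover have "phw c (r * y c) * (r * (2 * y c * Bt c 0 (y c))) - phb c (r * y c) = 2 * (r * y c) * phw c (r * y c) * (Bt c 0 (y c) - Bt c 0 (r * y c))"
  proof -
  have "0 < r * y c" using y0 r1 by simp
  from phb_eq[OF this, of c] show ?thesis by (simp add: algebra_simps)
  qed
  moreover have "0 <= 2 * (r * y c) * phw c (r * y c) * (Bt c 0 (y c) - Bt c 0 (r * y c))"
  using y0 r1 ra(2)[OF cS] Bt_antimono[OF y0, of "r * y c" c] phw_pos[of "r * y c" c] by (intro mult_nonneg_nonneg) auto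
  ultimately show "\<exists>D. (g has_real_derivative D) (at c) \<and> 0 <= D" by metis
 qed simp
 moreover have "g (real n) = k + pi / 2" using y0 Tj by (simp add: g_def yn r_def)
 ultimately have g1: "k + pi / 2 <= T (real (Suc n)) (r * y (real n + 1))" by (simp add: g_def add.commute)
 have S1: "real n + 1 \<in> ?S" by simp
 \<comment> \<open>\<open>Y_{n+1}\<close> vanishes at the end of the curve, so its first zero comes
   no later. It cannot come earlier: its phase would then be below \<open>k\<close> by at most
   \<open>pi / 2\<close>, where the sine does not vanish.\<close>
 have yy': "y (real n + 1) = ?y'"
 proof -
  have T1: "T (real (Suc n)) (y (real n + 1)) = k" "?y <= y (real n + 1)" using y[OF S1] by (simp_all add: add.commute)
  then have "bessel_Y (Suc n) (y (real n + 1)) = 0" using J'(2)[OF ya[OF S1]] by simp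
  moreover have "0 < y (real n + 1)" using T1(2) y0 by simp
  ultimately have le: "?y' <= y (real n + 1)" using first_zero_Y(3)[of "y (real n + 1)" "Suc n"] by force
  have ay': "a < ?y'" using first_zero_Y_less_Suc[of n] a by simp
  have lo: "k - pi / 2 <= T (real (Suc n)) ?y'"
  proof -
  have "k - pi / 2 <= T (real (Suc n)) ?y" unfolding k_def using T_le(1)[of ?y "real n + 1"] y0 by (simp add: add.commute)
  also have "... <= T (real (Suc n)) ?y'" using mono[OF a(2) first_zero_Y_less_Suc mn(2)] by simp
  finally show ?thesis .
  qed
  have "sin (T (real (Suc n)) ?y' - k) = 0"
  using J'(2)[OF ay'] first_zero_Y(1,2)[of "Suc n"] Nic_pos[of ?y' "real (Suc n)"] by simp
  have "\<not> ?y' < y (real n + 1)"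
  proof
  assume "?y' < y (real n + 1)"
  then have "T (real (Suc n)) ?y' < k" using mono[OF ay' _ mn(2)] T1 by metis
  then have "sin (k - T (real (Suc n)) ?y') > 0" using lo pi_gt_zero by (intro sin_gt_zero) linarith+
  then show False using \<open>sin (T (real (Suc n)) ?y' - k) = 0\<close> by (metis less_irrefl minus_diff_eq neg_equal_0_iff_equal sin_minus)
  qed
  then show ?thesis using le by simp
 qed
 have ay': "a < ?y'" using ya[OF S1] yy' by simp
 have "?j' <= r * ?y'"
 proof -
  have "T (real (Suc n)) ?y' = k" using y[OF S1] yy' by (simp add: add.commute)
  then have "\<exists>x\<ge>?y'. x <= r * ?y' \<and> T (real (Suc n)) x = k + pi / 2"
  using g1 ra(2)[OF S1] ay' cont mn unfolding yy' by (intro IVT) auto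
  then obtain x where x: "?y' <= x" "x <= r * ?y'" "T (real (Suc n)) x = k + pi / 2" by blast
  have "JB (Suc n) x = 0" using J'(1)[of x] x ay' by simp
  moreover have "0 < x" using x ay' a by simp
  ultimately have "?j' <= x" using first_zero_J(3)[of x "Suc n"] by force
  then show ?thesis using x by simp
 qed
 then show ?thesis using first_zero_Y(1)[of "Suc n"] unfolding r_def by (simp add: divide_le_eq)
qed

section \<open>Resonances\<close>

definition resonance_fun :: "nat => real => real => real" where
 "resonance_fun n lam x = dY n x * JB n (lam * x) - lam * dJ n (lam * x) * bessel_Y n x"

lemma exists_resonance:
 assumes lam: "0 < lam" and x1: "0 < x1" and J: "!!x. 0 < x ==> x < x1 ==> 0 < JB n (lam * x)"
  and neg: "resonance_fun n lam x1 < 0"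
 shows "\<exists>x. 0 < x \<and> x < x1 \<and> resonance_fun n lam x = 0"
proof -
 let ?J = "JB n" and ?Y = "bessel_Y n"
 define h where "h x = ?Y x / ?J (lam * x)" for x
 have sc: "filterlim (%x::real. lam * x) (at_right 0) (at_right 0)"
  using lam by (intro filterlim_times_pos[of "%x. x" 0 "at_right 0" lam]) (auto simp: filterlim_ident)
 \<comment> \<open>\<open>h\<close> is split into \<open>J x / J (lam * x)\<close>, which tends to
   \<open>1 / lam ^ n\<close>, and \<open>Y / J\<close>, which tends to minus infinity.\<close>
 have "((%x. (?J x / (x / 2) ^ n) / (?J (lam * x) / (lam * x / 2) ^ n) / lam ^ n) --->
  (1 / fact n) / (1 / fact n) / lam ^ n) (at_right 0)"
  using lam by (intro tendsto_divide tendsto_J tendsto_const filterlim_compose[OF tendsto_J sc]) auto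
 then have "((%x. ?J x / ?J (lam * x)) ---> 1 / lam ^ n) (at_right 0)"
 proof (rule Lim_transform_eventually[THEN tendsto_eq_rhs])
  show "\<forall>\<^sub>F x in at_right 0. ?J x / (x / 2) ^ n / (?J (lam * x) / (lam * x / 2) ^ n) / lam ^ n = ?J x / ?J (lam * x)"
  using eventually_at_right_less[of 0] by eventually_elim (use lam in \<open>simp add: power_mult_distrib power_divide field_simps\<close>)
 qed simp
 from filterlim_tendsto_pos_mult_at_bot[OF this _ YJ_at_bot]
 have "filterlim (%x. ?J x / ?J (lam * x) * (?Y x / ?J x)) at_bot (at_right 0)" using lam by (simp only: zero_less_divide_1_iff zero_less_power)
 moreover have "\<forall>\<^sub>F x in at_right 0. ?J x / ?J (lam * x) * (?Y x / ?J x) = h x"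
  using J_pos_near_0[of n] by eventually_elim (simp add: h_def)
 ultimately have "filterlim h at_bot (at_right 0)" by (rule filterlim_cong[THEN iffD1, OF refl refl, rotated])
 then have "\<forall>\<^sub>F x in at_right 0. h x <= h (x1 / 2) - 1" by (simp add: filterlim_at_bot)
 moreover have "\<forall>\<^sub>F x in at_right 0. 0 < x \<and> x < x1 / 2" using x1 by (intro eventually_at_rightI[of 0 "x1 / 2"]) auto
 ultimately have "\<forall>\<^sub>F x in at_right 0. h x < h (x1 / 2) \<and> 0 < x \<and> x < x1 / 2" by eventually_elim auto
 then obtain a where a: "h a < h (x1 / 2)" "0 < a" "a < x1 / 2"
  using eventually_happens'[OF trivial_limit_at_right_real] by blast
 have D: "(h has_real_derivative resonance_fun n lam x / (?J (lam * x) * ?J (lam * x))) (at x)" if "0 < x" "x < x1" for x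
 proof -
  have "0 < lam * x" using lam that by simp
  then have "((%x. ?J (lam * x)) has_real_derivative dJ n (lam * x) * lam) (at x)"
  by (auto intro!: derivative_eq_intros DERIV_chain2[OF DERIV_J])
  from DERIV_divide[OF DERIV_Y[OF that(1), of n] this] J[OF that]
  show ?thesis by (simp add: h_def[abs_def] resonance_fun_def mult_ac)
 qed
 obtain z where z: "a < z" "z < x1 / 2" "h (x1 / 2) - h a = (x1 / 2 - a) * (resonance_fun n lam z / (?J (lam * z) * ?J (lam * z)))"
  using MVT2[OF a(3), of h "%x. resonance_fun n lam x / (?J (lam * x) * ?J (lam * x))"] D a x1 by force
 have z0: "0 < z" "z < x1" using z a x1 by auto
 have "0 < (x1 / 2 - a) * (resonance_fun n lam z / (?J (lam * z) * ?J (lam * z)))" using z a by simp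
 then have pos: "0 < resonance_fun n lam z"
  using a J[OF z0] by (simp add: zero_less_mult_iff zero_less_divide_iff)
 have cont: "isCont (resonance_fun n lam) x" if "0 < x" for x
 proof -
  have "0 < lam * x" using lam that by simp
  then show ?thesis unfolding resonance_fun_def[abs_def] using that
  by (intro continuous_intros isCont_bessel isCont_o2[OF _ isCont_bessel(1)] isCont_o2[OF _ isCont_bessel(3)]) auto
 qed
 have "\<exists>x\<ge>z. x <= x1 \<and> resonance_fun n lam x = 0"
  using pos neg z0 cont by (intro IVT2) auto
 then obtain x where x: "z <= x" "x <= x1" "resonance_fun n lam x = 0" by blast
 then have "x ~= x1" using neg by auto
 then show ?thesis using x z0 by (intro exI[of _ x]) auto
qed

text \<open>At \<open>x = j_n / lam\<close> the first term vanishes and the second is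
  \<open>- lam * J'\<close> at \<open>j_n\<close> times \<open>Y\<close> at
  \<open>j_n / lam\<close>. There \<open>J'\<close> is negative, and so is \<open>Y\<close>, because
  \<open>j_n / lam < y_n\<close>.\<close>

lemma exists_resonance_first_zero:
 assumes lam: "0 < lam" and less: "first_zero_J n / first_zero_Y n < lam"
 shows "\<exists>x. 0 < x \<and> lam * x < first_zero_J n \<and> resonance_fun n lam x = 0"
proof -
 let ?j = "first_zero_J n"
 have j: "0 < ?j" by (rule first_zero_J)
 have "?j / lam < first_zero_Y n"
  using less lam first_zero_Y(1)[of n] by (simp add: field_simps)
 then have "bessel_Y n (?j / lam) < 0" using j lam by (intro first_zero_Y) auto
 then have "0 < dJ n ?j * bessel_Y n (?j / lam)" using dJ_first_zero(1)[of n] by (simp add: mult_neg_neg)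
 then have "resonance_fun n lam (?j / lam) < 0"
  using lam first_zero_J(2)[of n] by (simp add: resonance_fun_def mult.assoc)
 moreover have "0 < JB n (lam * x)" if "0 < x" "x < ?j / lam" for x
  using that lam by (intro first_zero_J(3)) (auto simp: field_simps)
 ultimately obtain x where "0 < x" "x < ?j / lam" "resonance_fun n lam x = 0"
  using exists_resonance[OF lam, of "?j / lam" n] j lam by auto
 then show ?thesis using lam by (intro exI[of _ x]) (auto simp: field_simps)
qed

lemma zero_ratio_less_Least:
 assumes "1 < lam" "(LEAST n. first_zero_J n / first_zero_Y n < lam) <= n"
 shows "first_zero_J n / first_zero_Y n < lam"
 using assms(2)
proof (induction rule: dec_induct)
 case base
 show ?case using exists_zero_ratio_less[OF assms(1)] by (rule LeastI_ex)
next
 case (step n)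
 then show ?case using zero_ratio_antimono[of n] by simp
qed

section \<open>Explicit estimates for order zero and large contrast\<close>

lemma clifford_J_bounds:
 assumes "0 <= w" "w <= 1"
 shows "1 / fact n - w / fact (Suc n) <= clifford_J n w" "clifford_J n w <= 1 / fact n"
  "clifford_J n w <= 1 / fact n - w / fact (Suc n) + w^2 / (2 * fact (n + 2))"
proof -
 define a where "a k = w ^ k / (fact k * fact (n + k))" for k
 have eq: "clifford_J n w = (\<Sum>k. (- 1) ^ k * a k)" by (simp add: clifford_J_def a_def)
 have "summable (%k. w ^ k / fact k)" by (rule summable_power_fact)
 then have "(%k. w ^ k / fact k) \<longlonglongrightarrow> 0" by (rule summable_LIMSEQ_zero)
 then have lim: "a \<longlonglongrightarrow> 0"
 proof (rule Lim_null_comparison[rotated])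
  show "\<forall>\<^sub>F k in sequentially. norm (a k) <= w ^ k / fact k"
  using assms by (intro always_eventually allI) (auto simp: a_def divide_simps mult_le_cancel_left1 fact_ge_1)
 qed
 have pos: "0 <= a k" for k using assms by (simp add: a_def)
 have dec: "a (Suc k) <= a k" for k
 proof -
  have "w * w ^ k <= w ^ k" using assms by (simp add: mult_left_le_one_le)
  moreover have "fact k * fact (n + k) <= (fact (Suc k) * fact (n + Suc k) :: real)"
  by (intro mult_mono fact_mono) auto
  ultimately show ?thesis using assms unfolding a_def power_Suc by (intro frac_le) auto
 qed
 note L = summable_Leibniz'[OF lim pos dec]
 show "1 / fact n - w / fact (Suc n) <= clifford_J n w"
  using L(2)[of 1] unfolding eq by (simp add: a_def numeral_2_eq_2)
 show "clifford_J n w <= 1 / fact n" using L(4)[of 0] unfolding eq by (simp add: a_def)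
 show "clifford_J n w <= 1 / fact n - w / fact (Suc n) + w^2 / (2 * fact (n + 2))"
  using L(4)[of 1] unfolding eq by (simp add: a_def numeral_2_eq_2)
qed

text \<open>For order 0 the first term is kept exactly, as \<open>- 2 * euler_mascheroni\<close>;
  the rest is bounded crudely, since only very small \<open>v\<close> will occur.\<close>

lemma clifford_S_bounds:
 assumes "0 <= v"
 shows "- 2 * euler_mascheroni - 4 * v * exp v <= clifford_S 0 v" "clifford_S 1 v <= 3 * exp v"
proof -
 have ex: "(%k. v ^ k / fact k) sums exp v" using exp_converges[of v] by (simp add: scaleR_conv_of_real field_simps)
 define f where "f n k = (- 1) ^ k * (Digamma (real k + 1) + Digamma (real (n + k) + 1)) / (fact k * fact (n + k)) * v ^ k" for n k
 have f: "clifford_S n v = suminf (f n)" "summable (f n)" for n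
  using summable_clifford_S[of n v] unfolding clifford_S_def f_def by auto
 have b1: "f 1 k <= 3 * (v ^ k / fact k)" for k
 proof -
  have "\<bar>Digamma (real k + 1) + Digamma (real (1 + k) + 1)\<bar> <= 3 * real (Suc k)"
  using abs_Digamma_le[of k] abs_Digamma_le[of "1 + k"] by simp
  also have "... <= 3 * fact (Suc k)" using fact_ge_self[of "Suc k"] by (metis mult_left_mono of_nat_fact of_nat_le_iff zero_le_numeral)
  finally have D: "\<bar>Digamma (real k + 1) + Digamma (real (1 + k) + 1)\<bar> <= 3 * fact (Suc k)" .
  have "f 1 k <= \<bar>f 1 k\<bar>" by simp
  also have "... = \<bar>Digamma (real k + 1) + Digamma (real (1 + k) + 1)\<bar> / (fact k * fact (Suc k)) * v ^ k"
  using assms by (simp add: f_def abs_mult)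
  also have "... <= 3 * fact (Suc k) / (fact k * fact (Suc k)) * v ^ k"
  using assms by (intro mult_right_mono divide_right_mono D) auto
  also have "... = 3 * (v ^ k / fact k)" by (simp add: fact_Suc del: of_nat_Suc)
  finally show ?thesis .
 qed
 show "clifford_S 1 v <= 3 * exp v"
  unfolding f(1) sums_unique[OF ex] suminf_mult[OF sums_summable[OF ex], symmetric]
  by (intro suminf_le b1 f(2) summable_mult sums_summable[OF ex])
 have b0: "- (4 * v * (v ^ k / fact k)) <= f 0 (Suc k)" for k
 proof -
  have "\<bar>Digamma (real (Suc k) + 1) + Digamma (real (0 + Suc k) + 1)\<bar> <= 4 * real (Suc k)"
  using abs_Digamma_le[of "Suc k"] by simp
  also have "... <= 4 * real (Suc k) * fact (Suc k)" using fact_ge_1[of "Suc k", where 'a=real] by (simp add: mult_le_cancel_left1)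
  finally have D: "\<bar>Digamma (real (Suc k) + 1) + Digamma (real (0 + Suc k) + 1)\<bar> <= 4 * real (Suc k) * fact (Suc k)" .
  have "- f 0 (Suc k) <= \<bar>f 0 (Suc k)\<bar>" by simp
  also have "... = \<bar>Digamma (real (Suc k) + 1) + Digamma (real (0 + Suc k) + 1)\<bar> / (fact (Suc k) * fact (Suc k)) * v ^ Suc k"
  using assms unfolding f_def add_0 abs_mult abs_divide by simp
  also have "... <= 4 * real (Suc k) * fact (Suc k) / (fact (Suc k) * fact (Suc k)) * v ^ Suc k"
  using assms by (intro mult_right_mono divide_right_mono D) auto
  also have "... = 4 * v * (v ^ k / fact k)" by (simp add: fact_Suc del: of_nat_Suc)
  finally show ?thesis by simp
 qed
 have "- (4 * v) * exp v = (\<Sum>k. - (4 * v) * (v ^ k / fact k))"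
  unfolding sums_unique[OF ex] by (rule suminf_mult[OF sums_summable[OF ex], symmetric])
 also have "... <= (\<Sum>k. f 0 (Suc k))"
  by (intro suminf_le summable_mult sums_summable[OF ex] summable_shift f(2)) (use b0 in simp)
 also have "... = clifford_S 0 v - f 0 0" unfolding f(1) suminf_head[OF f(2)] by simp
 also have "f 0 0 = - 2 * euler_mascheroni" by (simp add: f_def Digamma_1)
 finally show "- 2 * euler_mascheroni - 4 * v * exp v <= clifford_S 0 v" by simp
qed

text \<open>\<open>X\<close> is chosen so that \<open>w = X^2 / 4\<close> satisfies
  \<open>2 * w * ln lam = (1 + 1 / (2 * sqrt (ln lam)))^2\<close>. At \<open>x = X / lam\<close> the
  resonance function is negative iff \<open>A * clifford_J 0 w < w * clifford_J 1 w * B\<close>,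
  where \<open>A\<close> is close to 1 and \<open>B\<close> grows like \<open>2 * ln lam\<close>. So
  the excess \<open>t\<close> of that square over 1 must pay for all corrections.\<close>

lemma exists_resonance_large_contrast:
 fixes lam :: real
 defines "X \<equiv> sqrt 2 / sqrt (ln lam) * (1 + 1 / (2 * sqrt (ln lam)))"
 assumes lam: "exp 2 < lam"
 shows "\<exists>x. 0 < x \<and> lam * x < X \<and> resonance_fun 0 lam x = 0" and "0 < X"
proof -
 have lam0: "0 < lam" using lam by (rule less_trans[OF exp_gt_zero])
 define L where "L = ln lam"
 have L: "2 < L" using lam lam0 by (simp add: L_def ln_less_cancel_iff[of "exp 2" lam, simplified ln_exp])
 define s where "s = sqrt L"
 have s: "0 < s" "s * s = L" "1.41 < s"
 proof -
  show "0 < s" "s * s = L" using L by (auto simp: s_def)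
  have "sqrt (1.41\<^sup>2) < sqrt L" using L by (intro real_sqrt_less_mono) (simp add: power2_eq_square)
  then show "1.41 < s" by (simp add: s_def)
 qed
 define w where "w = X^2 / 4"
 define t where "t = 1 / s + 1 / (4 * L)"
 have X: "X = sqrt 2 / s * (1 + 1 / (2 * s))" by (simp add: X_def s_def L_def)
 show X0: "0 < X" using s by (simp add: X add_pos_pos)
 have wL: "w * (2 * L) = 1 + t"
  using s unfolding w_def X t_def s(2)[symmetric] by (simp add: power2_eq_square field_simps)
 have sL: "1 / s = s / L" using s(1) L unfolding s(2)[symmetric] by simp
 \<comment> \<open>\<open>1 / s = s / L >= 1.41 / L\<close> and
   \<open>1 / (4 * L) = 0.25 / L\<close>.\<close>
 have t: "1.66 / L <= t" using s L unfolding t_def sL by (simp add: field_simps)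
 have si: "1 / s < 0.7093" using s by (simp add: field_simps)
 have "1 / (4 * L) <= 0.125" using L by (simp add: field_simps)
 then have "w * (2 * L) <= 1.836" using si by (simp add: wL t_def)
 then have w1: "w * L <= 0.918" by simp
 have w0: "0 < w" using X0 by (simp add: w_def)
 have "w * 2 <= w * L" using L w0 by simp
 then have w: "w <= 0.46" using w1 by simp
 \<comment> \<open>The excess pays for \<open>1.8 * w\<close>, because \<open>w * L <= 0.918\<close>
   and \<open>1.8 * 0.918 < 1.66\<close>.\<close>
 have tw: "1.8 * w <= t"
 proof -
  have "w <= 0.918 / L" using w1 L by (simp add: field_simps)
  then have "1.8 * w <= 1.8 * (0.918 / L)" by simp
  also have "... = 1.6524 / L" by simp
  also have "... <= 1.66 / L" using L by (intro divide_right_mono) auto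
  finally show ?thesis using t by simp
 qed
 have lnw: "ln w <= 0" "- ln w <= 2 * L - 1"
 proof -
  show "ln w <= 0" using w w0 by simp
  have "0 <= t" using tw w0 by simp
  then have "1 <= w * (2 * L)" using wL by simp
  then have "0 <= ln (w * (2 * L))" by simp
  also have "... = ln w + ln (2 * L)" using w0 L by (simp add: ln_mult)
  also have "ln (2 * L) <= 2 * L - 1" using L by (intro ln_le_minus_one) auto
  finally show "- ln w <= 2 * L - 1" by simp
 qed
 \<comment> \<open>\<open>7 <= exp 2 < lam\<close>, the former by the eighth power of a Taylor bound
   for \<open>exp (1 / 4)\<close>, and \<open>1 + L <= exp L = lam\<close>. So
   \<open>v = w / lam^2\<close> remains small even after multiplication by
   \<open>1 + L\<close>.\<close>
 have E: "7 * (1 + L) <= lam^2"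
 proof -
  have "1 + 1 / 4 + (1 / 4)^2 / 2 <= exp (1 / 4 :: real)" by (rule exp_lower_Taylor_quadratic) simp
  then have "(1.28125 :: real) ^ 8 <= exp (1 / 4) ^ 8" by (intro power_mono) (simp_all add: power2_eq_square)
  also have "... = exp 2" by (simp add: exp_of_nat_mult[symmetric])
  finally have e8: "(1.28125 :: real) ^ 8 <= exp 2" .
  have "7 <= (1.28125 :: real) ^ 8" by (simp add: power_divide)
  then have "7 <= lam" using e8 lam by linarith
  moreover have "1 + L <= lam"
  proof -
  have "exp L = lam" using lam0 by (simp add: L_def)
  then show ?thesis using exp_ge_add_one_self[of L] by simp
  qed
  ultimately show ?thesis using L unfolding power2_eq_square by (intro mult_mono) auto
 qed
 define v where "v = w / lam^2"
 have v0: "0 < v" using w0 lam0 by (simp add: v_def)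
 have v1: "v * (1 + L) <= w / 7"
 proof -
  have "v * (7 * (1 + L)) <= v * lam^2" using E v0 by simp
  also have "... = w" using lam0 by (simp add: v_def)
  finally show ?thesis by (simp add: algebra_simps)
 qed
 have "v * 3 <= v * (1 + L)" using v0 L by simp
 then have v: "v <= 0.022" using v1 w by simp
 have ev: "exp v <= 1.03"
 proof -
  have "exp v <= 1 + v + v^2" using v v0 by (intro exp_bound) auto
  also have "v^2 <= 0.022\<^sup>2" using v v0 by (intro power_mono) auto
  finally show ?thesis using v by (simp add: power2_eq_square)
 qed
 have lnv: "ln v = ln w - 2 * L" using w0 lam0 by (simp add: v_def L_def ln_div ln_realpow)
 have C0v: "1 - v <= clifford_J 0 v" and C1v: "0 <= clifford_J 1 v" "clifford_J 1 v <= 1"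
  using clifford_J_bounds[of v 0] clifford_J_bounds[of v 1] v v0 by auto
 \<comment> \<open>The alternating bound \<open>1 - w + w^2 / 4\<close> is a perfect square; one
   factor \<open>1 - w / 2\<close> will cancel against the lower bound of
   \<open>clifford_J 1 w\<close>.\<close>
 have C0w: "clifford_J 0 w <= (1 - w / 2)^2" and C1w: "1 - w / 2 <= clifford_J 1 w"
  using clifford_J_bounds[of w 0] clifford_J_bounds[of w 1] w w0 by (auto simp: power2_eq_square algebra_simps)
 have C0w0: "0 <= clifford_J 0 w" using clifford_J_bounds(1)[of w 0] w w0 by simp
 define x where "x = X / lam"
 have x0: "0 < x" using X0 lam0 by (simp add: x_def)
 have xv: "x^2 / 4 = v" by (simp add: x_def v_def w_def power_divide)
 have lx: "lam * x = X" using lam0 by (simp add: x_def)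
 define B where "B = - pi * bessel_Y 0 x"
 define A where "A = - pi / 2 * (x * bessel_Y 1 x)"
 \<comment> \<open>The loss 1.413 covers \<open>2 * euler_mascheroni < 13 / 11\<close>, the digamma
   remainder \<open>4 * 0.022 * 1.03\<close>, and \<open>2 * L * v <= 0.132\<close>.\<close>
 have B: "2 * L - 1.413 <= B"
 proof -
  have "B = - (ln v * clifford_J 0 v - clifford_S 0 v)"
  unfolding B_def bessel_Y_clifford[OF x0] xv clifford_Y_def by (simp add: clifford_P_def)
  then have "B = (2 * L - ln w) * clifford_J 0 v + clifford_S 0 v" unfolding lnv by (simp add: algebra_simps)
  moreover have "2 * L * (1 - v) <= (2 * L - ln w) * clifford_J 0 v"
  using lnw L C0v v by (intro mult_mono) auto
  moreover have "- 13 / 11 - 4 * v * exp v <= clifford_S 0 v"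
  using clifford_S_bounds(1)[of v] v0 euler_mascheroni_less_13_over_22 by simp
  moreover have "4 * v * exp v <= 4 * 0.022 * 1.03" using v v0 ev by (intro mult_mono) auto
  moreover have "2 * (v * (1 + L)) <= 2 * (0.46 / 7)" using v1 w by simp
  then have "2 * (L * v) <= 0.132" using v0 by (simp add: algebra_simps)
  ultimately show ?thesis by (simp add: algebra_simps)
 qed
 \<comment> \<open>The correction to 1 is at most
   \<open>4 * v * (1 + L) <= 4 / 7 * w\<close>.\<close>
 have A: "A <= 1 + 0.6 * w"
 proof -
  have "A = 1 + v * ((2 * L - ln w) * clifford_J 1 v) + v * clifford_S 1 v"
  proof -
  have "A = - pi / 2 * (4 * (x^2 / 4) / 2 * clifford_Y 1 v)"
  unfolding A_def bessel_Y_clifford[OF x0] xv by (simp add: power2_eq_square xv[symmetric])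
  also have "... = - pi * v * clifford_Y 1 v" unfolding xv by simp
  also have "... = - v * (ln v * clifford_J 1 v - 1 / v - clifford_S 1 v)" by (simp add: clifford_Y_def clifford_P_def)
  also have "... = 1 + v * ((2 * L - ln w) * clifford_J 1 v) + v * clifford_S 1 v"
  using v0 by (simp add: lnv algebra_simps)
  finally show ?thesis .
  qed
  also have "(2 * L - ln w) * clifford_J 1 v <= (4 * L - 1) * 1" using lnw L C1v by (intro mult_mono) auto
  also have "clifford_S 1 v <= 3.09" using clifford_S_bounds(2)[of v] v0 ev by simp
  finally have "A <= 1 + v * ((4 * L - 1) * 1) + v * 3.09" using v0 by simp
  also have "... <= 1 + 4 * (v * (1 + L))" using v0 by (simp add: algebra_simps)
  finally show ?thesis using v1 w0 by simp
 qed
 have AB: "A * clifford_J 0 w < w * clifford_J 1 w * B"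
 proof -
  have "A * clifford_J 0 w <= (1 + 0.6 * w) * (1 - w / 2)^2" using A C0w C0w0 w0 by (intro mult_mono) auto
  also have "... = ((1 + 0.6 * w) * (1 - w / 2)) * (1 - w / 2)" by (simp add: power2_eq_square)
  also have "(1 + 0.6 * w) * (1 - w / 2) < w * (2 * L - 1.413)"
  proof -
  have Q: "1 + 0.1 * w - Q < 1 + 1.8 * w - 1.413 * w" if "0 < Q" for Q using w0 that by simp
  have "(1 + 0.6 * w) * (1 - w / 2) = 1 + 0.1 * w - 0.3 * (w * w)" by (simp add: field_simps)
  also have "... < 1 + 1.8 * w - 1.413 * w" using w0 by (intro Q) simp
  also have "... <= 1 + t - 1.413 * w" using tw by simp
  also have "... = w * (2 * L - 1.413)" using wL by (simp add: algebra_simps)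
  finally show ?thesis .
  qed
  also have "w * (2 * L - 1.413) <= w * B" using B w0 by simp
  finally have "A * clifford_J 0 w < (w * B) * (1 - w / 2)" using w by (simp add: mult_strict_right_mono)
  also have "... <= (w * B) * clifford_J 1 w" using C1w B L w0 by (intro mult_left_mono) auto
  finally show ?thesis by (simp add: mult_ac)
 qed
 have "x * resonance_fun 0 lam x = - (x * bessel_Y 1 x) * bessel_J 0 X + X * bessel_J 1 X * bessel_Y 0 x"
  using lx[symmetric] by (simp add: resonance_fun_def dY_def dJ_def algebra_simps)
 also have "- (x * bessel_Y 1 x) = 2 / pi * A" by (simp add: A_def)
 also have "bessel_J 0 X = clifford_J 0 w" using bessel_J_clifford[OF X0, of 0] by (simp add: w_def)
 also have "X * bessel_J 1 X = 2 * w * clifford_J 1 w" using bessel_J_clifford[OF X0, of 1] by (simp add: w_def power2_eq_square)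
 also have "bessel_Y 0 x = - B / pi" by (simp add: B_def)
 finally have "x * resonance_fun 0 lam x = 2 / pi * (A * clifford_J 0 w - w * clifford_J 1 w * B)" by (simp add: algebra_simps)
 also have "... < 0" using AB by (intro mult_pos_neg) auto
 finally have "x * resonance_fun 0 lam x < 0" .
 then have neg: "resonance_fun 0 lam x < 0" using x0 by (simp add: mult_less_0_iff)
 have "0 < JB 0 (lam * y)" if y: "0 < y" "y < x" for y
 proof -
  have ly: "0 < lam * y" "lam * y < X" using y lam0 lx by (auto simp: lx[symmetric])
  have "(lam * y)^2 / 4 <= w" unfolding w_def using ly by (intro divide_right_mono power_mono) auto
  then have "0 < clifford_J 0 ((lam * y)^2 / 4)" using clifford_J_bounds(1)[of "(lam * y)^2 / 4" 0] w by simp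
  then show ?thesis using bessel_J_clifford[OF ly(1), of 0] by simp
 qed
 from exists_resonance[OF lam0 x0 this neg]
 obtain y where "0 < y" "y < x" "resonance_fun 0 lam y = 0" by auto
 then show "\<exists>x. 0 < x \<and> lam * x < X \<and> resonance_fun 0 lam x = 0"
  using lam0 lx by (intro exI[of _ y]) (auto simp: lx[symmetric])
qed

section \<open>Integration over the plane in polar form\<close>

lemma Basis_real_2: "(Basis :: (real ^ 2) set) = {axis 1 1, axis 2 1}"
 by (simp add: Basis_vec_def UNIV_2 doubleton_eq_iff)

text \<open>The bridge from \<open>real ^ 2\<close>, whose orthogonal maps preserve Lebesgue
  measure, to the complex plane and its rotations.\<close>

lemma distr_lborel_vec_complex:
 "distr (lborel :: (real ^ 2) measure) borel (%v. Complex (v $ 1) (v $ 2)) = lborel"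
proof (rule lborel_eqI[symmetric])
 have m: "(%v :: real ^ 2. Complex (v $ 1) (v $ 2)) \<in> borel_measurable borel"
  by (intro borel_measurable_continuous_onI) (auto simp: Complex_eq intro!: continuous_intros)
 fix l u :: complex
 assume le: "!!b. b \<in> Basis ==> l \<bullet> b <= u \<bullet> b"
 let ?W = "%z. vector [Re z, Im z] :: real ^ 2"
 have "(%v :: real ^ 2. Complex (v $ 1) (v $ 2)) -` box l u = box (?W l) (?W u)"
  by (intro set_eqI) (auto simp: mem_box Basis_complex_def Basis_real_2 inner_axis)
 then have "emeasure (distr lborel borel (%v :: real ^ 2. Complex (v $ 1) (v $ 2))) (box l u) = emeasure lborel (box (?W l) (?W u))"
  by (subst emeasure_distr) (use m in auto)
 also have "... = ennreal (\<Prod>b\<in>Basis. (?W u - ?W l) \<bullet> b)"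
  using le[of 1] le[of \<i>] by (intro emeasure_lborel_box) (auto simp: Basis_real_2 Basis_complex_def inner_axis)
 also have "(\<Prod>b\<in>Basis. (?W u - ?W l) \<bullet> b) = (\<Prod>b\<in>Basis. (u - l) \<bullet> b)"
  by (simp add: Basis_real_2 Basis_complex_def inner_axis axis_eq_axis)
 finally show "emeasure (distr lborel borel (%v :: real ^ 2. Complex (v $ 1) (v $ 2))) (box l u) = ennreal (\<Prod>b\<in>Basis. (u - l) \<bullet> b)" .
qed simp

lemma distr_lborel_rotation: "distr lborel borel (%z. cis th * z) = (lborel :: complex measure)"
proof (rule lborel_eqI[symmetric])
 let ?V = "%v :: real ^ 2. Complex (v $ 1) (v $ 2)" and ?W = "%z. vector [Re z, Im z] :: real ^ 2"
 define T where "T v = ?W (cis (- th) * ?V v)" for v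
 have V: "?V \<in> borel_measurable borel"
  by (intro borel_measurable_continuous_onI) (auto simp: Complex_eq intro!: continuous_intros)
 have rot: "(%z. cis th * z) \<in> borel_measurable borel" by simp
 have WV: "vector [v $ 1, v $ 2] = v" for v :: "real ^ 2" by (simp add: vec_eq_iff forall_2)
 have VW: "?V (?W z) = z" for z by (simp add: complex_eq_iff)
 have norm_V: "norm (?V v) = norm v" for v by (simp add: norm_vec_def L2_set_def sum_2 cmod_def)
 have "linear T"
  by (intro linearI) (auto simp: T_def vec_eq_iff forall_2 algebra_simps)
 moreover have "norm (T v) = norm v" for v
  unfolding T_def norm_V[symmetric] VW by (simp add: norm_mult)
 ultimately have T: "orthogonal_transformation T" by (simp add: orthogonal_transformation)
 fix l u :: complex
 assume le: "!!b. b \<in> Basis ==> l \<bullet> b <= u \<bullet> b"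
 let ?B = "?V -` box l u"
 have B: "?B = box (?W l) (?W u)" by (intro set_eqI) (auto simp: mem_box Basis_complex_def Basis_real_2 inner_axis)
 have rb: "(%z. cis th * z) -` box l u \<in> sets borel" using measurable_sets[OF rot, of "box l u"] by simp
 have pre: "?V -` ((%z. cis th * z) -` box l u) = T ` ?B"
 proof -
  have TW: "v = T (?W (cis th * ?V v))" for v
  unfolding T_def VW by (simp add: mult.assoc[symmetric] cis_mult WV)
  have VT: "cis th * ?V (T v) = ?V v" for v
  unfolding T_def VW by (simp add: mult.assoc[symmetric] cis_mult)
  show ?thesis
  proof (intro set_eqI iffI)
  fix v assume "v \<in> ?V -` ((%z. cis th * z) -` box l u)"
  then have "cis th * ?V v \<in> box l u" unfolding vimage_def by blast
  then have "?V (?W (cis th * ?V v)) \<in> box l u" unfolding VW .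
  then show "v \<in> T ` ?B" using TW[of v] unfolding vimage_def by blast
  next
  fix v assume "v \<in> T ` ?B"
  then obtain w where w: "v = T w" "?V w \<in> box l u" by blast
  have "cis th * ?V v \<in> box l u" unfolding w(1) VT by (rule w(2))
  then show "v \<in> ?V -` ((%z. cis th * z) -` box l u)" unfolding vimage_def by blast
  qed
 qed
 have lm: "?B \<in> lmeasurable" unfolding B by simp
 have tm: "T ` ?B \<in> lmeasurable" using measurable_orthogonal_image[OF T lm] .
 have bs: "T ` ?B \<in> sets borel" unfolding pre[symmetric] using measurable_sets[OF V rb] by simp
 have "emeasure (distr lborel borel (%z. cis th * z)) (box l u) = emeasure lborel ((%z. cis th * z) -` box l u)"
  by (subst emeasure_distr) auto
 also have "... = emeasure lborel (T ` ?B)"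
  by (subst distr_lborel_vec_complex[symmetric], subst emeasure_distr) (use V rb pre in auto)
 also have "... = emeasure lebesgue (T ` ?B)" using bs by simp
 also have "... = emeasure lebesgue ?B"
  using measure_orthogonal_image[OF T lm] tm lm by (simp add: emeasure_eq_measure2 fmeasurableD2)
 also have "... = emeasure lborel ?B" unfolding B by simp
 also have "... = emeasure lborel (box l u)"
 proof -
  have "emeasure lborel ?B = emeasure (distr lborel borel ?V) (box l u)" by (subst emeasure_distr) (use V in auto)
  then show ?thesis unfolding distr_lborel_vec_complex .
 qed
 also have "... = ennreal (\<Prod>b\<in>Basis. (u - l) \<bullet> b)" by (rule emeasure_lborel_box[OF le])
 finally show "emeasure (distr lborel borel (%z. cis th * z)) (box l u) = ennreal (\<Prod>b\<in>Basis. (u - l) \<bullet> b)" .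
qed simp

text \<open>The area of a disc is linear in the squared radius, so the radial part of plane measure
  has constant density \<open>pi\<close> in this variable. It is enough to compare half-lines, a
  generating family stable under intersection.\<close>

lemma distr_lborel_norm_square:
 "distr lborel borel (%z :: complex. (norm z)\<^sup>2) = density lborel (%rh. ennreal (pi * indicator {0..} rh))"
  (is "?M = ?N")
proof (rule measure_eqI_generator_eq[where E="range atMost" and \<Omega>=UNIV and A="%i. {..real i}"])
 have emM: "emeasure ?M {..t} = ennreal (if t <= 0 then 0 else pi * t)" for t
 proof -
  have "emeasure ?M {..t} = emeasure lborel {z :: complex. (norm z)\<^sup>2 <= t}"
  by (subst emeasure_distr) (auto simp: vimage_def)
  also have "{z :: complex. (norm z)\<^sup>2 <= t} = (if t < 0 then {} else cball 0 (sqrt t))"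
  using real_le_rsqrt real_sqrt_le_iff
  by (auto simp: not_less real_le_rsqrt sqrt_le_D) (smt (verit) zero_le_power2, smt (verit) norm_ge_zero real_sqrt_pow2 power_mono)
  also have "emeasure lborel ... = ennreal (if t <= 0 then 0 else pi * t)"
  using emeasure_cball[of "sqrt t" "0 :: complex"] by (auto simp: unit_ball_vol_2 not_less power2_eq_square)
  finally show ?thesis .
 qed
 have emN: "emeasure ?N {..t} = ennreal (if t <= 0 then 0 else pi * t)" for t
 proof -
  have "emeasure ?N {..t} = (\<integral>\<^sup>+rh. ennreal (pi * indicator {0..} rh) * indicator {..t} rh \<partial>lborel)"
  by (subst emeasure_density) auto
  also have "... = (\<integral>\<^sup>+rh. ennreal pi * indicator {0..t} rh \<partial>lborel)"
  by (intro nn_integral_cong) (auto simp: indicator_def)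
  also have "... = ennreal (if t <= 0 then 0 else pi * t)"
  by (subst nn_integral_cmult_indicator) (auto simp: emeasure_lborel_Icc_eq ennreal_mult)
  finally show ?thesis .
 qed
 show "Int_stable (range (atMost :: real => _))" by (auto simp: Int_stable_def)
 show "emeasure ?M X = emeasure ?N X" if "X \<in> range atMost" for X using that emM emN by auto
 show "sets ?M = sigma_sets UNIV (range atMost)" "sets ?N = sigma_sets UNIV (range atMost)"
  by (simp_all add: borel_eq_atMost)
 show "(\<Union>i. {..real i}) = UNIV" using real_arch_simple by auto
 show "emeasure ?M {..real i} ~= \<infinity>" for i unfolding emM by simp
qed auto

lemma integral_periodic_shift:
 fixes f :: "real => complex"
 assumes f: "continuous_on UNIV f" and per: "!!x. f (x + 2 * pi) = f x" and al: "0 <= al" "al <= 2 * pi"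
 shows "integral {0..2 * pi} (%x. f (x + al)) = integral {0..2 * pi} f"
proof -
 have int: "f integrable_on {a..b}" for a b
  by (intro integrable_continuous_interval continuous_on_subset[OF f]) auto
 have sh: "integral {a..b} (%x. f (x + c)) = integral {a + c..b + c} f" for a b c
  using integral_shift[of a c b f] continuous_on_subset[OF f] by (auto simp: o_def)
 have "integral {0..2 * pi} (%x. f (x + al)) = integral {al..2 * pi + al} f" using sh[of 0 "2 * pi" al] by simp
 also have "... = integral {al..2 * pi} f + integral {2 * pi..2 * pi + al} f"
  using al int by (intro Henstock_Kurzweil_Integration.integral_combine[symmetric]) auto
 also have "integral {2 * pi..2 * pi + al} f = integral {0..al} f"
  using sh[of 0 al "2 * pi"] by (simp add: per add.commute)
 also have "integral {al..2 * pi} f + integral {0..al} f = integral {0..2 * pi} f"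
  using al int by (subst add.commute) (intro Henstock_Kurzweil_Integration.integral_combine, auto)
 finally show ?thesis .
qed

text \<open>The \<open>m\<close>-th Fourier coefficient on the circle of squared radius
  \<open>rh\<close>, times \<open>r ^ m\<close>; the factor comes from pairing with
  \<open>cnj z ^ m\<close>. As \<open>sqrt\<close> is continuous on the whole line, so is the
  profile of a continuous field.\<close>

definition mode_profile :: "(complex => complex) => nat => real => complex" where
 "mode_profile u m rh = circle_coeff u (sqrt rh) (int m) * of_real (sqrt rh ^ m)"

lemma continuous_on_circle_coeff:
 assumes "continuous_on UNIV u"
 shows "continuous_on UNIV (%r. circle_coeff u r n)"
proof -
 have "continuous_on (UNIV \<times> cbox 0 (2 * pi)) (%(r, th). u (rcis r th) * cis (- (of_int n * th)))"
  unfolding split_beta rcis_def by (intro continuous_intros continuous_on_compose2[OF assms]) auto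
 from integral_continuous_on_param[OF this] show ?thesis
  unfolding circle_coeff_def by (intro continuous_intros) auto
qed

lemma continuous_on_mode_profile:
 assumes "continuous_on UNIV u"
 shows "continuous_on UNIV (mode_profile u m)"
 unfolding mode_profile_def[abs_def]
proof (intro continuous_on_mult)
 show "continuous_on UNIV (%rh. circle_coeff u (sqrt rh) (int m))"
  by (rule continuous_on_compose2[OF continuous_on_circle_coeff[OF assms], of UNIV sqrt]) (auto intro: continuous_intros)
 show "continuous_on UNIV (%rh. of_real (sqrt rh ^ m) :: complex)" by (intro continuous_intros)
qed

text \<open>Polar integration without a change of variables: the plane integral is averaged over all
  rotations, Fubini turns the angular average into a Fourier coefficient that depends on
  \<open>|z|^2\<close> only, and the push-forward of plane measure under \<open>|z|^2\<close>
  finishes.\<close>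

lemma plane_integral_mode:
 assumes u: "continuous_on UNIV u" and G: "G \<in> borel_measurable borel" "!!rh. \<bar>G rh\<bar> <= B" "!!rh. G rh ~= 0 ==> a <= rh \<and> rh <= b" and a: "0 < a"
 shows "(LINT z|lborel. u z * (of_real (G ((norm z)^2)) * cnj z ^ m)) = of_real pi * (LINT rh|lborel. of_real (G rh) * mode_profile u m rh)"
proof -
 define F where "F z = u z * (of_real (G ((norm z)^2)) * cnj z ^ m)" for z
 have um [measurable]: "u \<in> borel_measurable borel" by (rule borel_measurable_continuous_onI[OF u])
 have cm [measurable]: "(%z. cnj z ^ m) \<in> borel_measurable borel" by (intro borel_measurable_continuous_onI continuous_intros)
 have [measurable]: "G \<in> borel_measurable borel" by fact
 have Fm [measurable]: "F \<in> borel_measurable borel" unfolding F_def[abs_def] by measurable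
 have F0: "F z = 0" if "z \<notin> cball (0 :: complex) (sqrt b)" for z
 proof -
  have "G ((norm z)^2) = 0"
  using that G(3)[of "(norm z)^2"] real_le_rsqrt[of "norm z" b] by auto
  then show ?thesis by (simp add: F_def)
 qed
 obtain C where C: "!!z. z \<in> cball (0 :: complex) (sqrt b) ==> norm (u z * cnj z ^ m) <= C"
 proof -
  have "compact ((%z. u z * cnj z ^ m) ` cball (0 :: complex) (sqrt b))"
  by (intro compact_continuous_image continuous_intros continuous_on_subset[OF u]) auto
  from compact_imp_bounded[OF this] show ?thesis using that unfolding bounded_iff by blast
 qed
 have FB: "norm (F z) <= C * B" if "z \<in> cball (0 :: complex) (sqrt b)" for z
 proof -
  have "norm (F z) = norm (u z * cnj z ^ m) * \<bar>G ((norm z)^2)\<bar>" by (simp add: F_def norm_mult)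
  also have "... <= C * B" using C[OF that] G(2) order_trans[OF norm_ge_zero C[OF that]] by (intro mult_mono) auto
  finally show ?thesis .
 qed
 define H where "H th z = indicator {0..2 * pi} th *\<^sub>R F (cis th * z)" for th :: real and z
 have Hm: "(%p. H (fst p) (snd p)) \<in> borel_measurable (lborel \<Otimes>\<^sub>M lborel)"
 proof -
  have "(%p :: real \<times> complex. cis (fst p) * snd p) \<in> borel_measurable (borel \<Otimes>\<^sub>M borel)"
  unfolding borel_prod by (intro borel_measurable_continuous_onI continuous_intros)
  then have [measurable]: "(%p :: real \<times> complex. cis (fst p) * snd p) \<in> borel_measurable (lborel \<Otimes>\<^sub>M lborel)"
  by (simp cong: measurable_cong_sets sets_pair_measure_cong)
  show ?thesis unfolding H_def by measurable
 qed
 have Hint: "integrable (lborel \<Otimes>\<^sub>M lborel) (%p. H (fst p) (snd p))"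
 proof (rule integrableI_bounded_set[where A="{0..2 * pi} \<times> cball (0 :: complex) (sqrt b)" and B="C * B"])
  show "emeasure (lborel \<Otimes>\<^sub>M lborel) ({0..2 * pi} \<times> cball (0 :: complex) (sqrt b)) < \<infinity>"
  by (subst lborel.emeasure_pair_measure_Times) (use emeasure_lborel_cball_finite[of "0 :: complex" "sqrt b"] in \<open>auto simp: ennreal_mult_less_top\<close>)
  show "AE p in lborel \<Otimes>\<^sub>M lborel. p \<in> {0..2 * pi} \<times> cball (0 :: complex) (sqrt b) --> norm (H (fst p) (snd p)) <= C * B"
  using FB by (intro always_eventually) (auto simp: H_def norm_mult)
  show "AE p in lborel \<Otimes>\<^sub>M lborel. p \<notin> {0..2 * pi} \<times> cball (0 :: complex) (sqrt b) --> H (fst p) (snd p) = 0"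
  using F0 by (intro always_eventually) (auto simp: H_def norm_mult indicator_def)
 qed (use Hm in auto)
 have rot: "(LINT z|lborel. F (cis th * z)) = integral\<^sup>L lborel F" for th
 proof -
  have "integral\<^sup>L (distr lborel borel (%z. cis th * z)) F = (LINT z|lborel. F (cis th * z))"
  by (rule integral_distr) auto
  then show ?thesis by (simp add: distr_lborel_rotation)
 qed
 have inner: "(LINT th|lborel. H th z) = of_real (2 * pi) * (of_real (G ((norm z)^2)) * mode_profile u m ((norm z)^2))" for z
 proof (cases "z = 0")
  case True
  then have "G ((norm z)^2) = 0" using G(3)[of 0] a by fastforce
  then show ?thesis using True by (simp add: H_def F_def)
 next
  case False
  define r where "r = norm z"
  define al where "al = Arg2pi z"
  have al: "0 <= al" "al <= 2 * pi" using Arg2pi_ge_0 Arg2pi_lt_2pi less_imp_le by (auto simp: al_def)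
  have z: "z = rcis r al" using Arg2pi_eq[of z] by (simp add: rcis_def cis_conv_exp r_def al_def mult.commute)
  define f where "f th = u (rcis r th) * cis (- (of_int (int m) * th))" for th
  have fc: "continuous_on UNIV f" unfolding f_def rcis_def by (intro continuous_intros continuous_on_compose2[OF u]) auto
  have per: "f (x + 2 * pi) = f x" for x
  proof -
  have "cis (- (real m * (x + 2 * pi))) = cis (- (real m * x)) * cis (2 * pi * - real m)"
  by (simp add: cis_mult algebra_simps)
  also have "cis (2 * pi * - real m) = 1" by (rule cis_multiple_2pi) simp
  finally show ?thesis by (simp add: f_def rcis_def cis_mult[symmetric])
  qed
  have Hf: "H th z = (of_real (G (r^2)) * of_real (r ^ m)) * (indicator {0..2 * pi} th *\<^sub>R f (th + al))" for th
  proof -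
  have "cis th * z = rcis r (th + al)" unfolding z rcis_def by (simp add: cis_mult mult_ac add.commute)
  moreover have "cnj (rcis r ph) ^ m = of_real (r ^ m) * cis (- (of_int (int m) * ph))" for ph
  proof -
  have "cnj (rcis r ph) ^ m = of_real (r ^ m) * cis (- ph) ^ m" by (simp add: rcis_def power_mult_distrib cis_cnj)
  also have "cis (- ph) ^ m = cis (- (of_int (int m) * ph))" by (simp only: Complex.DeMoivre of_int_of_nat_eq mult_minus_right)
  finally show ?thesis .
  qed
  moreover have "norm (rcis r (th + al)) = r" by (simp add: r_def)
  ultimately show ?thesis by (simp add: H_def F_def f_def mult_ac scaleR_conv_of_real)
  qed
  have "(LINT th|lborel. H th z) = (of_real (G (r^2)) * of_real (r ^ m)) * (LINT th|lborel. indicator {0..2 * pi} th *\<^sub>R f (th + al))"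
  unfolding Hf by (rule integral_mult_right_zero)
  also have "(LINT th|lborel. indicator {0..2 * pi} th *\<^sub>R f (th + al)) = integral {0..2 * pi} (%th. f (th + al))"
  unfolding set_lebesgue_integral_def[symmetric]
  by (intro set_borel_integral_eq_integral borel_integrable_atLeastAtMost' continuous_on_compose2[OF fc] continuous_intros) auto
  also have "... = integral {0..2 * pi} f" by (rule integral_periodic_shift[OF fc per al])
  finally have "(LINT th|lborel. H th z) = (of_real (G (r^2)) * of_real (r ^ m)) * integral {0..2 * pi} f" .
  moreover have "sqrt (r^2) = r" by (simp add: r_def)
  ultimately show ?thesis unfolding r_def[symmetric] mode_profile_def circle_coeff_def by (simp add: f_def[abs_def])
 qed
 define I where "I = integral\<^sup>L lborel F"
 have "(LINT z|lborel. H th z) = indicator {0..2 * pi} th *\<^sub>R I" for th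
  unfolding H_def by (simp only: integral_scaleR_right rot I_def)
 then have "(LINT th|lborel. LINT z|lborel. H th z) = (LINT th|lborel. indicator {0..2 * pi} th *\<^sub>R I)"
  by (simp only:)
 also have "... = of_real (2 * pi) * I" by (simp add: scaleR_conv_of_real)
 finally have "of_real (2 * pi) * I = (LINT th|lborel. LINT z|lborel. H th z)" by (rule sym)
 also have "... = (LINT z|lborel. LINT th|lborel. H th z)"
  using lborel_pair.Fubini_integral[of H] Hint by (simp add: split_beta')
 also have "... = of_real (2 * pi) * (LINT z|lborel. of_real (G ((norm (z :: complex))^2)) * mode_profile u m ((norm z)^2))"
  unfolding inner by (rule integral_mult_right_zero)
 finally have "I = (LINT z|lborel. of_real (G ((norm (z :: complex))^2)) * mode_profile u m ((norm z)^2))"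
  by (rule mult_left_cancel[THEN iffD1, rotated]) simp
 also have "... = (LINT rh|distr lborel borel (%z :: complex. (norm z)\<^sup>2). of_real (G rh) * mode_profile u m rh)"
  using borel_measurable_continuous_onI[OF continuous_on_mode_profile[OF u]] by (intro integral_distr[symmetric]) auto
 also have "... = (LINT rh|lborel. (pi * indicator {0..} rh) *\<^sub>R (of_real (G rh) * mode_profile u m rh))"
  unfolding distr_lborel_norm_square
  using borel_measurable_continuous_onI[OF continuous_on_mode_profile[OF u]] by (intro integral_density) auto
 also have "... = (LINT rh|lborel. of_real pi * (of_real (G rh) * mode_profile u m rh))"
 proof (intro Bochner_Integration.integral_cong refl)
  fix rh :: real
  show "(pi * indicator {0..} rh) *\<^sub>R (of_real (G rh) * mode_profile u m rh) = of_real pi * (of_real (G rh) * mode_profile u m rh)"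
  using G(3)[of rh] a by (cases "G rh = 0") (auto simp: scaleR_conv_of_real)
 qed
 also have "... = of_real pi * (LINT rh|lborel. of_real (G rh) * mode_profile u m rh)" by (rule integral_mult_right_zero)
 finally show ?thesis unfolding I_def F_def[abs_def] .
qed

section \<open>The radial equation of a Fourier mode\<close>

lemma test_funI:
 assumes d: "!!z. (ph has_derivative ph' z) (at z)"
  and c: "continuous_on UNIV (%z. ph' z 1)" "continuous_on UNIV (%z. ph' z \<i>)"
  and s: "!!z. R < norm z ==> ph z = 0"
 shows "test_fun ph" "partial e ph = (%z. ph' z e)"
proof -
 show p: "partial e ph = (%z. ph' z e)" for e
  unfolding partial_def using frechet_derivative_at[OF d] by auto
 have "{z. ph z ~= 0} \<subseteq> cball 0 R" using s by (auto simp: not_less[symmetric])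
 then have "compact (closure {z. ph z ~= 0})"
  using bounded_subset[OF bounded_cball] compact_closure by blast
 then show "test_fun ph" unfolding test_fun_def p using c d differentiable_def by blast
qed

text \<open>\<open>|f| <= |f|^2 + 1\<close> on a ball outside which the bounded factor
  vanishes.\<close>

lemma integrable_L2_loc_mult:
 assumes f: "L2_loc f" and \<psi>: "\<psi> \<in> borel_measurable borel" "!!z. norm (\<psi> z) <= B" "!!z. R < norm z ==> \<psi> z = 0"
 shows "integrable lebesgue (%z. f z * \<psi> z)"
proof (rule Bochner_Integration.integrable_bound)
 let ?K = "cball (0 :: complex) R"
 have B: "0 <= B" using order_trans[OF norm_ge_zero \<psi>(2)] .
 have "set_integrable lebesgue ?K (%z. (norm (f z))\<^sup>2)" using f compact_cball unfolding L2_loc_def by blast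
 moreover have "integrable lebesgue (indicator ?K :: complex => real)"
  by (rule lmeasurable_cball[unfolded lmeasurable_iff_integrable])
 ultimately show "integrable lebesgue (%z. B * (indicator ?K z *\<^sub>R (norm (f z))\<^sup>2 + indicator ?K z))"
  unfolding set_integrable_def by (intro integrable_mult_right Bochner_Integration.integrable_add)
 have "f \<in> borel_measurable lebesgue" using f by (simp add: L2_loc_def)
 moreover have "\<psi> \<in> borel_measurable lebesgue"
  using \<psi>(1) by (intro measurable_completion) simp
 ultimately show "(%z. f z * \<psi> z) \<in> borel_measurable lebesgue" by (rule borel_measurable_times)
 have bound: "norm (f z * \<psi> z) <= B * (indicator ?K z *\<^sub>R (norm (f z))\<^sup>2 + indicator ?K z)" for z
 proof (cases "z \<in> ?K")
  case True
  have "2 * norm (f z) <= (norm (f z))^2 + 1" using zero_le_power2[of "norm (f z) - 1"] by (simp add: power2_diff)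
  then have "norm (f z) <= (norm (f z))^2 + 1" using norm_ge_zero[of "f z"] by linarith
  then have "norm (\<psi> z) * norm (f z) <= B * ((norm (f z))^2 + 1)" using \<psi>(2)[of z] B by (intro mult_mono) auto
  then show ?thesis using True by (simp add: norm_mult mult.commute)
 next
  case False
  then show ?thesis using \<psi>(3)[of z] by simp
 qed
 show "AE z in lebesgue. norm (f z * \<psi> z) <= norm (B * (indicator ?K z *\<^sub>R (norm (f z))\<^sup>2 + indicator ?K z))"
  by (intro always_eventually allI order_trans[OF bound]) (simp only: real_norm_def abs_ge_self)
qed

lemma bounded_compact_support:
 fixes \<psi> :: "complex => complex"
 assumes "continuous_on UNIV \<psi>" "!!z. R < norm z ==> \<psi> z = 0"
 obtains B where "!!z. norm (\<psi> z) <= B"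
proof -
 have "compact (\<psi> ` cball 0 R)" by (intro compact_continuous_image continuous_on_subset[OF assms(1)]) auto
 from compact_imp_bounded[OF this] obtain B where B: "!!z. z \<in> cball 0 R ==> norm (\<psi> z) <= B"
  unfolding bounded_iff by blast
 have "norm (\<psi> z) <= max B 0" for z
  using B[of z] assms(2)[of z] by (cases "norm z <= R") auto
 then show ?thesis by (rule that)
qed

lemma has_derivative_radial:
 assumes "(A has_real_derivative A') (at ((norm z)^2))"
 shows "((%z :: complex. complex_of_real (A ((norm z)^2))) has_derivative (%h. of_real (2 * (z \<bullet> h) * A'))) (at z)"
proof -
 have "((%z :: complex. z \<bullet> z) has_derivative (%h. z \<bullet> h + h \<bullet> z)) (at z)"
  by (rule has_derivative_inner[OF has_derivative_ident has_derivative_ident])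
 then have "((%z :: complex. (norm z)\<^sup>2) has_derivative (%h. 2 * (z \<bullet> h))) (at z)"
  by (simp add: power2_norm_eq_inner inner_commute)
 from has_derivative_of_real[OF DERIV_compose_FDERIV[OF assms this]] show ?thesis .
qed

lemma has_derivative_cnj_power: "((%z. cnj z ^ m) has_derivative (%h. of_nat m * cnj h * cnj z ^ (m - 1))) (at z)"
proof -
 have "(cnj has_derivative cnj) (at z)" by (rule bounded_linear_imp_has_derivative[OF bounded_linear_cnj])
 from has_derivative_power[OF this, of m] show ?thesis .
qed

text \<open>The test function \<open>g (|z|^2) * cnj z ^ m\<close> is regular at the origin, and as
  \<open>cnj z ^ m\<close> is harmonic its Laplacian is
  \<open>4 * rh * g2 + 4 * (m + 1) * g1\<close> times \<open>cnj z ^ m\<close>. Its first partials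
  are test functions too, which moves the weak gradient back onto \<open>u\<close>.\<close>

lemma weak_mode_equation:
 fixes g g1 g2 C :: "real => real"
 assumes u: "continuous_on UNIV u" and weak: "weak_helmholtz (%z. C ((norm z)^2)) u"
  and C: "C \<in> borel_measurable borel" "!!rh. \<bar>C rh\<bar> <= CB"
  and g: "!!rh. (g has_real_derivative g1 rh) (at rh)" "!!rh. (g1 has_real_derivative g2 rh) (at rh)" "continuous_on UNIV g2"
  and supp: "0 < a" "!!rh. rh \<notin> {a<..<b} ==> g rh = 0 \<and> g1 rh = 0 \<and> g2 rh = 0"
 shows "(LINT rh|lborel. of_real (4 * rh * g2 rh + 4 * (real m + 1) * g1 rh + C rh * g rh) * mode_profile u m rh) = 0"
proof -
 define R where "R = sqrt b"
 have out: "g ((norm z)^2) = 0 \<and> g1 ((norm z)^2) = 0 \<and> g2 ((norm z)^2) = 0" if "R < norm z" for z :: complex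
  using that supp(2)[of "(norm z)^2"] real_le_rsqrt[of "norm z" b] by (force simp: R_def)
 define ph where "ph z = of_real (g ((norm z)^2)) * cnj z ^ m" for z
 define ph' where "ph' z h = of_real (g ((norm z)^2)) * (of_nat m * cnj h * cnj z ^ (m - 1))
  + of_real (2 * (z \<bullet> h) * g1 ((norm z)^2)) * cnj z ^ m" for z h
 define ph'' where "ph'' e z h =
  of_real (g ((norm z)^2)) * (of_nat m * cnj e * (of_nat (m - 1) * cnj h * cnj z ^ (m - 1 - 1)))
  + of_real (2 * (z \<bullet> h) * g1 ((norm z)^2)) * (of_nat m * cnj e * cnj z ^ (m - 1))
  + (of_real (2 * (z \<bullet> e)) * of_real (g1 ((norm z)^2)) * (of_nat m * cnj h * cnj z ^ (m - 1))
  + (of_real (2 * (z \<bullet> e)) * of_real (2 * (z \<bullet> h) * g2 ((norm z)^2)) + of_real (2 * (h \<bullet> e)) * of_real (g1 ((norm z)^2))) * cnj z ^ m)" for e z h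
 have d: "(ph has_derivative ph' z) (at z)" for z
  unfolding ph_def[abs_def] ph'_def by (rule has_derivative_mult[OF has_derivative_radial[OF g(1)] has_derivative_cnj_power])
 have d': "((%z. ph' z e) has_derivative ph'' e z) (at z)" for e z
 proof -
  have 1: "((%z. of_nat m * cnj e * cnj z ^ (m - 1)) has_derivative (%h. of_nat m * cnj e * (of_nat (m - 1) * cnj h * cnj z ^ (m - 1 - 1)))) (at z)"
  by (rule has_derivative_mult_right[OF has_derivative_cnj_power])
  have 2: "((%z. complex_of_real (2 * (z \<bullet> e))) has_derivative (%h. of_real (2 * (h \<bullet> e)))) (at z)"
  by (intro has_derivative_of_real has_derivative_mult_right has_derivative_inner_left has_derivative_ident)
  have "ph' z e = of_real (g ((norm z)^2)) * (of_nat m * cnj e * cnj z ^ (m - 1))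
  + of_real (2 * (z \<bullet> e)) * of_real (g1 ((norm z)^2)) * cnj z ^ m" for z by (simp add: ph'_def)
  then show ?thesis unfolding ph''_def
  by (simp only:) (intro has_derivative_add[OF has_derivative_mult[OF has_derivative_radial[OF g(1)] 1]
  has_derivative_mult[OF has_derivative_mult[OF 2 has_derivative_radial[OF g(2)]] has_derivative_cnj_power]])
 qed
 have cg: "continuous_on UNIV g" "continuous_on UNIV g1"
  using g(1,2) by (auto intro!: continuous_at_imp_continuous_on DERIV_isCont)
 have cr: "continuous_on UNIV (%z :: complex. complex_of_real (f ((norm z)^2)))" if "continuous_on UNIV f" for f
  by (intro continuous_on_of_real continuous_on_compose2[OF that] continuous_intros) auto
 note crs = cr[OF cg(1)] cr[OF cg(2)] cr[OF g(3)]
 have cn: "continuous_on UNIV (%z. cnj z ^ k)" and ci: "continuous_on UNIV (%z :: complex. complex_of_real (z \<bullet> h))" for k h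
  by (intro continuous_intros)+
 have c1: "continuous_on UNIV (%z. ph' z e)" for e
  unfolding ph'_def of_real_mult by (intro continuous_on_add continuous_on_mult continuous_on_const cn ci crs)
 have c2: "continuous_on UNIV (%z. ph'' e z h)" for e h
  unfolding ph''_def of_real_mult by (intro continuous_on_add continuous_on_mult continuous_on_const cn ci crs)
 have s0: "ph z = 0" and s1: "ph' z e = 0" and s2: "ph'' e z h = 0" if "R < norm z" for z e h
  using out[OF that] by (simp_all add: ph_def ph'_def ph''_def)
 have T: "test_fun ph" "partial h ph = (%z. ph' z h)" for h
  using test_funI[of ph ph' R, OF d c1 c1] s0 by blast+
 have T': "test_fun (%z. ph' z e)" "partial h (%z. ph' z e) = (%z. ph'' e z h)" for e h
  using test_funI[of "%z. ph' z e" "ph'' e" R, OF d' c2 c2] s1 by blast+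
 obtain gx gy where H: "H1_loc_gradient u gx gy"
  and E: "!!ph. test_fun ph ==> (LINT z|lebesgue. gx z * partial 1 ph z + gy z * partial \<i> ph z)
  = (LINT z|lebesgue. of_real (C ((norm z)^2)) * u z * ph z)"
  using weak unfolding weak_helmholtz_def by blast
 from H have H1: "L2_loc u" "L2_loc gx" "L2_loc gy" "weak_partial 1 u gx" "weak_partial \<i> u gy"
  unfolding H1_loc_gradient_def by simp_all
 have int: "integrable lebesgue (%z. f z * \<psi> z)" if f: "L2_loc f" and c: "continuous_on UNIV \<psi>" and s: "!!z. R < norm z ==> \<psi> z = 0" for f \<psi>
 proof -
  obtain B where "!!z. norm (\<psi> z) <= B" using bounded_compact_support[OF c s] by blast
  from integrable_L2_loc_mult[OF f borel_measurable_continuous_onI[OF c] this s] show ?thesis .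
 qed
 have c0: "continuous_on UNIV ph" unfolding ph_def by (intro continuous_on_mult cn crs)
 have [measurable]: "C \<in> borel_measurable borel" by (rule C)
 have Cm: "(%z :: complex. complex_of_real (C ((norm z)^2))) \<in> borel_measurable borel" by measurable
 have intC: "integrable lebesgue (%z. u z * (of_real (C ((norm z)^2)) * ph z))"
 proof -
  obtain B where B: "!!z. norm (ph z) <= B" using bounded_compact_support[OF c0 s0] by blast
  have "norm (of_real (C ((norm z)^2)) * ph z) <= CB * B" for z
  unfolding norm_mult norm_of_real using C(2) B order_trans[OF abs_ge_zero C(2)] by (intro mult_mono) auto
  then show ?thesis
  using Cm borel_measurable_continuous_onI[OF c0] s0 by (intro integrable_L2_loc_mult[OF H1(1), of _ "CB * B" R]) auto
 qed
 have E1: "(LINT z|lebesgue. u z * ph'' 1 z 1) = - (LINT z|lebesgue. gx z * ph' z 1)"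
  using H1(4)[unfolded weak_partial_def, rule_format, OF T'(1)[of 1]] unfolding T'(2) .
 have E2: "(LINT z|lebesgue. u z * ph'' \<i> z \<i>) = - (LINT z|lebesgue. gy z * ph' z \<i>)"
  using H1(5)[unfolded weak_partial_def, rule_format, OF T'(1)[of \<i>]] unfolding T'(2) .
 have E3: "(LINT z|lebesgue. gx z * ph' z 1) + (LINT z|lebesgue. gy z * ph' z \<i>)
  = (LINT z|lebesgue. u z * (of_real (C ((norm z)^2)) * ph z))"
  using E[OF T(1)] Bochner_Integration.integral_add[OF int[OF H1(2) c1[of 1] s1] int[OF H1(3) c1[of \<i>] s1]]
  unfolding T(2) by (simp add: mult_ac)
 define G where "G rh = 4 * rh * g2 rh + 4 * (real m + 1) * g1 rh + C rh * g rh" for rh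
 have lap: "ph'' 1 z 1 + ph'' \<i> z \<i> + of_real (C ((norm z)^2)) * ph z = of_real (G ((norm z)^2)) * cnj z ^ m" for z
 proof -
  define k where "k = cnj z"
  have zk: "of_real (Re z) - \<i> * of_real (Im z) = k" by (simp add: k_def complex_eq_iff)
  have zz: "(norm z)^2 = Re z * Re z + Im z * Im z" by (simp add: cmod_power2 flip: power2_eq_square)
  have m: "of_nat m * (k ^ (m - 1) * k) = of_nat m * k ^ m" by (cases m) auto
  define A0 A1 A2 where "A0 = complex_of_real (g ((norm z)^2))" and "A1 = complex_of_real (g1 ((norm z)^2))" and "A2 = complex_of_real (g2 ((norm z)^2))"
  define x y where "x = complex_of_real (Re z)" and "y = complex_of_real (Im z)"
  have xy: "x - \<i> * y = k" and N: "complex_of_real ((norm z)^2) = x * x + y * y"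
  using zk zz by (simp_all add: x_def y_def)
  have "ph'' 1 z 1 + ph'' \<i> z \<i> = 4 * A1 * (of_nat m * (k ^ (m - 1) * (x - \<i> * y))) + 4 * A1 * k ^ m + 4 * (x * x + y * y) * A2 * k ^ m"
  by (simp add: ph''_def k_def[symmetric] A0_def[symmetric] A1_def[symmetric] A2_def[symmetric] x_def[symmetric] y_def[symmetric] algebra_simps)
  also have "... = 4 * A1 * (of_nat m * k ^ m) + 4 * A1 * k ^ m + 4 * of_real ((norm z)^2) * A2 * k ^ m"
  unfolding xy m N by simp
  finally show ?thesis by (simp add: ph_def G_def k_def[symmetric] A0_def A1_def A2_def algebra_simps)
 qed
 have "(LINT z|lebesgue. u z * ph'' 1 z 1) + (LINT z|lebesgue. u z * ph'' \<i> z \<i>) + (LINT z|lebesgue. u z * (of_real (C ((norm z)^2)) * ph z)) = 0"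
  unfolding E1 E2 E3[symmetric] by simp
 moreover have "(LINT z|lebesgue. u z * ph'' 1 z 1) + (LINT z|lebesgue. u z * ph'' \<i> z \<i>) + (LINT z|lebesgue. u z * (of_real (C ((norm z)^2)) * ph z))
  = (LINT z|lebesgue. u z * (of_real (G ((norm z)^2)) * cnj z ^ m))"
  unfolding lap[symmetric] distrib_left
  by (simp only: Bochner_Integration.integral_add[OF Bochner_Integration.integrable_add[OF int[OF H1(1) c2[of 1 1] s2] int[OF H1(1) c2[of \<i> \<i>] s2]] intC]
  Bochner_Integration.integral_add[OF int[OF H1(1) c2[of 1 1] s2] int[OF H1(1) c2[of \<i> \<i>] s2]])
 ultimately have Z: "(LINT z|lebesgue. u z * (of_real (G ((norm z)^2)) * cnj z ^ m)) = 0" by simp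
 have [measurable]: "g \<in> borel_measurable borel" "g1 \<in> borel_measurable borel" "g2 \<in> borel_measurable borel"
  using cg g(3) by (auto intro: borel_measurable_continuous_onI)
 have Gm [measurable]: "G \<in> borel_measurable borel" unfolding G_def[abs_def] by measurable
 obtain GB where GB: "!!rh. \<bar>G rh\<bar> <= GB"
 proof -
  have bd: "\<exists>B. \<forall>rh\<in>{a..b}. \<bar>f rh\<bar> <= B" if "continuous_on UNIV f" for f :: "real => real"
  using compact_imp_bounded[OF compact_continuous_image[OF continuous_on_subset[OF that] compact_Icc[of a b]]]
  unfolding bounded_iff by auto
  have "continuous_on UNIV (%rh. 4 * rh * g2 rh + 4 * (real m + 1) * g1 rh)" by (intro continuous_intros cg g(3))
  from bd[OF this] obtain B1 where B1: "!!rh. rh \<in> {a..b} ==> \<bar>4 * rh * g2 rh + 4 * (real m + 1) * g1 rh\<bar> <= B1" by blast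
  from bd[OF cg(1)] obtain B2 where B2: "!!rh. rh \<in> {a..b} ==> \<bar>g rh\<bar> <= B2" by blast
  have "\<bar>G rh\<bar> <= max 0 (B1 + CB * B2)" for rh
  proof (cases "rh \<in> {a<..<b}")
  case True
  then have r: "rh \<in> {a..b}" by auto
  have "\<bar>C rh * g rh\<bar> <= CB * B2" unfolding abs_mult
  using C(2) B2[OF r] order_trans[OF abs_ge_zero C(2)] by (intro mult_mono) auto
  then show ?thesis using B1[OF r] unfolding G_def by linarith
  next
  case False
  then show ?thesis using supp(2)[OF False] by (simp add: G_def)
  qed
  then show ?thesis using that by blast
 qed
 have "(LINT z|lborel. u z * (of_real (G ((norm z)^2)) * cnj z ^ m)) = of_real pi * (LINT rh|lborel. of_real (G rh) * mode_profile u m rh)"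
 proof (rule plane_integral_mode[OF u Gm GB _ supp(1), of b])
  show "a <= rh \<and> rh <= b" if "G rh ~= 0" for rh using that supp(2)[of rh] by (force simp: G_def)
 qed
 moreover have "(LINT z|lebesgue. u z * (of_real (G ((norm z)^2)) * cnj z ^ m)) = (LINT z|lborel. u z * (of_real (G ((norm z)^2)) * cnj z ^ m))"
 proof (rule integral_completion)
  have [measurable]: "u \<in> borel_measurable borel" "(%z. cnj z ^ m) \<in> borel_measurable borel"
  using u by (auto intro!: borel_measurable_continuous_onI continuous_intros)
  show "(%z. u z * (of_real (G ((norm z)^2)) * cnj z ^ m)) \<in> borel_measurable lborel" by measurable
 qed
 ultimately show ?thesis using Z by (simp add: G_def)
qed

section \<open>Truncated powers and hat functions\<close>

definition spline :: "nat => real => real" where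
 "spline k x = (max 0 x) ^ k / fact k"

lemma DERIV_spline: "(spline (Suc (Suc k)) has_real_derivative spline (Suc k) x) (at x)"
proof (cases x "0 :: real" rule: linorder_cases)
 case less
 have "((%x. 0) has_real_derivative 0) (at x)" by simp
 then have "(spline (Suc (Suc k)) has_real_derivative 0) (at x)"
  by (rule has_field_derivative_transform_within_open[of _ _ _ "{..<0}"]) (use less in \<open>auto simp: spline_def\<close>)
 then show ?thesis using less by (simp add: spline_def max_def)
next
 case equal
 have "((%h. \<bar>h\<bar> ^ Suc k) ---> \<bar>0\<bar> ^ Suc k) (at (0 :: real))" by (intro tendsto_intros)
 then have "((%h. \<bar>h\<bar> ^ Suc k) ---> 0) (at (0 :: real))" by simp
 then have "((%h. (max 0 h) ^ Suc (Suc k) / fact (Suc (Suc k)) / h) ---> 0) (at (0 :: real))"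
 proof (rule Lim_null_comparison[rotated])
  have "norm ((max 0 h) ^ Suc (Suc k) / fact (Suc (Suc k)) / h) <= \<bar>h\<bar> ^ Suc k" for h :: real
  proof (cases "0 < h")
  case True
  then have "(max 0 h) ^ Suc (Suc k) / fact (Suc (Suc k)) / h = h ^ Suc k / fact (Suc (Suc k))"
  by (simp add: max_def)
  also have "... <= h ^ Suc k / 1" using True by (intro divide_left_mono fact_ge_1) auto
  finally show ?thesis using True by simp
  next
  case False
  then have "norm ((max 0 h) ^ Suc (Suc k) / fact (Suc (Suc k)) / h) = 0" by simp
  also have "... <= \<bar>h\<bar> ^ Suc k" by (intro zero_le_power abs_ge_zero)
  finally show ?thesis .
  qed
  then show "\<forall>\<^sub>F h in at 0. norm ((max 0 h) ^ Suc (Suc k) / fact (Suc (Suc k)) / h) <= \<bar>h\<bar> ^ Suc k" by (intro always_eventually allI)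
 qed
 then show ?thesis using equal unfolding DERIV_def spline_def by simp
next
 case greater
 have "((%x. x ^ Suc (Suc k) / fact (Suc (Suc k))) has_real_derivative real (Suc (Suc k)) * x ^ Suc k / fact (Suc (Suc k))) (at x)"
  using DERIV_cdivide[OF DERIV_pow[of "Suc (Suc k)" x], of "fact (Suc (Suc k))"] by (simp only: diff_Suc_Suc minus_nat.diff_0)
 moreover have "real (Suc (Suc k)) * x ^ Suc k / fact (Suc (Suc k)) = x ^ Suc k / fact (Suc k)"
  unfolding fact_Suc[of "Suc k"] by (simp del: of_nat_Suc fact_Suc power_Suc)
 ultimately have "((%x. x ^ Suc (Suc k) / fact (Suc (Suc k))) has_real_derivative spline (Suc k) x) (at x)"
  using greater by (simp add: spline_def max_def)
 then show ?thesis
  by (rule has_field_derivative_transform_within_open[of _ _ _ "{0<..}"]) (use greater in \<open>auto simp: spline_def\<close>)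
qed

text \<open>Second differences of truncated powers: index 1 is a hat of half-width \<open>d\<close>
  and mass \<open>d^2\<close>; indices 2 and 3 are its iterated primitives, which become
  \<open>d^2\<close> and \<open>d^2 * x\<close> to the right of the hat.\<close>

definition bspline :: "real => nat => real => real" where
 "bspline d k x = spline k (x + d) - 2 * spline k x + spline k (x - d)"

lemma DERIV_bspline:
 "((%x. bspline d (Suc (Suc k)) (x - s)) has_real_derivative bspline d (Suc k) (x - s)) (at x)"
proof -
 have c: "((%x. spline (Suc (Suc k)) (x - t)) has_real_derivative spline (Suc k) (x - t)) (at x)" for t
 proof -
  have "((%x. x - t) has_real_derivative 1) (at x)" by (auto intro!: derivative_eq_intros)
  from DERIV_chain2[where f="spline (Suc (Suc k))" and g="%x. x - t", OF DERIV_spline this] show ?thesis by simp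
 qed
 have "((%x. spline (Suc (Suc k)) (x - (s - d)) - 2 * spline (Suc (Suc k)) (x - s) + spline (Suc (Suc k)) (x - (s + d)))
  has_real_derivative spline (Suc k) (x - (s - d)) - 2 * spline (Suc k) (x - s) + spline (Suc k) (x - (s + d))) (at x)"
  by (intro DERIV_add DERIV_diff DERIV_cmult c)
 then show ?thesis by (simp add: bspline_def algebra_simps)
qed

lemma continuous_on_bspline: "continuous_on UNIV (bspline d k)"
 unfolding bspline_def[abs_def] spline_def by (intro continuous_intros) auto

lemma bspline_left: "0 < k ==> 0 < d ==> x <= - d ==> bspline d k x = 0"
 by (simp add: bspline_def spline_def max.absorb1)

lemma bspline_right:
 assumes "0 < d" "d <= x"
 shows "bspline d (Suc 0) x = 0" "bspline d (Suc (Suc 0)) x = d^2" "bspline d (Suc (Suc (Suc 0))) x = d^2 * x"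
 using assms by (simp_all add: bspline_def spline_def max.absorb2 power2_eq_square field_simps)

lemma bspline_nonneg: "0 < d ==> 0 <= bspline d (Suc 0) x"
 by (auto simp: bspline_def spline_def max_def)

text \<open>The hat is nonnegative with mass \<open>d^2\<close>, so it averages \<open>P\<close>
  over a neighbourhood of \<open>s\<close> where \<open>P\<close> deviates from \<open>P s\<close>
  by at most \<open>et\<close>.\<close>

lemma bspline_average:
 fixes P :: "real => complex"
 assumes P: "continuous_on {a..b} P" and d: "0 < d" "a <= s - d" "s + d <= b"
  and close: "!!rh. s - d < rh ==> rh < s + d ==> norm (P rh - P s) <= et"
 shows "(%rh. bspline d (Suc 0) (rh - s) *\<^sub>R P rh) integrable_on {a..b}"
  and "norm (integral {a..b} (%rh. bspline d (Suc 0) (rh - s) *\<^sub>R P rh) - d^2 *\<^sub>R P s) <= d^2 * et"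
proof -
 let ?t = "%rh. bspline d (Suc 0) (rh - s)"
 have ct: "continuous_on S ?t" for S
  by (intro continuous_on_compose2[OF continuous_on_bspline] continuous_intros) auto
 show int: "(%rh. ?t rh *\<^sub>R P rh) integrable_on {a..b}"
  by (intro integrable_continuous_interval continuous_on_scaleR ct P)
 have "(?t has_integral (bspline d (Suc (Suc 0)) (b - s) - bspline d (Suc (Suc 0)) (a - s))) {a..b}"
  using d DERIV_bspline[of d 0 s]
  by (intro fundamental_theorem_of_calculus)
  (auto simp: has_real_derivative_iff_has_vector_derivative[symmetric] intro: has_field_derivative_at_within)
 then have it: "(?t has_integral d\<^sup>2) {a..b}"
  using bspline_right(2)[of d "b - s"] bspline_left[of "Suc (Suc 0)" d "a - s"] d by simp
 have ic: "((%rh. ?t rh *\<^sub>R P s) has_integral d\<^sup>2 *\<^sub>R P s) {a..b}" by (rule has_integral_scaleR_left[OF it])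
 have "integral {a..b} (%rh. ?t rh *\<^sub>R P rh) - d^2 *\<^sub>R P s = integral {a..b} (%rh. ?t rh *\<^sub>R (P rh - P s))"
  using Henstock_Kurzweil_Integration.integral_diff[OF int has_integral_integrable[OF ic]] integral_unique[OF ic]
  by (simp add: scaleR_diff_right)
 also have "norm ... <= integral {a..b} (%rh. ?t rh * et)"
 proof (rule integral_norm_bound_integral)
  show "(%rh. ?t rh *\<^sub>R (P rh - P s)) integrable_on {a..b}"
  by (intro integrable_continuous_interval continuous_on_scaleR continuous_on_diff continuous_on_const ct P)
  show "(%rh. ?t rh * et) integrable_on {a..b}"
  by (intro integrable_continuous_interval continuous_on_mult continuous_on_const ct)
  fix rh assume "rh \<in> {a..b}"
  show "norm (?t rh *\<^sub>R (P rh - P s)) <= ?t rh * et"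
  proof (cases "s - d < rh \<and> rh < s + d")
  case True
  then show ?thesis using close[of rh] bspline_nonneg[OF d(1), of "rh - s"] by (simp add: mult_left_mono)
  next
  case False
  then have "?t rh = 0" using bspline_left[of "Suc 0" d "rh - s"] bspline_right(1)[of d "rh - s"] d by auto
  then show ?thesis by simp
  qed
 qed
 also have "integral {a..b} (%rh. ?t rh * et) = d^2 * et"
  by (rule integral_unique[OF has_integral_mult_left[OF it]])
 finally show "norm (integral {a..b} (%rh. ?t rh *\<^sub>R P rh) - d^2 *\<^sub>R P s) <= d^2 * et" .
qed

text \<open>A du Bois-Reymond lemma: a combination of three hat functions with vanishing mass and first
 moment is the second derivative of an admissible \<open>g\<close>.\<close>

lemma affine_of_weak_second_derivative:
 fixes P :: "real => complex"
 assumes P: "continuous_on {0<..} P"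
  and weak: "!!g g1 g2 a b. (!!rh. (g has_real_derivative g1 rh) (at rh)) ==> (!!rh. (g1 has_real_derivative g2 rh) (at rh)) ==>
  continuous_on UNIV g2 ==> 0 < a ==> a < b ==> (!!rh. rh \<notin> {a<..<b} ==> g rh = 0 \<and> g1 rh = 0 \<and> g2 rh = 0) ==>
  ((%rh. g2 rh *\<^sub>R P rh) has_integral 0) {a..b}"
  and s: "0 < s"
 shows "P s = (2 - s) *\<^sub>R P 1 + (s - 1) *\<^sub>R P 2"
proof -
 let ?E = "P s - ((2 - s) *\<^sub>R P 1 + (s - 1) *\<^sub>R P 2)"
 have "norm ?E <= (1 + \<bar>2 - s\<bar> + \<bar>s - 1\<bar>) * et" if et: "0 < et" for et
 proof -
  have "\<exists>e>0. \<forall>rh. \<bar>rh - t\<bar> < e --> norm (P rh - P t) <= et" if "0 < t" for t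
  proof -
  have "isCont P t" using P that continuous_on_eq_continuous_at[OF open_greaterThan] by blast
  then obtain e where "0 < e" "!!rh. dist rh t < e ==> dist (P rh) (P t) < et"
  using et unfolding continuous_at_eps_delta by blast
  then show ?thesis by (intro exI[of _ e]) (auto simp: dist_real_def dist_norm less_imp_le)
  qed
  from this[of s] this[of 1] this[of 2] s obtain e0 e1 e2 where
  e: "0 < e0" "!!rh. \<bar>rh - s\<bar> < e0 ==> norm (P rh - P s) <= et"
  "0 < e1" "!!rh. \<bar>rh - 1\<bar> < e1 ==> norm (P rh - P 1) <= et"
  "0 < e2" "!!rh. \<bar>rh - 2\<bar> < e2 ==> norm (P rh - P 2) <= et" by auto
  define c where "c = min (min s 1) (min e0 (min e1 e2))"
  have c: "0 < c" "c <= s" "c <= 1" "c <= e0" "c <= e1" "c <= e2" using e s by (auto simp: c_def)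
  define d where "d = c / 4"
  define a where "a = d"
  define b where "b = max s 2 + d"
  have d: "0 < d" "2 * d <= s" "2 * d <= 1" "d <= e0" "d <= e1" "d <= e2" using c by (auto simp: d_def)
  \<comment> \<open>The coefficients are those of linear interpolation at 1 and 2. They annul mass
    and first moment, so that the iterated primitives \<open>d^2\<close> and \<open>d^2 * x\<close>
    cancel to the right of all three hats.\<close>
  define g where "g k rh = bspline d k (rh - s) - (2 - s) * bspline d k (rh - 1) - (s - 1) * bspline d k (rh - 2)" for k rh
  have D: "(g (Suc (Suc k)) has_real_derivative g (Suc k) rh) (at rh)" for k rh
  unfolding g_def[abs_def] by (intro DERIV_diff DERIV_cmult DERIV_bspline)
  have cg: "continuous_on UNIV (g k)" for k
  unfolding g_def[abs_def] by (intro continuous_intros continuous_on_compose2[OF continuous_on_bspline]) auto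
  have out: "g (Suc (Suc (Suc 0))) rh = 0 \<and> g (Suc (Suc 0)) rh = 0 \<and> g (Suc 0) rh = 0" if "rh \<notin> {a<..<b}" for rh
  proof (cases "rh <= a")
  case True
  then show ?thesis using d by (simp add: g_def bspline_left a_def)
  next
  case False
  then have "max s 2 + d <= rh" using that by (simp add: b_def)
  then show ?thesis using d by (simp add: g_def bspline_right algebra_simps)
  qed
  have ab: "0 < a" "a < b" using d by (auto simp: a_def b_def)
  from weak[OF D D cg ab out]
  have I: "((%rh. g (Suc 0) rh *\<^sub>R P rh) has_integral 0) {a..b}" .
  have Pab: "continuous_on {a..b} P" by (rule continuous_on_subset[OF P]) (use ab in auto)
  define I' where "I' t = integral {a..b} (%rh. bspline d (Suc 0) (rh - t) *\<^sub>R P rh)" for t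
  have near: "s - d < rh ==> rh < s + d ==> norm (P rh - P s) <= et"
  "1 - d < rh ==> rh < 1 + d ==> norm (P rh - P 1) <= et"
  "2 - d < rh ==> rh < 2 + d ==> norm (P rh - P 2) <= et" for rh
  using d by (intro e(2) e(4) e(6); simp add: abs_less_iff)+
  have sab: "a <= s - d" "s + d <= b" "a <= 1 - d" "1 + d <= b" "a <= 2 - d" "2 + d <= b"
  using d by (auto simp: a_def b_def)
  note Is = bspline_average[OF Pab d(1) sab(1,2) near(1), folded I'_def]
  and I1 = bspline_average[OF Pab d(1) sab(3,4) near(2), folded I'_def]
  and I2 = bspline_average[OF Pab d(1) sab(5,6) near(3), folded I'_def]
  have "((%rh. bspline d (Suc 0) (rh - s) *\<^sub>R P rh - (2 - s) *\<^sub>R (bspline d (Suc 0) (rh - 1) *\<^sub>R P rh) - (s - 1) *\<^sub>R (bspline d (Suc 0) (rh - 2) *\<^sub>R P rh))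
  has_integral (I' s - (2 - s) *\<^sub>R I' 1 - (s - 1) *\<^sub>R I' 2)) {a..b}"
  unfolding I'_def by (intro has_integral_diff has_integral_cmul integrable_integral Is I1 I2)
  moreover have "(%rh. bspline d (Suc 0) (rh - s) *\<^sub>R P rh - (2 - s) *\<^sub>R (bspline d (Suc 0) (rh - 1) *\<^sub>R P rh) - (s - 1) *\<^sub>R (bspline d (Suc 0) (rh - 2) *\<^sub>R P rh))
  = (%rh. g (Suc 0) rh *\<^sub>R P rh)"
  by (simp add: g_def scaleR_diff_left)
  ultimately have "((%rh. g (Suc 0) rh *\<^sub>R P rh) has_integral (I' s - (2 - s) *\<^sub>R I' 1 - (s - 1) *\<^sub>R I' 2)) {a..b}" by (simp only:)
  then have Z: "I' s - (2 - s) *\<^sub>R I' 1 - (s - 1) *\<^sub>R I' 2 = 0" by (rule has_integral_unique[OF _ I])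
  have "d^2 *\<^sub>R ?E = - ((I' s - d^2 *\<^sub>R P s) - (2 - s) *\<^sub>R (I' 1 - d^2 *\<^sub>R P 1) - (s - 1) *\<^sub>R (I' 2 - d^2 *\<^sub>R P 2))
  + (I' s - (2 - s) *\<^sub>R I' 1 - (s - 1) *\<^sub>R I' 2)"
  by (simp add: algebra_simps)
  then have "norm (d^2 *\<^sub>R ?E) = norm ((I' s - d^2 *\<^sub>R P s) - (2 - s) *\<^sub>R (I' 1 - d^2 *\<^sub>R P 1) - (s - 1) *\<^sub>R (I' 2 - d^2 *\<^sub>R P 2))"
  unfolding Z by (simp only: add_0_right norm_minus_cancel)
  also have "... <= norm (I' s - d^2 *\<^sub>R P s) + norm ((2 - s) *\<^sub>R (I' 1 - d^2 *\<^sub>R P 1)) + norm ((s - 1) *\<^sub>R (I' 2 - d^2 *\<^sub>R P 2))"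
  by (intro order_trans[OF norm_triangle_ineq4] add_right_mono norm_triangle_ineq4)
  also have "... <= d^2 * et + \<bar>2 - s\<bar> * (d^2 * et) + \<bar>s - 1\<bar> * (d^2 * et)"
  unfolding norm_scaleR by (intro add_mono mult_left_mono Is I1 I2) auto
  also have "... = d^2 * ((1 + \<bar>2 - s\<bar> + \<bar>s - 1\<bar>) * et)" by (simp add: algebra_simps)
  finally have "d^2 * norm ?E <= d^2 * ((1 + \<bar>2 - s\<bar> + \<bar>s - 1\<bar>) * et)" by simp
  then show ?thesis using d(1) by (simp only: mult_le_cancel_left_pos zero_less_power)
 qed
 then have bound: "norm ?E <= k * et" if "0 < et" "k = 1 + \<bar>2 - s\<bar> + \<bar>s - 1\<bar>" for et k using that by blast
 have "norm ?E <= 0 + et" if "0 < et" for et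
 proof -
  define k where "k = 1 + \<bar>2 - s\<bar> + \<bar>s - 1\<bar>"
  have k: "0 < k" by (simp add: k_def add_pos_nonneg)
  have "norm ?E <= k * (et / k)" by (rule bound[OF _ k_def]) (use k that in simp)
  also have "... = 0 + et" using k by simp
  finally show ?thesis .
 qed
 then have "norm ?E <= 0" by (rule field_le_epsilon)
 then show ?thesis by simp
qed

text \<open>In distributional form the equation is
  \<open>(4 rho W)'' - 4 (m + 1) W' + C W = 0\<close>. Two integrations show that \<open>P\<close>,
  which is \<open>4 rho W\<close> corrected by iterated primitives of \<open>W\<close> and
  \<open>C W\<close>, is affine, and this makes \<open>W\<close> differentiable.
  \<open>S = 2 rho W'\<close> is continuous even at the jump of \<open>C\<close>, which contains the
  transmission condition.\<close>

lemma radial_equation: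
 fixes W :: "real => complex" and m :: real
 assumes W: "continuous_on UNIV W" and e: "0 < e"
  and weak: "!!g g1 g2 a b. (!!rh. (g has_real_derivative g1 rh) (at rh)) ==> (!!rh. (g1 has_real_derivative g2 rh) (at rh)) ==>
  continuous_on UNIV g2 ==> 0 < a ==> a < b ==> (!!rh. rh \<notin> {a<..<b} ==> g rh = 0 \<and> g1 rh = 0 \<and> g2 rh = 0) ==>
  (LINT rh|lborel. of_real (4 * rh * g2 rh + 4 * (m + 1) * g1 rh + (if rh < e then c1 else c2) * g rh) * W rh) = 0"
 shows "\<exists>S. continuous_on {0<..} S \<and> (\<forall>rh>0. (W has_vector_derivative S rh /\<^sub>R (2 * rh)) (at rh)) \<and>
  (\<forall>rh>0. rh ~= e --> (S has_vector_derivative (m / rh) *\<^sub>R S rh - ((if rh < e then c1 else c2) / 2) *\<^sub>R W rh) (at rh))"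
proof -
 define C where "C rh = (if rh < e then c1 else c2)" for rh
 have prim: "\<exists>F. continuous_on {0<..} F \<and> (\<forall>rh>0. (F has_vector_derivative f rh) (at rh))"
  if f: "continuous_on UNIV f" for f :: "real => complex"
 proof -
  define F where "F rh = integral {0..rh} f" for rh
  have D: "(F has_vector_derivative f rh) (at rh)" if "0 < rh" for rh
  proof -
  have "(F has_vector_derivative f rh) (at rh within {0..rh + 1})"
  unfolding F_def[abs_def] using that by (intro integral_has_vector_derivative continuous_on_subset[OF f]) auto
  moreover have "at rh within {0..rh + 1} = at rh" using that by (intro at_within_interior) simp
  ultimately show ?thesis by simp
  qed
  then have "continuous_on {0<..} F"
  by (intro continuous_at_imp_continuous_on ballI) (auto intro: has_vector_derivative_continuous)
  then show ?thesis using D by blast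
 qed
 obtain M where M: "continuous_on {0<..} M" "!!rh. 0 < rh ==> (M has_vector_derivative W rh) (at rh)" using prim[OF W] by blast
 \<comment> \<open>A primitive of \<open>C * W\<close> that is continuous across the jump at
   \<open>e\<close>.\<close>
 define K where "K rh = c2 *\<^sub>R M (max rh 0) + (c1 - c2) *\<^sub>R M (min rh e)" for rh
 have Kc: "continuous_on {0<..} K" unfolding K_def
  using e by (intro continuous_intros continuous_on_compose2[OF M(1)]) auto
 have KD: "(K has_vector_derivative C rh *\<^sub>R W rh) (at rh)" if r: "0 < rh" "rh ~= e" for rh
 proof (cases "rh < e")
  case True
  have "((%rh. c2 *\<^sub>R M rh + (c1 - c2) *\<^sub>R M rh) has_vector_derivative c2 *\<^sub>R W rh + (c1 - c2) *\<^sub>R W rh) (at rh)"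
  by (intro has_vector_derivative_add bounded_linear.has_vector_derivative[OF bounded_linear_scaleR_right] M r)
  then have "((%rh. c2 *\<^sub>R M rh + (c1 - c2) *\<^sub>R M rh) has_vector_derivative C rh *\<^sub>R W rh) (at rh)"
  using True by (simp add: C_def scaleR_add_left[symmetric])
  then show ?thesis
  by (rule has_vector_derivative_transform_within_open[of _ _ _ "{0<..<e}"]) (use True r in \<open>auto simp: K_def\<close>)
 next
  case False
  have "((%rh. c2 *\<^sub>R M rh + (c1 - c2) *\<^sub>R M e) has_vector_derivative c2 *\<^sub>R W rh + 0) (at rh)"
  by (intro has_vector_derivative_add bounded_linear.has_vector_derivative[OF bounded_linear_scaleR_right] M r has_vector_derivative_const)
  then have "((%rh. c2 *\<^sub>R M rh + (c1 - c2) *\<^sub>R M e) has_vector_derivative C rh *\<^sub>R W rh) (at rh)"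
  using False by (simp add: C_def)
  then show ?thesis
  by (rule has_vector_derivative_transform_within_open[of _ _ _ "{e<..}"]) (use False r e in \<open>auto simp: K_def\<close>)
 qed
 have "\<exists>L. continuous_on {0<..} L \<and> (\<forall>rh>0. (L has_vector_derivative K rh) (at rh))"
 proof -
  define F where "F rh = (if rh \<ge> 1 then integral {1..rh} K else - integral {rh..1} K)" for rh
  have D: "(F has_vector_derivative K rh) (at rh)" if r: "0 < rh" for rh
  proof -
  define l where "l = min (rh / 2) (1 / 2)"
  define h where "h = max (rh + 1) 2"
  have l: "0 < l" "l < rh" "l < 1" "rh < h" "1 < h" using r by (auto simp: l_def h_def min_def max_def)
  have ci: "K integrable_on {x..y}" if "l <= x" for x y
  by (intro integrable_continuous_interval continuous_on_subset[OF Kc]) (use that l in auto)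
  have "((%x. integral {l..x} K) has_vector_derivative K rh) (at rh within {l..h})"
  using l by (intro integral_has_vector_derivative continuous_on_subset[OF Kc]) auto
  moreover have "at rh within {l..h} = at rh" using l by (intro at_within_interior) simp
  ultimately have "((%x. integral {l..x} K - integral {l..1} K) has_vector_derivative K rh - 0) (at rh)"
  by (intro has_vector_derivative_diff has_vector_derivative_const) simp
  then have "((%x. integral {l..x} K - integral {l..1} K) has_vector_derivative K rh) (at rh)" by simp
  then show ?thesis
  proof (rule has_vector_derivative_transform_within_open[of _ _ _ "{l<..}"])
  fix x assume x: "x \<in> {l<..}"
  show "integral {l..x} K - integral {l..1} K = F x"
  using Henstock_Kurzweil_Integration.integral_combine[of l 1 x K] Henstock_Kurzweil_Integration.integral_combine[of l x 1 K] ci x l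
  by (auto simp: F_def algebra_simps)
  qed (use l in auto)
  qed
  then have "continuous_on {0<..} F"
  by (intro continuous_at_imp_continuous_on ballI) (auto intro: has_vector_derivative_continuous)
  then show ?thesis using D by blast
 qed
 then obtain L where L: "continuous_on {0<..} L" "!!rh. 0 < rh ==> (L has_vector_derivative K rh) (at rh)" by blast
 define P where "P rh = (4 * rh) *\<^sub>R W rh - (4 * (m + 1)) *\<^sub>R M rh + L rh" for rh
 have Pc: "continuous_on {0<..} P"
  unfolding P_def by (intro continuous_intros M L continuous_on_subset[OF W]) auto
 have aff: "P s = (2 - s) *\<^sub>R P 1 + (s - 1) *\<^sub>R P 2" if "0 < s" for s
 proof (rule affine_of_weak_second_derivative[OF Pc _ that])
  fix g g1 g2 :: "real => real" and a b :: real
  assume g: "!!rh. (g has_real_derivative g1 rh) (at rh)" "!!rh. (g1 has_real_derivative g2 rh) (at rh)" "continuous_on UNIV g2"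
  and ab: "0 < a" "a < b" and supp: "!!rh. rh \<notin> {a<..<b} ==> g rh = 0 \<and> g1 rh = 0 \<and> g2 rh = 0"
  have cg: "continuous_on S g" "continuous_on S g1" for S
  using g(1,2) by (auto intro!: continuous_at_imp_continuous_on DERIV_isCont)
  have sub: "continuous_on {a..b} f" if "continuous_on {0<..} f" for f :: "real => complex"
  by (rule continuous_on_subset[OF that]) (use ab in auto)
  define F where "F rh = of_real (4 * rh * g2 rh + 4 * (m + 1) * g1 rh + C rh * g rh) * W rh" for rh
  have Fi: "(F has_integral 0) {a..b}"
  proof -
  have F0: "F rh = 0" if "rh \<notin> {a..b}" for rh using supp[of rh] that by (force simp: F_def)
  have [measurable]: "g \<in> borel_measurable borel" "g1 \<in> borel_measurable borel" "g2 \<in> borel_measurable borel" "W \<in> borel_measurable borel"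
  using cg g(3) W by (auto intro: borel_measurable_continuous_onI)
  have Fm: "F \<in> borel_measurable borel" unfolding F_def[abs_def] C_def by measurable
  have "compact ((%rh. (of_real (4 * rh * g2 rh + 4 * (m + 1) * g1 rh) * W rh, of_real (g rh) * W rh)) ` {a..b})"
  by (intro compact_continuous_image continuous_intros cg continuous_on_subset[OF g(3)] continuous_on_subset[OF W]) auto
  from compact_imp_bounded[OF this] obtain B where B: "!!rh. rh \<in> {a..b} ==> norm (of_real (4 * rh * g2 rh + 4 * (m + 1) * g1 rh) * W rh, of_real (g rh) * W rh) <= B"
  unfolding bounded_iff by blast
  have FB: "norm (F rh) <= B + max \<bar>c1\<bar> \<bar>c2\<bar> * B" if "rh \<in> {a..b}" for rh
  proof -
  have n1: "norm (of_real (4 * rh * g2 rh + 4 * (m + 1) * g1 rh) * W rh) <= B" and n2: "norm (of_real (g rh) * W rh) <= B"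
  by (rule order_trans[OF norm_fst_le B[OF that]], rule order_trans[OF norm_snd_le B[OF that]])
  have "F rh = of_real (4 * rh * g2 rh + 4 * (m + 1) * g1 rh) * W rh + of_real (C rh) * (of_real (g rh) * W rh)"
  by (simp add: F_def algebra_simps)
  moreover have "norm (of_real (C rh) * (of_real (g rh) * W rh)) <= max \<bar>c1\<bar> \<bar>c2\<bar> * B"
  by (subst norm_mult) (intro mult_mono n2, auto simp: C_def)
  ultimately show ?thesis by (simp only: norm_triangle_mono[OF n1])
  qed
  have "integrable lborel F"
  using Fm FB F0 by (intro integrableI_bounded_set[of "{a..b}" lborel F "B + max \<bar>c1\<bar> \<bar>c2\<bar> * B"]) (auto simp: emeasure_lborel_Icc_eq)
  then have "(F has_integral integral\<^sup>L lborel F) UNIV" by (rule has_integral_integral_lborel)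
  moreover have "integral\<^sup>L lborel F = 0" using weak[OF g ab supp] by (simp add: F_def[abs_def] C_def)
  ultimately have "(F has_integral 0) UNIV" by simp
  moreover have "(%rh. if rh \<in> {a..b} then F rh else 0) = F" using F0 by auto
  ultimately show ?thesis using has_integral_restrict_UNIV[of "{a..b}" F 0] by simp
  qed
  \<comment> \<open>Collects the boundary terms of the integrations by parts; it vanishes at both
    ends together with \<open>g\<close> and \<open>g1\<close>.\<close>
  define Z where "Z rh = (4 * (m + 1) * g1 rh) *\<^sub>R M rh + g rh *\<^sub>R K rh - g1 rh *\<^sub>R L rh" for rh
  have Zi: "((%rh. F rh - g2 rh *\<^sub>R P rh) has_integral Z b - Z a) {a..b}"
  proof (rule fundamental_theorem_of_calculus_interior_strong[of "{e}"])
  show "continuous_on {a..b} Z" unfolding Z_def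
  by (intro continuous_intros cg sub M L Kc)
  fix rh assume "rh \<in> {a<..<b} - {e}"
  then have r: "0 < rh" "rh ~= e" using ab by auto
  have "(Z has_vector_derivative ((4 * (m + 1) * g1 rh) *\<^sub>R W rh + (4 * (m + 1) * g2 rh) *\<^sub>R M rh)
  + (g rh *\<^sub>R (C rh *\<^sub>R W rh) + g1 rh *\<^sub>R K rh) - (g1 rh *\<^sub>R K rh + g2 rh *\<^sub>R L rh)) (at rh)"
  unfolding Z_def[abs_def]
  by (intro has_vector_derivative_diff has_vector_derivative_add has_vector_derivative_scaleR DERIV_cmult g M L KD r)
  moreover have "((4 * (m + 1) * g1 rh) *\<^sub>R W rh + (4 * (m + 1) * g2 rh) *\<^sub>R M rh)
  + (g rh *\<^sub>R (C rh *\<^sub>R W rh) + g1 rh *\<^sub>R K rh) - (g1 rh *\<^sub>R K rh + g2 rh *\<^sub>R L rh) = F rh - g2 rh *\<^sub>R P rh"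
  unfolding F_def P_def by (simp add: scaleR_conv_of_real algebra_simps)
  ultimately show "(Z has_vector_derivative F rh - g2 rh *\<^sub>R P rh) (at rh)" by simp
  qed (use ab in auto)
  have "Z b - Z a = 0" using supp[of a] supp[of b] by (simp add: Z_def)
  with has_integral_diff[OF Fi Zi] show "((%rh. g2 rh *\<^sub>R P rh) has_integral 0) {a..b}" by simp
 qed
 \<comment> \<open>Obtained by differentiating the affine relation and solving for
   \<open>2 rho W'\<close>.\<close>
 define S where "S rh = (2 * m) *\<^sub>R W rh - (1 / 2) *\<^sub>R K rh + (1 / 2) *\<^sub>R (P 2 - P 1)" for rh
 have WD: "(W has_vector_derivative S rh /\<^sub>R (2 * rh)) (at rh)" if r: "0 < rh" for rh
 proof -
  define N where "N rh = (4 * (m + 1)) *\<^sub>R M rh - L rh + ((2 - rh) *\<^sub>R P 1 + (rh - 1) *\<^sub>R P 2)" for rh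
  have WN: "W x = (1 / (4 * x)) *\<^sub>R N x" if "0 < x" for x
  proof -
  have "N x = (4 * x) *\<^sub>R W x" using aff[OF that] unfolding N_def P_def[of x] by (simp add: algebra_simps)
  then show ?thesis using that by simp
  qed
  have d1: "((%x. (2 - x) *\<^sub>R P 1) has_vector_derivative (2 - rh) *\<^sub>R 0 + (- 1) *\<^sub>R P 1) (at rh)"
  "((%x. (x - 1) *\<^sub>R P 2) has_vector_derivative (rh - 1) *\<^sub>R 0 + 1 *\<^sub>R P 2) (at rh)"
  by (intro has_vector_derivative_scaleR has_vector_derivative_const; auto intro!: derivative_eq_intros)+
  have ND: "(N has_vector_derivative (4 * (m + 1)) *\<^sub>R W rh - K rh + (((2 - rh) *\<^sub>R 0 + (- 1) *\<^sub>R P 1) + ((rh - 1) *\<^sub>R 0 + 1 *\<^sub>R P 2))) (at rh)"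
  unfolding N_def[abs_def]
  by (intro has_vector_derivative_add has_vector_derivative_diff d1 bounded_linear.has_vector_derivative[OF bounded_linear_scaleR_right] M L r)
  have "((%x. 1 / (4 * x)) has_real_derivative - 1 / (4 * rh * rh)) (at rh)"
  using r by (auto intro!: derivative_eq_intros simp: field_simps)
  from has_vector_derivative_scaleR[OF this ND]
  have "((%x. (1 / (4 * x)) *\<^sub>R N x) has_vector_derivative (1 / (4 * rh)) *\<^sub>R
  ((4 * (m + 1)) *\<^sub>R W rh - K rh + (((2 - rh) *\<^sub>R 0 + (- 1) *\<^sub>R P 1) + ((rh - 1) *\<^sub>R 0 + 1 *\<^sub>R P 2)))
  + (- 1 / (4 * rh * rh)) *\<^sub>R N rh) (at rh)" .
  moreover have "N rh = (4 * rh) *\<^sub>R W rh" using WN[OF r] r by simp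
  then have "(1 / (4 * rh)) *\<^sub>R
  ((4 * (m + 1)) *\<^sub>R W rh - K rh + (((2 - rh) *\<^sub>R 0 + (- 1) *\<^sub>R P 1) + ((rh - 1) *\<^sub>R 0 + 1 *\<^sub>R P 2)))
  + (- 1 / (4 * rh * rh)) *\<^sub>R N rh = S rh /\<^sub>R (2 * rh)"
  using r unfolding S_def by (simp add: scaleR_conv_of_real field_simps)
  ultimately have "((%x. (1 / (4 * x)) *\<^sub>R N x) has_vector_derivative S rh /\<^sub>R (2 * rh)) (at rh)" by (simp only:)
  then show ?thesis
  by (rule has_vector_derivative_transform_within_open[of _ _ _ "{0<..}"]) (use r WN in auto)
 qed
 have SD: "(S has_vector_derivative (m / rh) *\<^sub>R S rh - (C rh / 2) *\<^sub>R W rh) (at rh)" if r: "0 < rh" "rh ~= e" for rh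
 proof -
  have S': "S = (%rh. (2 * m) *\<^sub>R W rh - (1 / 2) *\<^sub>R K rh + (1 / 2) *\<^sub>R (P 2 - P 1))" by (simp add: S_def fun_eq_iff)
  have "((%rh. (2 * m) *\<^sub>R W rh - (1 / 2) *\<^sub>R K rh + (1 / 2) *\<^sub>R (P 2 - P 1)) has_vector_derivative
  (2 * m) *\<^sub>R (S rh /\<^sub>R (2 * rh)) - (1 / 2) *\<^sub>R (C rh *\<^sub>R W rh) + 0) (at rh)"
  by (intro has_vector_derivative_add has_vector_derivative_diff bounded_linear.has_vector_derivative[OF bounded_linear_scaleR_right]
  WD KD r has_vector_derivative_const)
  moreover have "(2 * m) *\<^sub>R (S rh /\<^sub>R (2 * rh)) = (m / rh) *\<^sub>R S rh"
  unfolding scaleR_scaleR by (rule arg_cong[where f="%c. c *\<^sub>R S rh"]) (use r in \<open>simp add: field_simps\<close>)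
  moreover have "(1 / 2) *\<^sub>R (C rh *\<^sub>R W rh) = (C rh / 2) *\<^sub>R W rh" by simp
  ultimately show ?thesis unfolding S'[symmetric] by (simp only: add_0_right)
 qed
 have "continuous_on {0<..} S" unfolding S_def by (intro continuous_intros Kc continuous_on_subset[OF W]) auto
 then show ?thesis using WD SD unfolding C_def by blast
qed

section \<open>Modes of the incident and scattered fields\<close>

lemma tendsto_power_mult_Y:
 assumes "0 < n"
 shows "((%x. (x / 2) ^ n * bessel_Y n x) ---> - fact (n - 1) / pi) (at_right 0)"
proof -
 obtain j where n: "n = Suc j" using assms by (cases n) auto
 have P: "(clifford_P n ---> clifford_P n 0) (at_right 0)"
  unfolding clifford_P_def[abs_def] by (intro tendsto_intros)
 have P0: "clifford_P n 0 = fact (n - 1)"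
  unfolding clifford_P_def n sum.lessThan_Suc_shift by simp
 have l: "((%z::real. z * ln z) ---> 0) (at_right 0)" by real_asymp
 have pw: "((%z::real. z ^ k) ---> 0 ^ k) (at_right 0)" for k by (intro tendsto_intros)
 have "((%z. (z * ln z * z ^ j * clifford_J n z - clifford_P n z - z ^ n * clifford_S n z) / pi) --->
  (0 * 0 ^ j * (1 / fact n) - clifford_P n 0 - 0 ^ n * clifford_S n 0) / pi) (at_right 0)"
  by (intro tendsto_divide tendsto_diff tendsto_mult l pw P tendsto_clifford_J tendsto_clifford_S tendsto_const) simp
 then have "((%z. (z * ln z * z ^ j * clifford_J n z - clifford_P n z - z ^ n * clifford_S n z) / pi) ---> - fact (n - 1) / pi) (at_right 0)"
  by (rule tendsto_eq_rhs) (simp only: P0, simp add: n)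
 from filterlim_compose[OF this filterlim_sq_quarter]
 have "((%x. ((x^2 / 4) * ln (x^2 / 4) * (x^2 / 4) ^ j * clifford_J n (x^2 / 4) - clifford_P n (x^2 / 4) - (x^2 / 4) ^ n * clifford_S n (x^2 / 4)) / pi)
  ---> - fact (n - 1) / pi) (at_right 0)" .
 then show ?thesis
 proof (rule Lim_transform_eventually)
  show "\<forall>\<^sub>F x in at_right 0. ((x^2 / 4) * ln (x^2 / 4) * (x^2 / 4) ^ j * clifford_J n (x^2 / 4) - clifford_P n (x^2 / 4) - (x^2 / 4) ^ n * clifford_S n (x^2 / 4)) / pi
  = (x / 2) ^ n * bessel_Y n x"
  using eventually_at_right_less[of 0]
  proof eventually_elim
  case (elim x)
  define z where "z = x^2 / 4"
  have z: "z ^ n ~= 0" using elim by (simp add: z_def)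
  have "(x / 2) ^ n * (x / 2) ^ n = z ^ n"
  unfolding power_mult_distrib[symmetric] z_def by (simp add: power2_eq_square)
  then have "(x / 2) ^ n * bessel_Y n x = z ^ n * clifford_Y n z"
  by (simp add: bessel_Y_clifford[OF elim] z_def mult.assoc[symmetric])
  also have "... = (z ^ n * ln z * clifford_J n z - clifford_P n z - z ^ n * clifford_S n z) / pi"
  using z by (simp add: clifford_Y_def right_diff_distrib mult.assoc)
  also have "z ^ n * ln z = z * ln z * z ^ j" by (simp add: n)
  finally show ?case unfolding z_def[symmetric] by (rule sym)
  qed
 qed
qed

text \<open>Serves to exclude \<open>Y\<close> inside the scatterer, for which large values at some
  points near 0 suffice. Order 0 diverges logarithmically; for \<open>n > 0\<close>,
  \<open>(x / 2) ^ n * Y_n\<close> has a nonzero limit.\<close>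

lemma Y_unbounded:
 assumes "0 < d"
 shows "\<exists>x. 0 < x \<and> x < d \<and> B < \<bar>bessel_Y n x\<bar>"
proof (rule ccontr)
 assume "\<not> ?thesis"
 then have B: "\<bar>bessel_Y n x\<bar> <= B" if "0 < x" "x < d" for x using that by (metis not_less)
 have ev: "\<forall>\<^sub>F x in at_right 0. 0 < x \<and> x < d" by (rule eventually_at_rightI[OF _ assms]) simp
 show False
 proof (cases "n = 0")
  case True
  have "\<forall>\<^sub>F x in at_right 0. bessel_Y 0 x <= - B - 1" using Y0_at_bot by (simp add: filterlim_at_bot)
  with ev have "\<forall>\<^sub>F x :: real in at_right 0. False"
  by eventually_elim (use B True in force)
  then show False by simp
 next
  case False
  have "((%x. (x / 2) ^ n * B) ---> (0 / 2) ^ n * B) (at_right (0 :: real))" by (intro tendsto_intros) simp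
  then have "((%x. (x / 2) ^ n * B) ---> 0) (at_right (0 :: real))"
  by (rule tendsto_eq_rhs) (simp add: power_0_left False)
  then have "((%x. (x / 2) ^ n * bessel_Y n x) ---> 0) (at_right 0)"
  by (rule Lim_null_comparison[rotated])
  (use ev in eventually_elim, use B in \<open>auto simp: abs_mult intro!: mult_left_mono\<close>)
  from tendsto_unique[OF trivial_limit_at_right_real this tendsto_power_mult_Y] False show False by simp
 qed
qed

text \<open>Bessel's equation as a first-order system in \<open>U\<close> and
  \<open>Q = r * U'\<close>. In this form the wave number enters only the equation for
  \<open>Q'\<close>, so its jump at the interface leaves both unknowns continuous.\<close>

lemma bessel_system:
 assumes k: "0 < k" and r: "0 < r"
 shows "((%r. JB n (k * r)) has_real_derivative (k * r * dJ n (k * r)) / r) (at r)"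
  "((%r. bessel_Y n (k * r)) has_real_derivative (k * r * dY n (k * r)) / r) (at r)"
  "((%r. k * r * dJ n (k * r)) has_real_derivative ((real n)^2 / r - k^2 * r) * JB n (k * r)) (at r)"
  "((%r. k * r * dY n (k * r)) has_real_derivative ((real n)^2 / r - k^2 * r) * bessel_Y n (k * r)) (at r)"
proof -
 have kr: "0 < k * r" using k r by simp
 have sc: "((%r. k * r) has_real_derivative k) (at r)" by (auto intro!: derivative_eq_intros)
 show "((%r. JB n (k * r)) has_real_derivative (k * r * dJ n (k * r)) / r) (at r)"
  using DERIV_chain2[where f="JB n" and g="%r. k * r", OF DERIV_J[OF kr] sc] r by (simp add: mult.commute)
 show "((%r. bessel_Y n (k * r)) has_real_derivative (k * r * dY n (k * r)) / r) (at r)"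
  using DERIV_chain2[where f="bessel_Y n" and g="%r. k * r", OF DERIV_Y[OF kr] sc] r by (simp add: mult.commute)
 have alg: "k * d + (- d / (k * r) - (1 - (real n)^2 / (k * r)^2) * y) * k * (k * r) = ((real n)^2 / r - k^2 * r) * y" for d y
  using k r by (simp add: field_simps power2_eq_square)
 show "((%r. k * r * dJ n (k * r)) has_real_derivative ((real n)^2 / r - k^2 * r) * JB n (k * r)) (at r)"
  using DERIV_mult[OF sc DERIV_chain2[where f="dJ n" and g="%r. k * r", OF DERIV_dJ[OF kr] sc]] unfolding alg .
 show "((%r. k * r * dY n (k * r)) has_real_derivative ((real n)^2 / r - k^2 * r) * bessel_Y n (k * r)) (at r)"
  using DERIV_mult[OF sc DERIV_chain2[where f="dY n" and g="%r. k * r", OF DERIV_dY[OF kr] sc]] unfolding alg .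
qed

text \<open>The Wronskians of \<open>U\<close> with \<open>J\<close> and with \<open>Y\<close> are
  constant; since that of \<open>J\<close> and \<open>Y\<close> does not vanish, \<open>U\<close>
  and \<open>Q\<close> are both recovered from them.\<close>

lemma bessel_combination:
 fixes U Q :: "real => complex"
 assumes k: "0 < k" and I: "open I" "convex I" "I \<subseteq> {0<..}"
  and U: "!!r. r \<in> I ==> (U has_vector_derivative Q r /\<^sub>R r) (at r)"
  and Q: "!!r. r \<in> I ==> (Q has_vector_derivative ((real n)^2 / r - k^2 * r) *\<^sub>R U r) (at r)"
 shows "\<exists>al be. \<forall>r\<in>I. U r = al * of_real (JB n (k * r)) + be * of_real (bessel_Y n (k * r)) \<and>
  Q r = al * of_real (k * r * dJ n (k * r)) + be * of_real (k * r * dY n (k * r))"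
proof -
 have const: "\<exists>c. \<forall>r\<in>I. q r *\<^sub>R U r - y r *\<^sub>R Q r = c"
  if y: "!!r. 0 < r ==> (y has_real_derivative q r / r) (at r)"
  and q: "!!r. 0 < r ==> (q has_real_derivative ((real n)^2 / r - k^2 * r) * y r) (at r)" for y q :: "real => real"
 proof -
  have "((%r. q r *\<^sub>R U r - y r *\<^sub>R Q r) has_vector_derivative 0) (at r within I)" if r: "r \<in> I" for r
  proof -
  have r0: "0 < r" using r I by auto
  have "((%r. q r *\<^sub>R U r - y r *\<^sub>R Q r) has_vector_derivative
  (q r *\<^sub>R (Q r /\<^sub>R r) + (((real n)^2 / r - k^2 * r) * y r) *\<^sub>R U r)
  - (y r *\<^sub>R (((real n)^2 / r - k^2 * r) *\<^sub>R U r) + (q r / r) *\<^sub>R Q r)) (at r)"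
  by (intro has_vector_derivative_diff has_vector_derivative_scaleR y q r0 U Q r)
  moreover have "(q r *\<^sub>R (Q r /\<^sub>R r) + (((real n)^2 / r - k^2 * r) * y r) *\<^sub>R U r)
  - (y r *\<^sub>R (((real n)^2 / r - k^2 * r) *\<^sub>R U r) + (q r / r) *\<^sub>R Q r) = 0"
  by (simp add: divide_inverse mult.commute)
  ultimately show ?thesis by (metis has_vector_derivative_at_within)
  qed
  from has_vector_derivative_zero_constant[OF I(2) this] show ?thesis by metis
 qed
 from const[OF bessel_system(1,3)[OF k]] obtain B where
  B: "!!r. r \<in> I ==> (k * r * dJ n (k * r)) *\<^sub>R U r - JB n (k * r) *\<^sub>R Q r = B" by blast
 from const[OF bessel_system(2,4)[OF k]] obtain A where
  A: "!!r. r \<in> I ==> (k * r * dY n (k * r)) *\<^sub>R U r - bessel_Y n (k * r) *\<^sub>R Q r = A" by blast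
 have "U r = (of_real (pi / 2) * A) * of_real (JB n (k * r)) + (- of_real (pi / 2) * B) * of_real (bessel_Y n (k * r)) \<and>
  Q r = (of_real (pi / 2) * A) * of_real (k * r * dJ n (k * r)) + (- of_real (pi / 2) * B) * of_real (k * r * dY n (k * r))" if r: "r \<in> I" for r
 proof -
  have r0: "0 < k * r" using r I k by auto
  have cancel: "x * (2 / (pi * x)) = 2 / pi" if "0 < x" for x :: real using that by simp
  define J Y j y where "J = complex_of_real (JB n (k * r))" and "Y = complex_of_real (bessel_Y n (k * r))"
  and "j = complex_of_real (k * r * dJ n (k * r))" and "y = complex_of_real (k * r * dY n (k * r))"
  have "k * r * (JB n (k * r) * dY n (k * r) - dJ n (k * r) * bessel_Y n (k * r)) = 2 / pi"
  unfolding wronskian[OF r0, of n] by (rule cancel[OF r0])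
  then have "complex_of_real (k * r * (JB n (k * r) * dY n (k * r) - dJ n (k * r) * bessel_Y n (k * r))) = of_real (2 / pi)"
  by (simp only:)
  then have W: "of_real (pi / 2) * (J * y - j * Y) = 1"
  unfolding J_def Y_def j_def y_def by (simp add: algebra_simps)
  have A': "A = y * U r - Y * Q r" and B': "B = j * U r - J * Q r"
  using A[OF r] B[OF r] by (simp_all add: J_def Y_def j_def y_def scaleR_conv_of_real)
  have "(of_real (pi / 2) * A) * J + (- of_real (pi / 2) * B) * Y = (of_real (pi / 2) * (J * y - j * Y)) * U r"
  "(of_real (pi / 2) * A) * j + (- of_real (pi / 2) * B) * y = (of_real (pi / 2) * (J * y - j * Y)) * Q r"
  unfolding A' B' by (simp_all add: algebra_simps)
  then show ?thesis unfolding W J_def[symmetric] Y_def[symmetric] j_def[symmetric] y_def[symmetric] by simp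
 qed
 then show ?thesis by blast
qed

section \<open>Fourier coefficients of the incident field\<close>

lemma cis_integral:
 assumes "j ~= 0"
 shows "((%th. cis (of_int j * th)) has_integral 0) {0..2 * pi}"
proof -
 have D: "((%th. cis (of_int j * th) / (\<i> * of_int j)) has_vector_derivative cis (of_int j * th)) (at th within {0..2 * pi})" for th
 proof -
  have "((%th. exp (th *\<^sub>R (\<i> * of_int j))) has_vector_derivative (exp (th *\<^sub>R (\<i> * of_int j)) * (\<i> * of_int j))) (at th within {0..2 * pi})"
  by (rule exp_scaleR_has_vector_derivative_right)
  from has_vector_derivative_divide[OF this, of "\<i> * of_int j"] show ?thesis
  using assms by (simp add: cis_conv_exp scaleR_conv_of_real mult_ac)
 qed
 have "cis (of_int j * (2 * pi)) = 1" using cis_multiple_2pi[of "of_int j"] by (simp add: mult.commute)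
 then show ?thesis using fundamental_theorem_of_calculus[of 0 "2 * pi", OF _ D] by simp
qed

lemma incident_mode_rcis:
 assumes "0 < r"
 shows "incident_mode a k (rcis r th) n = a n * of_real (bessel_J n (k * r)) * cis (of_int n * th)"
proof -
 have "sgn (rcis r th) = cis th" using assms by (simp add: sgn_eq rcis_def norm_mult)
 moreover have "rcis r th ~= 0" using assms by simp
 ultimately have "cis (Arg (rcis r th)) = cis th" by (simp add: cis_Arg)
 then have "cis (of_int n * Arg (rcis r th)) = cis (of_int n * th)" by (metis cis_power_int)
 then show ?thesis using assms by (simp add: incident_mode_def)
qed

text \<open>Convergence at angle 0 is unconditional, hence absolute, and the moduli of the modes do
  not depend on the angle; so the series converges uniformly on the circle and may be integrated
  termwise.\<close>

lemma incident_field_circle: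
 assumes sum: "!!z. incident_mode a k z summable_on UNIV" and r: "0 < r"
 shows "continuous_on {0..2 * pi} (%th. incident_field a k (rcis r th))"
  and "circle_coeff (incident_field a k) r m = a m * of_real (bessel_J m (k * r))"
proof -
 define b where "b n = a n * of_real (bessel_J n (k * r))" for n
 have "incident_mode a k (rcis r 0) = b" unfolding fun_eq_iff b_def incident_mode_rcis[OF r] by simp
 with sum[of "rcis r 0"] have "b summable_on UNIV" by (simp only:)
 then have nb: "(%n. norm (b n)) summable_on UNIV" by (simp add: summable_on_iff_abs_summable_on_complex)
 have field: "incident_field a k (rcis r th) = (\<Sum>\<^sub>\<infinity>n. b n * cis (of_int n * th))" for th
  unfolding incident_field_def by (rule infsum_cong) (simp add: incident_mode_rcis[OF r] b_def)
 have U: "uniform_limit {0..2 * pi} (%F th. \<Sum>n\<in>F. b n * cis (of_int n * th)) (%th. \<Sum>\<^sub>\<infinity>n. b n * cis (of_int n * th)) (finite_subsets_at_top UNIV)"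
  by (rule Weierstrass_m_test_general[OF _ nb]) (simp add: norm_mult)
 have c: "continuous_on {0..2 * pi} (%th. \<Sum>n\<in>F. b n * cis (of_int n * th))" for F by (intro continuous_intros)
 show "continuous_on {0..2 * pi} (%th. incident_field a k (rcis r th))"
  unfolding field by (rule uniform_limit_theorem[OF _ U]) (simp_all add: c)
 have U': "uniform_limit {0..2 * pi} (%F th. \<Sum>n\<in>F. b n * cis (of_int (n - m) * th)) (%th. \<Sum>\<^sub>\<infinity>n. b n * cis (of_int (n - m) * th)) (finite_subsets_at_top UNIV)"
  by (rule Weierstrass_m_test_general[OF _ nb]) (simp add: norm_mult)
 have c': "continuous_on {0..2 * pi} (%th. \<Sum>n\<in>F. b n * cis (of_int (n - m) * th))" for F by (intro continuous_intros)
 obtain I L where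
  I: "!!F. ((%th. \<Sum>n\<in>F. b n * cis (of_int (n - m) * th)) has_integral I F) {0..2 * pi}"
  and L: "((%th. \<Sum>\<^sub>\<infinity>n. b n * cis (of_int (n - m) * th)) has_integral L) {0..2 * pi}"
  and lim: "(I ---> L) (finite_subsets_at_top UNIV)"
 proof (rule uniform_limit_integral[OF U' c' finite_subsets_at_top_neq_bot])
  fix I L
  assume "!!F. ((%th. \<Sum>n\<in>F. b n * cis (of_int (n - m) * th)) has_integral I F) {0..2 * pi}"
  "((%th. \<Sum>\<^sub>\<infinity>n. b n * cis (of_int (n - m) * th)) has_integral L) {0..2 * pi}"
  "(I ---> L) (finite_subsets_at_top UNIV)"
  then show thesis by (rule that)
 qed
 have IF: "I F = b m * of_real (2 * pi)" if F: "finite F" "m \<in> F" for F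
 proof -
  have tm: "((%th. b n * cis (of_int (n - m) * th)) has_integral (if n = m then b m * of_real (2 * pi) else 0)) {0..2 * pi}" for n
  proof (cases "n = m")
  case True
  have "((%th. b m) has_integral (2 * pi) *\<^sub>R b m) {0..2 * pi}" using has_integral_const_real[of "b m" 0 "2 * pi"] by simp
  then show ?thesis using True by (simp add: scaleR_conv_of_real mult_ac)
  next
  case False
  then show ?thesis using has_integral_mult_right[OF cis_integral[of "n - m"], of "b n"] by simp
  qed
  have "((%th. \<Sum>n\<in>F. b n * cis (of_int (n - m) * th)) has_integral (\<Sum>n\<in>F. if n = m then b m * of_real (2 * pi) else 0)) {0..2 * pi}"
  by (rule has_integral_sum[OF F(1) tm])
  from has_integral_unique[OF I this] show ?thesis using F by simp
 qed
 have "\<forall>\<^sub>F F in finite_subsets_at_top UNIV. I F = b m * of_real (2 * pi)"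
  unfolding eventually_finite_subsets_at_top by (intro exI[of _ "{m}"]) (auto simp: IF)
 then have "(I ---> b m * of_real (2 * pi)) (finite_subsets_at_top UNIV)" by (rule tendsto_eventually)
 then have Lb: "L = b m * of_real (2 * pi)" using lim tendsto_unique finite_subsets_at_top_neq_bot by blast
 have "incident_field a k (rcis r th) * cis (- (of_int m * th)) = (\<Sum>\<^sub>\<infinity>n. b n * cis (of_int (n - m) * th))" for th
 proof -
  have "incident_field a k (rcis r th) * cis (- (of_int m * th)) = (\<Sum>\<^sub>\<infinity>n. b n * cis (of_int n * th) * cis (- (of_int m * th)))"
  unfolding field by (rule infsum_cmult_left'[symmetric])
  then show ?thesis by (simp add: mult.assoc cis_mult left_diff_distrib)
 qed
 then have "integral {0..2 * pi} (%th. incident_field a k (rcis r th) * cis (- (of_int m * th))) = L"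
  using integral_unique[OF L] by simp
 then show "circle_coeff (incident_field a k) r m = a m * of_real (bessel_J m (k * r))"
  unfolding circle_coeff_def Lb b_def by simp
qed

text \<open>The equation in \<open>rho = r^2\<close> rewritten in \<open>r\<close> after removing
  the factor \<open>r ^ m\<close>: \<open>U = r^(-m) W\<close> and
  \<open>Q = r U' = r^(-m) (S - m W)\<close>, with \<open>W\<close> and \<open>S\<close> taken at
  \<open>r^2\<close>.\<close>

lemma helmholtz_mode:
 assumes u: "continuous_on UNIV u" and weak: "weak_helmholtz (%z. om\<^sup>2 * ball_index ep q q0 z) u" and ep: "0 < ep"
 shows "\<exists>Q. continuous_on {0<..} Q \<and>
  (\<forall>r>0. ((%r. circle_coeff u r (int m)) has_vector_derivative Q r /\<^sub>R r) (at r)) \<and>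
  (\<forall>r>0. r ~= ep --> (Q has_vector_derivative
  ((real m)^2 / r - (if r < ep then om\<^sup>2 * q else om\<^sup>2 * q0) * r) *\<^sub>R circle_coeff u r (int m)) (at r))"
proof -
 define C where "C rh = (if rh < ep\<^sup>2 then om\<^sup>2 * q else om\<^sup>2 * q0)" for rh
 have less_iff: "r^2 < ep\<^sup>2 \<longleftrightarrow> r < ep" if "0 <= r" for r
  using that ep power_strict_mono[of r ep 2] power_less_imp_less_base[of r 2 ep] by auto
 have "(%z. om\<^sup>2 * ball_index ep q q0 z) = (%z :: complex. C ((norm z)^2))"
  by (auto simp: C_def ball_index_def less_iff)
 then have weak': "weak_helmholtz (%z. C ((norm z)^2)) u" using weak by simp
 have Cm: "C \<in> borel_measurable borel" unfolding C_def[abs_def] by measurable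
 have CB: "\<bar>C rh\<bar> <= max \<bar>om\<^sup>2 * q\<bar> \<bar>om\<^sup>2 * q0\<bar>" for rh by (simp add: C_def)
 define W where "W = mode_profile u m"
 have "\<exists>S. continuous_on {0<..} S \<and> (\<forall>rh>0. (W has_vector_derivative S rh /\<^sub>R (2 * rh)) (at rh)) \<and>
  (\<forall>rh>0. rh ~= ep\<^sup>2 --> (S has_vector_derivative (real m / rh) *\<^sub>R S rh - ((if rh < ep\<^sup>2 then om\<^sup>2 * q else om\<^sup>2 * q0) / 2) *\<^sub>R W rh) (at rh))"
 proof (rule radial_equation)
  show "continuous_on UNIV W" unfolding W_def by (rule continuous_on_mode_profile[OF u])
  show "0 < ep\<^sup>2" using ep by simp
  fix g g1 g2 :: "real => real" and a b :: real
  assume g: "!!rh. (g has_real_derivative g1 rh) (at rh)" "!!rh. (g1 has_real_derivative g2 rh) (at rh)" "continuous_on UNIV g2"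
  and ab: "0 < a" "a < b" and supp: "!!rh. rh \<notin> {a<..<b} ==> g rh = 0 \<and> g1 rh = 0 \<and> g2 rh = 0"
  from weak_mode_equation[OF u weak' Cm CB g ab(1) supp, where m=m]
  show "(LINT rh|lborel. of_real (4 * rh * g2 rh + 4 * (real m + 1) * g1 rh + (if rh < ep\<^sup>2 then om\<^sup>2 * q else om\<^sup>2 * q0) * g rh) * W rh) = 0"
  unfolding W_def C_def .
 qed
 then obtain S where S: "continuous_on {0<..} S" "!!rh. 0 < rh ==> (W has_vector_derivative S rh /\<^sub>R (2 * rh)) (at rh)"
  "!!rh. 0 < rh ==> rh ~= ep\<^sup>2 ==> (S has_vector_derivative (real m / rh) *\<^sub>R S rh - (C rh / 2) *\<^sub>R W rh) (at rh)"
  unfolding C_def by blast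
 define f where "f r = 1 / r ^ m" for r :: real
 define U where "U r = circle_coeff u r (int m)" for r
 have UW: "U r = f r *\<^sub>R W (r^2)" if "0 < r" for r
  using that by (simp add: U_def f_def W_def mode_profile_def scaleR_conv_of_real)
 have sq: "((%r. r\<^sup>2) has_vector_derivative 2 * r) (at r)" for r :: real
  by (auto simp: has_real_derivative_iff_has_vector_derivative[symmetric] intro!: derivative_eq_intros)
 have fD: "(f has_real_derivative - (real m / r) * f r) (at r)" if "0 < r" for r
 proof -
  have "((%r. inverse (r ^ m)) has_real_derivative - (inverse (r ^ m) * (real m * r ^ (m - Suc 0)) * inverse (r ^ m))) (at r)"
  using that by (intro DERIV_inverse' DERIV_pow) auto
  moreover have "- (inverse (r ^ m) * (real m * r ^ (m - Suc 0)) * inverse (r ^ m)) = - (real m / r) * f r"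
  using that by (cases m) (auto simp: f_def field_simps)
  moreover have "(%r. inverse (r ^ m)) = f" by (simp add: f_def fun_eq_iff divide_inverse)
  ultimately show ?thesis by (simp only:)
 qed
 have WD: "((%r. W (r^2)) has_vector_derivative S (r^2) /\<^sub>R r) (at r)" if r: "0 < r" for r
 proof -
  have "0 < r^2" using r by simp
  from vector_diff_chain_at[OF sq S(2)[OF this]]
  have "((%r. W (r^2)) has_vector_derivative (2 * r) *\<^sub>R (S (r^2) /\<^sub>R (2 * r^2))) (at r)" by (simp add: o_def)
  moreover have "(2 * r) *\<^sub>R (S (r^2) /\<^sub>R (2 * r^2)) = S (r^2) /\<^sub>R r"
  unfolding scaleR_scaleR by (rule arg_cong[where f="%c. c *\<^sub>R S (r^2)"]) (use r in \<open>simp add: power2_eq_square field_simps\<close>)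
  ultimately show ?thesis by (simp only:)
 qed
 have SD: "((%r. S (r^2)) has_vector_derivative (2 * real m / r) *\<^sub>R S (r^2) - (r * C (r^2)) *\<^sub>R W (r^2)) (at r)" if r: "0 < r" "r ~= ep" for r
 proof -
  have "0 < r^2" "r^2 ~= ep\<^sup>2" using r ep by (auto simp: power2_eq_iff)
  from vector_diff_chain_at[OF sq S(3)[OF this]]
  have "((%r. S (r^2)) has_vector_derivative (2 * r) *\<^sub>R ((real m / r^2) *\<^sub>R S (r^2) - (C (r^2) / 2) *\<^sub>R W (r^2))) (at r)" by (simp add: o_def)
  moreover have "(2 * r) *\<^sub>R ((real m / r^2) *\<^sub>R S (r^2) - (C (r^2) / 2) *\<^sub>R W (r^2)) = (2 * real m / r) *\<^sub>R S (r^2) - (r * C (r^2)) *\<^sub>R W (r^2)"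
  unfolding scaleR_diff_right scaleR_scaleR
  by (rule arg_cong2[where f="%c d. c *\<^sub>R S (r^2) - d *\<^sub>R W (r^2)"]) (use r in \<open>simp_all add: power2_eq_square field_simps\<close>)
  ultimately show ?thesis by (simp only:)
 qed
 define Q where "Q r = f r *\<^sub>R (S (r^2) - real m *\<^sub>R W (r^2))" for r
 have UD: "(U has_vector_derivative Q r /\<^sub>R r) (at r)" if r: "0 < r" for r
 proof -
  have "((%r. f r *\<^sub>R W (r^2)) has_vector_derivative f r *\<^sub>R (S (r^2) /\<^sub>R r) + (- (real m / r) * f r) *\<^sub>R W (r^2)) (at r)"
  by (intro has_vector_derivative_scaleR fD WD r)
  moreover have "f r *\<^sub>R (S (r^2) /\<^sub>R r) + (- (real m / r) * f r) *\<^sub>R W (r^2) = Q r /\<^sub>R r"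
  by (simp add: Q_def scaleR_diff_right divide_inverse mult_ac)
  ultimately have "((%r. f r *\<^sub>R W (r^2)) has_vector_derivative Q r /\<^sub>R r) (at r)" by (simp only:)
  then show ?thesis
  by (rule has_vector_derivative_transform_within_open[of _ _ _ "{0<..}"]) (use r UW in auto)
 qed
 have QD: "(Q has_vector_derivative ((real m)^2 / r - C (r^2) * r) *\<^sub>R U r) (at r)" if r: "0 < r" "r ~= ep" for r
 proof -
  have Q': "Q = (%r. f r *\<^sub>R (S (r^2) - real m *\<^sub>R W (r^2)))" by (simp add: Q_def fun_eq_iff)
  have "((%r. f r *\<^sub>R (S (r^2) - real m *\<^sub>R W (r^2))) has_vector_derivative
  f r *\<^sub>R (((2 * real m / r) *\<^sub>R S (r^2) - (r * C (r^2)) *\<^sub>R W (r^2)) - real m *\<^sub>R (S (r^2) /\<^sub>R r))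
  + (- (real m / r) * f r) *\<^sub>R (S (r^2) - real m *\<^sub>R W (r^2))) (at r)"
  by (intro has_vector_derivative_scaleR has_vector_derivative_diff bounded_linear.has_vector_derivative[OF bounded_linear_scaleR_right] fD WD SD r)
  moreover have "f r *\<^sub>R (((2 * real m / r) *\<^sub>R S (r^2) - (r * C (r^2)) *\<^sub>R W (r^2)) - real m *\<^sub>R (S (r^2) /\<^sub>R r))
  + (- (real m / r) * f r) *\<^sub>R (S (r^2) - real m *\<^sub>R W (r^2)) = ((real m)^2 / r - C (r^2) * r) *\<^sub>R U r"
  unfolding UW[OF r(1)] by (simp add: scaleR_conv_of_real divide_inverse power2_eq_square algebra_simps)
  ultimately show ?thesis unfolding Q' by (simp only:)
 qed
 have "continuous_on {0<..} Q"
  unfolding Q_def f_def W_def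
  by (intro continuous_intros continuous_on_compose2[OF S(1)] continuous_on_compose2[OF continuous_on_mode_profile[OF u]]) auto
 moreover have "C (r^2) = (if r < ep then om\<^sup>2 * q else om\<^sup>2 * q0)" if "0 < r" for r using that by (simp add: C_def less_iff)
 ultimately show ?thesis using UD QD unfolding U_def[abs_def] by (intro exI[of _ Q]) simp
qed

text \<open>A nonzero multiple of \<open>Y\<close> would be unbounded near the centre, while
  \<open>J\<close> and \<open>U\<close> are bounded there.\<close>

lemma interior_mode:
 fixes U Q :: "real => complex"
 assumes k: "0 < k" and ep: "0 < ep" and B: "!!r. 0 < r ==> r < ep ==> norm (U r) <= B"
  and U: "!!r. 0 < r ==> r < ep ==> (U has_vector_derivative Q r /\<^sub>R r) (at r)"
  and Q: "!!r. 0 < r ==> r < ep ==> (Q has_vector_derivative ((real n)^2 / r - k^2 * r) *\<^sub>R U r) (at r)"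
 shows "\<exists>al. \<forall>r. 0 < r \<and> r < ep --> U r = al * of_real (JB n (k * r)) \<and> Q r = al * of_real (k * r * dJ n (k * r))"
proof -
 have "\<exists>al be. \<forall>r\<in>{0<..<ep}. U r = al * of_real (JB n (k * r)) + be * of_real (bessel_Y n (k * r)) \<and>
  Q r = al * of_real (k * r * dJ n (k * r)) + be * of_real (k * r * dY n (k * r))"
  by (rule bessel_combination[OF k]) (use U Q in auto)
 then obtain al be where ab: "!!r. 0 < r ==> r < ep ==> U r = al * of_real (JB n (k * r)) + be * of_real (bessel_Y n (k * r)) \<and>
  Q r = al * of_real (k * r * dJ n (k * r)) + be * of_real (k * r * dY n (k * r))" by auto
 have "be = 0"
 proof (rule ccontr)
  assume be: "be ~= 0"
  have "\<forall>\<^sub>F x in at_right 0. JB n x < 2"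
  using order_tendstoD(2)[OF tendsto_J_0[of n], of 2] by (auto split: if_splits)
  with J_pos_near_0[of n] have "\<forall>\<^sub>F x in at_right 0. \<bar>JB n x\<bar> <= 2" by eventually_elim simp
  then obtain d where d: "0 < d" "!!x. 0 < x ==> x < d ==> \<bar>JB n x\<bar> <= 2"
  by (auto simp: eventually_at_right_field)
  obtain x where x: "0 < x" "x < min d (k * ep)" "(B + norm al * 2) / norm be < \<bar>bessel_Y n x\<bar>"
  using Y_unbounded[of "min d (k * ep)"] d k ep by (metis min_less_iff_conj mult_pos_pos)
  define r where "r = x / k"
  have r: "0 < r" "r < ep" "k * r = x" using x k by (auto simp: r_def field_simps)
  have "be * of_real (bessel_Y n x) = U r - al * of_real (JB n x)" using ab[OF r(1,2)] r(3) by simp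
  then have "norm be * \<bar>bessel_Y n x\<bar> = norm (U r - al * of_real (JB n x))" by (metis norm_mult norm_of_real)
  also have "... <= norm (U r) + norm (al * of_real (JB n x))" by (rule norm_triangle_ineq4)
  also have "... <= B + norm al * 2" using B[OF r(1,2)] d(2)[of x] x unfolding norm_mult norm_of_real by (intro add_mono mult_left_mono) auto
  finally show False using x(3) be by (simp add: field_simps)
 qed
 then show ?thesis using ab by (intro exI[of _ al]) simp
qed

text \<open>A unit factor makes the derivative real and positive, so a bound on increments to the
  right is enough. Thus the radiation condition can act on circle averages through increments,
  without differentiating under the integral sign.\<close>

lemma norm_vector_derivative_le_Lipschitz:
 fixes h :: "real => complex"
 assumes h: "(h has_vector_derivative h') (at r)" and L: "!!y. r < y ==> norm (h y - h r) <= c * (y - r)"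
 shows "norm h' <= c"
proof (cases "h' = 0")
 case True
 then show ?thesis using order_trans[OF norm_ge_zero L[of "r + 1"]] by simp
next
 case False
 define w where "w = cnj h' / norm h'"
 have "w * h' = h' * cnj h' / of_real (norm h')" by (simp add: w_def mult.commute)
 also have "h' * cnj h' = of_real (norm h') * of_real (norm h')"
  using complex_norm_square[of h'] by (simp add: power2_eq_square)
 also have "of_real (norm h') * of_real (norm h') / of_real (norm h') = complex_of_real (norm h')" using False by simp
 finally have w: "norm w = 1" "w * h' = norm h'" using False by (simp_all add: w_def norm_divide)
 have "((%y. Re (w * h y)) has_real_derivative norm h') (at r)"
  using bounded_linear.has_vector_derivative[OF bounded_linear_compose[OF bounded_linear_Re bounded_linear_mult_right[of w]] h] w(2)
  by (simp add: has_real_derivative_iff_has_vector_derivative)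
 then have "((%y. Re (w * h y)) has_real_derivative norm h') (at r within {r<..})"
  by (rule has_field_derivative_at_within)
 then have "((%y. (Re (w * h y) - Re (w * h r)) / (y - r)) ---> norm h') (at_right r)"
  unfolding has_field_derivative_iff .
 moreover have "\<forall>\<^sub>F y in at_right r. (Re (w * h y) - Re (w * h r)) / (y - r) <= c"
  using eventually_at_right_less[of r]
 proof eventually_elim
  case (elim y)
  have "Re (w * h y) - Re (w * h r) = Re (w * (h y - h r))" by (simp add: algebra_simps)
  also have "... <= norm (w * (h y - h r))" by (rule complex_Re_le_cmod)
  also have "... <= c * (y - r)" using L[OF elim] w by (simp add: norm_mult)
  finally show ?case using elim by (simp add: divide_le_eq)
 qed
 ultimately show ?thesis by (rule tendsto_upperbound) simp
qed

text \<open>Integrated along rays, the radiation condition passes to the Fourier coefficients on circles.\<close>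

lemma outgoing_circle_coeff:
 assumes out: "outgoing k v" and c: "!!r. 0 < r ==> continuous_on {0..2 * pi} (%th. v (rcis r th))" and de: "0 < de"
 shows "\<exists>R0>0. \<forall>r V'. R0 < r --> ((%r. circle_coeff v r n) has_vector_derivative V') (at r) -->
  norm (V' - \<i> * of_real k * circle_coeff v r n) <= de * r powr (- 1 / 2)"
proof -
 have ev: "\<forall>\<^sub>F z in at_infinity. radial_fun v z differentiable (at (norm z))"
  and sm: "(%z. vector_derivative (radial_fun v z) (at (norm z)) - \<i> * of_real k * v z) \<in> o[at_infinity](%z. complex_of_real (norm z powr (- 1 / 2)))"
  using out unfolding outgoing_def by auto
 from ev landau_o.smallD[OF sm de]
 have "\<forall>\<^sub>F z in at_infinity. radial_fun v z differentiable (at (norm z)) \<and>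
  norm (vector_derivative (radial_fun v z) (at (norm z)) - \<i> * of_real k * v z) <= de * norm z powr (- 1 / 2)"
  by eventually_elim simp
 then obtain b where b: "!!z. b <= norm z ==> radial_fun v z differentiable (at (norm z)) \<and>
  norm (vector_derivative (radial_fun v z) (at (norm z)) - \<i> * of_real k * v z) <= de * norm z powr (- 1 / 2)"
  unfolding eventually_at_infinity by blast
 define R0 where "R0 = max b 1"
 \<comment> \<open>The integrating factor \<open>exp (- i k r)\<close>: it turns
   \<open>v' - i k v\<close> into the derivative of \<open>E * v\<close>, up to a factor of modulus
   1.\<close>
 define E where "E r = exp (r *\<^sub>R (- \<i> * of_real k))" for r
 have nE: "norm (E r) = 1" for r by (simp add: E_def)
 define h where "h th r = E r * v (rcis r th)" for th r
 have ray: "norm (h th r2 - h th r1) <= de * r1 powr (- 1 / 2) * (r2 - r1)" if r: "R0 < r1" "r1 < r2" for r1 r2 th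
 proof -
  define f where "f t = v (t *\<^sub>R cis th)" for t
  have fD: "(f has_vector_derivative vector_derivative f (at t)) (at t)"
  and fb: "norm (vector_derivative f (at t) - \<i> * of_real k * f t) <= de * r1 powr (- 1 / 2)" if t: "r1 <= t" for t
  proof -
  have t0: "0 < t" "b <= t" using t r by (auto simp: R0_def)
  have "sgn (rcis t th) = cis th" using t0 by (simp add: sgn_eq rcis_def norm_mult)
  then have "radial_fun v (rcis t th) = f" by (simp add: radial_fun_def f_def fun_eq_iff)
  moreover have "v (rcis t th) = f t" by (simp add: f_def rcis_def scaleR_conv_of_real)
  ultimately have "f differentiable (at t)" "norm (vector_derivative f (at t) - \<i> * of_real k * f t) <= de * t powr (- 1 / 2)"
  using b[of "rcis t th"] t0 by simp_all
  moreover have "t powr (- 1 / 2) <= r1 powr (- 1 / 2)" using t r by (intro powr_mono2') (auto simp: R0_def)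
  ultimately show "(f has_vector_derivative vector_derivative f (at t)) (at t)"
  "norm (vector_derivative f (at t) - \<i> * of_real k * f t) <= de * r1 powr (- 1 / 2)"
  using de by (auto simp: vector_derivative_works intro: order_trans mult_left_mono)
  qed
  have hf: "h th t = E t * f t" for t by (simp add: h_def f_def rcis_def scaleR_conv_of_real)
  have hD: "((%t. E t * f t) has_vector_derivative E t * (vector_derivative f (at t) - \<i> * of_real k * f t)) (at t within {r1..r2})" if "t \<in> {r1..r2}" for t
  proof -
  have "r1 <= t" using that by simp
  have "(E has_vector_derivative E t * (- \<i> * of_real k)) (at t)"
  unfolding E_def[abs_def] by (rule exp_scaleR_has_vector_derivative_right)
  from has_vector_derivative_mult[OF this fD[OF \<open>r1 <= t\<close>]]
  have "((%t. E t * f t) has_vector_derivative E t * (vector_derivative f (at t) - \<i> * of_real k * f t)) (at t)"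
  by (simp add: algebra_simps)
  then show ?thesis by (rule has_vector_derivative_at_within)
  qed
  have "norm (E r2 * f r2 - E r1 * f r1) <= de * r1 powr (- 1 / 2) * norm (r2 - r1)"
  proof (rule differentiable_bound[where S="{r1..r2}" and f="%t. E t * f t" and f'="%t h. h *\<^sub>R (E t * (vector_derivative f (at t) - \<i> * of_real k * f t))"])
  fix t assume t: "t \<in> {r1..r2}"
  show "((%t. E t * f t) has_derivative (%h. h *\<^sub>R (E t * (vector_derivative f (at t) - \<i> * of_real k * f t)))) (at t within {r1..r2})"
  using hD[OF t] unfolding has_vector_derivative_def .
  show "onorm (%h. h *\<^sub>R (E t * (vector_derivative f (at t) - \<i> * of_real k * f t))) <= de * r1 powr (- 1 / 2)"
  using fb[of t] t de by (intro onorm_bound) (auto simp: norm_mult nE mult.commute[of "\<bar>_\<bar>"] intro!: mult_right_mono)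
  qed (use r in auto)
  then show ?thesis using r by (simp add: hf)
 qed
 show ?thesis
 proof (intro exI[of _ R0] conjI allI impI)
  show "0 < R0" by (simp add: R0_def)
  fix r V' assume r: "R0 < r" and V': "((%r. circle_coeff v r n) has_vector_derivative V') (at r)"
  have r0: "0 < r" using r by (simp add: R0_def)
  define V where "V r = circle_coeff v r n" for r
  have lip: "norm (E y * V y - E r * V r) <= de * r powr (- 1 / 2) * (y - r)" if y: "r < y" for y
  proof -
  define F where "F s th = v (rcis s th) * cis (- (of_int n * th))" for s th
  have cF: "continuous_on {0..2 * pi} (F s)" if "0 < s" for s
  unfolding F_def using that by (intro continuous_intros c)
  have iF: "F s integrable_on {0..2 * pi}" if "0 < s" for s by (intro integrable_continuous_interval cF that)
  have y0: "0 < y" using y r0 by simp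
  have "E y * V y - E r * V r = of_real (1 / (2 * pi)) * (integral {0..2 * pi} (%th. E y * F y th) - integral {0..2 * pi} (%th. E r * F r th))"
  proof -
  have "V s = of_real (1 / (2 * pi)) * integral {0..2 * pi} (F s)" for s
  by (simp add: V_def circle_coeff_def F_def[abs_def])
  then show ?thesis by (simp add: algebra_simps)
  qed
  also have "integral {0..2 * pi} (%th. E y * F y th) - integral {0..2 * pi} (%th. E r * F r th) = integral {0..2 * pi} (%th. E y * F y th - E r * F r th)"
  using iF[OF y0] iF[OF r0] by (intro Henstock_Kurzweil_Integration.integral_diff[symmetric] integrable_on_mult_right)
  finally have "norm (E y * V y - E r * V r) = (1 / (2 * pi)) * norm (integral {0..2 * pi} (%th. E y * F y th - E r * F r th))"
  by (simp only: norm_mult norm_of_real) simp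
  moreover have "norm (integral {0..2 * pi} (%th. E y * F y th - E r * F r th)) <= (de * r powr (- 1 / 2) * (y - r)) * (2 * pi - 0)"
  proof (rule integral_bound)
  show "continuous_on {0..2 * pi} (%th. E y * F y th - E r * F r th)"
  by (intro continuous_on_diff continuous_on_mult continuous_on_const cF y0 r0)
  fix th
  have "E y * F y th - E r * F r th = (h th y - h th r) * cis (- (of_int n * th))" by (simp add: F_def h_def algebra_simps)
  then show "norm (E y * F y th - E r * F r th) <= de * r powr (- 1 / 2) * (y - r)"
  using ray[OF r y, of th] by (simp add: norm_mult)
  qed simp
  ultimately show ?thesis by (simp add: divide_le_eq)
  qed
  have ED: "(E has_vector_derivative E r * (- \<i> * of_real k)) (at r)"
  unfolding E_def[abs_def] by (rule exp_scaleR_has_vector_derivative_right)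
  from has_vector_derivative_mult[OF this V'[folded V_def]]
  have "((%r. E r * V r) has_vector_derivative E r * (V' - \<i> * of_real k * V r)) (at r)" by (simp add: algebra_simps)
  from norm_vector_derivative_le_Lipschitz[OF this lip]
  show "norm (V' - \<i> * of_real k * circle_coeff v r n) <= de * r powr (- 1 / 2)"
  by (simp add: norm_mult nE V_def)
 qed
qed

text \<open>\<open>H' - i H = w H\<close> with \<open>w\<close> tending to 0, whereas
  \<open>cnj H' - i cnj H = cnj (w + 2 i) cnj H\<close>. As \<open>sqrt x * |H|\<close> tends to
  \<open>sqrt (2 / pi)\<close>, an incoming part would leave a term of exact order
  \<open>r^(-1/2)\<close>, which the radiation condition forbids.\<close>

lemma outgoing_combination:
 assumes k: "0 < k"
  and V: "!!de. 0 < de ==> \<exists>R0>0. \<forall>r>R0. norm (of_real k * (ga * (dH n (k * r) - \<i> * hankel1 n (k * r))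
  + be * (cnj (dH n (k * r)) - \<i> * cnj (hankel1 n (k * r))))) <= de * r powr (- 1 / 2)"
 shows "be = 0"
proof -
 define w where "w x = Complex (Nic (real n) 1 x / (2 * x * Nic (real n) 0 x)) (2 / (pi * x * Nic (real n) 0 x) - 1)" for x
 have w0: "(w ---> 0) at_top" unfolding w_def[abs_def] by (rule hankel_outgoing_coeff)
 define L where "L x = sqrt (x * Nic (real n) 0 x) * (norm be * norm (w x + 2 * \<i>) - norm ga * norm (w x))" for x
 have "(L ---> sqrt (2 / pi) * (norm be * norm (0 + 2 * \<i>) - norm ga * norm (0 :: complex))) at_top"
  unfolding L_def[abs_def] by (intro tendsto_intros w0 Nic_at_top(1))
 then have Ll: "(L ---> sqrt (2 / pi) * (norm be * 2)) at_top" by (simp add: norm_mult)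
 have bound: "\<forall>\<^sub>F x in at_top. L x <= de / sqrt k" if de: "0 < de" for de
 proof -
  obtain R0 where R0: "0 < R0" "!!r. R0 < r ==> norm (of_real k * (ga * (dH n (k * r) - \<i> * hankel1 n (k * r))
  + be * (cnj (dH n (k * r)) - \<i> * cnj (hankel1 n (k * r))))) <= de * r powr (- 1 / 2)" using V[OF de] by blast
  show ?thesis using eventually_gt_at_top[of "k * R0"]
  proof eventually_elim
  case (elim x)
  have x0: "0 < x" using elim k R0(1) by (metis less_trans mult_pos_pos)
  define r where "r = x / k"
  have r: "R0 < r" "k * r = x" "0 < r" using elim k x0 by (auto simp: r_def field_simps)
  let ?H = "hankel1 n x"
  have o: "dH n x - \<i> * ?H = w x * ?H" using hankel_outgoing[OF x0, of n] by (simp add: w_def)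
  then have "dH n x + \<i> * ?H = (w x + 2 * \<i>) * ?H" by (simp add: algebra_simps)
  then have "cnj (dH n x + \<i> * ?H) = cnj ((w x + 2 * \<i>) * ?H)" by (simp only:)
  then have o': "cnj (dH n x) - \<i> * cnj ?H = cnj (w x + 2 * \<i>) * cnj ?H" by simp
  have nH: "norm ?H = sqrt (Nic (real n) 0 x)" using hankel_norm[OF x0, of n] by (metis norm_ge_zero real_sqrt_unique)
  have "norm ?H * (norm be * norm (w x + 2 * \<i>) - norm ga * norm (w x))
  = norm (be * (cnj (w x + 2 * \<i>) * cnj ?H)) - norm (ga * (w x * ?H))"
  by (simp only: norm_mult complex_mod_cnj) (simp add: algebra_simps)
  also have "... <= norm (ga * (w x * ?H) + be * (cnj (w x + 2 * \<i>) * cnj ?H))"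
  by (metis add.commute norm_diff_ineq)
  finally have "k * (norm ?H * (norm be * norm (w x + 2 * \<i>) - norm ga * norm (w x))) <= k * norm (ga * (w x * ?H) + be * (cnj (w x + 2 * \<i>) * cnj ?H))"
  using k by simp
  also have "... = norm (of_real k * (ga * (dH n x - \<i> * ?H) + be * (cnj (dH n x) - \<i> * cnj ?H)))"
  unfolding o o' norm_mult[of "of_real k"] using k by simp
  also have "... <= de * r powr (- 1 / 2)" using R0(2)[OF r(1)] unfolding r(2) .
  also have "r powr (- 1 / 2) = sqrt k / sqrt x"
  using r(3) x0 k by (simp add: powr_minus_divide powr_half_sqrt r_def real_sqrt_divide)
  finally have "k * (norm ?H * (norm be * norm (w x + 2 * \<i>) - norm ga * norm (w x))) <= de * (sqrt k / sqrt x)" .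
  then have "(sqrt x / k) * (k * (norm ?H * (norm be * norm (w x + 2 * \<i>) - norm ga * norm (w x)))) <= (sqrt x / k) * (de * (sqrt k / sqrt x))"
  using k x0 by (intro mult_left_mono) auto
  moreover have "(sqrt x / k) * (k * (norm ?H * (norm be * norm (w x + 2 * \<i>) - norm ga * norm (w x)))) = L x"
  using k by (simp add: L_def nH real_sqrt_mult)
  moreover have "(sqrt x / k) * (de * (sqrt k / sqrt x)) = de / sqrt k"
  using k x0 real_sqrt_mult_self[of k] by (simp add: field_simps)
  ultimately show ?case by (simp only:)
  qed
 qed
 have "sqrt (2 / pi) * (norm be * 2) <= 0 + e" if "0 < e" for e
 proof -
  have "\<forall>\<^sub>F x in at_top. L x <= (e * sqrt k) / sqrt k" by (rule bound) (use k that in simp)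
  then have "\<forall>\<^sub>F x in at_top. L x <= e" using k by simp
  from tendsto_upperbound[OF Ll this] show ?thesis by simp
 qed
 then have "sqrt (2 / pi) * (norm be * 2) <= 0" by (rule field_le_epsilon)
 moreover have "0 < sqrt (2 / pi)" by simp
 ultimately have "norm be <= 0" by (metis mult_le_0_iff not_less mult_pos_pos zero_less_numeral)
 then show ?thesis by simp
qed

section \<open>The scattering coefficient at a resonance\<close>

text \<open>Inside, the mode is a multiple of \<open>J (lam k r)\<close>; outside, it is the
  incident part plus \<open>ga * H\<close>. Continuity of \<open>U\<close> and \<open>Q\<close> at
  \<open>ep\<close> gives \<open>ga * D = - a * Re D\<close>, where at a resonance \<open>D\<close>
  is real and nonzero; hence \<open>ga = - a\<close>. The coefficient follows from the weak equation
  and the radiation condition, for whichever solution is given.\<close>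

lemma scattered_coeff_at_resonance:
 assumes pos: "0 < ep" "0 < q" "0 < q0" "0 < om" and k: "k = sqrt q0 * om" and lam: "lam = sqrt (q / q0)"
  and sum: "!!z. incident_mode a k z summable_on UNIV"
  and sol: "scattering_solution ep q q0 om (incident_field a k) u"
  and res: "resonance_fun m lam (k * ep) = 0" and R: "ep <= R"
 shows "circle_coeff (%z. u z - incident_field a k z) R (int m) = - a (int m) * hankel1 m (k * R)"
proof -
 let ?us = "%z. u z - incident_field a k z" and ?a = "a (int m)"
 have k0: "0 < k" using pos k by simp
 have lam0: "0 < lam" using pos lam by simp
 define l where "l = lam * k"
 have l0: "0 < l" using k0 lam0 by (simp add: l_def)
 have k2: "k^2 = om\<^sup>2 * q0" using pos by (simp add: k power_mult_distrib mult.commute)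
 have l2: "l^2 = om\<^sup>2 * q" using pos by (simp add: l_def power_mult_distrib k2 lam)
 have cu: "continuous_on UNIV u" and weak: "weak_helmholtz (%z. om\<^sup>2 * ball_index ep q q0 z) u" and out: "outgoing k ?us"
  using sol by (simp_all add: scattering_solution_def k mult.commute)
 define U where "U r = circle_coeff u r (int m)" for r
 define J where "J r = complex_of_real (JB m (k * r))" for r
 obtain Q where Qc: "continuous_on {0<..} Q" and U: "!!r. 0 < r ==> (U has_vector_derivative Q r /\<^sub>R r) (at r)"
  and Q: "!!r. 0 < r ==> r ~= ep ==> (Q has_vector_derivative ((real m)^2 / r - (if r < ep then l\<^sup>2 else k\<^sup>2) * r) *\<^sub>R U r) (at r)"
  using helmholtz_mode[OF cu weak pos(1), of m] unfolding U_def[abs_def] k2 l2 by blast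
 have Ucont: "continuous_on UNIV U" unfolding U_def by (rule continuous_on_circle_coeff[OF cu])
 have "compact (U ` {0..ep})" by (intro compact_continuous_image continuous_on_subset[OF Ucont]) auto
 from compact_imp_bounded[OF this] obtain B where B: "!!r. r \<in> {0..ep} ==> norm (U r) <= B"
  unfolding bounded_iff by blast
 have "\<exists>al. \<forall>r. 0 < r \<and> r < ep --> U r = al * of_real (JB m (l * r)) \<and> Q r = al * of_real (l * r * dJ m (l * r))"
 proof (rule interior_mode[OF l0 pos(1), of U B])
  show "(Q has_vector_derivative ((real m)^2 / r - l^2 * r) *\<^sub>R U r) (at r)" if "0 < r" "r < ep" for r
  using Q[of r] that by simp
 qed (use B U in auto)
 then obtain al where inside: "!!r. 0 < r ==> r < ep ==> U r = al * of_real (JB m (l * r)) \<and> Q r = al * of_real (l * r * dJ m (l * r))"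
  by blast
 have "\<exists>al be. \<forall>r\<in>{ep<..}. U r = al * of_real (JB m (k * r)) + be * of_real (bessel_Y m (k * r)) \<and>
  Q r = al * of_real (k * r * dJ m (k * r)) + be * of_real (k * r * dY m (k * r))"
 proof (rule bessel_combination[OF k0])
  show "(Q has_vector_derivative ((real m)^2 / r - k^2 * r) *\<^sub>R U r) (at r)" if "r \<in> {ep<..}" for r
  using Q[of r] that pos(1) by simp
 qed (use U pos(1) in auto)
 then obtain al' be' where ab: "!!r. ep < r ==> U r = al' * of_real (JB m (k * r)) + be' * of_real (bessel_Y m (k * r)) \<and>
  Q r = al' * of_real (k * r * dJ m (k * r)) + be' * of_real (k * r * dY m (k * r))" by (metis greaterThan_iff)
 \<comment> \<open>Change of basis from \<open>J\<close>, \<open>Y\<close> to the outgoing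
   \<open>H\<close> and the incoming \<open>cnj H\<close>.\<close>
 define ga where "ga = (al' - ?a - \<i> * be') / 2"
 define be where "be = (al' - ?a + \<i> * be') / 2"
 have gb: "(al' - ?a) * of_real s + be' * of_real t = ga * Complex s t + be * cnj (Complex s t)" for s t
 proof -
  have e: "Complex s t = of_real s + \<i> * of_real t" "cnj (Complex s t) = of_real s - \<i> * of_real t" by (simp_all add: complex_eq_iff)
  have "ga * (of_real s + \<i> * of_real t) + be * (of_real s - \<i> * of_real t) = (ga + be) * of_real s + \<i> * (ga - be) * of_real t"
  by (simp add: algebra_simps)
  also have "ga + be = al' - ?a" by (simp add: ga_def be_def field_simps)
  also have "\<i> * (ga - be) = be'" by (simp add: ga_def be_def diff_divide_distrib[symmetric])
  finally show ?thesis unfolding e by simp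
 qed
 have V: "U r - ?a * J r = ga * hankel1 m (k * r) + be * cnj (hankel1 m (k * r))"
  and QV: "Q r - ?a * of_real (k * r * dJ m (k * r)) = of_real (k * r) * (ga * dH m (k * r) + be * cnj (dH m (k * r)))" if "ep < r" for r
 proof -
  show "U r - ?a * J r = ga * hankel1 m (k * r) + be * cnj (hankel1 m (k * r))"
  using ab[OF that] gb[of "JB m (k * r)" "bessel_Y m (k * r)"] by (simp add: hankel1_def J_def algebra_simps)
  have "Q r - ?a * of_real (k * r * dJ m (k * r)) = of_real (k * r) * ((al' - ?a) * of_real (dJ m (k * r)) + be' * of_real (dY m (k * r)))"
  using ab[OF that] by (simp add: algebra_simps)
  then show "Q r - ?a * of_real (k * r * dJ m (k * r)) = of_real (k * r) * (ga * dH m (k * r) + be * cnj (dH m (k * r)))"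
  unfolding gb dH_def .
 qed
 have coeff: "circle_coeff ?us r (int m) = U r - ?a * J r" if r: "0 < r" for r
 proof -
  have c1: "continuous_on {0..2 * pi} (%th. u (rcis r th) * cis (- (of_int (int m) * th)))"
  unfolding rcis_def by (intro continuous_intros continuous_on_compose2[OF cu]) auto
  have c2: "continuous_on {0..2 * pi} (%th. incident_field a k (rcis r th) * cis (- (of_int (int m) * th)))"
  by (intro continuous_on_mult incident_field_circle(1)[OF sum r] continuous_intros)
  have "circle_coeff ?us r (int m) = circle_coeff u r (int m) - circle_coeff (incident_field a k) r (int m)"
  unfolding circle_coeff_def left_diff_distrib
  by (subst Henstock_Kurzweil_Integration.integral_diff)
  (auto intro: integrable_continuous_interval c1[unfolded of_int_of_nat_eq] c2[unfolded of_int_of_nat_eq] simp: right_diff_distrib)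
  then show ?thesis by (simp add: U_def J_def incident_field_circle(2)[OF sum r])
 qed
 have cus: "continuous_on {0..2 * pi} (%th. ?us (rcis r th))" if "0 < r" for r
 proof (intro continuous_on_diff incident_field_circle(1)[OF sum that])
  show "continuous_on {0..2 * pi} (%th. u (rcis r th))"
  unfolding rcis_def by (intro continuous_intros continuous_on_compose2[OF cu]) auto
 qed
 have "be = 0"
 proof (rule outgoing_combination[OF k0])
  fix de :: real assume "0 < de"
  from outgoing_circle_coeff[OF out cus this, of "int m"] obtain R0 where
  R0: "0 < R0" "!!r V'. R0 < r ==> ((%r. circle_coeff ?us r (int m)) has_vector_derivative V') (at r) ==>
  norm (V' - \<i> * of_real k * circle_coeff ?us r (int m)) <= de * r powr (- 1 / 2)" by blast
  show "\<exists>R0>0. \<forall>r>R0. norm (of_real k * (ga * (dH m (k * r) - \<i> * hankel1 m (k * r))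
  + be * (cnj (dH m (k * r)) - \<i> * cnj (hankel1 m (k * r))))) <= de * r powr (- 1 / 2)"
  proof (intro exI[of _ "max R0 ep"] conjI allI impI)
  fix r assume "max R0 ep < r"
  then have r: "R0 < r" "ep < r" "0 < r" using pos(1) by auto
  have JD: "(J has_vector_derivative of_real ((k * r * dJ m (k * r)) / r)) (at r)"
  unfolding J_def[abs_def] by (rule has_vector_derivative_of_real[OF bessel_system(1)[OF k0 r(3)]])
  have "((%r. U r - ?a * J r) has_vector_derivative Q r /\<^sub>R r - ?a * of_real ((k * r * dJ m (k * r)) / r)) (at r)"
  by (intro has_vector_derivative_diff U r(3) bounded_linear.has_vector_derivative[OF bounded_linear_mult_right JD])
  moreover have "Q r /\<^sub>R r - ?a * of_real ((k * r * dJ m (k * r)) / r) = of_real k * (ga * dH m (k * r) + be * cnj (dH m (k * r)))"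
  proof -
  have "Q r /\<^sub>R r - ?a * of_real ((k * r * dJ m (k * r)) / r) = (Q r - ?a * of_real (k * r * dJ m (k * r))) / of_real r"
  by (simp add: scaleR_conv_of_real divide_inverse algebra_simps)
  also have "... = of_real k * (ga * dH m (k * r) + be * cnj (dH m (k * r)))" unfolding QV[OF r(2)] using r(3) by simp
  finally show ?thesis .
  qed
  ultimately have "((%r. U r - ?a * J r) has_vector_derivative of_real k * (ga * dH m (k * r) + be * cnj (dH m (k * r)))) (at r)"
  by (simp only:)
  then have "((%r. circle_coeff ?us r (int m)) has_vector_derivative of_real k * (ga * dH m (k * r) + be * cnj (dH m (k * r)))) (at r)"
  by (rule has_vector_derivative_transform_within_open[of _ _ _ "{0<..}"]) (use r coeff in auto)
  from R0(2)[OF r(1) this]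
  have "norm (of_real k * (ga * dH m (k * r) + be * cnj (dH m (k * r))) - \<i> * of_real k * (ga * hankel1 m (k * r) + be * cnj (hankel1 m (k * r)))) <= de * r powr (- 1 / 2)"
  unfolding coeff[OF r(3)] V[OF r(2)] .
  moreover have "of_real k * (ga * dH m (k * r) + be * cnj (dH m (k * r))) - \<i> * of_real k * (ga * hankel1 m (k * r) + be * cnj (hankel1 m (k * r)))
  = of_real k * (ga * (dH m (k * r) - \<i> * hankel1 m (k * r)) + be * (cnj (dH m (k * r)) - \<i> * cnj (hankel1 m (k * r))))"
  by (simp only: algebra_simps)
  ultimately show "norm (of_real k * (ga * (dH m (k * r) - \<i> * hankel1 m (k * r)) + be * (cnj (dH m (k * r)) - \<i> * cnj (hankel1 m (k * r))))) <= de * r powr (- 1 / 2)"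
  by (simp only:)
  qed (use R0 in auto)
 qed
 note V' = V[unfolded this, simplified] and QV' = QV[unfolded this, simplified]
 have bc: "continuous_on {0<..} (%r. complex_of_real (f (c * r)))" if "!!S. S \<subseteq> {0<..} ==> continuous_on S f" "0 < c" for f :: "real => real" and c
  by (intro continuous_on_of_real continuous_on_compose2[OF that(1)[OF order_refl]] continuous_on_mult continuous_on_const continuous_on_id)
  (use that(2) in auto)
 have bcs: "continuous_on {0<..} (%r. complex_of_real (JB m (c * r)))" "continuous_on {0<..} (%r. complex_of_real (bessel_Y m (c * r)))"
  "continuous_on {0<..} (%r. complex_of_real (dJ m (c * r)))" "continuous_on {0<..} (%r. complex_of_real (dY m (c * r)))" if "0 < c" for c
  by (rule bc[OF _ that], rule continuous_on_bessel, assumption)+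
 have Hc: "continuous_on {0<..} (%r. hankel1 m (k * r))" "continuous_on {0<..} (%r. dH m (k * r))"
  unfolding hankel1_def dH_def Complex_eq by (intro continuous_on_add continuous_on_mult continuous_on_const bcs k0)+
 \<comment> \<open>By continuity, an identity valid on one side of the interface extends to
   \<open>ep\<close> itself; this yields the matching conditions.\<close>
 have at_ep: "f ep = 0" if f: "continuous_on {0<..} f" and z: "(\<forall>r. 0 < r \<and> r < ep --> f r = 0) \<or> (\<forall>r>ep. f r = 0)" for f :: "real => complex"
 proof -
  have c: "isCont f ep" using f pos(1) continuous_on_eq_continuous_at[OF open_greaterThan] by blast
  have c': "(f ---> f ep) (at_left ep)" "(f ---> f ep) (at_right ep)"
  using c unfolding isCont_def by (auto intro: filterlim_at_split[THEN iffD1, THEN conjunct1] filterlim_at_split[THEN iffD1, THEN conjunct2])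
  from z show ?thesis
  proof
  assume "\<forall>r. 0 < r \<and> r < ep --> f r = 0"
  then have "\<forall>\<^sub>F r in at_left ep. f r = 0" using pos(1) by (intro eventually_at_leftI[of 0]) auto
  from tendsto_unique[OF trivial_limit_at_left_real c'(1) tendsto_eventually[OF this]] show ?thesis .
  next
  assume "\<forall>r>ep. f r = 0"
  then have "\<forall>\<^sub>F r in at_right ep. f r = 0" by (intro eventually_at_rightI[of ep "ep + 1"]) auto
  from tendsto_unique[OF trivial_limit_at_right_real c'(2) tendsto_eventually[OF this]] show ?thesis .
  qed
 qed
 have Uc: "continuous_on {0<..} U" by (rule continuous_on_subset[OF Ucont]) auto
 have e1: "U ep - al * of_real (JB m (l * ep)) = 0"
  by (rule at_ep[of "%r. U r - al * of_real (JB m (l * r))"])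
  (intro continuous_on_diff continuous_on_mult continuous_on_const Uc bcs l0, use inside in auto)
 have e2: "Q ep - al * (of_real (l * ep) * of_real (dJ m (l * ep))) = 0"
  by (rule at_ep[of "%r. Q r - al * (of_real (l * r) * of_real (dJ m (l * r)))"])
  (intro continuous_on_diff continuous_on_mult continuous_on_const continuous_on_of_real continuous_on_id Qc bcs l0, use inside in auto)
 have e3: "U ep - ?a * J ep - ga * hankel1 m (k * ep) = 0"
  unfolding J_def by (rule at_ep[of "%r. U r - ?a * of_real (JB m (k * r)) - ga * hankel1 m (k * r)"])
  (intro continuous_on_diff continuous_on_mult continuous_on_const Uc bcs k0 Hc, use V' in \<open>auto simp: J_def\<close>)
 have e4: "Q ep - ?a * (of_real (k * ep) * of_real (dJ m (k * ep))) - of_real (k * ep) * (ga * dH m (k * ep)) = 0"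
  by (rule at_ep[of "%r. Q r - ?a * (of_real (k * r) * of_real (dJ m (k * r))) - of_real (k * r) * (ga * dH m (k * r))"])
  (intro continuous_on_diff continuous_on_mult continuous_on_const continuous_on_of_real continuous_on_id Qc bcs k0 Hc, use QV' in auto)
 define x where "x = k * ep"
 have x0: "0 < x" "0 < lam * x" using k0 pos(1) lam0 by (auto simp: x_def)
 have lx: "l * ep = lam * x" by (simp add: l_def x_def)
 define j d where "j = JB m (lam * x)" and "d = lam * dJ m (lam * x)"
 have m1: "al * of_real j = ?a * of_real (JB m x) + ga * hankel1 m x"
  using e1 e3 unfolding J_def lx x_def[symmetric] j_def by (simp add: algebra_simps)
 have "of_real x * (al * of_real d) = of_real x * (?a * of_real (dJ m x) + ga * dH m x)"
  using e2 e4 unfolding lx x_def[symmetric] d_def by (simp add: algebra_simps)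
 then have m2: "al * of_real d = ?a * of_real (dJ m x) + ga * dH m x" using x0(1) by simp
 define rh where "rh = dJ m x * j - d * JB m x"
 have im: "dY m x * j - d * bessel_Y m x = 0" using res unfolding resonance_fun_def x_def[symmetric] j_def d_def .
 have D: "dH m x * of_real j - of_real d * hankel1 m x = of_real rh"
  using im by (simp add: complex_eq_iff dH_def hankel1_def rh_def)
 have "(?a * of_real (JB m x) + ga * hankel1 m x) * of_real d = (?a * of_real (dJ m x) + ga * dH m x) * of_real j"
  unfolding m1[symmetric] m2[symmetric] by simp
 then have "ga * (dH m x * of_real j - of_real d * hankel1 m x) = - ?a * of_real rh"
  by (simp add: rh_def algebra_simps)
 then have "(ga + ?a) * of_real rh = 0" unfolding D by (simp add: algebra_simps)
 \<comment> \<open>If \<open>D\<close> were 0, the Wronskian at \<open>x\<close> would force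
   \<open>J\<close> and \<open>J'\<close> both to vanish at \<open>lam * x\<close>, against the
   Wronskian there.\<close>
 moreover have "rh ~= 0"
 proof
  assume "rh = 0"
  then have re: "dJ m x * j = d * JB m x" by (simp add: rh_def)
  have im': "dY m x * j = d * bessel_Y m x" using im by simp
  have wr: "JB m x * dY m x - dJ m x * bessel_Y m x ~= 0" using wronskian[OF x0(1), of m] x0(1) by simp
  have "(JB m x * dY m x - dJ m x * bessel_Y m x) * j = JB m x * (dY m x * j) - (dJ m x * j) * bessel_Y m x" by (simp add: algebra_simps)
  also have "... = 0" unfolding re im' by simp
  finally have "j = 0" using wr by simp
  have "(JB m x * dY m x - dJ m x * bessel_Y m x) * d = (d * JB m x) * dY m x - dJ m x * (d * bessel_Y m x)" by (simp add: algebra_simps)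
  also have "... = 0" unfolding re[symmetric] im'[symmetric] by simp
  finally have "d = 0" using wr by simp
  have "dJ m (lam * x) = 0" using \<open>d = 0\<close> lam0 by (simp add: d_def)
  then show False using wronskian[OF x0(2), of m] \<open>j = 0\<close> lam0 x0(1) by (auto simp: j_def)
 qed
 ultimately have "ga + ?a = 0" by simp
 then have ga: "ga = - ?a" by (simp add: add_eq_0_iff)
 have "U R - ?a * J R = ga * hankel1 m (k * R)"
 proof (cases "R = ep")
  case True
  then show ?thesis using e3 by simp
 next
  case False
  then show ?thesis using V'[of R] R by simp
 qed
 then show ?thesis using coeff[of R] R pos(1) ga by simp
qed

text \<open>One term bounds the sum from below, and the factor \<open>sqrt (2 * pi) >= 1\<close> is
  dropped; a divergent sum gives the value infinity.\<close>

lemma circle_norm_ge_mode: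
 "ereal (norm (circle_coeff f R (int n)) * (1 + real n) powr \<sigma>) <= circle_norm \<sigma> R f"
proof -
 define w where "w n = (norm (circle_coeff f R n))^2 * (1 + \<bar>of_int n\<bar>) powr (2 * \<sigma>)" for n :: int
 have nonneg: "0 <= w n" for n by (simp add: w_def)
 have eq: "circle_norm \<sigma> R f = (if w summable_on UNIV then ereal (sqrt (2 * pi) * sqrt (\<Sum>\<^sub>\<infinity>n. w n)) else \<infinity>)"
  by (simp add: circle_norm_def w_def[abs_def] Let_def)
 show ?thesis
 proof (cases "w summable_on UNIV")
  case True
  have "(norm (circle_coeff f R (int n)) * (1 + real n) powr \<sigma>)^2 = w (int n)"
  by (simp add: w_def power_mult_distrib power2_eq_square[of "_ powr _"] powr_add[symmetric])
  also have "w (int n) <= (\<Sum>\<^sub>\<infinity>n. w n)"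
  using finite_sum_le_infsum[OF True, of "{int n}"] nonneg by simp
  finally have "norm (circle_coeff f R (int n)) * (1 + real n) powr \<sigma> <= sqrt (\<Sum>\<^sub>\<infinity>n. w n)" by (rule real_le_rsqrt)
  also have "... = 1 * sqrt (\<Sum>\<^sub>\<infinity>n. w n)" by simp
  also have "... <= sqrt (2 * pi) * sqrt (\<Sum>\<^sub>\<infinity>n. w n)"
  using pi_ge_two by (intro mult_right_mono) (auto intro!: infsum_nonneg nonneg)
  finally show ?thesis using True by (simp add: eq)
 qed (simp add: eq)
qed

theorem theorem4p3:
  fixes \<epsilon> q q0 lam R \<sigma> :: real and a :: "int \<Rightarrow> complex"
    and u us :: "real \<Rightarrow> complex \<Rightarrow> complex" and n0 :: nat
  assumes "0 < \<epsilon>" "0 < q" "0 < q0"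
    and "lam = sqrt (q / q0)" "1 < lam" "\<epsilon> \<le> R"
    and "\<And>\<omega> z. 0 < \<omega> \<Longrightarrow> incident_mode a (sqrt q0 * \<omega>) z summable_on UNIV"
    and "\<And>\<omega>. 0 < \<omega> \<Longrightarrow>
           scattering_solution \<epsilon> q q0 \<omega> (incident_field a (sqrt q0 * \<omega>)) (u \<omega>)"
    and "\<And>\<omega> z. us \<omega> z = u \<omega> z - incident_field a (sqrt q0 * \<omega>) z"
    and "n0 = (LEAST n. first_zero_J n / first_zero_Y n < lam)"
  shows "(\<forall>p\<ge>n0.
      (SUP n\<in>{n0..p}. ereal (norm (a (int n)) * (1 + real n) powr \<sigma>
           * norm (hankel1 n (first_zero_J n / lam * (R / \<epsilon>)))))
      \<le> (SUP \<omega>\<in>{\<omega>. 0 < \<omega> \<and> lam * (sqrt q0 * \<omega> * \<epsilon>) \<le> first_zero_J p}.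
           circle_norm \<sigma> R (us \<omega>))) \<and>
    (exp 2 < lam \<longrightarrow>
      ereal (norm (a 0) * norm (hankel1 0
           (sqrt 2 / (lam * sqrt (ln lam)) * (1 + 1 / (2 * sqrt (ln lam))) * (R / \<epsilon>))))
      \<le> (SUP \<omega>\<in>{\<omega>. 0 < \<omega> \<and>
               lam * (sqrt q0 * \<omega> * \<epsilon>) < sqrt 2 / sqrt (ln lam) * (1 + 1 / (2 * sqrt (ln lam)))}.
           circle_norm \<sigma> R (us \<omega>)))"
proof -
 have lam0: "0 < lam" using assms(5) by simp
 \<comment> \<open>A resonance \<open>x\<close> is realised by the frequency
   \<open>x / (sqrt q0 * \<epsilon>)\<close>. Its position is known only through the upper bound
   \<open>y\<close>, so the modulus of \<open>H\<close> is bounded below by its value at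
   \<open>y * (R / \<epsilon>)\<close>.\<close>
 have bound: "\<exists>\<omega>. 0 < \<omega> \<and> sqrt q0 * \<omega> * \<epsilon> = x \<and>
  ereal (norm (a (int n)) * (1 + real n) powr \<sigma> * norm (hankel1 n (y * (R / \<epsilon>)))) <= circle_norm \<sigma> R (us \<omega>)"
  if x: "0 < x" "x <= y" and res: "resonance_fun n lam x = 0" for n x y
 proof -
  define \<omega> where "\<omega> = x / (sqrt q0 * \<epsilon>)"
  have \<omega>: "0 < \<omega>" "sqrt q0 * \<omega> * \<epsilon> = x" using x assms(1,3) by (simp_all add: \<omega>_def)
  have "us \<omega> = (%z. u \<omega> z - incident_field a (sqrt q0 * \<omega>) z)" using assms(9) by blast
  moreover have "circle_coeff (%z. u \<omega> z - incident_field a (sqrt q0 * \<omega>) z) R (int n) = - a (int n) * hankel1 n (sqrt q0 * \<omega> * R)"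
  using res \<omega> by (intro scattered_coeff_at_resonance[OF assms(1-3) \<omega>(1) refl assms(4) assms(7)[OF \<omega>(1)] assms(8)[OF \<omega>(1)] _ assms(6)]) simp
  ultimately have c: "circle_coeff (us \<omega>) R (int n) = - a (int n) * hankel1 n (sqrt q0 * \<omega> * R)" by simp
  have k: "sqrt q0 * \<omega> * R = x * (R / \<epsilon>)" using assms(1,3) by (simp add: \<omega>_def)
  have "0 < R / \<epsilon>" using assms(1,6) by simp
  then have "norm (hankel1 n (y * (R / \<epsilon>))) <= norm (hankel1 n (x * (R / \<epsilon>)))"
  using x by (intro hankel_antimono mult_right_mono mult_pos_pos) auto
  then have "norm (a (int n)) * (1 + real n) powr \<sigma> * norm (hankel1 n (y * (R / \<epsilon>))) <= norm (circle_coeff (us \<omega>) R (int n)) * (1 + real n) powr \<sigma>"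
  unfolding c k norm_mult by (simp add: mult_ac mult_left_mono)
  then have "ereal (norm (a (int n)) * (1 + real n) powr \<sigma> * norm (hankel1 n (y * (R / \<epsilon>)))) <= ereal (norm (circle_coeff (us \<omega>) R (int n)) * (1 + real n) powr \<sigma>)"
  by (simp only: ereal_less_eq)
  from order_trans[OF this circle_norm_ge_mode[of "us \<omega>" R n \<sigma>]] \<omega> show ?thesis by blast
 qed
 show ?thesis
 proof (intro conjI allI impI SUP_least)
  fix p n assume "n0 <= p" "n \<in> {n0..p}"
  then have n: "n0 <= n" "n <= p" by auto
  have "first_zero_J n / first_zero_Y n < lam"
  using n(1) unfolding assms(10) by (rule zero_ratio_less_Least[OF assms(5)])
  then obtain x where x: "0 < x" "lam * x < first_zero_J n" "resonance_fun n lam x = 0"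
  using exists_resonance_first_zero[OF lam0] by blast
  have "x <= first_zero_J n / lam" using x lam0 by (simp add: pos_le_divide_eq mult.commute)
  from bound[OF x(1) this x(3)] obtain \<omega> where \<omega>: "0 < \<omega>" "sqrt q0 * \<omega> * \<epsilon> = x"
  "ereal (norm (a (int n)) * (1 + real n) powr \<sigma> * norm (hankel1 n (first_zero_J n / lam * (R / \<epsilon>)))) <= circle_norm \<sigma> R (us \<omega>)" by blast
  have "lam * x <= first_zero_J p" using x(2) first_zero_J_mono[OF n(2)] by simp
  then show "ereal (norm (a (int n)) * (1 + real n) powr \<sigma> * norm (hankel1 n (first_zero_J n / lam * (R / \<epsilon>))))
  <= (SUP \<omega>\<in>{\<omega>. 0 < \<omega> \<and> lam * (sqrt q0 * \<omega> * \<epsilon>) <= first_zero_J p}. circle_norm \<sigma> R (us \<omega>))"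
  using \<omega> by (intro SUP_upper2[of \<omega>]) auto
 next
  assume lam2: "exp 2 < lam"
  define X where "X = sqrt 2 / sqrt (ln lam) * (1 + 1 / (2 * sqrt (ln lam)))"
  obtain x where x: "0 < x" "lam * x < X" "resonance_fun 0 lam x = 0"
  using exists_resonance_large_contrast(1)[OF lam2] unfolding X_def by blast
  have "x <= X / lam" using x lam0 by (simp add: pos_le_divide_eq mult.commute)
  from bound[OF x(1) this x(3)] obtain \<omega> where \<omega>: "0 < \<omega>" "sqrt q0 * \<omega> * \<epsilon> = x"
  "ereal (norm (a 0) * norm (hankel1 0 (X / lam * (R / \<epsilon>)))) <= circle_norm \<sigma> R (us \<omega>)" by auto
  have "sqrt 2 / (lam * sqrt (ln lam)) * (1 + 1 / (2 * sqrt (ln lam))) = X / lam" by (simp add: X_def mult.commute)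
  then show "ereal (norm (a 0) * norm (hankel1 0
  (sqrt 2 / (lam * sqrt (ln lam)) * (1 + 1 / (2 * sqrt (ln lam))) * (R / \<epsilon>))))
  <= (SUP \<omega>\<in>{\<omega>. 0 < \<omega> \<and>
  lam * (sqrt q0 * \<omega> * \<epsilon>) < sqrt 2 / sqrt (ln lam) * (1 + 1 / (2 * sqrt (ln lam)))}.
  circle_norm \<sigma> R (us \<omega>))"
  using \<omega> x(2) unfolding X_def[symmetric] by (intro SUP_upper2[of \<omega>]) auto
 qed
qed

end
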